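(* Let $A$ and $B$ be algebras over $k$, let $R:B\otimes A\to A\otimes B$ be an invertible twisting map, let $E$ be a right $A$-module with a right connection $\nabla^E:E\to E\otimes_A\Omega^1A$, and let $F$ be a right $B$-module with a right connection $\nabla^F:F\to F\otimes_B\Omega^1B$. Let $\tau_{F,A}:F\otimes A\to A\otimes F$ be an invertible right module twisting map with inverse $\sigma_{A,F}:A\otimes F\to F\otimes A$, such that $$(A\otimes\nabla^F)\circ\tau_{F,A}=(\tau_{F,A}\otimes\Omega^1B)\circ(F\otimes\widetilde R)\circ(\nabla^F\otimes A)$$ as maps $F\otimes A\to A\otimes (F\otimes_B\Omega^1B)$. Then the linear map $$\nabla:E\otimes B\oplus A\otimes F\longrightarrow (E\otimes B\oplus A\otimes F)\otimes_{A\otimes_RB}(\Omega^1A\otimes B\oplus A\otimes\Omega^1B),$$ $$\nabla(e\otimes b,a\otimes f):=\nabla_1(e\otimes b)+\nabla_2(a\otimes f),$$ is a right connection on the right $(A\otimes_RB)$-module $E\otimes B\oplus A\otimes F$ with respect to the differential calculus $\Omega A\otimes_{\widetilde R}\Omega B$, where $\nabla_1,\nabla_2$ are given by $$\nabla_1(e\otimes b)=\sum_i (e_i\otimes 1)\otimes(d_Aa_i\otimes b)+(e\otimes 1)\otimes(1\otimes d_Bb)\quad\text{if }\nabla^E(e)=\sum_ie_i\otimes_Ad_Aa_i,$$ $$\nabla_2(a\otimes f)=\sum_k(a\otimes f_k)\otimes(1\otimes d_Bb_k)+\sum(1\otimes f_\sigma)\otimes(d_A(a_\sigma)\otimes 1)\quad\text{if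 }\nabla^F(f)=\sum_kf_k\otimes_Bd_Bb_k,\ \ \sigma_{A,F}(a\otimes f)=\sum f_\sigma\otimes a_\sigma,$$ the middle tensor products being over $A\otimes_RB$.
   Context: All algebras are associative unital over a field $k$; $\otimes=\otimes_k$; an object's name also denotes its identity map; $\mu_D$ is the multiplication of an algebra $D$. $\Omega A=\bigoplus_p\Omega^pA$, with differential $d_A$, is the universal differential graded algebra of $A$ (similarly for $B$). Given a differential calculus $(\Omega D,d)$ over an algebra $D$ (a differential graded algebra generated, as such, by $\Omega^0D=D$), a right connection on a right $D$-module $M$ is a linear map $\nabla:M\to M\otimes_D\Omega^1D$ with $\nabla(m\cdot x)=(\nabla m)\cdot x+m\otimes dx$ for $m\in M$, $x\in D$. A twisting map is a linear map $R:B\otimes A\to A\otimes B$ with $R(b\otimes1)=1\otimes b$, $R(1\otimes a)=a\otimes1$, $R\circ(B\otimes\mu_A)=(\mu_A\otimes B)\circ(A\otimes R)\circ(R\otimes A)$ and $R\circ(\mu_B\otimes A)=(A\otimes\mu_B)\circ(R\otimes B)\circ(B\otimes R)$. Write $R(b\otimes a)=a_R\otimes b_R$ (summation omitted). The twisted tensor product $A\otimes_RB$ is $A\otimes B$ with product $(a\otimes b)(a'\otimes b')=aa'_R\otimes b_Rb'$. Any twisting map $R$ extends uniquely to a twisting map $\widetilde R:\Omega B\otimes\Omega A\to\Omega A\otimes\Omega B$ with $\widetilde R\circ(d_B\otimes\Omega A)=(\varepsilon_A\otimes d_B)\circ\widetilde R$ and $\widetilde R\circ(\Omega B\otimes d_A)=(d_A\otimes\varepsilon_B)\circ\widetilde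 R$, where $\varepsilon(\omega)=(-1)^{|\omega|}\omega$. Then $\Omega A\otimes_{\widetilde R}\Omega B$, with differential $d(\varphi\otimes\omega)=d_A\varphi\otimes\omega+(-1)^{|\varphi|}\varphi\otimes d_B\omega$, is a differential calculus over $A\otimes_RB$ whose module of 1-forms is $\Omega^1A\otimes B\oplus A\otimes\Omega^1B$. A right module twisting map for a right $B$-module $F$ with action $\rho:F\otimes B\to F$ is a linear map $\tau_{F,A}:F\otimes A\to A\otimes F$, written $\tau_{F,A}(f\otimes a)=a_\tau\otimes f_\tau$, with $\tau_{F,A}\circ(F\otimes\mu_A)=(\mu_A\otimes F)\circ(A\otimes\tau_{F,A})\circ(\tau_{F,A}\otimes A)$ and $\tau_{F,A}\circ(\rho\otimes A)=(A\otimes\rho)\circ(\tau_{F,A}\otimes B)\circ(F\otimes R)$. The right $(A\otimes_RB)$-module structure on $E\otimes B\oplus A\otimes F$ is $(e\otimes b)\cdot(\alpha\otimes\beta)=e\alpha_R\otimes b_R\beta$ and $(a\otimes f)\cdot(\alpha\otimes\beta)=a\alpha_\tau\otimes f_\tau\beta$. The elements $e\otimes b$ and $a\otimes f$ are identified with $(e\otimes b,0)$ and $(0,a\otimes f)$. In the compatibility condition on $\nabla^F$, the composite $(\tau_{F,A}\otimes\Omega^1B)\circ(F\otimes\widetilde R)$ is computed on representatives, sending $f\otimes_B\eta\otimes a$ to $(a_{\widetilde R})_\tau\otimes f_\tau\otimes_B\eta_{\widetilde R}$, where $\widetilde R(\eta\otimes a)=a_{\widetilde R}\otimes\eta_{\widetilde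 R}$. *)

theory Defs
  imports "HOL-Algebra.Module" "HOL-Algebra.QuotRing"
begin

section \<open>Linear algebra over a field, in records\<close>

text \<open>Vector spaces over \<open>K\<close> are records satisfying the locale \<^locale>\<open>module\<close>; their ring
  multiplication and unit are ignored unless the space is an algebra.
  All functions between structures are only meaningful on the carriers.\<close>

locale k_algebra = K?: field K + module K A + ring A for K (structure) and A (structure) +
  assumes smult_mult_left:
      "\<lbrakk>c \<in> carrier K; x \<in> carrier A; y \<in> carrier A\<rbrakk> \<Longrightarrow>
       (c \<odot>\<^bsub>A\<^esub> x) \<otimes>\<^bsub>A\<^esub> y = c \<odot>\<^bsub>A\<^esub> (x \<otimes>\<^bsub>A\<^esub> y)"
    and smult_mult_right:
      "\<lbrakk>c \<in> carrier K; x \<in> carrier A; y \<in> carrier A\<rbrakk> \<Longrightarrow>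
       x \<otimes>\<^bsub>A\<^esub> (c \<odot>\<^bsub>A\<^esub> y) = c \<odot>\<^bsub>A\<^esub> (x \<otimes>\<^bsub>A\<^esub> y)"

record ('k, 'm, 'd) right_module = "('k, 'm) module" +
  ract :: "['m, 'd] \<Rightarrow> 'm" (infixl \<open>\<triangleleft>\<index>\<close> 70)

record ('k, 'm, 'd) bimodule = "('k, 'm, 'd) right_module" +
  lact :: "['d, 'm] \<Rightarrow> 'm"

locale right_module = k_algebra K D + M?: module K M
  for K :: "('k, 'c) ring_scheme" (structure) and D :: "('k, 'd, 'q) module_scheme" (structure)
    and M :: "('k, 'm, 'd, 'z) right_module_scheme" (structure) +
  assumes ract_closed:
      "\<lbrakk>m \<in> carrier M; x \<in> carrier D\<rbrakk> \<Longrightarrow> m \<triangleleft>\<^bsub>M\<^esub> x \<in> carrier M"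
    and ract_add_left:
      "\<lbrakk>m \<in> carrier M; m' \<in> carrier M; x \<in> carrier D\<rbrakk> \<Longrightarrow>
       (m \<oplus>\<^bsub>M\<^esub> m') \<triangleleft>\<^bsub>M\<^esub> x = m \<triangleleft>\<^bsub>M\<^esub> x \<oplus>\<^bsub>M\<^esub> m' \<triangleleft>\<^bsub>M\<^esub> x"
    and ract_add_right:
      "\<lbrakk>m \<in> carrier M; x \<in> carrier D; y \<in> carrier D\<rbrakk> \<Longrightarrow>
       m \<triangleleft>\<^bsub>M\<^esub> (x \<oplus>\<^bsub>D\<^esub> y) = m \<triangleleft>\<^bsub>M\<^esub> x \<oplus>\<^bsub>M\<^esub> m \<triangleleft>\<^bsub>M\<^esub> y"
    and ract_smult_left:
      "\<lbrakk>c \<in> carrier K; m \<in> carrier M; x \<in> carrier D\<rbrakk> \<Longrightarrow>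
       (c \<odot>\<^bsub>M\<^esub> m) \<triangleleft>\<^bsub>M\<^esub> x = c \<odot>\<^bsub>M\<^esub> (m \<triangleleft>\<^bsub>M\<^esub> x)"
    and ract_smult_right:
      "\<lbrakk>c \<in> carrier K; m \<in> carrier M; x \<in> carrier D\<rbrakk> \<Longrightarrow>
       m \<triangleleft>\<^bsub>M\<^esub> (c \<odot>\<^bsub>D\<^esub> x) = c \<odot>\<^bsub>M\<^esub> (m \<triangleleft>\<^bsub>M\<^esub> x)"
    and ract_mult:
      "\<lbrakk>m \<in> carrier M; x \<in> carrier D; y \<in> carrier D\<rbrakk> \<Longrightarrow>
       m \<triangleleft>\<^bsub>M\<^esub> (x \<otimes>\<^bsub>D\<^esub> y) = (m \<triangleleft>\<^bsub>M\<^esub> x) \<triangleleft>\<^bsub>M\<^esub> y"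
    and ract_one:
      "m \<in> carrier M \<Longrightarrow> m \<triangleleft>\<^bsub>M\<^esub> \<one>\<^bsub>D\<^esub> = m"

definition linear_map ::
  "('k, 'c) ring_scheme \<Rightarrow> ('k, 'v, 'r) module_scheme \<Rightarrow> ('k, 'w, 's) module_scheme \<Rightarrow> ('v \<Rightarrow> 'w) \<Rightarrow> bool"
  where "linear_map K V W f \<longleftrightarrow>
    f \<in> carrier V \<rightarrow> carrier W \<and>
    (\<forall>x\<in>carrier V. \<forall>y\<in>carrier V. f (x \<oplus>\<^bsub>V\<^esub> y) = f x \<oplus>\<^bsub>W\<^esub> f y) \<and>
    (\<forall>c\<in>carrier K. \<forall>x\<in>carrier V. f (c \<odot>\<^bsub>V\<^esub> x) = c \<odot>\<^bsub>W\<^esub> f x)"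

definition lin_span ::
  "('k, 'c) ring_scheme \<Rightarrow> ('k, 'v, 'r) module_scheme \<Rightarrow> 'v set \<Rightarrow> 'v set"
  where "lin_span K V S = \<Inter>{N. submodule N K V \<and> S \<subseteq> N}"

text \<open>\<open>quotient_map V I f\<close> is the map induced on \<open>V / I\<close> by an endomorphism \<open>f\<close> of \<open>V\<close> with
  \<open>f I \<subseteq> I\<close>, in the style of \<^const>\<open>rcoset_mult\<close>.\<close>

definition quotient_map :: "('v, 'r) ring_scheme \<Rightarrow> 'v set \<Rightarrow> ('v \<Rightarrow> 'v) \<Rightarrow> 'v set \<Rightarrow> 'v set"
  where "quotient_map V I f X = (\<Union>x\<in>X. I +>\<^bsub>V\<^esub> f x)"

definition quotient_module :: "('k, 'v, 'r) module_scheme \<Rightarrow> 'v set \<Rightarrow> ('k, 'v set) module"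
  where "quotient_module V I =
    \<lparr>carrier = carrier (V Quot I), mult = mult (V Quot I), one = one (V Quot I),
     zero = zero (V Quot I), add = add (V Quot I),
     smult = (\<lambda>c. quotient_map V I (\<lambda>x. c \<odot>\<^bsub>V\<^esub> x))\<rparr>"

definition monom_fun :: "('k, 'c) ring_scheme \<Rightarrow> 'x \<Rightarrow> 'x \<Rightarrow> 'k"
  where "monom_fun K x = (\<lambda>y. if y = x then \<one>\<^bsub>K\<^esub> else \<zero>\<^bsub>K\<^esub>)"

definition free_module :: "('k, 'c) ring_scheme \<Rightarrow> 'x set \<Rightarrow> ('k, 'x \<Rightarrow> 'k) module"
  where "free_module K X =
    \<lparr>carrier = {p. range p \<subseteq> carrier K \<and> finite {x. p x \<noteq> \<zero>\<^bsub>K\<^esub>} \<and> {x. p x \<noteq> \<zero>\<^bsub>K\<^esub>} \<subseteq> X},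
     mult = undefined, one = undefined,
     zero = (\<lambda>_. \<zero>\<^bsub>K\<^esub>), add = (\<lambda>p q x. p x \<oplus>\<^bsub>K\<^esub> q x),
     smult = (\<lambda>c p x. c \<otimes>\<^bsub>K\<^esub> p x)\<rparr>"

definition free_eval ::
  "('k, 'c) ring_scheme \<Rightarrow> ('k, 'u, 'r) module_scheme \<Rightarrow> ('x \<Rightarrow> 'u) \<Rightarrow> ('x \<Rightarrow> 'k) \<Rightarrow> 'u"
  where "free_eval K U h p = (\<Oplus>\<^bsub>U\<^esub>x\<in>{x. p x \<noteq> \<zero>\<^bsub>K\<^esub>}. p x \<odot>\<^bsub>U\<^esub> h x)"


section \<open>Tensor products\<close>

type_synonym ('k, 'v, 'w) tens = "('v \<times> 'w \<Rightarrow> 'k) set"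

definition tensor_relations ::
  "('k, 'c) ring_scheme \<Rightarrow> ('k, 'v, 'r) module_scheme \<Rightarrow> ('k, 'w, 's) module_scheme \<Rightarrow>
   ('v \<times> 'w \<Rightarrow> 'k) set"
  where "tensor_relations K V W =
    (let P = free_module K (carrier V \<times> carrier W); m = (\<lambda>v w. monom_fun K (v, w)) in
      {m (v \<oplus>\<^bsub>V\<^esub> v') w \<ominus>\<^bsub>P\<^esub> (m v w \<oplus>\<^bsub>P\<^esub> m v' w) | v v' w.
        v \<in> carrier V \<and> v' \<in> carrier V \<and> w \<in> carrier W} \<union>
      {m v (w \<oplus>\<^bsub>W\<^esub> w') \<ominus>\<^bsub>P\<^esub> (m v w \<oplus>\<^bsub>P\<^esub> m v w') | v w w'.
        v \<in> carrier V \<and> w \<in> carrier W \<and> w' \<in> carrier W} \<union>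
      {m (c \<odot>\<^bsub>V\<^esub> v) w \<ominus>\<^bsub>P\<^esub> c \<odot>\<^bsub>P\<^esub> m v w | c v w.
        c \<in> carrier K \<and> v \<in> carrier V \<and> w \<in> carrier W} \<union>
      {m v (c \<odot>\<^bsub>W\<^esub> w) \<ominus>\<^bsub>P\<^esub> c \<odot>\<^bsub>P\<^esub> m v w | c v w.
        c \<in> carrier K \<and> v \<in> carrier V \<and> w \<in> carrier W})"

definition tensor_kernel ::
  "('k, 'c) ring_scheme \<Rightarrow> ('k, 'v, 'r) module_scheme \<Rightarrow> ('k, 'w, 's) module_scheme \<Rightarrow>
   ('v \<times> 'w \<Rightarrow> 'k) set"
  where "tensor_kernel K V W =
    lin_span K (free_module K (carrier V \<times> carrier W)) (tensor_relations K V W)"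

definition tensor ::
  "('k, 'c) ring_scheme \<Rightarrow> ('k, 'v, 'r) module_scheme \<Rightarrow> ('k, 'w, 's) module_scheme \<Rightarrow>
   ('k, ('k, 'v, 'w) tens) module"
  where "tensor K V W =
    quotient_module (free_module K (carrier V \<times> carrier W)) (tensor_kernel K V W)"

definition pure ::
  "('k, 'c) ring_scheme \<Rightarrow> ('k, 'v, 'r) module_scheme \<Rightarrow> ('k, 'w, 's) module_scheme \<Rightarrow>
   'v \<Rightarrow> 'w \<Rightarrow> ('k, 'v, 'w) tens"
  where "pure K V W v w =
    tensor_kernel K V W +>\<^bsub>free_module K (carrier V \<times> carrier W)\<^esub> monom_fun K (v, w)"

text \<open>\<open>tensor_lift K U \<beta>\<close> is the linear map with \<open>v \<otimes> w \<mapsto> \<beta> v w\<close> into \<open>U\<close>, for bilinear \<open>\<beta>\<close>.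
  It renders Sweedler-type notation: if \<open>t = \<Sum> v\<^sub>i \<otimes> w\<^sub>i\<close> then
  \<open>tensor_lift K U \<beta> t = \<Sum> \<beta> v\<^sub>i w\<^sub>i\<close>.\<close>

definition tensor_lift ::
  "('k, 'c) ring_scheme \<Rightarrow> ('k, 'u, 'r) module_scheme \<Rightarrow> ('v \<Rightarrow> 'w \<Rightarrow> 'u) \<Rightarrow> ('k, 'v, 'w) tens \<Rightarrow> 'u"
  where "tensor_lift K U \<beta> X = the_elem (free_eval K U (\<lambda>(v, w). \<beta> v w) ` X)"

definition tensor_map ::
  "('k, 'c) ring_scheme \<Rightarrow> ('k, 'v, 'r) module_scheme \<Rightarrow> ('k, 'w, 's) module_scheme \<Rightarrow>
   ('x \<Rightarrow> 'v) \<Rightarrow> ('y \<Rightarrow> 'w) \<Rightarrow> ('k, 'x, 'y) tens \<Rightarrow> ('k, 'v, 'w) tens"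
  where "tensor_map K V W f g = tensor_lift K (tensor K V W) (\<lambda>x y. pure K V W (f x) (g y))"

text \<open>\<open>M \<otimes>\<^sub>D N\<close> is the quotient of \<open>M \<otimes> N\<close> by the span of the elements
  \<open>m x \<otimes> n - m \<otimes> x n\<close>; its right \<open>D\<close>-action is that of \<open>N\<close>.\<close>

definition balanced_kernel ::
  "('k, 'c) ring_scheme \<Rightarrow> ('k, 'd, 'q) module_scheme \<Rightarrow> ('k, 'm, 'd, 'r) right_module_scheme \<Rightarrow>
   ('k, 'n, 'd, 's) bimodule_scheme \<Rightarrow> ('k, 'm, 'n) tens set"
  where "balanced_kernel K D M N =
    lin_span K (tensor K M N)
      {pure K M N (m \<triangleleft>\<^bsub>M\<^esub> x) n \<ominus>\<^bsub>tensor K M N\<^esub> pure K M N m (lact N x n) | m x n.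
        m \<in> carrier M \<and> x \<in> carrier D \<and> n \<in> carrier N}"

definition tensor_over ::
  "('k, 'c) ring_scheme \<Rightarrow> ('k, 'd, 'q) module_scheme \<Rightarrow> ('k, 'm, 'd, 'r) right_module_scheme \<Rightarrow>
   ('k, 'n, 'd, 's) bimodule_scheme \<Rightarrow> ('k, ('k, 'm, 'n) tens set, 'd) right_module"
  where "tensor_over K D M N =
    module.extend (quotient_module (tensor K M N) (balanced_kernel K D M N))
      \<lparr>ract = (\<lambda>X x. quotient_map (tensor K M N) (balanced_kernel K D M N)
                 (tensor_map K M N (\<lambda>m. m) (\<lambda>n. n \<triangleleft>\<^bsub>N\<^esub> x)) X)\<rparr>"

definition pure_over ::
  "('k, 'c) ring_scheme \<Rightarrow> ('k, 'd, 'q) module_scheme \<Rightarrow> ('k, 'm, 'd, 'r) right_module_scheme \<Rightarrow>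
   ('k, 'n, 'd, 's) bimodule_scheme \<Rightarrow> 'm \<Rightarrow> 'n \<Rightarrow> ('k, 'm, 'n) tens set"
  where "pure_over K D M N m n = balanced_kernel K D M N +>\<^bsub>tensor K M N\<^esub> pure K M N m n"

definition tensor_over_lift ::
  "('k, 'c) ring_scheme \<Rightarrow> ('k, 'u, 'r) module_scheme \<Rightarrow> ('m \<Rightarrow> 'n \<Rightarrow> 'u) \<Rightarrow>
   ('k, 'm, 'n) tens set \<Rightarrow> 'u"
  where "tensor_over_lift K U \<beta> X = the_elem (tensor_lift K U \<beta> ` X)"


section \<open>Differential calculi and connections\<close>

text \<open>\<open>embed\<close> identifies \<open>D\<close> with the forms of degree 0.\<close>

record ('k, 'd, 'w) calculus =
  forms :: "('k, 'w) module"
  homogeneous :: "nat \<Rightarrow> 'w set"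
  differential :: "'w \<Rightarrow> 'w"
  embed :: "'d \<Rightarrow> 'w"

definition decomposition :: "('k, 'd, 'w) calculus \<Rightarrow> 'w \<Rightarrow> (nat \<Rightarrow> 'w) \<Rightarrow> bool"
  where "decomposition C \<omega> s \<longleftrightarrow>
    (\<forall>n. s n \<in> homogeneous C n) \<and> finite {n. s n \<noteq> \<zero>\<^bsub>forms C\<^esub>} \<and>
    \<omega> = (\<Oplus>\<^bsub>forms C\<^esub>n\<in>{n. s n \<noteq> \<zero>\<^bsub>forms C\<^esub>}. s n)"

text \<open>\<open>signed C n \<omega> = (-1)\<^sup>n \<omega>\<close>, and \<open>parity C\<close> is the map \<open>\<epsilon>\<close>, equal to \<open>signed C n\<close> in
  degree \<open>n\<close>.\<close>

definition signed :: "('k, 'd, 'w) calculus \<Rightarrow> nat \<Rightarrow> 'w \<Rightarrow> 'w"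
  where "signed C n \<omega> = (if even n then \<omega> else \<ominus>\<^bsub>forms C\<^esub> \<omega>)"

definition parity :: "('k, 'd, 'w) calculus \<Rightarrow> 'w \<Rightarrow> 'w"
  where "parity C \<omega> =
    (let s = (THE s. decomposition C \<omega> s) in
      \<Oplus>\<^bsub>forms C\<^esub>n\<in>{n. s n \<noteq> \<zero>\<^bsub>forms C\<^esub>}. signed C n (s n))"

locale differential_calculus = D: k_algebra K D + W: k_algebra K "forms C"
  for K :: "('k, 'c) ring_scheme" (structure) and D :: "('k, 'd, 'q) module_scheme" (structure)
    and C :: "('k, 'd, 'w) calculus" +
  assumes homogeneous_submodule: "submodule (homogeneous C n) K (forms C)"
    and direct_sum: "\<omega> \<in> carrier (forms C) \<Longrightarrow> \<exists>!s. decomposition C \<omega> s"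
    and homogeneous_mult:
      "\<lbrakk>\<phi> \<in> homogeneous C p; \<psi> \<in> homogeneous C q\<rbrakk> \<Longrightarrow>
       \<phi> \<otimes>\<^bsub>forms C\<^esub> \<psi> \<in> homogeneous C (p + q)"
    and embed_linear: "linear_map K D (forms C) (embed C)"
    and embed_hom: "embed C \<in> ring_hom D (forms C)"
    and embed_bij: "bij_betw (embed C) (carrier D) (homogeneous C 0)"
    and differential_linear: "linear_map K (forms C) (forms C) (differential C)"
    and differential_degree:
      "\<phi> \<in> homogeneous C p \<Longrightarrow> differential C \<phi> \<in> homogeneous C (Suc p)"
    and differential_square:
      "\<phi> \<in> carrier (forms C) \<Longrightarrow> differential C (differential C \<phi>) = \<zero>\<^bsub>forms C\<^esub>"
    and leibniz:
      "\<lbrakk>\<phi> \<in> homogeneous C p; \<psi> \<in> carrier (forms C)\<rbrakk> \<Longrightarrow>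
       differential C (\<phi> \<otimes>\<^bsub>forms C\<^esub> \<psi>) =
         differential C \<phi> \<otimes>\<^bsub>forms C\<^esub> \<psi>
           \<oplus>\<^bsub>forms C\<^esub> signed C p (\<phi> \<otimes>\<^bsub>forms C\<^esub> differential C \<psi>)"
    and generated:
      "\<lbrakk>submodule S K (forms C); embed C ` carrier D \<subseteq> S;
        \<And>\<phi> \<psi>. \<lbrakk>\<phi> \<in> S; \<psi> \<in> S\<rbrakk> \<Longrightarrow> \<phi> \<otimes>\<^bsub>forms C\<^esub> \<psi> \<in> S;
        \<And>\<phi>. \<phi> \<in> S \<Longrightarrow> differential C \<phi> \<in> S\<rbrakk> \<Longrightarrow> S = carrier (forms C)"

definition one_forms :: "('k, 'd, 'w) calculus \<Rightarrow> ('k, 'w, 'd) bimodule"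
  where "one_forms C =
    \<lparr>carrier = homogeneous C 1, mult = mult (forms C), one = one (forms C),
     zero = zero (forms C), add = add (forms C), smult = smult (forms C),
     ract = (\<lambda>\<omega> x. \<omega> \<otimes>\<^bsub>forms C\<^esub> embed C x), lact = (\<lambda>x \<omega>. embed C x \<otimes>\<^bsub>forms C\<^esub> \<omega>)\<rparr>"

definition d0 :: "('k, 'd, 'w) calculus \<Rightarrow> 'd \<Rightarrow> 'w"
  where "d0 C x = differential C (embed C x)"

definition right_connection ::
  "('k, 'c) ring_scheme \<Rightarrow> ('k, 'd, 'q) module_scheme \<Rightarrow> ('k, 'd, 'w) calculus \<Rightarrow>
   ('k, 'm, 'd) right_module \<Rightarrow> ('m \<Rightarrow> ('k, 'm, 'w) tens set) \<Rightarrow> bool"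
  where "right_connection K D C M nabla \<longleftrightarrow>
    differential_calculus K D C \<and> right_module K D M \<and>
    linear_map K M (tensor_over K D M (one_forms C)) nabla \<and>
    (\<forall>m\<in>carrier M. \<forall>x\<in>carrier D.
      nabla (m \<triangleleft>\<^bsub>M\<^esub> x) =
        nabla m \<triangleleft>\<^bsub>tensor_over K D M (one_forms C)\<^esub> x
          \<oplus>\<^bsub>tensor_over K D M (one_forms C)\<^esub> pure_over K D M (one_forms C) m (d0 C x))"


section \<open>The universal differential graded algebra\<close>

text \<open>It is presented as the quotient of the free algebra on symbols \<open>a\<close> (\<open>Elt a\<close>) and \<open>da\<close>
  (\<open>Diff a\<close>), for \<open>a \<in> A\<close>, by the relations that \<open>Elt\<close> is a homomorphism of unital algebras and
  \<open>Diff\<close> is a linear derivation along it.\<close>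

datatype 'a dgen = Elt 'a | is_Diff: Diff 'a

type_synonym ('k, 'a) form = "('a dgen list \<Rightarrow> 'k) set"

definition free_dga :: "('k, 'c) ring_scheme \<Rightarrow> ('k, 'a, 'r) module_scheme \<Rightarrow>
    ('k, 'a dgen list \<Rightarrow> 'k) module"
  where "free_dga K A =
    (free_module K (lists (Elt ` carrier A \<union> Diff ` carrier A)))
      \<lparr>mult := (\<lambda>p q w. \<Oplus>\<^bsub>K\<^esub>i\<in>{..length w}. p (take i w) \<otimes>\<^bsub>K\<^esub> q (drop i w)),
       one := monom_fun K []\<rparr>"

definition omega_relations :: "('k, 'c) ring_scheme \<Rightarrow> ('k, 'a, 'r) module_scheme \<Rightarrow>
    ('a dgen list \<Rightarrow> 'k) set"
  where "omega_relations K A =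
    (let G = free_dga K A; i = (\<lambda>a. monom_fun K [Elt a]); \<delta> = (\<lambda>a. monom_fun K [Diff a]) in
      {i (a \<oplus>\<^bsub>A\<^esub> b) \<ominus>\<^bsub>G\<^esub> (i a \<oplus>\<^bsub>G\<^esub> i b) | a b. a \<in> carrier A \<and> b \<in> carrier A} \<union>
      {i (c \<odot>\<^bsub>A\<^esub> a) \<ominus>\<^bsub>G\<^esub> c \<odot>\<^bsub>G\<^esub> i a | c a. c \<in> carrier K \<and> a \<in> carrier A} \<union>
      {i (a \<otimes>\<^bsub>A\<^esub> b) \<ominus>\<^bsub>G\<^esub> i a \<otimes>\<^bsub>G\<^esub> i b | a b. a \<in> carrier A \<and> b \<in> carrier A} \<union>
      {i \<one>\<^bsub>A\<^esub> \<ominus>\<^bsub>G\<^esub> \<one>\<^bsub>G\<^esub>} \<union>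
      {\<delta> (a \<oplus>\<^bsub>A\<^esub> b) \<ominus>\<^bsub>G\<^esub> (\<delta> a \<oplus>\<^bsub>G\<^esub> \<delta> b) | a b. a \<in> carrier A \<and> b \<in> carrier A} \<union>
      {\<delta> (c \<odot>\<^bsub>A\<^esub> a) \<ominus>\<^bsub>G\<^esub> c \<odot>\<^bsub>G\<^esub> \<delta> a | c a. c \<in> carrier K \<and> a \<in> carrier A} \<union>
      {\<delta> (a \<otimes>\<^bsub>A\<^esub> b) \<ominus>\<^bsub>G\<^esub> (\<delta> a \<otimes>\<^bsub>G\<^esub> i b \<oplus>\<^bsub>G\<^esub> i a \<otimes>\<^bsub>G\<^esub> \<delta> b) | a b.
        a \<in> carrier A \<and> b \<in> carrier A})"

definition omega_ideal :: "('k, 'c) ring_scheme \<Rightarrow> ('k, 'a, 'r) module_scheme \<Rightarrow>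
    ('a dgen list \<Rightarrow> 'k) set"
  where "omega_ideal K A = Idl\<^bsub>free_dga K A\<^esub> (omega_relations K A)"

definition word_degree :: "'a dgen list \<Rightarrow> nat"
  where "word_degree w = length (filter is_Diff w)"

text \<open>The graded derivation of the free algebra with \<open>a \<mapsto> da\<close>, \<open>da \<mapsto> 0\<close>, on words.\<close>

primrec word_differential :: "('k, 'c) ring_scheme \<Rightarrow> ('k, 'a, 'r) module_scheme \<Rightarrow>
    'a dgen list \<Rightarrow> 'a dgen list \<Rightarrow> 'k"
  where
    "word_differential K A [] = \<zero>\<^bsub>free_dga K A\<^esub>"
  | "word_differential K A (g # w) =
      (case g of
        Elt a \<Rightarrow> monom_fun K (Diff a # w)
          \<oplus>\<^bsub>free_dga K A\<^esub> monom_fun K [Elt a] \<otimes>\<^bsub>free_dga K A\<^esub> word_differential K A w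
      | Diff a \<Rightarrow> \<ominus>\<^bsub>free_dga K A\<^esub> (monom_fun K [Diff a] \<otimes>\<^bsub>free_dga K A\<^esub> word_differential K A w))"

definition omega :: "('k, 'c) ring_scheme \<Rightarrow> ('k, 'a, 'r) module_scheme \<Rightarrow>
    ('k, 'a, ('k, 'a) form) calculus"
  where "omega K A =
    \<lparr>forms = quotient_module (free_dga K A) (omega_ideal K A),
     homogeneous = (\<lambda>p. {omega_ideal K A +>\<^bsub>free_dga K A\<^esub> f | f.
       f \<in> carrier (free_dga K A) \<and> (\<forall>w. f w \<noteq> \<zero>\<^bsub>K\<^esub> \<longrightarrow> word_degree w = p)}),
     differential = quotient_map (free_dga K A) (omega_ideal K A)
       (free_eval K (free_dga K A) (word_differential K A)),
     embed = (\<lambda>a. omega_ideal K A +>\<^bsub>free_dga K A\<^esub> monom_fun K [Elt a])\<rparr>"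

abbreviation Omega :: "('k, 'c) ring_scheme \<Rightarrow> ('k, 'a, 'r) module_scheme \<Rightarrow>
    ('k, ('k, 'a) form) module"
  where "Omega K A \<equiv> forms (omega K A)"

section \<open>Twisting maps\<close>

text \<open>The identities between composites are evaluated on pure tensors \<open>b \<otimes> a \<otimes> a'\<close> and
  \<open>b \<otimes> b' \<otimes> a\<close>, which span the iterated tensor products.\<close>

definition twisting_map ::
  "('k, 'c) ring_scheme \<Rightarrow> ('k, 'a, 'r) module_scheme \<Rightarrow> ('k, 'b, 's) module_scheme \<Rightarrow>
   (('k, 'b, 'a) tens \<Rightarrow> ('k, 'a, 'b) tens) \<Rightarrow> bool"
  where "twisting_map K A B R \<longleftrightarrow>
    linear_map K (tensor K B A) (tensor K A B) R \<and>
    (\<forall>b\<in>carrier B. R (pure K B A b \<one>\<^bsub>A\<^esub>) = pure K A B \<one>\<^bsub>A\<^esub> b) \<and>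
    (\<forall>a\<in>carrier A. R (pure K B A \<one>\<^bsub>B\<^esub> a) = pure K A B a \<one>\<^bsub>B\<^esub>) \<and>
    (\<forall>b\<in>carrier B. \<forall>a\<in>carrier A. \<forall>a'\<in>carrier A.
      R (pure K B A b (a \<otimes>\<^bsub>A\<^esub> a')) =
        tensor_lift K (tensor K A B)
          (\<lambda>a\<^sub>R b\<^sub>R. tensor_map K A B (\<lambda>\<alpha>. a\<^sub>R \<otimes>\<^bsub>A\<^esub> \<alpha>) (\<lambda>\<beta>. \<beta>) (R (pure K B A b\<^sub>R a')))
          (R (pure K B A b a))) \<and>
    (\<forall>b\<in>carrier B. \<forall>b'\<in>carrier B. \<forall>a\<in>carrier A.
      R (pure K B A (b \<otimes>\<^bsub>B\<^esub> b') a) =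
        tensor_lift K (tensor K A B)
          (\<lambda>a\<^sub>R b'\<^sub>R. tensor_map K A B (\<lambda>\<alpha>. \<alpha>) (\<lambda>\<beta>. \<beta> \<otimes>\<^bsub>B\<^esub> b'\<^sub>R) (R (pure K B A b a\<^sub>R)))
          (R (pure K B A b' a)))"

definition twisted_tensor ::
  "('k, 'c) ring_scheme \<Rightarrow> ('k, 'a, 'r) module_scheme \<Rightarrow> ('k, 'b, 's) module_scheme \<Rightarrow>
   (('k, 'b, 'a) tens \<Rightarrow> ('k, 'a, 'b) tens) \<Rightarrow> ('k, ('k, 'a, 'b) tens) module"
  where "twisted_tensor K A B R =
    (tensor K A B)
      \<lparr>mult := (\<lambda>x y.
         tensor_lift K (tensor K A B)
           (\<lambda>a b. tensor_lift K (tensor K A B)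
             (\<lambda>a' b'. tensor_map K A B (\<lambda>a'\<^sub>R. a \<otimes>\<^bsub>A\<^esub> a'\<^sub>R) (\<lambda>b\<^sub>R. b\<^sub>R \<otimes>\<^bsub>B\<^esub> b') (R (pure K B A b a')))
             y)
           x),
       one := pure K A B \<one>\<^bsub>A\<^esub> \<one>\<^bsub>B\<^esub>\<rparr>"

text \<open>\<open>Rt\<close> is the extension of \<open>R\<close> to the universal differential graded algebras.\<close>

definition twisting_extension ::
  "('k, 'c) ring_scheme \<Rightarrow> ('k, 'a, 'r) module_scheme \<Rightarrow> ('k, 'b, 's) module_scheme \<Rightarrow>
   (('k, 'b, 'a) tens \<Rightarrow> ('k, 'a, 'b) tens) \<Rightarrow>
   (('k, ('k, 'b) form, ('k, 'a) form) tens \<Rightarrow> ('k, ('k, 'a) form, ('k, 'b) form) tens) \<Rightarrow> bool"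
  where "twisting_extension K A B R Rt \<longleftrightarrow>
    twisting_map K (Omega K A) (Omega K B) Rt \<and>
    (\<forall>b\<in>carrier B. \<forall>a\<in>carrier A.
      Rt (pure K (Omega K B) (Omega K A) (embed (omega K B) b) (embed (omega K A) a)) =
        tensor_map K (Omega K A) (Omega K B) (embed (omega K A)) (embed (omega K B))
          (R (pure K B A b a))) \<and>
    (\<forall>t\<in>carrier (tensor K (Omega K B) (Omega K A)).
      Rt (tensor_map K (Omega K B) (Omega K A) (differential (omega K B)) (\<lambda>\<phi>. \<phi>) t) =
        tensor_map K (Omega K A) (Omega K B) (parity (omega K A)) (differential (omega K B)) (Rt t) \<and>
      Rt (tensor_map K (Omega K B) (Omega K A) (\<lambda>\<omega>. \<omega>) (differential (omega K A)) t) =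
        tensor_map K (Omega K A) (Omega K B) (differential (omega K A)) (parity (omega K B)) (Rt t))"

text \<open>The module of one-forms of this calculus is \<open>\<Omega>\<^sup>1A \<otimes> B \<oplus> A \<otimes> \<Omega>\<^sup>1B\<close>, as the degree one part of
  \<open>\<Omega>A \<otimes> \<Omega>B\<close>.\<close>

definition twisted_calculus ::
  "('k, 'c) ring_scheme \<Rightarrow> ('k, 'a, 'r) module_scheme \<Rightarrow> ('k, 'b, 's) module_scheme \<Rightarrow>
   (('k, ('k, 'b) form, ('k, 'a) form) tens \<Rightarrow> ('k, ('k, 'a) form, ('k, 'b) form) tens) \<Rightarrow>
   ('k, ('k, 'a, 'b) tens, ('k, ('k, 'a) form, ('k, 'b) form) tens) calculus"
  where "twisted_calculus K A B Rt =
    (let T = tensor K (Omega K A) (Omega K B); t = pure K (Omega K A) (Omega K B) in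
      \<lparr>forms = twisted_tensor K (Omega K A) (Omega K B) Rt,
       homogeneous = (\<lambda>n. lin_span K T {t \<phi> \<omega> | \<phi> \<omega> p q.
         \<phi> \<in> homogeneous (omega K A) p \<and> \<omega> \<in> homogeneous (omega K B) q \<and> p + q = n}),
       differential = tensor_lift K T (\<lambda>\<phi> \<omega>.
         t (differential (omega K A) \<phi>) \<omega> \<oplus>\<^bsub>T\<^esub> t (parity (omega K A) \<phi>) (differential (omega K B) \<omega>)),
       embed = tensor_map K (Omega K A) (Omega K B) (embed (omega K A)) (embed (omega K B))\<rparr>)"


section \<open>Module twisting maps and the product connection\<close>

definition module_twisting_map ::
  "('k, 'c) ring_scheme \<Rightarrow> ('k, 'a, 'r) module_scheme \<Rightarrow> ('k, 'b, 's) module_scheme \<Rightarrow>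
   (('k, 'b, 'a) tens \<Rightarrow> ('k, 'a, 'b) tens) \<Rightarrow> ('k, 'f, 'b) right_module \<Rightarrow>
   (('k, 'f, 'a) tens \<Rightarrow> ('k, 'a, 'f) tens) \<Rightarrow> bool"
  where "module_twisting_map K A B R F \<tau> \<longleftrightarrow>
    linear_map K (tensor K F A) (tensor K A F) \<tau> \<and>
    (\<forall>f\<in>carrier F. \<forall>a\<in>carrier A. \<forall>a'\<in>carrier A.
      \<tau> (pure K F A f (a \<otimes>\<^bsub>A\<^esub> a')) =
        tensor_lift K (tensor K A F)
          (\<lambda>a\<^sub>\<tau> f\<^sub>\<tau>. tensor_map K A F (\<lambda>\<alpha>. a\<^sub>\<tau> \<otimes>\<^bsub>A\<^esub> \<alpha>) (\<lambda>g. g) (\<tau> (pure K F A f\<^sub>\<tau> a')))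
          (\<tau> (pure K F A f a))) \<and>
    (\<forall>f\<in>carrier F. \<forall>b\<in>carrier B. \<forall>a\<in>carrier A.
      \<tau> (pure K F A (f \<triangleleft>\<^bsub>F\<^esub> b) a) =
        tensor_lift K (tensor K A F)
          (\<lambda>a\<^sub>R b\<^sub>R. tensor_map K A F (\<lambda>\<alpha>. \<alpha>) (\<lambda>g. g \<triangleleft>\<^bsub>F\<^esub> b\<^sub>R) (\<tau> (pure K F A f a\<^sub>R)))
          (R (pure K B A b a)))"

text \<open>The restriction \<open>\<Omega>\<^sup>1B \<otimes> A \<rightarrow> A \<otimes> \<Omega>\<^sup>1B\<close> of \<open>Rt\<close>, on \<open>\<eta> \<otimes> a\<close>: its value in
  \<open>\<Omega>\<^sup>0A \<otimes> \<Omega>\<^sup>1B\<close> is read back in \<open>A \<otimes> \<Omega>\<^sup>1B\<close>.\<close>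

definition twist_one_form ::
  "('k, 'c) ring_scheme \<Rightarrow> ('k, 'a, 'r) module_scheme \<Rightarrow> ('k, 'b, 's) module_scheme \<Rightarrow>
   (('k, ('k, 'b) form, ('k, 'a) form) tens \<Rightarrow> ('k, ('k, 'a) form, ('k, 'b) form) tens) \<Rightarrow>
   ('k, 'b) form \<Rightarrow> 'a \<Rightarrow> ('k, 'a, ('k, 'b) form) tens"
  where "twist_one_form K A B Rt \<eta> a =
    inv_into (carrier (tensor K A (one_forms (omega K B))))
      (tensor_map K (Omega K A) (Omega K B) (embed (omega K A)) (\<lambda>\<omega>. \<omega>))
      (Rt (pure K (Omega K B) (Omega K A) \<eta> (embed (omega K A) a)))"

definition connection_compatible ::
  "('k, 'c) ring_scheme \<Rightarrow> ('k, 'a, 'r) module_scheme \<Rightarrow> ('k, 'b, 's) module_scheme \<Rightarrow>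
   (('k, ('k, 'b) form, ('k, 'a) form) tens \<Rightarrow> ('k, ('k, 'a) form, ('k, 'b) form) tens) \<Rightarrow>
   ('k, 'f, 'b) right_module \<Rightarrow> (('k, 'f, 'a) tens \<Rightarrow> ('k, 'a, 'f) tens) \<Rightarrow>
   ('f \<Rightarrow> ('k, 'f, ('k, 'b) form) tens set) \<Rightarrow> bool"
  where "connection_compatible K A B Rt F \<tau> nablaF \<longleftrightarrow>
    (let P = tensor_over K B F (one_forms (omega K B)) in
      \<forall>f\<in>carrier F. \<forall>a\<in>carrier A.
        tensor_map K A P (\<lambda>\<alpha>. \<alpha>) nablaF (\<tau> (pure K F A f a)) =
        tensor_over_lift K (tensor K A P)
          (\<lambda>g \<eta>. tensor_lift K (tensor K A P)
            (\<lambda>a\<^sub>R \<eta>\<^sub>R. tensor_map K A P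
              (\<lambda>\<alpha>. \<alpha>) (\<lambda>g\<^sub>\<tau>. pure_over K B F (one_forms (omega K B)) g\<^sub>\<tau> \<eta>\<^sub>R)
              (\<tau> (pure K F A g a\<^sub>R)))
            (twist_one_form K A B Rt \<eta> a))
          (nablaF f))"

definition sum_module ::
  "('k, 'c) ring_scheme \<Rightarrow> ('k, 'a, 'r) module_scheme \<Rightarrow> ('k, 'b, 's) module_scheme \<Rightarrow>
   (('k, 'b, 'a) tens \<Rightarrow> ('k, 'a, 'b) tens) \<Rightarrow>
   ('k, 'e, 'a) right_module \<Rightarrow> ('k, 'f, 'b) right_module \<Rightarrow>
   (('k, 'f, 'a) tens \<Rightarrow> ('k, 'a, 'f) tens) \<Rightarrow>
   ('k, ('k, 'e, 'b) tens \<times> ('k, 'a, 'f) tens, ('k, 'a, 'b) tens) right_module"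
  where "sum_module K A B R E F \<tau> =
    (let U = tensor K E B; V = tensor K A F in
      \<lparr>carrier = carrier U \<times> carrier V, mult = undefined, one = undefined,
       zero = (\<zero>\<^bsub>U\<^esub>, \<zero>\<^bsub>V\<^esub>),
       add = (\<lambda>(u, v) (u', v'). (u \<oplus>\<^bsub>U\<^esub> u', v \<oplus>\<^bsub>V\<^esub> v')),
       smult = (\<lambda>c (u, v). (c \<odot>\<^bsub>U\<^esub> u, c \<odot>\<^bsub>V\<^esub> v)),
       ract = (\<lambda>(u, v) y.
         (tensor_lift K U
            (\<lambda>e b. tensor_lift K U
              (\<lambda>\<alpha> \<beta>. tensor_map K E B (\<lambda>\<alpha>\<^sub>R. e \<triangleleft>\<^bsub>E\<^esub> \<alpha>\<^sub>R) (\<lambda>b\<^sub>R. b\<^sub>R \<otimes>\<^bsub>B\<^esub> \<beta>) (R (pure K B A b \<alpha>)))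
              y)
            u,
          tensor_lift K V
            (\<lambda>a f. tensor_lift K V
              (\<lambda>\<alpha> \<beta>. tensor_map K A F (\<lambda>\<alpha>\<^sub>\<tau>. a \<otimes>\<^bsub>A\<^esub> \<alpha>\<^sub>\<tau>) (\<lambda>f\<^sub>\<tau>. f\<^sub>\<tau> \<triangleleft>\<^bsub>F\<^esub> \<beta>) (\<tau> (pure K F A f \<alpha>)))
              y)
            v))\<rparr>)"

text \<open>The defining formulas of \<open>\<nabla>\<^sub>1\<close> and \<open>\<nabla>\<^sub>2\<close>, required for every way of writing
  \<open>\<nabla>\<^sup>E(e)\<close>, \<open>\<nabla>\<^sup>F(f)\<close> and \<open>\<sigma>(a \<otimes> f)\<close> as a finite sum of the indicated form.\<close>

definition nabla1_formula ::
  "('k, 'c) ring_scheme \<Rightarrow> ('k, 'a, 'r) module_scheme \<Rightarrow> ('k, 'b, 's) module_scheme \<Rightarrow>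
   (('k, 'b, 'a) tens \<Rightarrow> ('k, 'a, 'b) tens) \<Rightarrow>
   (('k, ('k, 'b) form, ('k, 'a) form) tens \<Rightarrow> ('k, ('k, 'a) form, ('k, 'b) form) tens) \<Rightarrow>
   ('k, 'e, 'a) right_module \<Rightarrow> ('k, 'f, 'b) right_module \<Rightarrow>
   (('k, 'f, 'a) tens \<Rightarrow> ('k, 'a, 'f) tens) \<Rightarrow>
   ('e \<Rightarrow> ('k, 'e, ('k, 'a) form) tens set) \<Rightarrow>
   (('k, 'e, 'b) tens \<Rightarrow>
     ('k, ('k, 'e, 'b) tens \<times> ('k, 'a, 'f) tens, ('k, ('k, 'a) form, ('k, 'b) form) tens) tens set)
   \<Rightarrow> bool"
  where "nabla1_formula K A B R Rt E F \<tau> nablaE N1 \<longleftrightarrow>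
    (let D = twisted_tensor K A B R; M = sum_module K A B R E F \<tau>;
         W = one_forms (twisted_calculus K A B Rt); T = tensor_over K D M W;
         left = (\<lambda>e b. (pure K E B e b, \<zero>\<^bsub>tensor K A F\<^esub>));
         form = pure K (Omega K A) (Omega K B);
         iA = embed (omega K A); iB = embed (omega K B);
         dA = d0 (omega K A); dB = d0 (omega K B)
     in linear_map K (tensor K E B) T N1 \<and>
        (\<forall>e\<in>carrier E. \<forall>b\<in>carrier B. \<forall>n. \<forall>ei\<in>{..<n::nat} \<rightarrow> carrier E. \<forall>ai\<in>{..<n} \<rightarrow> carrier A.
          nablaE e = (\<Oplus>\<^bsub>tensor_over K A E (one_forms (omega K A))\<^esub>i\<in>{..<n}.
                        pure_over K A E (one_forms (omega K A)) (ei i) (dA (ai i))) \<longrightarrow>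
          N1 (pure K E B e b) =
            (\<Oplus>\<^bsub>T\<^esub>i\<in>{..<n}. pure_over K D M W (left (ei i) \<one>\<^bsub>B\<^esub>) (form (dA (ai i)) (iB b)))
              \<oplus>\<^bsub>T\<^esub> pure_over K D M W (left e \<one>\<^bsub>B\<^esub>) (form (iA \<one>\<^bsub>A\<^esub>) (dB b))))"

definition nabla2_formula ::
  "('k, 'c) ring_scheme \<Rightarrow> ('k, 'a, 'r) module_scheme \<Rightarrow> ('k, 'b, 's) module_scheme \<Rightarrow>
   (('k, 'b, 'a) tens \<Rightarrow> ('k, 'a, 'b) tens) \<Rightarrow>
   (('k, ('k, 'b) form, ('k, 'a) form) tens \<Rightarrow> ('k, ('k, 'a) form, ('k, 'b) form) tens) \<Rightarrow>
   ('k, 'e, 'a) right_module \<Rightarrow> ('k, 'f, 'b) right_module \<Rightarrow>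
   (('k, 'f, 'a) tens \<Rightarrow> ('k, 'a, 'f) tens) \<Rightarrow> (('k, 'a, 'f) tens \<Rightarrow> ('k, 'f, 'a) tens) \<Rightarrow>
   ('f \<Rightarrow> ('k, 'f, ('k, 'b) form) tens set) \<Rightarrow>
   (('k, 'a, 'f) tens \<Rightarrow>
     ('k, ('k, 'e, 'b) tens \<times> ('k, 'a, 'f) tens, ('k, ('k, 'a) form, ('k, 'b) form) tens) tens set)
   \<Rightarrow> bool"
  where "nabla2_formula K A B R Rt E F \<tau> \<sigma> nablaF N2 \<longleftrightarrow>
    (let D = twisted_tensor K A B R; M = sum_module K A B R E F \<tau>;
         W = one_forms (twisted_calculus K A B Rt); T = tensor_over K D M W;
         right = (\<lambda>a f. (\<zero>\<^bsub>tensor K E B\<^esub>, pure K A F a f));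
         form = pure K (Omega K A) (Omega K B);
         iA = embed (omega K A); iB = embed (omega K B);
         dA = d0 (omega K A); dB = d0 (omega K B)
     in linear_map K (tensor K A F) T N2 \<and>
        (\<forall>a\<in>carrier A. \<forall>f\<in>carrier F.
         \<forall>n. \<forall>fk\<in>{..<n::nat} \<rightarrow> carrier F. \<forall>bk\<in>{..<n} \<rightarrow> carrier B.
         \<forall>m. \<forall>f\<^sub>\<sigma>\<in>{..<m::nat} \<rightarrow> carrier F. \<forall>a\<^sub>\<sigma>\<in>{..<m} \<rightarrow> carrier A.
          nablaF f = (\<Oplus>\<^bsub>tensor_over K B F (one_forms (omega K B))\<^esub>k\<in>{..<n}.
                        pure_over K B F (one_forms (omega K B)) (fk k) (dB (bk k))) \<and>
          \<sigma> (pure K A F a f) = (\<Oplus>\<^bsub>tensor K F A\<^esub>j\<in>{..<m}. pure K F A (f\<^sub>\<sigma> j) (a\<^sub>\<sigma> j)) \<longrightarrow>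
          N2 (pure K A F a f) =
            (\<Oplus>\<^bsub>T\<^esub>k\<in>{..<n}. pure_over K D M W (right a (fk k)) (form (iA \<one>\<^bsub>A\<^esub>) (dB (bk k))))
              \<oplus>\<^bsub>T\<^esub> (\<Oplus>\<^bsub>T\<^esub>j\<in>{..<m}.
                pure_over K D M W (right \<one>\<^bsub>A\<^esub> (f\<^sub>\<sigma> j)) (form (dA (a\<^sub>\<sigma> j)) (iB \<one>\<^bsub>B\<^esub>)))))"

end

theory Submission
  imports Defs
begin

text \<open>Let \<open>D = A \<otimes>\<^sub>R B\<close>, let \<open>M = E \<otimes> B \<oplus> A \<otimes> F\<close>, and let \<open>Z\<close> be the tensor product over \<open>D\<close> of \<open>M\<close> with
  the one-forms of \<open>\<Omega>A \<otimes> \<Omega>B\<close>.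

  The Leibniz rule propagates along products. Since \<open>d\<close> is a derivation, the assignment
  \<open>(m, z) \<mapsto> (m x, z x + m \<otimes> dx)\<close>, for \<open>m\<close> in \<open>M\<close> and \<open>z\<close> in \<open>Z\<close>, is an action of the elements \<open>x\<close> of \<open>D\<close>
  on pairs (\<open>leibniz_mult\<close>). So if a linear map \<open>N\<close> satisfies \<open>N(m x) = z x + m \<otimes> dx\<close> for one \<open>m\<close>, one
  \<open>z\<close> and all \<open>x\<close>, then it satisfies the Leibniz rule at every multiple \<open>m x\<close>; and the formula itself has
  to be verified only for factors of \<open>x\<close>. It remains to verify it at the elements \<open>e \<otimes> 1\<close> and \<open>1 \<otimes> f\<close>,
  whose multiples span \<open>M\<close>.

  At \<open>e \<otimes> 1\<close>, with \<open>z\<close> the image of \<open>\<nabla>\<^sup>E e\<close> under \<open>e' \<otimes> \<omega> \<mapsto> (e' \<otimes> 1) \<otimes> (\<omega> \<otimes> 1)\<close>, one takes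
  \<open>x = a \<otimes> b = (a \<otimes> 1)(1 \<otimes> b)\<close>: the factor \<open>a\<close> is the Leibniz rule of \<open>\<nabla>\<^sup>E\<close>, and the factor \<open>b\<close> is the
  definition of \<open>\<nabla>\<^sub>1\<close> (\<open>N1_leibniz\<close>).

  At \<open>1 \<otimes> f\<close>, with \<open>z\<close> the image of \<open>\<nabla>\<^sup>F f\<close>, the two factors occur in the other order. For
  \<open>x = a \<otimes> 1\<close> one has \<open>(1 \<otimes> f) x = \<tau>(f \<otimes> a)\<close>; the second sum in \<open>\<nabla>\<^sub>2\<close> is then \<open>(1 \<otimes> f) \<otimes> dx\<close> by
  definition, and the first sum is \<open>z x\<close>, which is exactly what the compatibility condition says
  (\<open>N2_first_\<tau>\<close>). For \<open>x = 1 \<otimes> b\<close> the formula comes from the Leibniz rule of \<open>\<nabla>\<^sup>F\<close>. Because \<open>R\<close> is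
  bijective, the products \<open>(1 \<otimes> b)(a \<otimes> 1) = R(b \<otimes> a)\<close> span \<open>D\<close>, and the formula propagates to all of \<open>D\<close>
  (\<open>N2_leibniz\<close>). Because \<open>\<tau>\<close> is bijective, the elements \<open>\<tau>(f \<otimes> a)\<close> span \<open>A \<otimes> F\<close>.

  The objects in this argument also have to exist. That \<open>D\<close>, and likewise \<open>\<Omega>A \<otimes> \<Omega>B\<close>, is an algebra
  acting on \<open>M\<close> is reduced to the identity \<open>((1 \<otimes> f) x) y = (1 \<otimes> f)(x y)\<close>, both sides being
  \<open>\<tau>(f \<otimes> \<alpha>) R(\<beta> \<otimes> \<alpha>')\<close> up to multiplication on the outside (\<open>act_assoc\<close>). That \<open>\<Omega>A \<otimes> \<Omega>B\<close> is a
  differential calculus rests on the fact that the extension of \<open>R\<close> preserves bidegrees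
  (\<open>Rt_bidegree\<close>); this follows from its compatibility with products and differentials, because a
  calculus is generated in degree zero. Both sides of the compatibility condition make sense because the
  right one is balanced over \<open>B\<close> (\<open>twist_form_balanced\<close>). Finally \<open>\<nabla>\<^sub>1\<close> and \<open>\<nabla>\<^sub>2\<close> are determined by their
  formulas because every element of \<open>E \<otimes>\<^sub>A \<Omega>\<^sup>1A\<close> is a finite sum of elements \<open>e \<otimes> da\<close>
  (\<open>tensor_one_forms_finite_sum\<close>).\<close>

section \<open>Linear maps\<close>

text \<open>The module axioms of both spaces are part of the predicate, so that the closure rules below
  carry them along: linearity of a composite is then a matter of composing rules, without separate
  side conditions on the spaces in between.\<close>

definition lin ::
  "('k, 'c) ring_scheme \<Rightarrow> ('k, 'v, 'r) module_scheme \<Rightarrow> ('k, 'w, 's) module_scheme \<Rightarrow> ('v \<Rightarrow> 'w) \<Rightarrow> bool"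
  where "lin K V W f \<longleftrightarrow> module K V \<and> module K W \<and> linear_map K V W f"

lemma linI:
  assumes "module K V" "module K W" "\<And>x. x \<in> carrier V \<Longrightarrow> f x \<in> carrier W"
    "\<And>x y. \<lbrakk>x \<in> carrier V; y \<in> carrier V\<rbrakk> \<Longrightarrow> f (x \<oplus>\<^bsub>V\<^esub> y) = f x \<oplus>\<^bsub>W\<^esub> f y"
    "\<And>c x. \<lbrakk>c \<in> carrier K; x \<in> carrier V\<rbrakk> \<Longrightarrow> f (c \<odot>\<^bsub>V\<^esub> x) = c \<odot>\<^bsub>W\<^esub> f x"
  shows "lin K V W f"
  using assms unfolding lin_def linear_map_def by auto

lemma lin_module: "lin K V W f \<Longrightarrow> module K V" "lin K V W f \<Longrightarrow> module K W"
  and lin_linear_map: "lin K V W f \<Longrightarrow> linear_map K V W f"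
  and lin_closed: "\<lbrakk>lin K V W f; x \<in> carrier V\<rbrakk> \<Longrightarrow> f x \<in> carrier W"
  and lin_add: "\<lbrakk>lin K V W f; x \<in> carrier V; y \<in> carrier V\<rbrakk> \<Longrightarrow> f (x \<oplus>\<^bsub>V\<^esub> y) = f x \<oplus>\<^bsub>W\<^esub> f y"
  and lin_smult: "\<lbrakk>lin K V W f; c \<in> carrier K; x \<in> carrier V\<rbrakk> \<Longrightarrow> f (c \<odot>\<^bsub>V\<^esub> x) = c \<odot>\<^bsub>W\<^esub> f x"
  unfolding lin_def linear_map_def by auto

lemma module_closed:
  assumes "module K V"
  shows "\<zero>\<^bsub>V\<^esub> \<in> carrier V"
    and "\<lbrakk>x \<in> carrier V; y \<in> carrier V\<rbrakk> \<Longrightarrow> x \<oplus>\<^bsub>V\<^esub> y \<in> carrier V"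
    and "x \<in> carrier V \<Longrightarrow> \<ominus>\<^bsub>V\<^esub> x \<in> carrier V"
    and "\<lbrakk>x \<in> carrier V; y \<in> carrier V\<rbrakk> \<Longrightarrow> x \<ominus>\<^bsub>V\<^esub> y \<in> carrier V"
    and "\<lbrakk>c \<in> carrier K; x \<in> carrier V\<rbrakk> \<Longrightarrow> c \<odot>\<^bsub>V\<^esub> x \<in> carrier V"
proof -
  interpret V: module K V by fact
  show "\<zero>\<^bsub>V\<^esub> \<in> carrier V"
    and "\<lbrakk>x \<in> carrier V; y \<in> carrier V\<rbrakk> \<Longrightarrow> x \<oplus>\<^bsub>V\<^esub> y \<in> carrier V"
    and "x \<in> carrier V \<Longrightarrow> \<ominus>\<^bsub>V\<^esub> x \<in> carrier V"
    and "\<lbrakk>x \<in> carrier V; y \<in> carrier V\<rbrakk> \<Longrightarrow> x \<ominus>\<^bsub>V\<^esub> y \<in> carrier V"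
    and "\<lbrakk>c \<in> carrier K; x \<in> carrier V\<rbrakk> \<Longrightarrow> c \<odot>\<^bsub>V\<^esub> x \<in> carrier V" by auto
qed

lemma module_minus_conv:
  assumes "module K V" "x \<in> carrier V"
  shows "\<ominus>\<^bsub>V\<^esub> x = (\<ominus>\<^bsub>K\<^esub> \<one>\<^bsub>K\<^esub>) \<odot>\<^bsub>V\<^esub> x"
proof -
  interpret V: module K V by fact
  show ?thesis using assms by (simp add: V.smult_l_minus)
qed

lemma lin_zero:
  assumes "lin K V W f" shows "f \<zero>\<^bsub>V\<^esub> = \<zero>\<^bsub>W\<^esub>"
proof -
  interpret V: module K V using lin_module(1)[OF assms] .
  interpret W: module K W using lin_module(2)[OF assms] .
  have "f (\<zero>\<^bsub>K\<^esub> \<odot>\<^bsub>V\<^esub> \<zero>\<^bsub>V\<^esub>) = \<zero>\<^bsub>K\<^esub> \<odot>\<^bsub>W\<^esub> f \<zero>\<^bsub>V\<^esub>" by (intro lin_smult[OF assms]) auto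
  then show ?thesis using lin_closed[OF assms, of "\<zero>\<^bsub>V\<^esub>"] by simp
qed

lemma lin_minus:
  assumes "lin K V W f" "x \<in> carrier V" shows "f (\<ominus>\<^bsub>V\<^esub> x) = \<ominus>\<^bsub>W\<^esub> f x"
proof -
  interpret V: module K V using lin_module(1)[OF assms(1)] .
  interpret W: module K W using lin_module(2)[OF assms(1)] .
  have "f ((\<ominus>\<^bsub>K\<^esub> \<one>\<^bsub>K\<^esub>) \<odot>\<^bsub>V\<^esub> x) = (\<ominus>\<^bsub>K\<^esub> \<one>\<^bsub>K\<^esub>) \<odot>\<^bsub>W\<^esub> f x" using assms by (intro lin_smult[OF assms(1)]) auto
  then show ?thesis using assms lin_closed[OF assms]
    by (simp add: V.smult_l_minus W.smult_l_minus)
qed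

lemma lin_diff:
  assumes "lin K V W f" "x \<in> carrier V" "y \<in> carrier V" shows "f (x \<ominus>\<^bsub>V\<^esub> y) = f x \<ominus>\<^bsub>W\<^esub> f y"
  using assms lin_add[OF assms(1,2)] lin_minus[OF assms(1,3)] module_closed[OF lin_module(1)[OF assms(1)]]
  by (simp add: a_minus_def)

lemma lin_finsum:
  assumes f: "lin K V W f" and "finite I" "\<And>i. i \<in> I \<Longrightarrow> g i \<in> carrier V"
  shows "f (\<Oplus>\<^bsub>V\<^esub>i\<in>I. g i) = (\<Oplus>\<^bsub>W\<^esub>i\<in>I. f (g i))"
  using assms(2,3)
proof (induction I)
  interpret V: module K V using lin_module(1)[OF f] .
  interpret W: module K W using lin_module(2)[OF f] .
  case empty
  then show ?case using lin_zero[OF f] by simp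
next
  interpret V: module K V using lin_module(1)[OF f] .
  interpret W: module K W using lin_module(2)[OF f] .
  case (insert i I)
  then show ?case using lin_closed[OF f] by (simp add: lin_add[OF f] Pi_def)
qed

lemma lin_id: "module K V \<Longrightarrow> lin K V V (\<lambda>x. x)"
  by (rule linI) auto

lemma lin_comp: "\<lbrakk>lin K W U g; lin K V W f\<rbrakk> \<Longrightarrow> lin K V U (\<lambda>x. g (f x))"
  by (rule linI) (auto simp: lin_module lin_closed lin_add lin_smult)

lemma lin_const_zero: "\<lbrakk>module K V; module K W\<rbrakk> \<Longrightarrow> lin K V W (\<lambda>x. \<zero>\<^bsub>W\<^esub>)"
  by (rule linI) (auto simp: module.smult_r_null abelian_monoid.l_zero module.axioms abelian_group.axioms(1) module_closed)

lemma lin_plus: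
  assumes "lin K V W f" "lin K V W g" shows "lin K V W (\<lambda>x. f x \<oplus>\<^bsub>W\<^esub> g x)"
proof -
  interpret W: module K W using lin_module(2)[OF assms(1)] .
  show ?thesis
    using assms by (intro linI) (auto simp: lin_module lin_closed lin_add lin_smult W.smult_r_distr W.a_ac)
qed

lemma lin_uminus:
  assumes "lin K V W f" shows "lin K V W (\<lambda>x. \<ominus>\<^bsub>W\<^esub> f x)"
proof -
  interpret W: module K W using lin_module(2)[OF assms(1)] .
  show ?thesis
    using assms by (intro linI) (auto simp: lin_module lin_closed lin_add lin_smult W.smult_r_minus W.minus_add)
qed

lemma lin_scale:
  assumes "lin K V W f" "c \<in> carrier K" shows "lin K V W (\<lambda>x. c \<odot>\<^bsub>W\<^esub> f x)"
proof -
  interpret W: module K W using lin_module(2)[OF assms(1)] .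
  have "lin K W W (\<lambda>y. c \<odot>\<^bsub>W\<^esub> y)"
    using assms by (intro linI) (auto simp: W.smult_r_distr W.smult_assoc1[symmetric] W.R.m_comm W.module_axioms)
  from lin_comp[OF this assms(1)] show ?thesis .
qed

lemma lin_sum:
  assumes "finite I" "module K V" "module K W" "\<And>i. i \<in> I \<Longrightarrow> lin K V W (f i)"
  shows "lin K V W (\<lambda>x. \<Oplus>\<^bsub>W\<^esub>i\<in>I. f i x)"
proof -
  interpret W: module K W by fact
  interpret V: module K V by fact
  note c = lin_closed[OF assms(4)]
  show ?thesis using c assms(1)
  proof (intro linI assms(2,3))
    fix x y assume "x \<in> carrier V" "y \<in> carrier V"
    then show "(\<Oplus>\<^bsub>W\<^esub>i\<in>I. f i (x \<oplus>\<^bsub>V\<^esub> y)) = (\<Oplus>\<^bsub>W\<^esub>i\<in>I. f i x) \<oplus>\<^bsub>W\<^esub> (\<Oplus>\<^bsub>W\<^esub>i\<in>I. f i y)"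
    proof -
      assume xy: "x \<in> carrier V" "y \<in> carrier V"
      have "(\<Oplus>\<^bsub>W\<^esub>i\<in>I. f i (x \<oplus>\<^bsub>V\<^esub> y)) = (\<Oplus>\<^bsub>W\<^esub>i\<in>I. f i x \<oplus>\<^bsub>W\<^esub> f i y)"
        using c xy by (intro W.finsum_cong') (auto simp: lin_add[OF assms(4)])
      then show ?thesis using c xy by (simp add: W.finsum_addf Pi_def)
    qed
  next
    fix a x assume "a \<in> carrier K" "x \<in> carrier V"
    then show "(\<Oplus>\<^bsub>W\<^esub>i\<in>I. f i (a \<odot>\<^bsub>V\<^esub> x)) = a \<odot>\<^bsub>W\<^esub> (\<Oplus>\<^bsub>W\<^esub>i\<in>I. f i x)"
      using c assms(1) by (subst W.finsum_smult_ldistr) (auto intro!: W.finsum_cong' simp: lin_smult[OF assms(4)])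
  qed auto
qed

lemma lin_cong: "\<lbrakk>lin K X U g; \<And>x. x \<in> carrier X \<Longrightarrow> f x = g x\<rbrakk> \<Longrightarrow> lin K X U f"
  unfolding lin_def linear_map_def by (auto simp: Pi_def module_closed)

lemma lin_restrict:
  assumes f: "lin K V W f" and V': "module K V'" "carrier V' \<subseteq> carrier V" "add V' = add V" "smult V' = smult V"
    and W': "module K W'" "add W' = add W" "smult W' = smult W" and m: "\<And>x. x \<in> carrier V' \<Longrightarrow> f x \<in> carrier W'"
  shows "lin K V' W' f"
  using V'(2) by (intro linI V'(1) W'(1) m) (auto simp: V' W' lin_add[OF f] lin_smult[OF f] subset_iff)

section \<open>Submodules and spans\<close>

lemma submodule_facts:
  assumes "submodule N K V"
  shows "N \<subseteq> carrier V" "\<zero>\<^bsub>V\<^esub> \<in> N" "\<lbrakk>x \<in> N; y \<in> N\<rbrakk> \<Longrightarrow> x \<oplus>\<^bsub>V\<^esub> y \<in> N"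
    "\<lbrakk>c \<in> carrier K; x \<in> N\<rbrakk> \<Longrightarrow> c \<odot>\<^bsub>V\<^esub> x \<in> N"
proof -
  interpret submodule N K V by fact
  show "N \<subseteq> carrier V" "\<zero>\<^bsub>V\<^esub> \<in> N" "\<lbrakk>x \<in> N; y \<in> N\<rbrakk> \<Longrightarrow> x \<oplus>\<^bsub>V\<^esub> y \<in> N"
    "\<lbrakk>c \<in> carrier K; x \<in> N\<rbrakk> \<Longrightarrow> c \<odot>\<^bsub>V\<^esub> x \<in> N"
    using subset m_closed one_closed smult_closed by auto
qed

lemma submodule_minus:
  assumes "submodule N K V" "module K V" "x \<in> N" shows "\<ominus>\<^bsub>V\<^esub> x \<in> N"
  by (meson assms module.submoduleE(3))

lemma submodule_intro:
  assumes "module K V" "N \<subseteq> carrier V" "\<zero>\<^bsub>V\<^esub> \<in> N"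
    "\<And>x y. \<lbrakk>x \<in> N; y \<in> N\<rbrakk> \<Longrightarrow> x \<oplus>\<^bsub>V\<^esub> y \<in> N"
    "\<And>c x. \<lbrakk>c \<in> carrier K; x \<in> N\<rbrakk> \<Longrightarrow> c \<odot>\<^bsub>V\<^esub> x \<in> N"
  shows "submodule N K V"
proof -
  interpret V: module K V by fact
  show ?thesis
    using assms by (intro V.submoduleI) (auto simp: module_minus_conv[OF assms(1)] subset_iff)
qed

lemma submodule_carrier: "module K V \<Longrightarrow> submodule (carrier V) K V"
  by (rule module.carrier_is_submodule)

lemma submodule_Inter:
  assumes "module K V" "\<And>N. N \<in> \<N> \<Longrightarrow> submodule N K V" "\<N> \<noteq> {}"
  shows "submodule (\<Inter>\<N>) K V"
  using assms by (intro submodule_intro) (auto dest: submodule_facts)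

lemma submodule_vimage:
  assumes "lin K V W f" "submodule N K W"
  shows "submodule {x \<in> carrier V. f x \<in> N} K V"
  using lin_module[OF assms(1)] submodule_facts[OF assms(2)]
  by (intro submodule_intro) (auto simp: lin_zero[OF assms(1)] lin_add[OF assms(1)] lin_smult[OF assms(1)] module_closed)

lemma submodule_equalizer:
  assumes f: "lin K V W f" and g: "lin K V W g"
  shows "submodule {x \<in> carrier V. f x = g x} K V"
  using lin_module[OF f]
  by (intro submodule_intro)
    (auto simp: lin_zero[OF f] lin_zero[OF g] lin_add[OF f] lin_add[OF g] lin_smult[OF f] lin_smult[OF g] module_closed)

lemma lin_span_least: "\<lbrakk>submodule N K V; S \<subseteq> N\<rbrakk> \<Longrightarrow> lin_span K V S \<subseteq> N"
  unfolding lin_span_def by auto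

lemma lin_span_superset: "S \<subseteq> lin_span K V S"
  unfolding lin_span_def by auto

lemma lin_span_submodule:
  assumes "module K V" "S \<subseteq> carrier V" shows "submodule (lin_span K V S) K V"
  unfolding lin_span_def using assms submodule_carrier[OF assms(1)] by (intro submodule_Inter) auto

lemma lin_span_eq_carrierI:
  assumes "module K V" "S \<subseteq> carrier V" "\<And>N. \<lbrakk>submodule N K V; S \<subseteq> N\<rbrakk> \<Longrightarrow> carrier V \<subseteq> N"
  shows "lin_span K V S = carrier V"
proof
  show "lin_span K V S \<subseteq> carrier V" using submodule_facts(1)[OF lin_span_submodule[OF assms(1,2)]] .
  show "carrier V \<subseteq> lin_span K V S"
    using assms(3)[OF lin_span_submodule[OF assms(1,2)] lin_span_superset] .
qed

lemma lin_eq_on_span: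
  assumes "lin K V W f" "lin K V W g" "S \<subseteq> carrier V" "\<And>x. x \<in> S \<Longrightarrow> f x = g x" "x \<in> lin_span K V S"
  shows "f x = g x"
  using lin_span_least[OF submodule_equalizer[OF assms(1,2)], of S] assms(3,4,5) by auto

lemma lin_maps_span:
  assumes "lin K V W f" "submodule N K W" "S \<subseteq> carrier V" "\<And>x. x \<in> S \<Longrightarrow> f x \<in> N" "x \<in> lin_span K V S"
  shows "f x \<in> N"
  using lin_span_least[OF submodule_vimage[OF assms(1,2)], of S] assms(3,4,5) by auto

lemma finsum_concat:
  assumes "module K V" "f \<in> {..<n::nat} \<rightarrow> carrier V" "g \<in> {..<m::nat} \<rightarrow> carrier V"
  shows "(\<Oplus>\<^bsub>V\<^esub>i\<in>{..<n + m}. if i < n then f i else g (i - n)) = (\<Oplus>\<^bsub>V\<^esub>i\<in>{..<n}. f i) \<oplus>\<^bsub>V\<^esub> (\<Oplus>\<^bsub>V\<^esub>i\<in>{..<m}. g i)"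
proof -
  interpret V: module K V by fact
  let ?h = "\<lambda>i. if i < n then f i else g (i - n)"
  have *: "{..<n + m} = {..<n} \<union> (\<lambda>i. i + n) ` {..<m}"
  proof (intro equalityI subsetI)
    fix x assume "x \<in> {..<n + m}"
    then have "x < n \<or> x = (x - n) + n \<and> x - n < m" by auto
    then show "x \<in> {..<n} \<union> (\<lambda>i. i + n) ` {..<m}" by blast
  qed auto
  have "(\<Oplus>\<^bsub>V\<^esub>i\<in>{..<n + m}. ?h i) = (\<Oplus>\<^bsub>V\<^esub>i\<in>{..<n}. ?h i) \<oplus>\<^bsub>V\<^esub> (\<Oplus>\<^bsub>V\<^esub>i\<in>(\<lambda>i. i + n) ` {..<m}. ?h i)"
    unfolding * using assms by (intro V.finsum_Un_disjoint) (auto simp: Pi_def)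
  also have "(\<Oplus>\<^bsub>V\<^esub>i\<in>{..<n}. ?h i) = (\<Oplus>\<^bsub>V\<^esub>i\<in>{..<n}. f i)"
    using assms by (intro V.finsum_cong') (auto simp: Pi_def)
  also have "(\<Oplus>\<^bsub>V\<^esub>i\<in>(\<lambda>i. i + n) ` {..<m}. ?h i) = (\<Oplus>\<^bsub>V\<^esub>i\<in>{..<m}. ?h (i + n))"
    using assms by (intro V.finsum_reindex) (auto simp: Pi_def inj_on_def)
  also have "\<dots> = (\<Oplus>\<^bsub>V\<^esub>i\<in>{..<m}. g i)"
    using assms by (intro V.finsum_cong') (auto simp: Pi_def)
  finally show ?thesis .
qed

lemma submodule_finsum:
  assumes V: "module K V" and N: "submodule N K V" and I: "finite I" and f: "\<And>i. i \<in> I \<Longrightarrow> f i \<in> N"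
  shows "(\<Oplus>\<^bsub>V\<^esub>i\<in>I. f i) \<in> N"
  using I f
proof (induction I)
  interpret V: module K V by fact
  note n = submodule_facts[OF N]
  case empty then show ?case using n by simp
next
  interpret V: module K V by fact
  note n = submodule_facts[OF N]
  case (insert i I)
  then have "f ` insert i I \<subseteq> carrier V" using n(1) by blast
  then show ?case using insert n(3) by (simp add: Pi_def image_subset_iff)
qed

text \<open>Scalars are absorbed into the spanning set, so the sums need no coefficients. This is
  the shape in which \<open>\<nabla>\<^sup>E(e)\<close>, \<open>\<nabla>\<^sup>F(f)\<close> and \<open>\<sigma>(a \<otimes> f)\<close> enter the formulas for \<open>\<nabla>\<^sub>1\<close> and \<open>\<nabla>\<^sub>2\<close>.\<close>

lemma lin_span_finite_sum:
  assumes V: "module K V" and G: "G \<subseteq> carrier V"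
    and sc: "\<And>c x. \<lbrakk>c \<in> carrier K; x \<in> G\<rbrakk> \<Longrightarrow> c \<odot>\<^bsub>V\<^esub> x \<in> G"
    and x: "x \<in> lin_span K V G"
  shows "\<exists>n g. g \<in> {..<n::nat} \<rightarrow> G \<and> x = (\<Oplus>\<^bsub>V\<^esub>i\<in>{..<n}. g i)"
proof -
  interpret V: module K V by fact
  let ?N = "{x. \<exists>n g. g \<in> {..<n::nat} \<rightarrow> G \<and> x = (\<Oplus>\<^bsub>V\<^esub>i\<in>{..<n}. g i)}"
  have "submodule ?N K V"
  proof (rule submodule_intro[OF V])
    show "?N \<subseteq> carrier V" using G by (auto intro!: V.finsum_closed)
    show "\<zero>\<^bsub>V\<^esub> \<in> ?N" by (auto intro!: exI[of _ "0::nat"])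
    fix x y assume "x \<in> ?N" "y \<in> ?N"
    then obtain n f m g where *: "f \<in> {..<n::nat} \<rightarrow> G" "x = (\<Oplus>\<^bsub>V\<^esub>i\<in>{..<n}. f i)"
      "g \<in> {..<m::nat} \<rightarrow> G" "y = (\<Oplus>\<^bsub>V\<^esub>i\<in>{..<m}. g i)" by auto
    have "x \<oplus>\<^bsub>V\<^esub> y = (\<Oplus>\<^bsub>V\<^esub>i\<in>{..<n + m}. if i < n then f i else g (i - n))"
      using * G by (subst finsum_concat[OF V]) (auto simp: Pi_def)
    moreover have "(\<lambda>i. if i < n then f i else g (i - n)) \<in> {..<n + m} \<rightarrow> G"
      using * by (auto simp: Pi_def)
    ultimately show "x \<oplus>\<^bsub>V\<^esub> y \<in> ?N" by blast
  next
    fix c x assume c: "c \<in> carrier K" and "x \<in> ?N"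
    then obtain n f where *: "f \<in> {..<n::nat} \<rightarrow> G" "x = (\<Oplus>\<^bsub>V\<^esub>i\<in>{..<n}. f i)" by auto
    have "c \<odot>\<^bsub>V\<^esub> x = (\<Oplus>\<^bsub>V\<^esub>i\<in>{..<n}. c \<odot>\<^bsub>V\<^esub> f i)"
      unfolding * using * c G by (intro V.finsum_smult_ldistr) (auto simp: Pi_def)
    moreover have "(\<lambda>i. c \<odot>\<^bsub>V\<^esub> f i) \<in> {..<n} \<rightarrow> G" using * c sc by (auto simp: Pi_def)
    ultimately show "c \<odot>\<^bsub>V\<^esub> x \<in> ?N" by blast
  qed
  moreover have "G \<subseteq> ?N"
  proof
    fix x assume "x \<in> G"
    then show "x \<in> ?N" using G by (auto intro!: exI[of _ "1::nat"] exI[of _ "\<lambda>_. x"] simp: lessThan_Suc)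
  qed
  ultimately show ?thesis using lin_span_least[of ?N K V G] x by blast
qed

section \<open>Quotient modules\<close>

lemma submodule_abelian_subgroup:
  assumes "submodule I K V" "module K V" shows "abelian_subgroup I V"
  using assms by (intro abelian_subgroupI3 additive_subgroupI) (auto simp: submodule.axioms module.axioms)

lemma quotient_simps:
  "carrier (quotient_module V I) = (\<lambda>x. I +>\<^bsub>V\<^esub> x) ` carrier V"
  "zero (quotient_module V I) = I"
  unfolding quotient_module_def FactRing_def A_RCOSETS_def' by auto

context
  fixes K :: "('k, 'c) ring_scheme" and V :: "('k, 'v, 'r) module_scheme" and I
  assumes V: "module K V" and I: "submodule I K V"
begin

interpretation V: module K V by (rule V)
interpretation I: abelian_subgroup I V by (rule submodule_abelian_subgroup[OF I V])

lemma coset_eq_iff: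
  assumes "x \<in> carrier V" "y \<in> carrier V"
  shows "I +>\<^bsub>V\<^esub> x = I +>\<^bsub>V\<^esub> y \<longleftrightarrow> x \<ominus>\<^bsub>V\<^esub> y \<in> I"
proof
  assume "I +>\<^bsub>V\<^esub> x = I +>\<^bsub>V\<^esub> y"
  then show "x \<ominus>\<^bsub>V\<^esub> y \<in> I"
    using V.a_coset_add_inv2[of I x y] V.a_coset_join1[OF _ _ I.a_subgroup] assms I.a_subset
    by (simp add: a_minus_def)
next
  assume "x \<ominus>\<^bsub>V\<^esub> y \<in> I"
  then show "I +>\<^bsub>V\<^esub> x = I +>\<^bsub>V\<^esub> y"
    using V.a_coset_add_inv1[of I x y] V.a_coset_join2[OF _ I.a_subgroup] assms I.a_subset
    by (simp add: a_minus_def)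
qed

lemma coset_self: "x \<in> carrier V \<Longrightarrow> x \<in> I +>\<^bsub>V\<^esub> x"
  by (rule I.a_rcos_self)

lemma coset_memD:
  assumes "x \<in> carrier V" "y \<in> I +>\<^bsub>V\<^esub> x" shows "y \<in> carrier V" "I +>\<^bsub>V\<^esub> y = I +>\<^bsub>V\<^esub> x" "y \<ominus>\<^bsub>V\<^esub> x \<in> I"
proof -
  show y: "y \<in> carrier V" using assms V.a_r_coset_subset_G I.a_subset by blast
  show e: "I +>\<^bsub>V\<^esub> y = I +>\<^bsub>V\<^esub> x" using V.a_repr_independence[OF assms(2,1) I.a_subgroup] by simp
  show "y \<ominus>\<^bsub>V\<^esub> x \<in> I" using coset_eq_iff[OF y assms(1)] e by simp
qed

lemma quotient_add:
  assumes "x \<in> carrier V" "y \<in> carrier V"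
  shows "(I +>\<^bsub>V\<^esub> x) \<oplus>\<^bsub>quotient_module V I\<^esub> (I +>\<^bsub>V\<^esub> y) = I +>\<^bsub>V\<^esub> (x \<oplus>\<^bsub>V\<^esub> y)"
  using assms unfolding quotient_module_def FactRing_def by (simp add: I.a_rcos_sum)

lemma quotient_map_coset:
  assumes f: "lin K V V f" and fI: "\<And>x. x \<in> I \<Longrightarrow> f x \<in> I" and x: "x \<in> carrier V"
  shows "quotient_map V I f (I +>\<^bsub>V\<^esub> x) = I +>\<^bsub>V\<^esub> f x"
proof -
  have "I +>\<^bsub>V\<^esub> f y = I +>\<^bsub>V\<^esub> f x" if "y \<in> I +>\<^bsub>V\<^esub> x" for y
    using coset_memD[OF x that] x fI by (subst coset_eq_iff) (auto simp: lin_closed[OF f] lin_diff[OF f, symmetric])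
  then show ?thesis unfolding quotient_map_def using coset_self[OF x] by blast
qed

lemma quotient_smult:
  assumes c: "c \<in> carrier K" and x: "x \<in> carrier V"
  shows "c \<odot>\<^bsub>quotient_module V I\<^esub> (I +>\<^bsub>V\<^esub> x) = I +>\<^bsub>V\<^esub> (c \<odot>\<^bsub>V\<^esub> x)"
  unfolding quotient_module_def using quotient_map_coset[OF lin_scale[OF lin_id[OF V] c] _ x] submodule_facts(4)[OF I c]
  by simp

lemma quotient_is_module: "module K (quotient_module V I)"
proof (rule moduleI)
  show "cring K" by (rule V.R.cring_axioms)
  show "abelian_group (quotient_module V I)"
  proof (rule abelian_groupI, goal_cases)
    case (6 x)
    then obtain a where "a \<in> carrier V" "x = I +>\<^bsub>V\<^esub> a" by (auto simp: quotient_simps)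
    then show ?case
      by (intro bexI[of _ "I +>\<^bsub>V\<^esub> (\<ominus>\<^bsub>V\<^esub> a)"]) (auto simp: quotient_simps quotient_add V.l_neg I.a_subset)
  next
    case 2
    then show ?case using V.a_coset_add_zero[OF I.a_subset] by (force simp: quotient_simps)
  next
    case (5 x)
    then obtain a where a: "a \<in> carrier V" "x = I +>\<^bsub>V\<^esub> a" by (auto simp: quotient_simps)
    have "\<zero>\<^bsub>quotient_module V I\<^esub> = I +>\<^bsub>V\<^esub> \<zero>\<^bsub>V\<^esub>" by (simp add: quotient_simps I.a_subset)
    then show ?case using a by (simp add: quotient_add)
  qed (auto simp: quotient_simps quotient_add V.a_ac)
qed (auto simp: quotient_simps quotient_add quotient_smult V.smult_l_distr V.smult_r_distr V.smult_assoc1)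

lemma lin_coset: "lin K V (quotient_module V I) (\<lambda>x. I +>\<^bsub>V\<^esub> x)"
  by (rule linI[OF V quotient_is_module]) (auto simp: quotient_simps quotient_add quotient_smult)

lemma quotient_lift:
  assumes f: "lin K V U f" and fI: "\<And>x. x \<in> I \<Longrightarrow> f x = \<zero>\<^bsub>U\<^esub>"
  shows quotient_lift_coset: "x \<in> carrier V \<Longrightarrow> the_elem (f ` (I +>\<^bsub>V\<^esub> x)) = f x"
    and lin_quotient_lift: "lin K (quotient_module V I) U (\<lambda>X. the_elem (f ` X))"
proof -
  interpret U: module K U by (rule lin_module(2)[OF f])
  show *: "the_elem (f ` (I +>\<^bsub>V\<^esub> x)) = f x" if x: "x \<in> carrier V" for x
  proof -
    have "f y = f x" if "y \<in> I +>\<^bsub>V\<^esub> x" for y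
    proof -
      note y = coset_memD[OF x that]
      have "f (y \<ominus>\<^bsub>V\<^esub> x) = \<zero>\<^bsub>U\<^esub>" using fI y by simp
      then have "f y \<ominus>\<^bsub>U\<^esub> f x = \<zero>\<^bsub>U\<^esub>" using x y by (simp add: lin_diff[OF f])
      moreover have "f y = (f y \<ominus>\<^bsub>U\<^esub> f x) \<oplus>\<^bsub>U\<^esub> f x"
        using lin_closed[OF f x] lin_closed[OF f y(1)] by (simp add: a_minus_def U.a_assoc U.l_neg)
      ultimately show ?thesis using lin_closed[OF f x] by simp
    qed
    then have "f ` (I +>\<^bsub>V\<^esub> x) = {f x}" using coset_self[OF x] by blast
    then show ?thesis by simp
  qed
  show "lin K (quotient_module V I) U (\<lambda>X. the_elem (f ` X))"
    by (rule linI[OF quotient_is_module lin_module(2)[OF f]])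
      (auto simp: quotient_simps quotient_add quotient_smult * lin_closed[OF f] lin_add[OF f] lin_smult[OF f])
qed

end

lemma module_cong:
  assumes "carrier V = carrier V'" "add V = add V'" "zero V = zero V'" "smult V = smult V'" "module K V"
  shows "module K V'"
proof -
  interpret V: module K V by fact
  note [simp] = assms(1-4)[symmetric]
  have "abelian_group V'"
    by (rule abelian_groupI) (auto simp: V.a_ac intro: V.add.l_inv_ex)
  then show ?thesis
    by (intro moduleI) (auto simp: V.R.cring_axioms V.smult_l_distr V.smult_r_distr V.smult_assoc1)
qed

lemma module_restrict:
  assumes V: "module K V" and N: "submodule N K V" and e: "carrier V' = N" "add V' = add V" "zero V' = zero V" "smult V' = smult V"
  shows "module K V'"
  by (rule module_cong[OF _ _ _ _ submodule.submodule_is_module[OF N V]]) (simp_all add: e)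

section \<open>Free modules\<close>

lemma free_module_simps:
  "p \<in> carrier (free_module K X) \<longleftrightarrow> (\<forall>x. p x \<in> carrier K) \<and> finite {x. p x \<noteq> \<zero>\<^bsub>K\<^esub>} \<and> {x. p x \<noteq> \<zero>\<^bsub>K\<^esub>} \<subseteq> X"
  "\<zero>\<^bsub>free_module K X\<^esub> = (\<lambda>_. \<zero>\<^bsub>K\<^esub>)"
  "p \<oplus>\<^bsub>free_module K X\<^esub> q = (\<lambda>x. p x \<oplus>\<^bsub>K\<^esub> q x)"
  "c \<odot>\<^bsub>free_module K X\<^esub> p = (\<lambda>x. c \<otimes>\<^bsub>K\<^esub> p x)"
  by (auto simp: free_module_def)

lemma module_free_module:
  fixes K (structure)
  assumes "cring K" shows "module K (free_module K X)"
proof -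
  interpret cring K by fact
  have sub: "\<lbrakk>p \<in> carrier (free_module K X); q \<in> carrier (free_module K X)\<rbrakk> \<Longrightarrow> p \<oplus>\<^bsub>free_module K X\<^esub> q \<in> carrier (free_module K X)" for p q
  proof -
    assume a: "p \<in> carrier (free_module K X)" "q \<in> carrier (free_module K X)"
    have "{x. p x \<oplus> q x \<noteq> \<zero>} \<subseteq> {x. p x \<noteq> \<zero>} \<union> {x. q x \<noteq> \<zero>}" by auto
    then show ?thesis using a unfolding free_module_simps by (auto intro: finite_subset)
  qed
  have sc: "c \<odot>\<^bsub>free_module K X\<^esub> p \<in> carrier (free_module K X)" if "c \<in> carrier K" "p \<in> carrier (free_module K X)" for c p
  proof -
    have "{x. c \<otimes> p x \<noteq> \<zero>} \<subseteq> {x. p x \<noteq> \<zero>}" using that by (auto simp: free_module_simps)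
    then show ?thesis using that unfolding free_module_simps by (auto intro: finite_subset)
  qed
  have "abelian_group (free_module K X)"
  proof (rule abelian_groupI)
    fix p assume p: "p \<in> carrier (free_module K X)"
    have "{x. \<ominus> p x \<noteq> \<zero>} = {x. p x \<noteq> \<zero>}" using p by (auto simp: free_module_simps)
    then have "(\<lambda>x. \<ominus> p x) \<in> carrier (free_module K X)" using p by (auto simp: free_module_simps)
    moreover have "(\<lambda>x. \<ominus> p x) \<oplus>\<^bsub>free_module K X\<^esub> p = \<zero>\<^bsub>free_module K X\<^esub>"
      using p by (auto simp: free_module_simps l_neg)
    ultimately show "\<exists>q\<in>carrier (free_module K X). q \<oplus>\<^bsub>free_module K X\<^esub> p = \<zero>\<^bsub>free_module K X\<^esub>" by blast
  qed (use sub in \<open>auto simp: free_module_simps a_ac\<close>)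
  then show ?thesis
    by (intro moduleI assms sc)
      (auto simp: free_module_simps l_distr r_distr m_assoc)
qed

lemma monom_fun_closed:
  fixes K (structure)
  assumes "cring K" "x \<in> X" shows "monom_fun K x \<in> carrier (free_module K X)"
proof -
  interpret cring K by fact
  have "{y. monom_fun K x y \<noteq> \<zero>} \<subseteq> {x}" by (auto simp: monom_fun_def)
  then show ?thesis using assms(2) by (auto simp: free_module_simps intro: finite_subset) (auto simp: monom_fun_def)
qed

lemma free_eval_superset:
  assumes U: "module K U" and h: "\<And>x. x \<in> X \<Longrightarrow> h x \<in> carrier U" and p: "p \<in> carrier (free_module K X)"
    and Z: "finite Z" "{x. p x \<noteq> \<zero>\<^bsub>K\<^esub>} \<subseteq> Z" "Z \<subseteq> X"
  shows "free_eval K U h p = (\<Oplus>\<^bsub>U\<^esub>x\<in>Z. p x \<odot>\<^bsub>U\<^esub> h x)"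
proof -
  interpret U: module K U by fact
  show ?thesis unfolding free_eval_def using assms
    by (intro U.add.finprod_mono_neutral_cong_left) (auto simp: free_module_simps)
qed

lemma lin_free_eval:
  assumes U: "module K U" and h: "\<And>x. x \<in> X \<Longrightarrow> h x \<in> carrier U"
  shows "lin K (free_module K X) U (free_eval K U h)"
proof -
  interpret U: module K U by fact
  have P: "module K (free_module K X)" by (rule module_free_module[OF U.R.cring_axioms])
  show ?thesis
  proof (rule linI[OF P U])
    fix p assume "p \<in> carrier (free_module K X)"
    then show "free_eval K U h p \<in> carrier U"
      unfolding free_eval_def using h by (intro U.finsum_closed) (auto simp: free_module_simps)
  next
    fix p q assume pq: "p \<in> carrier (free_module K X)" "q \<in> carrier (free_module K X)"
    let ?Z = "{x. p x \<noteq> \<zero>\<^bsub>K\<^esub>} \<union> {x. q x \<noteq> \<zero>\<^bsub>K\<^esub>}"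
    have Z: "finite ?Z" "?Z \<subseteq> X" and c: "p x \<in> carrier K" "q x \<in> carrier K" for x
      using pq by (auto simp: free_module_simps)
    have Zs: "{x. (p \<oplus>\<^bsub>free_module K X\<^esub> q) x \<noteq> \<zero>\<^bsub>K\<^esub>} \<subseteq> ?Z"
      by (auto simp: free_module_simps)
    have hc: "h x \<in> carrier U" if "x \<in> ?Z" for x using Z(2) that h by blast
    have "free_eval K U h (p \<oplus>\<^bsub>free_module K X\<^esub> q) = (\<Oplus>\<^bsub>U\<^esub>x\<in>?Z. (p \<oplus>\<^bsub>free_module K X\<^esub> q) x \<odot>\<^bsub>U\<^esub> h x)"
      using h Z Zs pq by (intro free_eval_superset[OF U]) (auto intro: module_closed(2)[OF P])
    also have "\<dots> = (\<Oplus>\<^bsub>U\<^esub>x\<in>?Z. p x \<odot>\<^bsub>U\<^esub> h x \<oplus>\<^bsub>U\<^esub> q x \<odot>\<^bsub>U\<^esub> h x)"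
      using c hc by (intro U.finsum_cong') (auto simp: free_module_simps U.smult_l_distr)
    also have "\<dots> = (\<Oplus>\<^bsub>U\<^esub>x\<in>?Z. p x \<odot>\<^bsub>U\<^esub> h x) \<oplus>\<^bsub>U\<^esub> (\<Oplus>\<^bsub>U\<^esub>x\<in>?Z. q x \<odot>\<^bsub>U\<^esub> h x)"
      using c hc by (intro U.finsum_addf) auto
    also have "(\<Oplus>\<^bsub>U\<^esub>x\<in>?Z. p x \<odot>\<^bsub>U\<^esub> h x) = free_eval K U h p"
      using h Z pq by (intro free_eval_superset[OF U, symmetric]) auto
    also have "(\<Oplus>\<^bsub>U\<^esub>x\<in>?Z. q x \<odot>\<^bsub>U\<^esub> h x) = free_eval K U h q"
      using h Z pq by (intro free_eval_superset[OF U, symmetric]) auto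
    finally show "free_eval K U h (p \<oplus>\<^bsub>free_module K X\<^esub> q) = free_eval K U h p \<oplus>\<^bsub>U\<^esub> free_eval K U h q" .
  next
    fix c p assume c: "c \<in> carrier K" and p: "p \<in> carrier (free_module K X)"
    let ?Z = "{x. p x \<noteq> \<zero>\<^bsub>K\<^esub>}"
    have Z: "finite ?Z" "?Z \<subseteq> X" and pc: "p x \<in> carrier K" for x
      using p by (auto simp: free_module_simps)
    have Zs: "{x. (c \<odot>\<^bsub>free_module K X\<^esub> p) x \<noteq> \<zero>\<^bsub>K\<^esub>} \<subseteq> ?Z"
      using c by (auto simp: free_module_simps)
    have hc: "h x \<in> carrier U" if "x \<in> ?Z" for x using Z(2) that h by blast
    have "free_eval K U h (c \<odot>\<^bsub>free_module K X\<^esub> p) = (\<Oplus>\<^bsub>U\<^esub>x\<in>?Z. (c \<odot>\<^bsub>free_module K X\<^esub> p) x \<odot>\<^bsub>U\<^esub> h x)"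
      using h Z Zs p c by (intro free_eval_superset[OF U]) (auto intro: module_closed(5)[OF P])
    also have "\<dots> = (\<Oplus>\<^bsub>U\<^esub>x\<in>?Z. c \<odot>\<^bsub>U\<^esub> (p x \<odot>\<^bsub>U\<^esub> h x))"
      using c pc hc by (intro U.finsum_cong') (auto simp: free_module_simps U.smult_assoc1)
    also have "\<dots> = c \<odot>\<^bsub>U\<^esub> (\<Oplus>\<^bsub>U\<^esub>x\<in>?Z. p x \<odot>\<^bsub>U\<^esub> h x)"
      using c pc hc Z by (intro U.finsum_smult_ldistr[symmetric]) auto
    finally show "free_eval K U h (c \<odot>\<^bsub>free_module K X\<^esub> p) = c \<odot>\<^bsub>U\<^esub> free_eval K U h p"
      unfolding free_eval_def .
  qed
qed

lemma free_eval_monom: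
  assumes U: "module K U" and h: "\<And>x. x \<in> X \<Longrightarrow> h x \<in> carrier U" and x: "x \<in> X"
  shows "free_eval K U h (monom_fun K x) = h x"
proof -
  interpret U: module K U by fact
  have "free_eval K U h (monom_fun K x) = (\<Oplus>\<^bsub>U\<^esub>y\<in>{x}. monom_fun K x y \<odot>\<^bsub>U\<^esub> h y)"
    using x by (intro free_eval_superset[OF U] h monom_fun_closed[OF U.R.cring_axioms]) (auto simp: monom_fun_def)
  then show ?thesis using h[OF x] by (simp add: monom_fun_def)
qed

text \<open>By induction on a finite set containing the support: splitting off the value at one
  point shrinks the support.\<close>

lemma free_module_generated:
  fixes K (structure)
  assumes K: "cring K" and N: "submodule N K (free_module K X)" and m: "\<And>x. x \<in> X \<Longrightarrow> monom_fun K x \<in> N"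
    and p: "p \<in> carrier (free_module K X)"
  shows "p \<in> N"
proof -
  interpret cring K by fact
  note n = submodule_facts[OF N]
  have "\<forall>p. p \<in> carrier (free_module K X) \<and> {x. p x \<noteq> \<zero>} \<subseteq> Z \<longrightarrow> p \<in> N" if "finite Z" for Z
    using that
  proof (induction Z)
    case empty
    have "p = \<zero>\<^bsub>free_module K X\<^esub>" if "{x. p x \<noteq> \<zero>} \<subseteq> {}" for p using that by (auto simp: free_module_simps)
    then show ?case using n(2) by blast
  next
    case (insert x Z)
    show ?case
    proof (intro allI impI, elim conjE)
      fix p assume p: "p \<in> carrier (free_module K X)" "{y. p y \<noteq> \<zero>} \<subseteq> insert x Z"
      let ?q = "p(x := \<zero>)"
      have "{y. ?q y \<noteq> \<zero>} \<subseteq> {y. p y \<noteq> \<zero>}" by auto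
      moreover have "{y. ?q y \<noteq> \<zero>} \<subseteq> Z" using p(2) by auto
      moreover have "?q y \<in> carrier K" for y using p(1) by (auto simp: free_module_simps)
      ultimately have q: "?q \<in> N" using insert.IH p(1) unfolding free_module_simps by (meson finite_subset order_trans)
      show "p \<in> N"
      proof (cases "p x = \<zero>")
        case True
        then have "?q = p" by auto
        then show ?thesis using q by simp
      next
        case False
        then have x: "x \<in> X" and px: "p x \<in> carrier K" using p(1) by (auto simp: free_module_simps)
        have "p = ?q \<oplus>\<^bsub>free_module K X\<^esub> (p x \<odot>\<^bsub>free_module K X\<^esub> monom_fun K x)"
          using p(1) by (auto simp: free_module_simps monom_fun_def)
        then show ?thesis using n(3)[OF q n(4)[OF px m[OF x]]] by simp
      qed
    qed
  qed
  then show ?thesis using p by (auto simp: free_module_simps)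
qed

section \<open>Bilinear maps and tensor products\<close>

definition bilin where
  "bilin K V W U \<beta> \<longleftrightarrow> module K V \<and> module K W \<and> module K U \<and>
    (\<forall>v\<in>carrier V. lin K W U (\<beta> v)) \<and> (\<forall>w\<in>carrier W. lin K V U (\<lambda>v. \<beta> v w))"

lemma bilinI:
  assumes "module K V" "module K W" "module K U"
    "\<And>v. v \<in> carrier V \<Longrightarrow> lin K W U (\<lambda>w. \<beta> v w)" "\<And>w. w \<in> carrier W \<Longrightarrow> lin K V U (\<lambda>v. \<beta> v w)"
  shows "bilin K V W U \<beta>"
  using assms unfolding bilin_def by auto

lemma bilin_module:
  "bilin K V W U \<beta> \<Longrightarrow> module K V" "bilin K V W U \<beta> \<Longrightarrow> module K W" "bilin K V W U \<beta> \<Longrightarrow> module K U"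
  unfolding bilin_def by auto

lemma bilin_lin:
  "\<lbrakk>bilin K V W U \<beta>; v \<in> carrier V\<rbrakk> \<Longrightarrow> lin K W U (\<lambda>w. \<beta> v w)"
  "\<lbrakk>bilin K V W U \<beta>; w \<in> carrier W\<rbrakk> \<Longrightarrow> lin K V U (\<lambda>v. \<beta> v w)"
  unfolding bilin_def by auto

lemma bilin_lin_comp:
  "\<lbrakk>bilin K V W U \<beta>; v \<in> carrier V; lin K X W f\<rbrakk> \<Longrightarrow> lin K X U (\<lambda>x. \<beta> v (f x))"
  "\<lbrakk>bilin K V W U \<beta>; w \<in> carrier W; lin K X V g\<rbrakk> \<Longrightarrow> lin K X U (\<lambda>x. \<beta> (g x) w)"
  using lin_comp[OF bilin_lin(1), of K V W U \<beta> v X f] lin_comp[OF bilin_lin(2), of K V W U \<beta> w X g] by auto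

lemma bilin_closed: "\<lbrakk>bilin K V W U \<beta>; v \<in> carrier V; w \<in> carrier W\<rbrakk> \<Longrightarrow> \<beta> v w \<in> carrier U"
  using lin_closed[OF bilin_lin(1)] .

lemma bilin_comp:
  assumes "bilin K V W U \<beta>" "lin K V' V f" "lin K W' W g"
  shows "bilin K V' W' U (\<lambda>x y. \<beta> (f x) (g y))"
  using assms by (intro bilinI bilin_lin_comp[OF assms(1)]) (auto simp: lin_module bilin_module lin_closed)

lemma bilin_lin_after:
  assumes "bilin K V W U \<beta>" "lin K U U' f"
  shows "bilin K V W U' (\<lambda>x y. f (\<beta> x y))"
  using assms by (intro bilinI lin_comp[OF assms(2)] bilin_lin[OF assms(1)]) (auto simp: lin_module bilin_module)

lemma bilin_flip: "bilin K V W U \<beta> \<Longrightarrow> bilin K W V U (\<lambda>w v. \<beta> v w)"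
  unfolding bilin_def by auto

lemma bilin_maps_span:
  assumes b: "bilin K V W U \<beta>" and N: "submodule N K U" and S: "S \<subseteq> carrier V" "S' \<subseteq> carrier W"
    and m: "\<And>x y. \<lbrakk>x \<in> S; y \<in> S'\<rbrakk> \<Longrightarrow> \<beta> x y \<in> N"
    and x: "x \<in> lin_span K V S" and y: "y \<in> lin_span K W S'"
  shows "\<beta> x y \<in> N"
proof -
  have *: "\<beta> z y \<in> N" if "z \<in> S" for z
    using lin_maps_span[OF bilin_lin(1)[OF b] N S(2) _ y] S(1) m that by blast
  have y': "y \<in> carrier W"
    using y lin_span_least[OF submodule_carrier[OF bilin_module(2)[OF b]] S(2)] by blast
  show ?thesis
    by (rule lin_maps_span[OF bilin_lin(2)[OF b y'] N S(1) * x])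
qed

lemma tensor_relations_cases:
  assumes "r \<in> tensor_relations K V W"
  obtains (add_left) v v' w where "v \<in> carrier V" "v' \<in> carrier V" "w \<in> carrier W"
      "r = monom_fun K (v \<oplus>\<^bsub>V\<^esub> v', w) \<ominus>\<^bsub>free_module K (carrier V \<times> carrier W)\<^esub>
        (monom_fun K (v, w) \<oplus>\<^bsub>free_module K (carrier V \<times> carrier W)\<^esub> monom_fun K (v', w))"
  | (add_right) v w w' where "v \<in> carrier V" "w \<in> carrier W" "w' \<in> carrier W"
      "r = monom_fun K (v, w \<oplus>\<^bsub>W\<^esub> w') \<ominus>\<^bsub>free_module K (carrier V \<times> carrier W)\<^esub>
        (monom_fun K (v, w) \<oplus>\<^bsub>free_module K (carrier V \<times> carrier W)\<^esub> monom_fun K (v, w'))"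
  | (smult_left) c v w where "c \<in> carrier K" "v \<in> carrier V" "w \<in> carrier W"
      "r = monom_fun K (c \<odot>\<^bsub>V\<^esub> v, w) \<ominus>\<^bsub>free_module K (carrier V \<times> carrier W)\<^esub>
        c \<odot>\<^bsub>free_module K (carrier V \<times> carrier W)\<^esub> monom_fun K (v, w)"
  | (smult_right) c v w where "c \<in> carrier K" "v \<in> carrier V" "w \<in> carrier W"
      "r = monom_fun K (v, c \<odot>\<^bsub>W\<^esub> w) \<ominus>\<^bsub>free_module K (carrier V \<times> carrier W)\<^esub>
        c \<odot>\<^bsub>free_module K (carrier V \<times> carrier W)\<^esub> monom_fun K (v, w)"
  using assms unfolding tensor_relations_def Let_def by blast

context
  fixes K :: "('k, 'c) ring_scheme" and V :: "('k, 'v, 'r) module_scheme" and W :: "('k, 'w, 's) module_scheme"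
  assumes V: "module K V" and W: "module K W"
begin

interpretation V: module K V by (rule V)
interpretation W: module K W by (rule W)

private abbreviation "P \<equiv> free_module K (carrier V \<times> carrier W)"

private lemma P: "module K P" by (rule module_free_module[OF V.R.cring_axioms])

private lemma monom_P: "v \<in> carrier V \<Longrightarrow> w \<in> carrier W \<Longrightarrow> monom_fun K (v, w) \<in> carrier P"
  by (intro monom_fun_closed V.R.cring_axioms) auto

private lemma relations_P: "tensor_relations K V W \<subseteq> carrier P"
  by (auto elim!: tensor_relations_cases intro!: module_closed[OF P] monom_P)

private lemma kernel: "submodule (tensor_kernel K V W) K P"
  unfolding tensor_kernel_def by (rule lin_span_submodule[OF P relations_P])

private lemma relation_kernel: "r \<in> tensor_relations K V W \<Longrightarrow> r \<in> tensor_kernel K V W"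
  unfolding tensor_kernel_def by (rule subsetD[OF lin_span_superset])

lemma module_tensor: "module K (tensor K V W)"
  unfolding tensor_def by (rule quotient_is_module[OF P kernel])

private lemma coset: "lin K P (tensor K V W) (\<lambda>x. tensor_kernel K V W +>\<^bsub>P\<^esub> x)"
  unfolding tensor_def by (rule lin_coset[OF P kernel])

lemma bilin_pure: "bilin K V W (tensor K V W) (pure K V W)"
proof -
  have *: "tensor_kernel K V W +>\<^bsub>P\<^esub> x = tensor_kernel K V W +>\<^bsub>P\<^esub> y"
    if "x \<in> carrier P" "y \<in> carrier P" "x \<ominus>\<^bsub>P\<^esub> y \<in> tensor_relations K V W" for x y
    using that relation_kernel by (simp add: coset_eq_iff[OF P kernel])
  note r = monom_P module_closed(2,5)[OF P]
  show ?thesis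
  proof (intro bilinI linI V W module_tensor)
    fix v w assume "v \<in> carrier V" "w \<in> carrier W"
    then show "pure K V W v w \<in> carrier (tensor K V W)"
      unfolding pure_def by (intro lin_closed[OF coset] monom_P)
  next
    fix v w w' assume a: "v \<in> carrier V" "w \<in> carrier W" "w' \<in> carrier W"
    have "tensor_kernel K V W +>\<^bsub>P\<^esub> monom_fun K (v, w \<oplus>\<^bsub>W\<^esub> w') =
        tensor_kernel K V W +>\<^bsub>P\<^esub> (monom_fun K (v, w) \<oplus>\<^bsub>P\<^esub> monom_fun K (v, w'))"
      using a by (intro * r) (auto simp: tensor_relations_def Let_def)
    then show "pure K V W v (w \<oplus>\<^bsub>W\<^esub> w') = pure K V W v w \<oplus>\<^bsub>tensor K V W\<^esub> pure K V W v w'"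
      using a by (simp add: pure_def lin_add[OF coset] r)
  next
    fix v w c assume a: "v \<in> carrier V" "w \<in> carrier W" "c \<in> carrier K"
    have "tensor_kernel K V W +>\<^bsub>P\<^esub> monom_fun K (v, c \<odot>\<^bsub>W\<^esub> w) =
        tensor_kernel K V W +>\<^bsub>P\<^esub> (c \<odot>\<^bsub>P\<^esub> monom_fun K (v, w))"
      using a by (intro * r) (auto simp: tensor_relations_def Let_def)
    then show "pure K V W v (c \<odot>\<^bsub>W\<^esub> w) = c \<odot>\<^bsub>tensor K V W\<^esub> pure K V W v w"
      using a by (simp add: pure_def lin_smult[OF coset] r)
  next
    fix w v v' assume a: "w \<in> carrier W" "v \<in> carrier V" "v' \<in> carrier V"
    have "tensor_kernel K V W +>\<^bsub>P\<^esub> monom_fun K (v \<oplus>\<^bsub>V\<^esub> v', w) =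
        tensor_kernel K V W +>\<^bsub>P\<^esub> (monom_fun K (v, w) \<oplus>\<^bsub>P\<^esub> monom_fun K (v', w))"
      using a by (intro * r) (auto simp: tensor_relations_def Let_def)
    then show "pure K V W (v \<oplus>\<^bsub>V\<^esub> v') w = pure K V W v w \<oplus>\<^bsub>tensor K V W\<^esub> pure K V W v' w"
      using a by (simp add: pure_def lin_add[OF coset] r)
  next
    fix v w c assume a: "w \<in> carrier W" "c \<in> carrier K" "v \<in> carrier V"
    have "tensor_kernel K V W +>\<^bsub>P\<^esub> monom_fun K (c \<odot>\<^bsub>V\<^esub> v, w) =
        tensor_kernel K V W +>\<^bsub>P\<^esub> (c \<odot>\<^bsub>P\<^esub> monom_fun K (v, w))"
      using a by (intro * r) (auto simp: tensor_relations_def Let_def)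
    then show "pure K V W (c \<odot>\<^bsub>V\<^esub> v) w = c \<odot>\<^bsub>tensor K V W\<^esub> pure K V W v w"
      using a by (simp add: pure_def lin_smult[OF coset] r)
  qed (auto simp: pure_def intro!: lin_closed[OF coset] monom_P)
qed

lemma tensor_generated:
  assumes N: "submodule N K (tensor K V W)"
    and p: "\<And>v w. \<lbrakk>v \<in> carrier V; w \<in> carrier W\<rbrakk> \<Longrightarrow> pure K V W v w \<in> N"
    and t: "t \<in> carrier (tensor K V W)"
  shows "t \<in> N"
proof -
  obtain x where x: "x \<in> carrier P" "t = tensor_kernel K V W +>\<^bsub>P\<^esub> x"
    using t unfolding tensor_def quotient_simps by auto
  have "x \<in> {x \<in> carrier P. tensor_kernel K V W +>\<^bsub>P\<^esub> x \<in> N}"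
    using p by (intro free_module_generated[OF V.R.cring_axioms submodule_vimage[OF coset N] _ x(1)])
      (auto simp: pure_def monom_P)
  then show ?thesis using x by simp
qed

lemma tensor_span: "lin_span K (tensor K V W) {pure K V W v w | v w. v \<in> carrier V \<and> w \<in> carrier W} = carrier (tensor K V W)"
  using bilin_closed[OF bilin_pure] tensor_generated
  by (intro lin_span_eq_carrierI module_tensor) blast+

text \<open>The way in which Sweedler identities are verified throughout: all other arguments are fixed,
  and two linear maps in the remaining one are compared on pure tensors.\<close>

lemma tensor_ext:
  assumes "lin K (tensor K V W) U f" "lin K (tensor K V W) U g"
    "\<And>v w. \<lbrakk>v \<in> carrier V; w \<in> carrier W\<rbrakk> \<Longrightarrow> f (pure K V W v w) = g (pure K V W v w)"
    "t \<in> carrier (tensor K V W)"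
  shows "f t = g t"
  using tensor_generated[OF submodule_equalizer[OF assms(1,2)] _ assms(4)] assms(3) bilin_closed[OF bilin_pure]
  by blast

text \<open>Bilinearity of \<open>\<beta>\<close> says that the induced map on the free module kills the four kinds of
  relations, hence their span.\<close>

lemma tensor_lift:
  assumes b: "bilin K V W U \<beta>"
  shows lin_tensor_lift: "lin K (tensor K V W) U (tensor_lift K U \<beta>)"
    and tensor_lift_pure: "\<lbrakk>v \<in> carrier V; w \<in> carrier W\<rbrakk> \<Longrightarrow> tensor_lift K U \<beta> (pure K V W v w) = \<beta> v w"
proof -
  interpret U: module K U by (rule bilin_module(3)[OF b])
  let ?f = "free_eval K U (\<lambda>(v, w). \<beta> v w)"
  have f: "lin K P U ?f" by (rule lin_free_eval) (auto simp: U.module_axioms bilin_closed[OF b])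
  have fm: "?f (monom_fun K (v, w)) = \<beta> v w" if "v \<in> carrier V" "w \<in> carrier W" for v w
    using free_eval_monom[OF U.module_axioms, of "carrier V \<times> carrier W" "\<lambda>(v, w). \<beta> v w" "(v, w)"] that
    by (auto simp: bilin_closed[OF b])
  note bl = lin_add[OF bilin_lin(1)[OF b]] lin_add[OF bilin_lin(2)[OF b]] lin_smult[OF bilin_lin(1)[OF b]] lin_smult[OF bilin_lin(2)[OF b]]
    bilin_closed[OF b]
  have self: "x \<ominus>\<^bsub>U\<^esub> x = \<zero>\<^bsub>U\<^esub>" if "x \<in> carrier U" for x using that by (simp add: a_minus_def U.r_neg)
  have fr: "?f r = \<zero>\<^bsub>U\<^esub>" if "r \<in> tensor_relations K V W" for r
    using that
    by (cases rule: tensor_relations_cases)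
      (simp_all add: lin_diff[OF f] lin_add[OF f] lin_smult[OF f] module_closed[OF P] monom_P fm bl self)
  have f0: "?f r = \<zero>\<^bsub>U\<^esub>" if "r \<in> tensor_kernel K V W" for r
    using lin_eq_on_span[OF f lin_const_zero[OF P U.module_axioms] relations_P fr] that
    unfolding tensor_kernel_def by blast
  show "lin K (tensor K V W) U (tensor_lift K U \<beta>)"
    using lin_quotient_lift[OF P kernel f f0] unfolding tensor_def tensor_lift_def .
  show "tensor_lift K U \<beta> (pure K V W v w) = \<beta> v w" if "v \<in> carrier V" "w \<in> carrier W"
    using quotient_lift_coset[OF P kernel f f0 monom_P[OF that]] fm[OF that] unfolding pure_def tensor_lift_def by simp
qed

text \<open>Sweedler formulas nest lifts, so the integrand of an outer lift contains an
  inner one; it is linear in the outer variables for this reason.\<close>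

lemma lin_tensor_lift_param:
  assumes X: "module K X" and U: "module K U" and t: "t \<in> carrier (tensor K V W)"
    and b: "\<And>x. x \<in> carrier X \<Longrightarrow> bilin K V W U (\<beta> x)"
    and l: "\<And>v w. \<lbrakk>v \<in> carrier V; w \<in> carrier W\<rbrakk> \<Longrightarrow> lin K X U (\<lambda>x. \<beta> x v w)"
  shows "lin K X U (\<lambda>x. tensor_lift K U (\<beta> x) t)"
proof (rule linI[OF X U])
  note tl = lin_tensor_lift[OF b] and tp = tensor_lift_pure[OF b]
  fix x assume x: "x \<in> carrier X"
  show "tensor_lift K U (\<beta> x) t \<in> carrier U" using lin_closed[OF tl[OF x] t] .
  show "tensor_lift K U (\<beta> (x \<oplus>\<^bsub>X\<^esub> y)) t = tensor_lift K U (\<beta> x) t \<oplus>\<^bsub>U\<^esub> tensor_lift K U (\<beta> y) t"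
    if y: "y \<in> carrier X" for y
    using module_closed[OF X] x y t
    by (rule_tac tensor_ext[OF tl lin_plus[OF tl tl]]) (simp_all add: tp lin_add[OF l])
  show "tensor_lift K U (\<beta> (c \<odot>\<^bsub>X\<^esub> x)) t = c \<odot>\<^bsub>U\<^esub> tensor_lift K U (\<beta> x) t"
    if c: "c \<in> carrier K" for c
    using module_closed[OF X] x c t
    by (rule_tac tensor_ext[OF tl lin_scale[OF tl]]) (simp_all add: tp lin_smult[OF l])
qed

end

lemma tensor_map:
  assumes "lin K X V f" "lin K Y W g"
  shows lin_tensor_map: "lin K (tensor K X Y) (tensor K V W) (tensor_map K V W f g)"
    and tensor_map_pure: "\<lbrakk>x \<in> carrier X; y \<in> carrier Y\<rbrakk> \<Longrightarrow> tensor_map K V W f g (pure K X Y x y) = pure K V W (f x) (g y)"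
proof -
  note m = lin_module[OF assms(1)] lin_module[OF assms(2)]
  have b: "bilin K X Y (tensor K V W) (\<lambda>x y. pure K V W (f x) (g y))"
    by (rule bilin_comp[OF bilin_pure[OF m(2,4)] assms])
  show "lin K (tensor K X Y) (tensor K V W) (tensor_map K V W f g)"
    unfolding tensor_map_def by (rule lin_tensor_lift[OF m(1,3) b])
  show "\<lbrakk>x \<in> carrier X; y \<in> carrier Y\<rbrakk> \<Longrightarrow> tensor_map K V W f g (pure K X Y x y) = pure K V W (f x) (g y)"
    unfolding tensor_map_def by (rule tensor_lift_pure[OF m(1,3) b])
qed

lemma tensor_ext2:
  assumes m: "module K V" "module K W" "module K V'" "module K W'"
    and b: "bilin K (tensor K V W) (tensor K V' W') U \<beta>" "bilin K (tensor K V W) (tensor K V' W') U \<gamma>"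
    and eq: "\<And>v w v' w'. \<lbrakk>v \<in> carrier V; w \<in> carrier W; v' \<in> carrier V'; w' \<in> carrier W'\<rbrakk> \<Longrightarrow>
      \<beta> (pure K V W v w) (pure K V' W' v' w') = \<gamma> (pure K V W v w) (pure K V' W' v' w')"
    and t: "t \<in> carrier (tensor K V W)" "t' \<in> carrier (tensor K V' W')"
  shows "\<beta> t t' = \<gamma> t t'"
proof -
  have "\<beta> (pure K V W v w) t' = \<gamma> (pure K V W v w) t'" if "v \<in> carrier V" "w \<in> carrier W" for v w
    using that t eq bilin_closed[OF bilin_pure[OF m(1,2)]]
    by (rule_tac tensor_ext[OF m(3,4) bilin_lin(1)[OF b(1)] bilin_lin(1)[OF b(2)]]) auto
  then show ?thesis
    using t by (rule_tac tensor_ext[OF m(1,2) bilin_lin(2)[OF b(1)] bilin_lin(2)[OF b(2)]]) auto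
qed

lemma lin_tensor_map_param_left:
  assumes l: "lin K Y W g" and b: "bilin K X V' V \<beta>" and t: "t \<in> carrier (tensor K V' Y)"
  shows "lin K X (tensor K V W) (\<lambda>x. tensor_map K V W (\<beta> x) g t)"
proof -
  note m = bilin_module[OF b] lin_module[OF l]
  note p = bilin_pure[OF m(3,5)]
  show ?thesis unfolding tensor_map_def
    by (rule lin_tensor_lift_param[OF m(2,4,1) module_tensor[OF m(3,5)] t])
      (auto intro: bilin_comp[OF p _ l] bilin_lin[OF b] bilin_lin_comp[OF p] lin_closed[OF l])
qed

lemma lin_tensor_map_param_right:
  assumes l: "lin K Y V g" and b: "bilin K X W' W \<beta>" and t: "t \<in> carrier (tensor K Y W')"
  shows "lin K X (tensor K V W) (\<lambda>x. tensor_map K V W g (\<beta> x) t)"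
proof -
  note m = bilin_module[OF b] lin_module[OF l]
  note p = bilin_pure[OF m(5,3)]
  show ?thesis unfolding tensor_map_def
    by (rule lin_tensor_lift_param[OF m(4,2,1) module_tensor[OF m(5,3)] t])
      (auto intro: bilin_comp[OF p l] bilin_lin[OF b] bilin_lin_comp[OF p] lin_closed[OF l])
qed

lemma tensor_finite_sum:
  assumes m: "module K V" "module K W" and z: "z \<in> carrier (tensor K V W)"
  shows "\<exists>n f a. f \<in> {..<n::nat} \<rightarrow> carrier V \<and> a \<in> {..<n} \<rightarrow> carrier W \<and>
    z = (\<Oplus>\<^bsub>tensor K V W\<^esub>i\<in>{..<n}. pure K V W (f i) (a i))"
proof -
  let ?G = "{pure K V W v w | v w. v \<in> carrier V \<and> w \<in> carrier W}"
  note po = bilin_pure[OF m]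
  have G: "?G \<subseteq> carrier (tensor K V W)" using bilin_closed[OF po] by blast
  interpret T: module K "tensor K V W" by (rule module_tensor[OF m])
  have "c \<odot>\<^bsub>tensor K V W\<^esub> x \<in> ?G" if c: "c \<in> carrier K" and x: "x \<in> ?G" for c x
  proof -
    obtain v w where vw: "x = pure K V W v w" "v \<in> carrier V" "w \<in> carrier W" using x by blast
    have "c \<odot>\<^bsub>tensor K V W\<^esub> x = pure K V W (c \<odot>\<^bsub>V\<^esub> v) w"
      using lin_smult[OF bilin_lin(2)[OF po vw(3)] c vw(2)] vw by simp
    then show ?thesis using vw module_closed(5)[OF m(1) c vw(2)] by blast
  qed
  then obtain n g where g: "g \<in> {..<n::nat} \<rightarrow> ?G" "z = (\<Oplus>\<^bsub>tensor K V W\<^esub>i\<in>{..<n}. g i)"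
    using lin_span_finite_sum[OF T.module_axioms G, of z] z tensor_span[OF m] by blast
  have "\<forall>i\<in>{..<n}. \<exists>mb. fst mb \<in> carrier V \<and> snd mb \<in> carrier W \<and> g i = pure K V W (fst mb) (snd mb)"
    using g(1) by fastforce
  from bchoice[OF this] obtain mb where mb: "\<forall>i\<in>{..<n}. fst (mb i) \<in> carrier V \<and> snd (mb i) \<in> carrier W \<and> g i = pure K V W (fst (mb i)) (snd (mb i))"
    by (rule exE)
  have "z = (\<Oplus>\<^bsub>tensor K V W\<^esub>i\<in>{..<n}. pure K V W (fst (mb i)) (snd (mb i)))"
    unfolding g(2) using mb bilin_closed[OF po] by (intro T.finsum_cong') auto
  then show ?thesis using mb
    by (intro exI[of _ n] exI[of _ "\<lambda>i. fst (mb i)"] exI[of _ "\<lambda>i. snd (mb i)"]) auto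
qed

lemma tensor_map_cong:
  assumes "lin K X V f" "lin K Y W g" "\<And>x. x \<in> carrier X \<Longrightarrow> f x = f' x" "\<And>y. y \<in> carrier Y \<Longrightarrow> g y = g' y"
    and t: "t \<in> carrier (tensor K X Y)"
  shows "tensor_map K V W f g t = tensor_map K V W f' g' t"
proof -
  note m = lin_module[OF assms(1)] lin_module[OF assms(2)]
  have f': "lin K X V f'"
    using m assms(3) lin_closed[OF assms(1)] lin_add[OF assms(1)] lin_smult[OF assms(1)]
    by (intro linI m) (metis module_closed)+
  have g': "lin K Y W g'"
    using m assms(4) lin_closed[OF assms(2)] lin_add[OF assms(2)] lin_smult[OF assms(2)]
    by (intro linI m) (metis module_closed)+
  show ?thesis
    by (rule tensor_ext[OF m(1,3) lin_tensor_map[OF assms(1,2)] lin_tensor_map[OF f' g'] _ t])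
      (simp add: tensor_map_pure[OF assms(1,2)] tensor_map_pure[OF f' g'] assms(3,4))
qed

lemma tensor_map_compose:
  assumes f: "lin K X V f" "lin K V V' f'" and g: "lin K Y W g" "lin K W W' g'"
    and t: "t \<in> carrier (tensor K X Y)"
  shows "tensor_map K V' W' f' g' (tensor_map K V W f g t) = tensor_map K V' W' (\<lambda>x. f' (f x)) (\<lambda>y. g' (g y)) t"
proof -
  note m = lin_module[OF f(1)] lin_module[OF g(1)]
  have fc: "lin K X V' (\<lambda>x. f' (f x))" and gc: "lin K Y W' (\<lambda>y. g' (g y))"
    using lin_comp[OF f(2,1)] lin_comp[OF g(2,1)] by auto
  show ?thesis
    by (rule tensor_ext[OF m(1,3) lin_comp[OF lin_tensor_map[OF f(2) g(2)] lin_tensor_map[OF f(1) g(1)]] lin_tensor_map[OF fc gc] _ t])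
      (simp add: tensor_map_pure[OF f(1) g(1)] tensor_map_pure[OF f(2) g(2)] tensor_map_pure[OF fc gc] lin_closed[OF f(1)] lin_closed[OF g(1)])
qed

lemma tensor_map_id:
  assumes "module K V" "module K W" "t \<in> carrier (tensor K V W)"
    "\<And>x. x \<in> carrier V \<Longrightarrow> f x = x" "\<And>x. x \<in> carrier W \<Longrightarrow> g x = x"
  shows "tensor_map K V W f g t = t"
proof -
  note i = lin_id[OF assms(1)] lin_id[OF assms(2)]
  have "tensor_map K V W (\<lambda>x. x) (\<lambda>x. x) t = t"
    by (rule tensor_ext[OF assms(1,2) lin_tensor_map[OF i] lin_id[OF module_tensor[OF assms(1,2)]] _ assms(3)])
      (simp add: tensor_map_pure[OF i])
  moreover have "tensor_map K V W (\<lambda>x. x) (\<lambda>x. x) t = tensor_map K V W f g t"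
    using assms by (intro tensor_map_cong[OF i]) auto
  ultimately show ?thesis by simp
qed

section \<open>Algebras and modules\<close>

lemma k_algebra_facts:
  assumes "k_algebra K A"
  shows k_algebra_module: "module K A" and k_algebra_ring: "ring A" and k_algebra_field: "field K"
    and k_algebra_bilin: "bilin K A A A (\<lambda>x y. x \<otimes>\<^bsub>A\<^esub> y)"
proof -
  interpret A: k_algebra K A by fact
  show "module K A" "ring A" "field K" by (rule A.module_axioms A.ring_axioms A.K.field_axioms)+
  then show "bilin K A A A (\<lambda>x y. x \<otimes>\<^bsub>A\<^esub> y)"
    by (intro bilinI linI) (auto simp: A.l_distr A.r_distr A.smult_mult_left A.smult_mult_right)
qed

lemma k_algebraI:
  assumes K: "field K" and b: "bilin K A A A (\<lambda>x y. x \<otimes>\<^bsub>A\<^esub> y)" and one: "\<one>\<^bsub>A\<^esub> \<in> carrier A"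
    and unit: "\<And>x. x \<in> carrier A \<Longrightarrow> \<one>\<^bsub>A\<^esub> \<otimes>\<^bsub>A\<^esub> x = x" "\<And>x. x \<in> carrier A \<Longrightarrow> x \<otimes>\<^bsub>A\<^esub> \<one>\<^bsub>A\<^esub> = x"
    and assoc: "\<And>x y z. \<lbrakk>x \<in> carrier A; y \<in> carrier A; z \<in> carrier A\<rbrakk> \<Longrightarrow> (x \<otimes>\<^bsub>A\<^esub> y) \<otimes>\<^bsub>A\<^esub> z = x \<otimes>\<^bsub>A\<^esub> (y \<otimes>\<^bsub>A\<^esub> z)"
  shows "k_algebra K A"
proof -
  note m = bilin_module(1)[OF b]
  note ba = lin_add[OF bilin_lin(1)[OF b]] lin_add[OF bilin_lin(2)[OF b]] lin_smult[OF bilin_lin(1)[OF b]] lin_smult[OF bilin_lin(2)[OF b]]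
    bilin_closed[OF b]
  have "ring A" using m assms(3-) ba
    by (intro ringI monoidI) (auto simp: module_def)
  then show ?thesis using K m ba
    by (intro k_algebra.intro k_algebra_axioms.intro) auto
qed

lemma right_module_facts:
  assumes "right_module K D M"
  shows right_module_module: "module K M" and right_module_bilin: "bilin K M D M (\<lambda>m x. m \<triangleleft>\<^bsub>M\<^esub> x)"
    and right_module_mult: "\<lbrakk>m \<in> carrier M; x \<in> carrier D; y \<in> carrier D\<rbrakk> \<Longrightarrow> m \<triangleleft>\<^bsub>M\<^esub> (x \<otimes>\<^bsub>D\<^esub> y) = (m \<triangleleft>\<^bsub>M\<^esub> x) \<triangleleft>\<^bsub>M\<^esub> y"
    and right_module_one: "m \<in> carrier M \<Longrightarrow> m \<triangleleft>\<^bsub>M\<^esub> \<one>\<^bsub>D\<^esub> = m"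
proof -
  interpret right_module K D M by fact
  show "module K M" by (rule M.module_axioms)
  then show "bilin K M D M (\<lambda>m x. m \<triangleleft>\<^bsub>M\<^esub> x)"
    using k_algebra_module[OF k_algebra_axioms]
    by (intro bilinI linI)
      (auto simp: ract_closed ract_add_left ract_add_right ract_smult_left ract_smult_right)
qed (auto simp: right_module.ract_mult[OF assms] right_module.ract_one[OF assms])

lemma right_moduleI:
  assumes "k_algebra K D" and b: "bilin K M D M (\<lambda>m x. m \<triangleleft>\<^bsub>M\<^esub> x)"
    and "\<And>m x y. \<lbrakk>m \<in> carrier M; x \<in> carrier D; y \<in> carrier D\<rbrakk> \<Longrightarrow> m \<triangleleft>\<^bsub>M\<^esub> (x \<otimes>\<^bsub>D\<^esub> y) = (m \<triangleleft>\<^bsub>M\<^esub> x) \<triangleleft>\<^bsub>M\<^esub> y"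
    and "\<And>m. m \<in> carrier M \<Longrightarrow> m \<triangleleft>\<^bsub>M\<^esub> \<one>\<^bsub>D\<^esub> = m"
  shows "right_module K D M"
proof -
  note ba = lin_add[OF bilin_lin(1)[OF b]] lin_add[OF bilin_lin(2)[OF b]] lin_smult[OF bilin_lin(1)[OF b]] lin_smult[OF bilin_lin(2)[OF b]]
    bilin_closed[OF b]
  show ?thesis
    using assms ba bilin_module(1)[OF b]
    by (intro right_module.intro right_module_axioms.intro) auto
qed

text \<open>The properties of the bimodule of one-forms that make \<open>M \<otimes>\<^sub>D \<Omega>\<^sup>1\<close> a right module on which
  factors from \<open>D\<close> can be moved across the tensor sign.\<close>

locale bimod =
  fixes K :: "('k, 'c) ring_scheme" and D :: "('k, 'd, 'q) module_scheme"
    and N :: "('k, 'n, 'd, 's) bimodule_scheme"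
  assumes D_algebra: "k_algebra K D"
    and lact_bilin: "bilin K D N N (lact N)"
    and ract_bilin: "bilin K N D N (\<lambda>n x. n \<triangleleft>\<^bsub>N\<^esub> x)"
    and lact_ract: "\<lbrakk>x \<in> carrier D; n \<in> carrier N; y \<in> carrier D\<rbrakk> \<Longrightarrow> lact N x n \<triangleleft>\<^bsub>N\<^esub> y = lact N x (n \<triangleleft>\<^bsub>N\<^esub> y)"
    and ract_mult: "\<lbrakk>n \<in> carrier N; x \<in> carrier D; y \<in> carrier D\<rbrakk> \<Longrightarrow> n \<triangleleft>\<^bsub>N\<^esub> (x \<otimes>\<^bsub>D\<^esub> y) = (n \<triangleleft>\<^bsub>N\<^esub> x) \<triangleleft>\<^bsub>N\<^esub> y"

locale balanced_tensor = bimod K D N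
  for K :: "('k, 'c) ring_scheme" and D :: "('k, 'd, 'q) module_scheme"
    and M :: "('k, 'm, 'd, 'r) right_module_scheme" and N :: "('k, 'n, 'd, 's) bimodule_scheme" +
  assumes M_right_module: "right_module K D M"
begin

abbreviation "T \<equiv> tensor_over K D M N"
abbreviation "po \<equiv> pure_over K D M N"

lemma modules: "module K D" "module K M" "module K N"
  using bilin_module[OF lact_bilin] right_module_module[OF M_right_module] by auto

lemmas M_bilin = right_module_bilin[OF M_right_module]

lemma T_simps:
  "carrier T = carrier (quotient_module (tensor K M N) (balanced_kernel K D M N))"
  "zero T = zero (quotient_module (tensor K M N) (balanced_kernel K D M N))"
  "add T = add (quotient_module (tensor K M N) (balanced_kernel K D M N))"
  "smult T = smult (quotient_module (tensor K M N) (balanced_kernel K D M N))"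
  "z \<triangleleft>\<^bsub>T\<^esub> x = quotient_map (tensor K M N) (balanced_kernel K D M N) (tensor_map K M N (\<lambda>m. m) (\<lambda>n. n \<triangleleft>\<^bsub>N\<^esub> x)) z"
  unfolding tensor_over_def module.defs by simp_all

lemma MN: "module K (tensor K M N)" by (rule module_tensor[OF modules(2,3)])

lemmas MN_pure = bilin_pure[OF modules(2,3)]

lemma relations_closed:
  "{pure K M N (m \<triangleleft>\<^bsub>M\<^esub> x) n \<ominus>\<^bsub>tensor K M N\<^esub> pure K M N m (lact N x n) | m x n.
        m \<in> carrier M \<and> x \<in> carrier D \<and> n \<in> carrier N} \<subseteq> carrier (tensor K M N)"
  by (auto intro!: module_closed(4)[OF MN] bilin_closed[OF MN_pure] bilin_closed[OF M_bilin] bilin_closed[OF lact_bilin])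

lemma kernel: "submodule (balanced_kernel K D M N) K (tensor K M N)"
  unfolding balanced_kernel_def by (rule lin_span_submodule[OF MN relations_closed])

lemma module_T: "module K T"
  by (rule module_cong[OF _ _ _ _ quotient_is_module[OF MN kernel]]) (auto simp: T_simps)

lemma lin_T_iff:
  "lin K T U f \<longleftrightarrow> lin K (quotient_module (tensor K M N) (balanced_kernel K D M N)) U f"
  "lin K V T g \<longleftrightarrow> lin K V (quotient_module (tensor K M N) (balanced_kernel K D M N)) g"
  using module_T quotient_is_module[OF MN kernel] unfolding lin_def linear_map_def by (auto simp: T_simps)

lemma lin_over_coset: "lin K (tensor K M N) T (\<lambda>x. balanced_kernel K D M N +>\<^bsub>tensor K M N\<^esub> x)"
  unfolding lin_T_iff by (rule lin_coset[OF MN kernel])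

lemma bilin_pure_over: "bilin K M N T po"
  using bilin_lin_after[OF MN_pure lin_over_coset] unfolding pure_over_def[abs_def] .

lemma pure_over_balanced:
  assumes "m \<in> carrier M" "x \<in> carrier D" "n \<in> carrier N"
  shows "po (m \<triangleleft>\<^bsub>M\<^esub> x) n = po m (lact N x n)"
proof -
  have "pure K M N (m \<triangleleft>\<^bsub>M\<^esub> x) n \<ominus>\<^bsub>tensor K M N\<^esub> pure K M N m (lact N x n) \<in> balanced_kernel K D M N"
    unfolding balanced_kernel_def by (rule subsetD[OF lin_span_superset]) (use assms in blast)
  then show ?thesis unfolding pure_over_def
    using assms by (subst coset_eq_iff[OF MN kernel])
      (auto intro!: bilin_closed[OF MN_pure] bilin_closed[OF M_bilin] bilin_closed[OF lact_bilin])
qed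

lemma over_generated:
  assumes N': "submodule N' K T"
    and p: "\<And>m n. \<lbrakk>m \<in> carrier M; n \<in> carrier N\<rbrakk> \<Longrightarrow> po m n \<in> N'"
    and z: "z \<in> carrier T"
  shows "z \<in> N'"
proof -
  obtain x where x: "x \<in> carrier (tensor K M N)" "z = balanced_kernel K D M N +>\<^bsub>tensor K M N\<^esub> x"
    using z unfolding T_simps quotient_simps by auto
  have "x \<in> {x \<in> carrier (tensor K M N). balanced_kernel K D M N +>\<^bsub>tensor K M N\<^esub> x \<in> N'}"
    using p by (intro tensor_generated[OF modules(2,3) submodule_vimage[OF lin_over_coset N'] _ x(1)])
      (auto simp: pure_over_def bilin_closed[OF MN_pure])
  then show ?thesis using x by simp
qed

lemma over_ext:
  assumes "lin K T U f" "lin K T U g"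
    "\<And>m n. \<lbrakk>m \<in> carrier M; n \<in> carrier N\<rbrakk> \<Longrightarrow> f (po m n) = g (po m n)" "z \<in> carrier T"
  shows "f z = g z"
  using over_generated[OF submodule_equalizer[OF assms(1,2)] _ assms(4)] assms(3) bilin_closed[OF bilin_pure_over]
  by blast

lemma over_lift:
  assumes b: "bilin K M N U \<beta>"
    and bal: "\<And>m x n. \<lbrakk>m \<in> carrier M; x \<in> carrier D; n \<in> carrier N\<rbrakk> \<Longrightarrow> \<beta> (m \<triangleleft>\<^bsub>M\<^esub> x) n = \<beta> m (lact N x n)"
  shows lin_over_lift: "lin K T U (tensor_over_lift K U \<beta>)"
    and over_lift_pure: "\<lbrakk>m \<in> carrier M; n \<in> carrier N\<rbrakk> \<Longrightarrow> tensor_over_lift K U \<beta> (po m n) = \<beta> m n"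
proof -
  note f = lin_tensor_lift[OF modules(2,3) b] and fp = tensor_lift_pure[OF modules(2,3) b]
  interpret U: module K U by (rule bilin_module(3)[OF b])
  note cl = bilin_closed[OF MN_pure] bilin_closed[OF M_bilin] bilin_closed[OF lact_bilin] bilin_closed[OF b]
  have fr: "tensor_lift K U \<beta> r = \<zero>\<^bsub>U\<^esub>" if r0: "r \<in> {pure K M N (m \<triangleleft>\<^bsub>M\<^esub> x) n \<ominus>\<^bsub>tensor K M N\<^esub> pure K M N m (lact N x n) | m x n.
        m \<in> carrier M \<and> x \<in> carrier D \<and> n \<in> carrier N}" for r
  proof -
    obtain m x n where r: "r = pure K M N (m \<triangleleft>\<^bsub>M\<^esub> x) n \<ominus>\<^bsub>tensor K M N\<^esub> pure K M N m (lact N x n)"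
      and a: "m \<in> carrier M" "x \<in> carrier D" "n \<in> carrier N" using r0 by blast
    have "tensor_lift K U \<beta> r = \<beta> m (lact N x n) \<ominus>\<^bsub>U\<^esub> \<beta> m (lact N x n)"
      unfolding r using a by (simp add: lin_diff[OF f] fp cl bal)
    then show ?thesis using a by (simp add: a_minus_def U.r_neg cl)
  qed
  have f0: "tensor_lift K U \<beta> r = \<zero>\<^bsub>U\<^esub>" if "r \<in> balanced_kernel K D M N" for r
    using lin_eq_on_span[OF f lin_const_zero[OF MN U.module_axioms] relations_closed fr] that
    unfolding balanced_kernel_def by blast
  show "lin K T U (tensor_over_lift K U \<beta>)"
    using lin_quotient_lift[OF MN kernel f f0] unfolding lin_T_iff tensor_over_lift_def .
  show "tensor_over_lift K U \<beta> (po m n) = \<beta> m n" if "m \<in> carrier M" "n \<in> carrier N"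
    using quotient_lift_coset[OF MN kernel f f0 cl(1)[OF that]] fp[OF that] unfolding pure_over_def tensor_over_lift_def by simp
qed

lemma lin_over_lift_param:
  assumes X: "module K X" and U: "module K U" and z: "z \<in> carrier T"
    and b: "\<And>x. x \<in> carrier X \<Longrightarrow> bilin K M N U (\<beta> x)"
    and bal: "\<And>x m y n. \<lbrakk>x \<in> carrier X; m \<in> carrier M; y \<in> carrier D; n \<in> carrier N\<rbrakk> \<Longrightarrow> \<beta> x (m \<triangleleft>\<^bsub>M\<^esub> y) n = \<beta> x m (lact N y n)"
    and l: "\<And>m n. \<lbrakk>m \<in> carrier M; n \<in> carrier N\<rbrakk> \<Longrightarrow> lin K X U (\<lambda>x. \<beta> x m n)"
  shows "lin K X U (\<lambda>x. tensor_over_lift K U (\<beta> x) z)"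
proof (rule linI[OF X U])
  note tl = lin_over_lift[OF b bal] and tp = over_lift_pure[OF b bal]
  fix x assume x: "x \<in> carrier X"
  show "tensor_over_lift K U (\<beta> x) z \<in> carrier U" by (rule lin_closed[OF tl z]) (use x in auto)
  show "tensor_over_lift K U (\<beta> (x \<oplus>\<^bsub>X\<^esub> y)) z = tensor_over_lift K U (\<beta> x) z \<oplus>\<^bsub>U\<^esub> tensor_over_lift K U (\<beta> y) z"
    if y: "y \<in> carrier X" for y
  proof -
    have xy: "x \<oplus>\<^bsub>X\<^esub> y \<in> carrier X" using module_closed(2)[OF X x y] .
    show ?thesis
      by (rule over_ext[OF tl[OF xy xy] lin_plus[OF tl[OF x x] tl[OF y y]] _ z])
        (simp_all add: tp x y xy lin_add[OF l])
  qed
  show "tensor_over_lift K U (\<beta> (c \<odot>\<^bsub>X\<^esub> x)) z = c \<odot>\<^bsub>U\<^esub> tensor_over_lift K U (\<beta> x) z"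
    if c: "c \<in> carrier K" for c
  proof -
    have xy: "c \<odot>\<^bsub>X\<^esub> x \<in> carrier X" using module_closed(5)[OF X c x] .
    show ?thesis
      by (rule over_ext[OF tl[OF xy xy] lin_scale[OF tl[OF x x] c] _ z])
        (simp_all add: tp x xy c lin_smult[OF l])
  qed
qed

text \<open>The action of \<open>x\<close> on the right factor sends \<open>m y \<otimes> n - m \<otimes> y n\<close> to \<open>m y \<otimes> n x - m \<otimes> y (n x)\<close>,
  because the two actions on \<open>N\<close> commute; so it descends to the quotient.\<close>

lemma over_act:
  assumes x: "x \<in> carrier D"
  shows lin_over_act: "lin K T T (\<lambda>z. z \<triangleleft>\<^bsub>T\<^esub> x)"
    and over_act_pure: "\<lbrakk>m \<in> carrier M; n \<in> carrier N\<rbrakk> \<Longrightarrow> po m n \<triangleleft>\<^bsub>T\<^esub> x = po m (n \<triangleleft>\<^bsub>N\<^esub> x)"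
proof -
  let ?f = "tensor_map K M N (\<lambda>m. m) (\<lambda>n. n \<triangleleft>\<^bsub>N\<^esub> x)"
  note l = lin_id[OF modules(2)] bilin_lin(2)[OF ract_bilin x]
  note f = lin_tensor_map[OF l] and fp = tensor_map_pure[OF l]
  note cl = bilin_closed[OF MN_pure] bilin_closed[OF M_bilin] bilin_closed[OF lact_bilin] bilin_closed[OF ract_bilin]
  have fr: "?f r \<in> balanced_kernel K D M N" if r: "r \<in> balanced_kernel K D M N" for r
  proof (rule lin_maps_span[OF f kernel relations_closed _ r[unfolded balanced_kernel_def]])
    fix r assume "r \<in> {pure K M N (m \<triangleleft>\<^bsub>M\<^esub> x) n \<ominus>\<^bsub>tensor K M N\<^esub> pure K M N m (lact N x n) | m x n.
        m \<in> carrier M \<and> x \<in> carrier D \<and> n \<in> carrier N}"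
    then obtain m y n where r: "r = pure K M N (m \<triangleleft>\<^bsub>M\<^esub> y) n \<ominus>\<^bsub>tensor K M N\<^esub> pure K M N m (lact N y n)"
      and a: "m \<in> carrier M" "y \<in> carrier D" "n \<in> carrier N" by blast
    have "?f r = pure K M N (m \<triangleleft>\<^bsub>M\<^esub> y) (n \<triangleleft>\<^bsub>N\<^esub> x) \<ominus>\<^bsub>tensor K M N\<^esub> pure K M N m (lact N y (n \<triangleleft>\<^bsub>N\<^esub> x))"
      unfolding r using a x by (simp add: lin_diff[OF f] fp cl lact_ract)
    then show "?f r \<in> balanced_kernel K D M N"
      unfolding balanced_kernel_def using a x cl by (intro subsetD[OF lin_span_superset]) blast
  qed
  have q: "(balanced_kernel K D M N +>\<^bsub>tensor K M N\<^esub> t) \<triangleleft>\<^bsub>T\<^esub> x = balanced_kernel K D M N +>\<^bsub>tensor K M N\<^esub> ?f t"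
    if "t \<in> carrier (tensor K M N)" for t
    unfolding T_simps by (rule quotient_map_coset[OF MN kernel f fr that])
  note k = lin_over_coset
  show "lin K T T (\<lambda>z. z \<triangleleft>\<^bsub>T\<^esub> x)"
  proof (rule linI[OF module_T module_T])
    have ex: "\<exists>t \<in> carrier (tensor K M N). z = balanced_kernel K D M N +>\<^bsub>tensor K M N\<^esub> t" if "z \<in> carrier T" for z
      using that unfolding T_simps quotient_simps by auto
    fix z assume z: "z \<in> carrier T"
    then obtain t where t: "t \<in> carrier (tensor K M N)" "z = balanced_kernel K D M N +>\<^bsub>tensor K M N\<^esub> t" using ex by blast
    show "z \<triangleleft>\<^bsub>T\<^esub> x \<in> carrier T" using t by (simp add: q lin_closed[OF k] lin_closed[OF f])
    show "(c \<odot>\<^bsub>T\<^esub> z) \<triangleleft>\<^bsub>T\<^esub> x = c \<odot>\<^bsub>T\<^esub> (z \<triangleleft>\<^bsub>T\<^esub> x)" if "c \<in> carrier K" for c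
      using t that by (simp add: q lin_closed[OF f] lin_smult[OF k, symmetric] lin_smult[OF f] module_closed[OF MN])
    fix z' assume "z' \<in> carrier T"
    then obtain t' where t': "t' \<in> carrier (tensor K M N)" "z' = balanced_kernel K D M N +>\<^bsub>tensor K M N\<^esub> t'" using ex by blast
    show "(z \<oplus>\<^bsub>T\<^esub> z') \<triangleleft>\<^bsub>T\<^esub> x = z \<triangleleft>\<^bsub>T\<^esub> x \<oplus>\<^bsub>T\<^esub> z' \<triangleleft>\<^bsub>T\<^esub> x"
      using t t' by (simp add: q lin_closed[OF f] lin_add[OF k, symmetric] lin_add[OF f] module_closed[OF MN])
  qed
  show "po m n \<triangleleft>\<^bsub>T\<^esub> x = po m (n \<triangleleft>\<^bsub>N\<^esub> x)" if "m \<in> carrier M" "n \<in> carrier N"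
    unfolding pure_over_def using that by (simp add: q cl fp)
qed

lemma bilin_over_act: "bilin K T D T (\<lambda>z x. z \<triangleleft>\<^bsub>T\<^esub> x)"
proof (intro bilinI modules module_T lin_over_act)
  fix z assume z: "z \<in> carrier T"
  note cl = bilin_closed[OF ract_bilin] bilin_closed[OF bilin_pure_over] module_closed[OF modules(1)]
  show "lin K D T (\<lambda>x. z \<triangleleft>\<^bsub>T\<^esub> x)"
  proof (rule linI[OF modules(1) module_T])
    fix x assume x: "x \<in> carrier D"
    show "z \<triangleleft>\<^bsub>T\<^esub> x \<in> carrier T" by (rule lin_closed[OF lin_over_act[OF x] z])
    show "z \<triangleleft>\<^bsub>T\<^esub> (c \<odot>\<^bsub>D\<^esub> x) = c \<odot>\<^bsub>T\<^esub> (z \<triangleleft>\<^bsub>T\<^esub> x)" if c: "c \<in> carrier K" for c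
      by (rule over_ext[OF lin_over_act lin_scale[OF lin_over_act[OF x] c] _ z])
        (simp_all add: over_act_pure x c cl lin_smult[OF bilin_lin(1)[OF ract_bilin]] lin_smult[OF bilin_lin(1)[OF bilin_pure_over]])
    show "z \<triangleleft>\<^bsub>T\<^esub> (x \<oplus>\<^bsub>D\<^esub> y) = z \<triangleleft>\<^bsub>T\<^esub> x \<oplus>\<^bsub>T\<^esub> z \<triangleleft>\<^bsub>T\<^esub> y" if y: "y \<in> carrier D" for y
      by (rule over_ext[OF lin_over_act lin_plus[OF lin_over_act[OF x] lin_over_act[OF y]] _ z])
        (simp_all add: over_act_pure x y cl lin_add[OF bilin_lin(1)[OF ract_bilin]] lin_add[OF bilin_lin(1)[OF bilin_pure_over]])
  qed
qed

lemma over_act_mult: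
  assumes "x \<in> carrier D" "y \<in> carrier D" "z \<in> carrier T"
  shows "z \<triangleleft>\<^bsub>T\<^esub> (x \<otimes>\<^bsub>D\<^esub> y) = (z \<triangleleft>\<^bsub>T\<^esub> x) \<triangleleft>\<^bsub>T\<^esub> y"
proof -
  have xy: "x \<otimes>\<^bsub>D\<^esub> y \<in> carrier D" using assms bilin_closed[OF k_algebra_bilin[OF D_algebra]] by auto
  show ?thesis
    by (rule over_ext[OF lin_over_act[OF xy] lin_comp[OF lin_over_act lin_over_act] _ assms(3)])
      (simp_all add: over_act_pure assms xy ract_mult bilin_closed[OF ract_bilin])
qed

end

section \<open>Twisted modules and twisted tensor products\<close>

text \<open>The right action \<open>(a \<otimes> f)(\<alpha> \<otimes> \<beta>) = a \<alpha>\<^sub>\<tau> \<otimes> f\<^sub>\<tau> \<beta>\<close> of the twisted tensor product on \<open>A \<otimes> F\<close>.\<close>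

definition twisted_act ::
  "('k, 'c) ring_scheme \<Rightarrow> ('k, 'a, 'r) module_scheme \<Rightarrow> ('k, 'f, 'b) right_module \<Rightarrow>
   (('k, 'f, 'a) tens \<Rightarrow> ('k, 'a, 'f) tens) \<Rightarrow> ('k, 'a, 'f) tens \<Rightarrow> ('k, 'a, 'b) tens \<Rightarrow> ('k, 'a, 'f) tens"
  where "twisted_act K A F \<tau> v y = tensor_lift K (tensor K A F)
    (\<lambda>a f. tensor_lift K (tensor K A F)
      (\<lambda>\<alpha> \<beta>. tensor_map K A F (\<lambda>x. a \<otimes>\<^bsub>A\<^esub> x) (\<lambda>g. g \<triangleleft>\<^bsub>F\<^esub> \<beta>) (\<tau> (pure K F A f \<alpha>))) y) v"

text \<open>For \<open>F = B\<close> and \<open>\<tau> = R\<close> the action on \<open>A \<otimes> F\<close> becomes the product of \<open>A \<otimes>\<^sub>R B\<close>. Facts about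
  twisted modules therefore specialise to the twisted tensor product, and are proved only once.\<close>

definition regular_module :: "('k, 'b, 'q) module_scheme \<Rightarrow> ('k, 'b, 'b) right_module"
  where "regular_module B = \<lparr>carrier = carrier B, mult = mult B, one = one B, zero = zero B, add = add B,
    smult = smult B, ract = mult B\<rparr>"

lemma regular_module_simps [simp]:
  "carrier (regular_module B) = carrier B" "add (regular_module B) = add B" "zero (regular_module B) = zero B"
  "smult (regular_module B) = smult B" "ract (regular_module B) = mult B"
  by (simp_all add: regular_module_def)

lemma tensor_regular_module [simp]:
  "tensor K A (regular_module B) = tensor K A B" "pure K A (regular_module B) = pure K A B"
  "tensor_map K A (regular_module B) = tensor_map K A B"
  "tensor K (regular_module B) A = tensor K B A" "pure K (regular_module B) A = pure K B A"
proof -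
  show 1: "tensor K A (regular_module B) = tensor K A B" "pure K A (regular_module B) = pure K A B"
    "tensor K (regular_module B) A = tensor K B A" "pure K (regular_module B) A = pure K B A"
    by (simp_all add: tensor_def pure_def[abs_def] tensor_kernel_def tensor_relations_def)
  show "tensor_map K A (regular_module B) = tensor_map K A B"
    by (intro ext) (simp add: tensor_map_def 1)
qed

lemma regular_module_right_module:
  assumes "k_algebra K B" shows "right_module K B (regular_module B)"
proof (rule right_moduleI[OF assms])
  interpret B: k_algebra K B by fact
  have m: "module K (regular_module B)"
    by (rule module_cong[OF _ _ _ _ B.module_axioms]) auto
  then show "bilin K (regular_module B) B (regular_module B) (\<lambda>m x. m \<triangleleft>\<^bsub>regular_module B\<^esub> x)"
    using B.module_axioms
    by (intro bilinI linI) (auto simp: B.l_distr B.r_distr B.smult_mult_left B.smult_mult_right)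
qed (use ring.is_monoid[OF k_algebra_ring[OF assms]] in \<open>auto simp: monoid.m_assoc monoid.r_one\<close>)

locale twisted_module =
  fixes K :: "('k, 'c) ring_scheme" and A :: "('k, 'a, 'r) module_scheme" and B :: "('k, 'b, 's) module_scheme"
    and R :: "('k, 'b, 'a) tens \<Rightarrow> ('k, 'a, 'b) tens" and F :: "('k, 'f, 'b) right_module"
    and \<tau> :: "('k, 'f, 'a) tens \<Rightarrow> ('k, 'a, 'f) tens"
  assumes A_algebra: "k_algebra K A" and B_algebra: "k_algebra K B"
    and F_module: "right_module K B F"
    and R_twisting: "twisting_map K A B R"
    and \<tau>_twisting: "module_twisting_map K A B R F \<tau>"
begin

abbreviation "V \<equiv> tensor K A F"
abbreviation "AB \<equiv> tensor K A B"
abbreviation "act \<equiv> twisted_act K A F \<tau>"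
abbreviation "Lm a \<equiv> tensor_map K A F (\<lambda>x. a \<otimes>\<^bsub>A\<^esub> x) (\<lambda>g. g)"
abbreviation "Rm b \<equiv> tensor_map K A F (\<lambda>x. x) (\<lambda>g. g \<triangleleft>\<^bsub>F\<^esub> b)"

lemma mods: "module K A" "module K B" "module K F" "module K V" "module K AB" "module K (tensor K B A)" "module K (tensor K F A)"
proof -
  show *: "module K A" "module K B" "module K F"
    by (rule k_algebra_module[OF A_algebra] k_algebra_module[OF B_algebra] right_module_module[OF F_module])+
  show "module K V" "module K AB" "module K (tensor K B A)" "module K (tensor K F A)"
    by (intro module_tensor *)+
qed

lemmas A_mult = k_algebra_bilin[OF A_algebra]
lemmas B_mult = k_algebra_bilin[OF B_algebra]
lemmas F_act = right_module_bilin[OF F_module]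
lemmas V_pure = bilin_pure[OF mods(1,3)]
lemmas AB_pure = bilin_pure[OF mods(1,2)]
lemmas FA_pure = bilin_pure[OF mods(3,1)]
lemmas BA_pure = bilin_pure[OF mods(2,1)]

lemma lin_\<tau>: "lin K (tensor K F A) V \<tau>"
  using \<tau>_twisting mods unfolding module_twisting_map_def lin_def by auto

lemma lin_R: "lin K (tensor K B A) AB R"
  using R_twisting mods unfolding twisting_map_def lin_def by auto

lemma ones: "\<one>\<^bsub>A\<^esub> \<in> carrier A" "\<one>\<^bsub>B\<^esub> \<in> carrier B"
  using k_algebra_ring[OF A_algebra] k_algebra_ring[OF B_algebra] by (auto simp: ring.ring_simprules)

lemmas closed = ones bilin_closed[OF A_mult] bilin_closed[OF B_mult] bilin_closed[OF F_act] bilin_closed[OF V_pure]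
  bilin_closed[OF AB_pure] bilin_closed[OF FA_pure] bilin_closed[OF BA_pure] lin_closed[OF lin_\<tau>] lin_closed[OF lin_R]

lemmas A_simps = ring.ring_simprules(11)[OF k_algebra_ring[OF A_algebra]] 
  monoid.l_one[OF ring.is_monoid[OF k_algebra_ring[OF A_algebra]]] monoid.r_one[OF ring.is_monoid[OF k_algebra_ring[OF A_algebra]]]
  monoid.l_one[OF ring.is_monoid[OF k_algebra_ring[OF B_algebra]]] monoid.r_one[OF ring.is_monoid[OF k_algebra_ring[OF B_algebra]]]
  right_module_one[OF F_module]

lemma lin_inner_map:
  assumes "a \<in> carrier A" "b \<in> carrier B"
  shows "lin K V V (tensor_map K A F (\<lambda>x. a \<otimes>\<^bsub>A\<^esub> x) (\<lambda>g. g \<triangleleft>\<^bsub>F\<^esub> b))"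
  by (rule lin_tensor_map[OF bilin_lin(1)[OF A_mult assms(1)] bilin_lin(2)[OF F_act assms(2)]])

lemma lin_Lm: "a \<in> carrier A \<Longrightarrow> lin K V V (Lm a)"
  by (rule lin_tensor_map[OF bilin_lin(1)[OF A_mult] lin_id[OF mods(3)]])

lemma lin_Rm: "b \<in> carrier B \<Longrightarrow> lin K V V (Rm b)"
  by (rule lin_tensor_map[OF lin_id[OF mods(1)] bilin_lin(2)[OF F_act]])

lemma Lm_pure: "\<lbrakk>a \<in> carrier A; x \<in> carrier A; g \<in> carrier F\<rbrakk> \<Longrightarrow> Lm a (pure K A F x g) = pure K A F (a \<otimes>\<^bsub>A\<^esub> x) g"
  by (rule tensor_map_pure[OF bilin_lin(1)[OF A_mult] lin_id[OF mods(3)]])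

lemma Rm_pure: "\<lbrakk>b \<in> carrier B; x \<in> carrier A; g \<in> carrier F\<rbrakk> \<Longrightarrow> Rm b (pure K A F x g) = pure K A F x (g \<triangleleft>\<^bsub>F\<^esub> b)"
  by (rule tensor_map_pure[OF lin_id[OF mods(1)] bilin_lin(2)[OF F_act]])

lemma bilin_inner:
  assumes a: "a \<in> carrier A" and f: "f \<in> carrier F"
  shows "bilin K A B V (\<lambda>\<alpha> \<beta>. tensor_map K A F (\<lambda>x. a \<otimes>\<^bsub>A\<^esub> x) (\<lambda>g. g \<triangleleft>\<^bsub>F\<^esub> \<beta>) (\<tau> (pure K F A f \<alpha>)))"
proof (rule bilinI[OF mods(1,2,4)])
  fix \<alpha> assume "\<alpha> \<in> carrier A"
  then show "lin K B V (\<lambda>\<beta>. tensor_map K A F (\<lambda>x. a \<otimes>\<^bsub>A\<^esub> x) (\<lambda>g. g \<triangleleft>\<^bsub>F\<^esub> \<beta>) (\<tau> (pure K F A f \<alpha>)))"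
    using f by (intro lin_tensor_map_param_right[OF bilin_lin(1)[OF A_mult a] bilin_flip[OF F_act]] closed)
next
  fix \<beta> assume "\<beta> \<in> carrier B"
  then show "lin K A V (\<lambda>\<alpha>. tensor_map K A F (\<lambda>x. a \<otimes>\<^bsub>A\<^esub> x) (\<lambda>g. g \<triangleleft>\<^bsub>F\<^esub> \<beta>) (\<tau> (pure K F A f \<alpha>)))"
    by (rule lin_comp[OF lin_inner_map[OF a] lin_comp[OF lin_\<tau> bilin_lin(1)[OF FA_pure f]]])
qed

lemma bilin_outer:
  assumes y: "y \<in> carrier AB"
  shows "bilin K A F V (\<lambda>a f. tensor_lift K V
      (\<lambda>\<alpha> \<beta>. tensor_map K A F (\<lambda>x. a \<otimes>\<^bsub>A\<^esub> x) (\<lambda>g. g \<triangleleft>\<^bsub>F\<^esub> \<beta>) (\<tau> (pure K F A f \<alpha>))) y)"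
proof (rule bilinI[OF mods(1,3,4)])
  fix a assume a: "a \<in> carrier A"
  show "lin K F V (\<lambda>f. tensor_lift K V
      (\<lambda>\<alpha> \<beta>. tensor_map K A F (\<lambda>x. a \<otimes>\<^bsub>A\<^esub> x) (\<lambda>g. g \<triangleleft>\<^bsub>F\<^esub> \<beta>) (\<tau> (pure K F A f \<alpha>))) y)"
    by (rule lin_tensor_lift_param[OF mods(1,2,3,4) y bilin_inner[OF a]], assumption)
      (rule lin_comp[OF lin_inner_map[OF a] lin_comp[OF lin_\<tau> bilin_lin(2)[OF FA_pure]]])
next
  fix f assume f: "f \<in> carrier F"
  show "lin K A V (\<lambda>a. tensor_lift K V
      (\<lambda>\<alpha> \<beta>. tensor_map K A F (\<lambda>x. a \<otimes>\<^bsub>A\<^esub> x) (\<lambda>g. g \<triangleleft>\<^bsub>F\<^esub> \<beta>) (\<tau> (pure K F A f \<alpha>))) y)"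
    by (rule lin_tensor_lift_param[OF mods(1,2,1,4) y bilin_inner[OF _ f]], assumption)
      (rule lin_tensor_map_param_left[OF bilin_lin(2)[OF F_act] A_mult], assumption, intro closed f)
qed

lemma bilin_act: "bilin K V AB V act"
proof (rule bilinI[OF mods(4,5,4)])
  fix y assume y: "y \<in> carrier AB"
  show "lin K V V (\<lambda>v. act v y)" unfolding twisted_act_def
    by (rule lin_tensor_lift[OF mods(1,3) bilin_outer[OF y]])
next
  fix v assume v: "v \<in> carrier V"
  show "lin K AB V (\<lambda>y. act v y)" unfolding twisted_act_def
    by (rule lin_tensor_lift_param[OF mods(1,3,5,4) v bilin_outer], assumption)
      (rule lin_tensor_lift[OF mods(1,2) bilin_inner])
qed

lemma act_pure:
  assumes "a \<in> carrier A" "f \<in> carrier F" "\<alpha> \<in> carrier A" "\<beta> \<in> carrier B"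
  shows "act (pure K A F a f) (pure K A B \<alpha> \<beta>) = tensor_map K A F (\<lambda>x. a \<otimes>\<^bsub>A\<^esub> x) (\<lambda>g. g \<triangleleft>\<^bsub>F\<^esub> \<beta>) (\<tau> (pure K F A f \<alpha>))"
  unfolding twisted_act_def using assms
  by (simp add: tensor_lift_pure[OF mods(1,3) bilin_outer] tensor_lift_pure[OF mods(1,2) bilin_inner] closed)

lemmas act_closed = bilin_closed[OF bilin_act]

text \<open>The action on \<open>A \<otimes> F\<close> is left \<open>A\<close>-linear, and by the next lemma right \<open>B\<close>-linear in the
  second argument. Identities for it reduce in this way to the elements \<open>1 \<otimes> f\<close> and \<open>\<alpha> \<otimes> 1\<close>, on which the
  action is \<open>\<tau>\<close> itself.\<close>

lemma act_Lm:
  assumes a: "a \<in> carrier A" and v: "v \<in> carrier V" and y: "y \<in> carrier AB"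
  shows "act (Lm a v) y = Lm a (act v y)"
proof (rule tensor_ext2[OF mods(1,3,1,2) _ _ _ v y])
  show "bilin K V AB V (\<lambda>v y. act (Lm a v) y)"
    using bilin_comp[OF bilin_act lin_Lm[OF a] lin_id[OF mods(5)]] .
  show "bilin K V AB V (\<lambda>v y. Lm a (act v y))"
    by (rule bilin_lin_after[OF bilin_act lin_Lm[OF a]])
  fix x f \<alpha> \<beta> assume h: "x \<in> carrier A" "f \<in> carrier F" "\<alpha> \<in> carrier A" "\<beta> \<in> carrier B"
  have "Lm a (act (pure K A F x f) (pure K A B \<alpha> \<beta>))
    = tensor_map K A F (\<lambda>z. a \<otimes>\<^bsub>A\<^esub> (x \<otimes>\<^bsub>A\<^esub> z)) (\<lambda>g. g \<triangleleft>\<^bsub>F\<^esub> \<beta>) (\<tau> (pure K F A f \<alpha>))"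
    using h a unfolding act_pure[OF h]
    by (intro tensor_map_compose[OF bilin_lin(1)[OF A_mult h(1)] bilin_lin(1)[OF A_mult a] bilin_lin(2)[OF F_act h(4)] lin_id[OF mods(3)]] closed)
  also have "\<dots> = tensor_map K A F (\<lambda>z. (a \<otimes>\<^bsub>A\<^esub> x) \<otimes>\<^bsub>A\<^esub> z) (\<lambda>g. g \<triangleleft>\<^bsub>F\<^esub> \<beta>) (\<tau> (pure K F A f \<alpha>))"
    using h a by (intro tensor_map_cong[OF lin_comp[OF bilin_lin(1)[OF A_mult] bilin_lin(1)[OF A_mult]] bilin_lin(2)[OF F_act]] closed)
      (simp_all add: A_simps)
  finally show "act (Lm a (pure K A F x f)) (pure K A B \<alpha> \<beta>) = Lm a (act (pure K A F x f) (pure K A B \<alpha> \<beta>))"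
    using h a by (simp add: Lm_pure act_pure closed)
qed

lemma act_Rm:
  assumes b: "b \<in> carrier B" and v: "v \<in> carrier V" and y: "y \<in> carrier AB"
  shows "act v (tensor_map K A B (\<lambda>x. x) (\<lambda>z. z \<otimes>\<^bsub>B\<^esub> b) y) = Rm b (act v y)"
proof (rule tensor_ext2[OF mods(1,3,1,2) _ _ _ v y])
  note r = lin_id[OF mods(1)] bilin_lin(2)[OF B_mult b]
  show "bilin K V AB V (\<lambda>v y. act v (tensor_map K A B (\<lambda>x. x) (\<lambda>z. z \<otimes>\<^bsub>B\<^esub> b) y))"
    using bilin_comp[OF bilin_act lin_id[OF mods(4)] lin_tensor_map[OF r]] .
  show "bilin K V AB V (\<lambda>v y. Rm b (act v y))"
    by (rule bilin_lin_after[OF bilin_act lin_Rm[OF b]])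
  fix x f \<alpha> \<beta> assume h: "x \<in> carrier A" "f \<in> carrier F" "\<alpha> \<in> carrier A" "\<beta> \<in> carrier B"
  have "Rm b (act (pure K A F x f) (pure K A B \<alpha> \<beta>))
    = tensor_map K A F (\<lambda>z. x \<otimes>\<^bsub>A\<^esub> z) (\<lambda>g. (g \<triangleleft>\<^bsub>F\<^esub> \<beta>) \<triangleleft>\<^bsub>F\<^esub> b) (\<tau> (pure K F A f \<alpha>))"
    using h b unfolding act_pure[OF h]
    by (intro tensor_map_compose[OF bilin_lin(1)[OF A_mult h(1)] lin_id[OF mods(1)] bilin_lin(2)[OF F_act h(4)] bilin_lin(2)[OF F_act b]] closed)
  also have "\<dots> = tensor_map K A F (\<lambda>z. x \<otimes>\<^bsub>A\<^esub> z) (\<lambda>g. g \<triangleleft>\<^bsub>F\<^esub> (\<beta> \<otimes>\<^bsub>B\<^esub> b)) (\<tau> (pure K F A f \<alpha>))"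
    using h b by (intro tensor_map_cong[OF bilin_lin(1)[OF A_mult] lin_comp[OF bilin_lin(2)[OF F_act] bilin_lin(2)[OF F_act]]] closed)
      (simp_all add: right_module_mult[OF F_module])
  finally show "act (pure K A F x f) (tensor_map K A B (\<lambda>x. x) (\<lambda>z. z \<otimes>\<^bsub>B\<^esub> b) (pure K A B \<alpha> \<beta>)) = Rm b (act (pure K A F x f) (pure K A B \<alpha> \<beta>))"
    using h b by (simp add: tensor_map_pure[OF r] act_pure closed)
qed

lemma act_generators:
  assumes "f \<in> carrier F" "\<alpha> \<in> carrier A"
  shows "act (pure K A F \<one>\<^bsub>A\<^esub> f) (pure K A B \<alpha> \<one>\<^bsub>B\<^esub>) = \<tau> (pure K F A f \<alpha>)"
  using assms by (simp add: act_pure closed) (rule tensor_map_id[OF mods(1,3)]; simp add: closed A_simps)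

text \<open>The two axioms of a module twisting map, rid of their Sweedler sums:
  \<open>\<tau>(f \<otimes> a a') = \<tau>(f \<otimes> a)(a' \<otimes> 1)\<close>, and in the next lemma \<open>\<tau>(f b \<otimes> a) = (1 \<otimes> f) R(b \<otimes> a)\<close>.\<close>

lemma \<tau>_mult:
  assumes h: "f \<in> carrier F" "a \<in> carrier A" "a' \<in> carrier A"
  shows "\<tau> (pure K F A f (a \<otimes>\<^bsub>A\<^esub> a')) = act (\<tau> (pure K F A f a)) (pure K A B a' \<one>\<^bsub>B\<^esub>)"
proof -
  have "tensor_lift K V (\<lambda>a\<^sub>\<tau> f\<^sub>\<tau>. Lm a\<^sub>\<tau> (\<tau> (pure K F A f\<^sub>\<tau> a'))) v = act v (pure K A B a' \<one>\<^bsub>B\<^esub>)"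
    if v: "v \<in> carrier V" for v
  proof (rule tensor_ext[OF mods(1,3) _ bilin_lin(2)[OF bilin_act] _ v])
    have b: "bilin K A F V (\<lambda>a\<^sub>\<tau> f\<^sub>\<tau>. Lm a\<^sub>\<tau> (\<tau> (pure K F A f\<^sub>\<tau> a')))"
      using h(3)
      by (intro bilinI mods lin_comp[OF lin_Lm lin_comp[OF lin_\<tau> bilin_lin(2)[OF FA_pure]]]
          lin_tensor_map_param_left[OF lin_id[OF mods(3)] A_mult] closed)
    show "lin K V V (tensor_lift K V (\<lambda>a\<^sub>\<tau> f\<^sub>\<tau>. Lm a\<^sub>\<tau> (\<tau> (pure K F A f\<^sub>\<tau> a'))))"
      by (rule lin_tensor_lift[OF mods(1,3) b])
    show "pure K A B a' \<one>\<^bsub>B\<^esub> \<in> carrier AB" using h by (intro closed)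
    fix p g assume pg: "p \<in> carrier A" "g \<in> carrier F"
    have "Lm p (\<tau> (pure K F A g a')) = act (pure K A F p g) (pure K A B a' \<one>\<^bsub>B\<^esub>)"
      using pg h by (simp add: act_pure closed)
        (rule tensor_map_cong[OF bilin_lin(1)[OF A_mult pg(1)] lin_id[OF mods(3)]]; simp add: A_simps closed)
    then show "tensor_lift K V (\<lambda>a\<^sub>\<tau> f\<^sub>\<tau>. Lm a\<^sub>\<tau> (\<tau> (pure K F A f\<^sub>\<tau> a'))) (pure K A F p g) = act (pure K A F p g) (pure K A B a' \<one>\<^bsub>B\<^esub>)"
      using pg by (simp add: tensor_lift_pure[OF mods(1,3) b])
  qed
  then show ?thesis using \<tau>_twisting h unfolding module_twisting_map_def by (simp add: closed)
qed

lemma \<tau>_ract: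
  assumes h: "f \<in> carrier F" "b \<in> carrier B" "a \<in> carrier A"
  shows "\<tau> (pure K F A (f \<triangleleft>\<^bsub>F\<^esub> b) a) = act (pure K A F \<one>\<^bsub>A\<^esub> f) (R (pure K B A b a))"
proof -
  have "tensor_lift K V (\<lambda>a\<^sub>R b\<^sub>R. Rm b\<^sub>R (\<tau> (pure K F A f a\<^sub>R))) t = act (pure K A F \<one>\<^bsub>A\<^esub> f) t"
    if t: "t \<in> carrier AB" for t
  proof (rule tensor_ext[OF mods(1,2) _ bilin_lin(1)[OF bilin_act] _ t])
    have b: "bilin K A B V (\<lambda>a\<^sub>R b\<^sub>R. Rm b\<^sub>R (\<tau> (pure K F A f a\<^sub>R)))"
      using h(1)
      by (intro bilinI mods lin_comp[OF lin_Rm lin_comp[OF lin_\<tau> bilin_lin(1)[OF FA_pure]]]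
          lin_tensor_map_param_right[OF lin_id[OF mods(1)] bilin_flip[OF F_act]] closed)
    show "lin K AB V (tensor_lift K V (\<lambda>a\<^sub>R b\<^sub>R. Rm b\<^sub>R (\<tau> (pure K F A f a\<^sub>R))))"
      by (rule lin_tensor_lift[OF mods(1,2) b])
    show "pure K A F \<one>\<^bsub>A\<^esub> f \<in> carrier V" using h by (intro closed)
    fix p g assume pg: "p \<in> carrier A" "g \<in> carrier B"
    have "Rm g (\<tau> (pure K F A f p)) = act (pure K A F \<one>\<^bsub>A\<^esub> f) (pure K A B p g)"
      using pg h by (simp add: act_pure closed)
        (rule tensor_map_cong[OF lin_id[OF mods(1)] bilin_lin(2)[OF F_act pg(2)]]; simp add: A_simps closed)
    then show "tensor_lift K V (\<lambda>a\<^sub>R b\<^sub>R. Rm b\<^sub>R (\<tau> (pure K F A f a\<^sub>R))) (pure K A B p g) = act (pure K A F \<one>\<^bsub>A\<^esub> f) (pure K A B p g)"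
      using pg by (simp add: tensor_lift_pure[OF mods(1,2) b])
  qed
  then show ?thesis using \<tau>_twisting h unfolding module_twisting_map_def by (simp add: closed)
qed

lemma pure_Lm: "\<lbrakk>a \<in> carrier A; f \<in> carrier F\<rbrakk> \<Longrightarrow> pure K A F a f = Lm a (pure K A F \<one>\<^bsub>A\<^esub> f)"
  by (simp add: Lm_pure closed A_simps)

end

lemma twisted_module_regular:
  assumes "k_algebra K A" "k_algebra K B" "twisting_map K A B R"
  shows "twisted_module K A B R (regular_module B) R"
  using assms regular_module_right_module[OF assms(2)]
  by (intro twisted_module.intro) (auto simp: twisting_map_def module_twisting_map_def)

locale twisted_algebra =
  fixes K :: "('k, 'c) ring_scheme" and A :: "('k, 'a, 'r) module_scheme" and B :: "('k, 'b, 's) module_scheme"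
    and R :: "('k, 'b, 'a) tens \<Rightarrow> ('k, 'a, 'b) tens"
  assumes A_algebra: "k_algebra K A" and B_algebra: "k_algebra K B"
    and R_twisting: "twisting_map K A B R"
begin

interpretation reg: twisted_module K A B R "regular_module B" R
  by (rule twisted_module_regular[OF A_algebra B_algebra R_twisting])

abbreviation "D \<equiv> twisted_tensor K A B R"
abbreviation "p \<equiv> pure K A B"

lemmas mods = reg.mods(1,2,5,6)

lemma D_simps: "carrier D = carrier (tensor K A B)" "add D = add (tensor K A B)" "zero D = zero (tensor K A B)"
  "smult D = smult (tensor K A B)" "one D = p \<one>\<^bsub>A\<^esub> \<one>\<^bsub>B\<^esub>"
  by (simp_all add: twisted_tensor_def)

lemma D_mult: "x \<otimes>\<^bsub>D\<^esub> y = twisted_act K A (regular_module B) R x y"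
  by (simp add: twisted_tensor_def twisted_act_def)

lemma lin_D_iff:
  "lin K D U f \<longleftrightarrow> lin K (tensor K A B) U f" "lin K V D g \<longleftrightarrow> lin K V (tensor K A B) g"
proof -
  have "module K D" by (rule module_cong[OF _ _ _ _ mods(3)]) (simp_all add: D_simps)
  then show "lin K D U f \<longleftrightarrow> lin K (tensor K A B) U f" "lin K V D g \<longleftrightarrow> lin K V (tensor K A B) g"
    using mods(3) by (simp_all add: lin_def linear_map_def D_simps)
qed

lemma module_D: "module K D" using lin_D_iff(1) lin_id[OF mods(3)] lin_module(1) by blast

lemma bilin_D_mult: "bilin K (tensor K A B) (tensor K A B) (tensor K A B) (\<lambda>x y. x \<otimes>\<^bsub>D\<^esub> y)"
  using reg.bilin_act unfolding D_mult by simp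

lemma submodule_D_iff: "submodule N K D \<longleftrightarrow> submodule N K (tensor K A B)"
proof
  assume N: "submodule N K D"
  show "submodule N K (tensor K A B)"
    using submodule_facts[OF N] by (intro submodule_intro mods) (simp_all add: D_simps)
next
  assume N: "submodule N K (tensor K A B)"
  show "submodule N K D"
    using submodule_facts[OF N] by (intro submodule_intro module_D) (simp_all add: D_simps)
qed

lemma D_finsum: "finsum D = finsum (tensor K A B)" "a_inv D = a_inv (tensor K A B)"
  unfolding finsum_def a_inv_def by (simp_all add: D_simps)

lemmas closed = reg.ones reg.closed(3,4,7,9,11) bilin_closed[OF bilin_D_mult]

lemma D_mult_pure:
  "\<lbrakk>a \<in> carrier A; b \<in> carrier B; a' \<in> carrier A; b' \<in> carrier B\<rbrakk> \<Longrightarrow>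
    p a b \<otimes>\<^bsub>D\<^esub> p a' b' = tensor_map K A B (\<lambda>x. a \<otimes>\<^bsub>A\<^esub> x) (\<lambda>g. g \<otimes>\<^bsub>B\<^esub> b') (R (pure K B A b a'))"
  using reg.act_pure[of a b a' b'] unfolding D_mult by simp

abbreviation "Lm a \<equiv> tensor_map K A B (\<lambda>x. a \<otimes>\<^bsub>A\<^esub> x) (\<lambda>g. g)"
abbreviation "Rm b \<equiv> tensor_map K A B (\<lambda>x. x) (\<lambda>g. g \<otimes>\<^bsub>B\<^esub> b)"

lemmas lin_Lm = reg.lin_Lm[simplified] and lin_Rm = reg.lin_Rm[simplified]
  and Lm_pure = reg.Lm_pure[simplified] and Rm_pure = reg.Rm_pure[simplified]
  and p_bilin = reg.AB_pure and lin_R = reg.lin_R and A_simps = reg.A_simps[simplified]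
  and A_mult = reg.A_mult and B_mult = reg.B_mult and BA_pure = reg.BA_pure

lemma D_mult_Lm:
  "\<lbrakk>a \<in> carrier A; x \<in> carrier (tensor K A B); y \<in> carrier (tensor K A B)\<rbrakk> \<Longrightarrow> Lm a x \<otimes>\<^bsub>D\<^esub> y = Lm a (x \<otimes>\<^bsub>D\<^esub> y)"
  using reg.act_Lm[of a x y] unfolding D_mult by simp

lemma D_mult_Rm:
  "\<lbrakk>b \<in> carrier B; x \<in> carrier (tensor K A B); y \<in> carrier (tensor K A B)\<rbrakk> \<Longrightarrow> x \<otimes>\<^bsub>D\<^esub> Rm b y = Rm b (x \<otimes>\<^bsub>D\<^esub> y)"
  using reg.act_Rm[of b x y] unfolding D_mult by simp

lemma D_mult_generators:
  "\<lbrakk>b \<in> carrier B; a \<in> carrier A\<rbrakk> \<Longrightarrow> p \<one>\<^bsub>A\<^esub> b \<otimes>\<^bsub>D\<^esub> p a \<one>\<^bsub>B\<^esub> = R (pure K B A b a)"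
  using reg.act_generators[of b a] unfolding D_mult by simp

lemma R_mult_left:
  "\<lbrakk>b \<in> carrier B; b' \<in> carrier B; a \<in> carrier A\<rbrakk> \<Longrightarrow> R (pure K B A (b \<otimes>\<^bsub>B\<^esub> b') a) = p \<one>\<^bsub>A\<^esub> b \<otimes>\<^bsub>D\<^esub> R (pure K B A b' a)"
  using reg.\<tau>_ract[of b b' a] unfolding D_mult by simp

lemma R_mult_right:
  "\<lbrakk>b \<in> carrier B; a \<in> carrier A; a' \<in> carrier A\<rbrakk> \<Longrightarrow> R (pure K B A b (a \<otimes>\<^bsub>A\<^esub> a')) = R (pure K B A b a) \<otimes>\<^bsub>D\<^esub> p a' \<one>\<^bsub>B\<^esub>"
  using reg.\<tau>_mult[of b a a'] unfolding D_mult by simp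

lemma R_one: "b \<in> carrier B \<Longrightarrow> R (pure K B A b \<one>\<^bsub>A\<^esub>) = p \<one>\<^bsub>A\<^esub> b" "a \<in> carrier A \<Longrightarrow> R (pure K B A \<one>\<^bsub>B\<^esub> a) = p a \<one>\<^bsub>B\<^esub>"
  using R_twisting unfolding twisting_map_def by auto

lemma left_mult_eq:
  assumes a: "a \<in> carrier A" and x: "x \<in> carrier (tensor K A B)"
  shows "p a \<one>\<^bsub>B\<^esub> \<otimes>\<^bsub>D\<^esub> x = Lm a x"
  by (rule tensor_ext[OF mods(1,2) bilin_lin(1)[OF bilin_D_mult] lin_Lm[OF a] _ x])
    (simp_all add: closed a D_mult_pure R_one Lm_pure A_simps
      tensor_map_pure[OF bilin_lin(1)[OF A_mult a] bilin_lin(2)[OF B_mult]])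

lemma right_mult_eq:
  assumes b: "b \<in> carrier B" and x: "x \<in> carrier (tensor K A B)"
  shows "x \<otimes>\<^bsub>D\<^esub> p \<one>\<^bsub>A\<^esub> b = Rm b x"
  by (rule tensor_ext[OF mods(1,2) bilin_lin(2)[OF bilin_D_mult] lin_Rm[OF b] _ x])
    (simp_all add: closed b D_mult_pure R_one Rm_pure A_simps
      tensor_map_pure[OF bilin_lin(1)[OF A_mult] bilin_lin(2)[OF B_mult b]])

lemma pure_eq_mult: "\<lbrakk>a \<in> carrier A; b \<in> carrier B\<rbrakk> \<Longrightarrow> p a b = p a \<one>\<^bsub>B\<^esub> \<otimes>\<^bsub>D\<^esub> p \<one>\<^bsub>A\<^esub> b"
  by (simp add: left_mult_eq closed Lm_pure A_simps)

lemma D_mult_pure_factored: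
  assumes h: "a \<in> carrier A" "b \<in> carrier B" "a' \<in> carrier A" "b' \<in> carrier B"
  shows "p a b \<otimes>\<^bsub>D\<^esub> p a' b' = Rm b' (Lm a (R (pure K B A b a')))"
  unfolding D_mult_pure[OF h] using h
  by (intro tensor_map_compose[OF bilin_lin(1)[OF A_mult h(1)] lin_id[OF mods(1)] lin_id[OF mods(2)] bilin_lin(2)[OF B_mult h(4)], symmetric] closed)

end

context twisted_module
begin

interpretation alg: twisted_algebra K A B R
  by (rule twisted_algebra.intro[OF A_algebra B_algebra R_twisting])

text \<open>With the next lemma the core of associativity: either way of bracketing
  \<open>(1 \<otimes> f)(\<alpha> \<otimes> \<beta>)(\<alpha>' \<otimes> 1)\<close> yields \<open>\<tau>(f \<otimes> \<alpha>) R(\<beta> \<otimes> \<alpha>')\<close>. The lemma at hand uses the second axiom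
  of \<open>\<tau>\<close>, the next one the first.\<close>

lemma act_Rm_left:
  assumes "\<beta> \<in> carrier B" "\<alpha> \<in> carrier A" "v \<in> carrier V"
  shows "act (Rm \<beta> v) (pure K A B \<alpha> \<one>\<^bsub>B\<^esub>) = act v (R (pure K B A \<beta> \<alpha>))"
proof (rule tensor_ext[OF mods(1,3) lin_comp[OF bilin_lin(2)[OF bilin_act] lin_Rm] bilin_lin(2)[OF bilin_act] _ assms(3)])
  fix x g assume h: "x \<in> carrier A" "g \<in> carrier F"
  have "act (Rm \<beta> (pure K A F x g)) (pure K A B \<alpha> \<one>\<^bsub>B\<^esub>) = Lm x (act (pure K A F \<one>\<^bsub>A\<^esub> (g \<triangleleft>\<^bsub>F\<^esub> \<beta>)) (pure K A B \<alpha> \<one>\<^bsub>B\<^esub>))"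
    using h assms by (simp add: Rm_pure act_Lm[symmetric] closed Lm_pure A_simps)
  also have "\<dots> = Lm x (act (pure K A F \<one>\<^bsub>A\<^esub> g) (R (pure K B A \<beta> \<alpha>)))"
    using h assms by (simp add: act_generators closed \<tau>_ract)
  also have "\<dots> = act (pure K A F x g) (R (pure K B A \<beta> \<alpha>))"
    using h assms by (simp add: act_Lm[symmetric] closed Lm_pure A_simps)
  finally show "act (Rm \<beta> (pure K A F x g)) (pure K A B \<alpha> \<one>\<^bsub>B\<^esub>) = act (pure K A F x g) (R (pure K B A \<beta> \<alpha>))" .
qed (use assms in \<open>auto intro: closed\<close>)

lemma act_Lm_right:
  assumes f: "f \<in> carrier F" and \<alpha>: "\<alpha> \<in> carrier A" and t: "t \<in> carrier AB"
  shows "act (pure K A F \<one>\<^bsub>A\<^esub> f) (alg.Lm \<alpha> t) = act (\<tau> (pure K F A f \<alpha>)) t"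
proof (rule tensor_ext[OF mods(1,2) lin_comp[OF bilin_lin(1)[OF bilin_act] alg.lin_Lm] bilin_lin(1)[OF bilin_act] _ t])
  fix r s assume h: "r \<in> carrier A" "s \<in> carrier B"
  have p: "pure K A B x s = alg.Rm s (pure K A B x \<one>\<^bsub>B\<^esub>)" if "x \<in> carrier A" for x
    using that h by (simp add: alg.Rm_pure closed A_simps)
  have "act (pure K A F \<one>\<^bsub>A\<^esub> f) (alg.Lm \<alpha> (pure K A B r s)) = Rm s (\<tau> (pure K F A f (\<alpha> \<otimes>\<^bsub>A\<^esub> r)))"
  proof -
    have "alg.Lm \<alpha> (pure K A B r s) = alg.Rm s (pure K A B (\<alpha> \<otimes>\<^bsub>A\<^esub> r) \<one>\<^bsub>B\<^esub>)"
      using h \<alpha> by (simp add: alg.Lm_pure alg.Rm_pure closed A_simps)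
    then show ?thesis using h \<alpha> f by (simp add: closed act_Rm act_generators)
  qed
  also have "\<dots> = act (\<tau> (pure K F A f \<alpha>)) (pure K A B r s)"
    using h \<alpha> f by (simp add: \<tau>_mult act_Rm[symmetric] closed p)
  finally show "act (pure K A F \<one>\<^bsub>A\<^esub> f) (alg.Lm \<alpha> (pure K A B r s)) = act (\<tau> (pure K F A f \<alpha>)) (pure K A B r s)" .
qed (use f \<alpha> in \<open>auto intro: closed\<close>)

lemma act_assoc:
  assumes v: "v \<in> carrier V" and x: "x \<in> carrier AB" and y: "y \<in> carrier AB"
  shows "act v (x \<otimes>\<^bsub>twisted_tensor K A B R\<^esub> y) = act (act v x) y"
proof (rule tensor_ext[OF mods(1,3) bilin_lin(2)[OF bilin_act] lin_comp[OF bilin_lin(2)[OF bilin_act] bilin_lin(2)[OF bilin_act]] _ v])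
  fix a f assume h: "a \<in> carrier A" "f \<in> carrier F"
  note c = closed act_closed alg.closed
  have af: "pure K A F a f \<in> carrier V" using h by (intro c)
  show "act (pure K A F a f) (x \<otimes>\<^bsub>twisted_tensor K A B R\<^esub> y) = act (act (pure K A F a f) x) y"
  proof (rule tensor_ext2[OF mods(1,2,1,2) _ _ _ x y])
    show "bilin K AB AB V (\<lambda>x y. act (pure K A F a f) (x \<otimes>\<^bsub>twisted_tensor K A B R\<^esub> y))"
      by (rule bilin_lin_after[OF alg.bilin_D_mult bilin_lin(1)[OF bilin_act af]])
    show "bilin K AB AB V (\<lambda>x y. act (act (pure K A F a f) x) y)"
      by (rule bilin_comp[OF bilin_act bilin_lin(1)[OF bilin_act af] lin_id[OF mods(5)]])
    fix \<alpha> \<beta> \<alpha>' \<beta>' assume g: "\<alpha> \<in> carrier A" "\<beta> \<in> carrier B" "\<alpha>' \<in> carrier A" "\<beta>' \<in> carrier B"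
    have pp: "pure K A B x b = alg.Rm b (pure K A B x \<one>\<^bsub>B\<^esub>)" if "x \<in> carrier A" "b \<in> carrier B" for x b
      using that by (simp add: alg.Rm_pure closed A_simps)
    let ?f = "pure K A F \<one>\<^bsub>A\<^esub> f" and ?w = "\<tau> (pure K F A f \<alpha>)"
    have "act ?f (pure K A B \<alpha> \<beta> \<otimes>\<^bsub>twisted_tensor K A B R\<^esub> pure K A B \<alpha>' \<beta>') = Rm \<beta>' (act ?w (R (pure K B A \<beta> \<alpha>')))"
      using g h by (simp add: alg.D_mult_pure_factored act_Rm act_Lm_right c lin_closed[OF alg.lin_Lm])
    also have "\<dots> = Rm \<beta>' (act (Rm \<beta> ?w) (pure K A B \<alpha>' \<one>\<^bsub>B\<^esub>))"
      using g h by (simp add: act_Rm_left c)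
    also have "\<dots> = act (Rm \<beta> ?w) (pure K A B \<alpha>' \<beta>')"
      using g h by (simp add: pp[of \<alpha>' \<beta>'] act_Rm c lin_closed[OF lin_Rm])
    also have "Rm \<beta> ?w = act ?f (pure K A B \<alpha> \<beta>)"
      using g h by (simp add: pp[of \<alpha> \<beta>] act_Rm c act_generators)
    finally have *: "act ?f (pure K A B \<alpha> \<beta> \<otimes>\<^bsub>twisted_tensor K A B R\<^esub> pure K A B \<alpha>' \<beta>') = act (act ?f (pure K A B \<alpha> \<beta>)) (pure K A B \<alpha>' \<beta>')" .
    show "act (pure K A F a f) (pure K A B \<alpha> \<beta> \<otimes>\<^bsub>twisted_tensor K A B R\<^esub> pure K A B \<alpha>' \<beta>')
      = act (act (pure K A F a f) (pure K A B \<alpha> \<beta>)) (pure K A B \<alpha>' \<beta>')"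
      using g h by (simp add: pure_Lm[of a f] act_Lm c *)
  qed
qed (use x y in \<open>auto intro: closed act_closed alg.closed\<close>)

text \<open>The first axiom with \<open>a' = 1\<close> says that \<open>1 \<otimes> 1\<close> fixes the image of \<open>\<tau>\<close>. Surjectivity of \<open>\<tau>\<close>
  thus provides unitality, which the axioms of a module twisting map do not contain.\<close>

lemma act_one_of_surj:
  assumes surj: "\<And>v. v \<in> carrier V \<Longrightarrow> \<exists>t \<in> carrier (tensor K F A). \<tau> t = v" and v: "v \<in> carrier V"
  shows "act v (pure K A B \<one>\<^bsub>A\<^esub> \<one>\<^bsub>B\<^esub>) = v"
proof -
  obtain t where t: "t \<in> carrier (tensor K F A)" "\<tau> t = v" using surj[OF v] by blast
  have "act (\<tau> t) (pure K A B \<one>\<^bsub>A\<^esub> \<one>\<^bsub>B\<^esub>) = \<tau> t"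
    by (rule tensor_ext[OF mods(3,1) lin_comp[OF bilin_lin(2)[OF bilin_act] lin_\<tau>] lin_\<tau> _ t(1)])
      (simp_all add: closed \<tau>_mult[symmetric] A_simps)
  then show ?thesis using t by simp
qed

end

context twisted_algebra
begin

interpretation reg: twisted_module K A B R "regular_module B" R
  by (rule twisted_module_regular[OF A_algebra B_algebra R_twisting])

lemma bilin_D_iff: "bilin K D D D \<beta> \<longleftrightarrow> bilin K (tensor K A B) (tensor K A B) (tensor K A B) \<beta>"
  using module_D mods(3) unfolding bilin_def by (simp add: lin_D_iff D_simps)

lemma twisted_tensor_algebra: "k_algebra K D"
proof (rule k_algebraI[OF k_algebra_field[OF A_algebra]])
  show "bilin K D D D (\<lambda>x y. x \<otimes>\<^bsub>D\<^esub> y)" using bilin_D_mult by (simp add: bilin_D_iff)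
  show "\<one>\<^bsub>D\<^esub> \<in> carrier D" by (simp add: D_simps closed)
  fix x assume x: "x \<in> carrier D"
  show "\<one>\<^bsub>D\<^esub> \<otimes>\<^bsub>D\<^esub> x = x" using x
    by (simp add: D_simps left_mult_eq closed) (rule tensor_map_id[OF mods(1,2)]; simp add: A_simps)
  show "x \<otimes>\<^bsub>D\<^esub> \<one>\<^bsub>D\<^esub> = x" using x
    by (simp add: D_simps right_mult_eq closed) (rule tensor_map_id[OF mods(1,2)]; simp add: A_simps)
  fix y z assume "y \<in> carrier D" "z \<in> carrier D"
  then show "(x \<otimes>\<^bsub>D\<^esub> y) \<otimes>\<^bsub>D\<^esub> z = x \<otimes>\<^bsub>D\<^esub> (y \<otimes>\<^bsub>D\<^esub> z)"
    using x reg.act_assoc[of x y z] by (simp add: D_simps D_mult)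
qed

end

text \<open>The right action \<open>(e \<otimes> b)(\<alpha> \<otimes> \<beta>) = e \<alpha>\<^sub>R \<otimes> b\<^sub>R \<beta>\<close> on \<open>E \<otimes> B\<close>. This is the module
  \<open>E \<otimes>\<^sub>A (A \<otimes>\<^sub>R B)\<close>, with \<open>inc e\<close> below in the role of \<open>x \<mapsto> e \<otimes> x\<close>; hence its properties follow from those
  of the product of \<open>A \<otimes>\<^sub>R B\<close>.\<close>

definition induced_act ::
  "('k, 'c) ring_scheme \<Rightarrow> ('k, 'b, 's) module_scheme \<Rightarrow> (('k, 'b, 'a) tens \<Rightarrow> ('k, 'a, 'b) tens) \<Rightarrow>
   ('k, 'a, 'r) module_scheme \<Rightarrow> ('k, 'e, 'a) right_module \<Rightarrow> ('k, 'e, 'b) tens \<Rightarrow> ('k, 'a, 'b) tens \<Rightarrow> ('k, 'e, 'b) tens"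
  where "induced_act K B R A E u y = tensor_lift K (tensor K E B)
    (\<lambda>e b. tensor_lift K (tensor K E B)
      (\<lambda>\<alpha> \<beta>. tensor_map K E B (\<lambda>x. e \<triangleleft>\<^bsub>E\<^esub> x) (\<lambda>g. g \<otimes>\<^bsub>B\<^esub> \<beta>) (R (pure K B A b \<alpha>))) y) u"

locale induced_module = twisted_algebra K A B R
  for K :: "('k, 'c) ring_scheme" and A :: "('k, 'a, 'r) module_scheme" and B :: "('k, 'b, 's) module_scheme"
    and R :: "('k, 'b, 'a) tens \<Rightarrow> ('k, 'a, 'b) tens" +
  fixes E :: "('k, 'e, 'a) right_module"
  assumes E_module: "right_module K A E"
begin

abbreviation "U \<equiv> tensor K E B"
abbreviation "eact \<equiv> induced_act K B R A E"
abbreviation "inc e \<equiv> tensor_map K E B (\<lambda>x. e \<triangleleft>\<^bsub>E\<^esub> x) (\<lambda>g. g)"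

lemma E_mod: "module K E" by (rule right_module_module[OF E_module])
lemma U_mod: "module K U" by (rule module_tensor[OF E_mod mods(2)])
lemmas E_act = right_module_bilin[OF E_module]
lemmas U_pure = bilin_pure[OF E_mod mods(2)]

lemma bilin_inc: "bilin K E (tensor K A B) U inc"
  by (intro bilinI E_mod mods U_mod lin_tensor_map[OF bilin_lin(1)[OF E_act] lin_id[OF mods(2)]]
      lin_tensor_map_param_left[OF lin_id[OF mods(2)] E_act])

lemma inc_pure: "\<lbrakk>e \<in> carrier E; a \<in> carrier A; b \<in> carrier B\<rbrakk> \<Longrightarrow> inc e (p a b) = pure K E B (e \<triangleleft>\<^bsub>E\<^esub> a) b"
  by (rule tensor_map_pure[OF bilin_lin(1)[OF E_act] lin_id[OF mods(2)]])

lemma bilin_inner_E: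
  assumes e: "e \<in> carrier E" and b: "b \<in> carrier B"
  shows "bilin K A B U (\<lambda>\<alpha> \<beta>. tensor_map K E B (\<lambda>x. e \<triangleleft>\<^bsub>E\<^esub> x) (\<lambda>g. g \<otimes>\<^bsub>B\<^esub> \<beta>) (R (pure K B A b \<alpha>)))"
proof (rule bilinI[OF mods(1,2) U_mod])
  fix \<alpha> assume "\<alpha> \<in> carrier A"
  then show "lin K B U (\<lambda>\<beta>. tensor_map K E B (\<lambda>x. e \<triangleleft>\<^bsub>E\<^esub> x) (\<lambda>g. g \<otimes>\<^bsub>B\<^esub> \<beta>) (R (pure K B A b \<alpha>)))"
    using b by (intro lin_tensor_map_param_right[OF bilin_lin(1)[OF E_act e] bilin_flip[OF B_mult]] closed)
next
  fix \<beta> assume "\<beta> \<in> carrier B"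
  then show "lin K A U (\<lambda>\<alpha>. tensor_map K E B (\<lambda>x. e \<triangleleft>\<^bsub>E\<^esub> x) (\<lambda>g. g \<otimes>\<^bsub>B\<^esub> \<beta>) (R (pure K B A b \<alpha>)))"
    by (intro lin_comp[OF lin_tensor_map[OF bilin_lin(1)[OF E_act e] bilin_lin(2)[OF B_mult]] lin_comp[OF lin_R bilin_lin(1)[OF BA_pure b]]])
qed

lemma inner_E:
  assumes e: "e \<in> carrier E" and b: "b \<in> carrier B" and y: "y \<in> carrier (tensor K A B)"
  shows "tensor_lift K U (\<lambda>\<alpha> \<beta>. tensor_map K E B (\<lambda>x. e \<triangleleft>\<^bsub>E\<^esub> x) (\<lambda>g. g \<otimes>\<^bsub>B\<^esub> \<beta>) (R (pure K B A b \<alpha>))) y = inc e (p \<one>\<^bsub>A\<^esub> b \<otimes>\<^bsub>D\<^esub> y)"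
proof (rule tensor_ext[OF mods(1,2) lin_tensor_lift[OF mods(1,2) bilin_inner_E[OF e b]]
      lin_comp[OF bilin_lin(1)[OF bilin_inc e] bilin_lin(1)[OF bilin_D_mult]] _ y])
  show "p \<one>\<^bsub>A\<^esub> b \<in> carrier (tensor K A B)" using b by (intro closed)
  fix \<alpha> \<beta> assume h: "\<alpha> \<in> carrier A" "\<beta> \<in> carrier B"
  have "inc e (p \<one>\<^bsub>A\<^esub> b \<otimes>\<^bsub>D\<^esub> p \<alpha> \<beta>) = tensor_map K E B (\<lambda>x. e \<triangleleft>\<^bsub>E\<^esub> (\<one>\<^bsub>A\<^esub> \<otimes>\<^bsub>A\<^esub> x)) (\<lambda>g. g \<otimes>\<^bsub>B\<^esub> \<beta>) (R (pure K B A b \<alpha>))"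
    using h b unfolding D_mult_pure[OF closed(1) b h]
    by (intro tensor_map_compose[OF bilin_lin(1)[OF A_mult closed(1)] bilin_lin(1)[OF E_act e] bilin_lin(2)[OF B_mult h(2)] lin_id[OF mods(2)]] closed)
  also have "\<dots> = tensor_map K E B (\<lambda>x. e \<triangleleft>\<^bsub>E\<^esub> x) (\<lambda>g. g \<otimes>\<^bsub>B\<^esub> \<beta>) (R (pure K B A b \<alpha>))"
    using h b by (intro tensor_map_cong[OF lin_comp[OF bilin_lin(1)[OF E_act e] bilin_lin(1)[OF A_mult closed(1)]] bilin_lin(2)[OF B_mult h(2)]] closed)
      (simp_all add: A_simps)
  finally show "tensor_lift K U (\<lambda>\<alpha> \<beta>. tensor_map K E B (\<lambda>x. e \<triangleleft>\<^bsub>E\<^esub> x) (\<lambda>g. g \<otimes>\<^bsub>B\<^esub> \<beta>) (R (pure K B A b \<alpha>))) (p \<alpha> \<beta>) = inc e (p \<one>\<^bsub>A\<^esub> b \<otimes>\<^bsub>D\<^esub> p \<alpha> \<beta>)"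
    using h by (simp add: tensor_lift_pure[OF mods(1,2) bilin_inner_E[OF e b]])
qed

lemma bilin_outer_E:
  assumes y: "y \<in> carrier (tensor K A B)"
  shows "bilin K E B U (\<lambda>e b. tensor_lift K U
      (\<lambda>\<alpha> \<beta>. tensor_map K E B (\<lambda>x. e \<triangleleft>\<^bsub>E\<^esub> x) (\<lambda>g. g \<otimes>\<^bsub>B\<^esub> \<beta>) (R (pure K B A b \<alpha>))) y)"
proof (rule bilinI[OF E_mod mods(2) U_mod])
  fix e assume e: "e \<in> carrier E"
  show "lin K B U (\<lambda>b. tensor_lift K U
      (\<lambda>\<alpha> \<beta>. tensor_map K E B (\<lambda>x. e \<triangleleft>\<^bsub>E\<^esub> x) (\<lambda>g. g \<otimes>\<^bsub>B\<^esub> \<beta>) (R (pure K B A b \<alpha>))) y)"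
    by (rule lin_cong[OF lin_comp[OF bilin_lin(1)[OF bilin_inc e] lin_comp[OF bilin_lin(2)[OF bilin_D_mult y] bilin_lin(1)[OF p_bilin closed(1)]]]])
      (rule inner_E[OF e _ y])
next
  fix b assume b: "b \<in> carrier B"
  show "lin K E U (\<lambda>e. tensor_lift K U
      (\<lambda>\<alpha> \<beta>. tensor_map K E B (\<lambda>x. e \<triangleleft>\<^bsub>E\<^esub> x) (\<lambda>g. g \<otimes>\<^bsub>B\<^esub> \<beta>) (R (pure K B A b \<alpha>))) y)"
    by (rule lin_cong[OF bilin_lin(2)[OF bilin_inc, of "p \<one>\<^bsub>A\<^esub> b \<otimes>\<^bsub>D\<^esub> y"]], intro closed b y) (rule inner_E[OF _ b y])
qed

lemma eact_pure:
  assumes "e \<in> carrier E" "b \<in> carrier B" "y \<in> carrier (tensor K A B)"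
  shows "eact (pure K E B e b) y = inc e (p \<one>\<^bsub>A\<^esub> b \<otimes>\<^bsub>D\<^esub> y)"
  unfolding induced_act_def
  by (simp add: tensor_lift_pure[OF E_mod mods(2) bilin_outer_E[OF assms(3)] assms(1,2)] inner_E[OF assms])

lemma bilin_eact: "bilin K U (tensor K A B) U eact"
proof (rule bilinI[OF U_mod mods(3) U_mod])
  fix y assume y: "y \<in> carrier (tensor K A B)"
  show "lin K U U (\<lambda>u. eact u y)" unfolding induced_act_def
    by (rule lin_tensor_lift[OF E_mod mods(2) bilin_outer_E[OF y]])
next
  fix u assume u: "u \<in> carrier U"
  show "lin K (tensor K A B) U (\<lambda>y. eact u y)" unfolding induced_act_def
    by (rule lin_tensor_lift_param[OF E_mod mods(2,3) U_mod u bilin_outer_E], assumption)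
      (rule lin_tensor_lift[OF mods(1,2) bilin_inner_E])
qed

lemma eact_inc:
  assumes e: "e \<in> carrier E" and x: "x \<in> carrier (tensor K A B)" and y: "y \<in> carrier (tensor K A B)"
  shows "eact (inc e x) y = inc e (x \<otimes>\<^bsub>D\<^esub> y)"
proof (rule tensor_ext[OF mods(1,2) lin_comp[OF bilin_lin(2)[OF bilin_eact y] bilin_lin(1)[OF bilin_inc e]]
      lin_comp[OF bilin_lin(1)[OF bilin_inc e] bilin_lin(2)[OF bilin_D_mult y]] _ x])
  fix a b assume h: "a \<in> carrier A" "b \<in> carrier B"
  let ?z = "p \<one>\<^bsub>A\<^esub> b \<otimes>\<^bsub>D\<^esub> y"
  have z: "?z \<in> carrier (tensor K A B)" using h y by (intro closed)
  have "inc e (p a b \<otimes>\<^bsub>D\<^esub> y) = inc e (Lm a ?z)"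
    using h y by (simp add: D_mult_Lm[symmetric] closed Lm_pure A_simps)
  also have "\<dots> = tensor_map K E B (\<lambda>x. e \<triangleleft>\<^bsub>E\<^esub> (a \<otimes>\<^bsub>A\<^esub> x)) (\<lambda>g. g) ?z"
    by (rule tensor_map_compose[OF bilin_lin(1)[OF A_mult h(1)] bilin_lin(1)[OF E_act e] lin_id[OF mods(2)] lin_id[OF mods(2)] z])
  also have "\<dots> = inc (e \<triangleleft>\<^bsub>E\<^esub> a) ?z"
    using h e by (intro tensor_map_cong[OF lin_comp[OF bilin_lin(1)[OF E_act e] bilin_lin(1)[OF A_mult h(1)]] lin_id[OF mods(2)] _ _ z])
      (simp_all add: right_module_mult[OF E_module])
  finally show "eact (inc e (p a b)) y = inc e (p a b \<otimes>\<^bsub>D\<^esub> y)"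
    using h e y by (simp add: inc_pure eact_pure bilin_closed[OF E_act])
qed

lemma pure_inc: "\<lbrakk>e \<in> carrier E; b \<in> carrier B\<rbrakk> \<Longrightarrow> pure K E B e b = inc e (p \<one>\<^bsub>A\<^esub> b)"
  by (simp add: inc_pure closed right_module_one[OF E_module])

lemma eact_assoc:
  assumes u: "u \<in> carrier U" and x: "x \<in> carrier (tensor K A B)" and y: "y \<in> carrier (tensor K A B)"
  shows "eact u (x \<otimes>\<^bsub>D\<^esub> y) = eact (eact u x) y"
proof -
  have ring: "ring D" by (rule k_algebra_ring[OF twisted_tensor_algebra])
  have xy: "x \<otimes>\<^bsub>D\<^esub> y \<in> carrier (tensor K A B)" using x y by (intro closed)
  show ?thesis
  proof (rule tensor_ext[OF E_mod mods(2) bilin_lin(2)[OF bilin_eact xy]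
        lin_comp[OF bilin_lin(2)[OF bilin_eact y] bilin_lin(2)[OF bilin_eact x]] _ u])
    fix e b assume h: "e \<in> carrier E" "b \<in> carrier B"
    have "p \<one>\<^bsub>A\<^esub> b \<otimes>\<^bsub>D\<^esub> (x \<otimes>\<^bsub>D\<^esub> y) = (p \<one>\<^bsub>A\<^esub> b \<otimes>\<^bsub>D\<^esub> x) \<otimes>\<^bsub>D\<^esub> y"
      using monoid.m_assoc[OF ring.is_monoid[OF ring], of "p \<one>\<^bsub>A\<^esub> b" x y] h x y by (simp add: D_simps closed)
    then show "eact (pure K E B e b) (x \<otimes>\<^bsub>D\<^esub> y) = eact (eact (pure K E B e b) x) y"
      using h x y by (simp add: eact_pure eact_inc closed)
  qed
qed

lemma eact_one:
  assumes u: "u \<in> carrier U" shows "eact u (p \<one>\<^bsub>A\<^esub> \<one>\<^bsub>B\<^esub>) = u"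
proof (rule tensor_ext[OF E_mod mods(2) bilin_lin(2)[OF bilin_eact] lin_id[OF U_mod] _ u])
  show "p \<one>\<^bsub>A\<^esub> \<one>\<^bsub>B\<^esub> \<in> carrier (tensor K A B)" by (intro closed)
  fix e b assume h: "e \<in> carrier E" "b \<in> carrier B"
  then show "eact (pure K E B e b) (p \<one>\<^bsub>A\<^esub> \<one>\<^bsub>B\<^esub>) = pure K E B e b"
    by (simp add: eact_pure closed right_mult_eq Rm_pure A_simps pure_inc[symmetric])
qed

end

section \<open>Graded spaces\<close>

context
  fixes K :: "('k, 'c) ring_scheme" and C :: "('k, 'd, 'w) calculus"
  assumes W: "module K (forms C)" and H: "\<And>n. submodule (homogeneous C n) K (forms C)"
begin

interpretation W: module K "forms C" by (rule W)

lemma homogeneous_closed: "x \<in> homogeneous C n \<Longrightarrow> x \<in> carrier (forms C)"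
  using submodule_facts(1)[OF H] by blast

lemma decomposition_superset:
  assumes d: "decomposition C \<omega> s" and Z: "finite Z" "{n. s n \<noteq> \<zero>\<^bsub>forms C\<^esub>} \<subseteq> Z"
  shows "\<omega> = (\<Oplus>\<^bsub>forms C\<^esub>n\<in>Z. s n)"
proof -
  have "(\<Oplus>\<^bsub>forms C\<^esub>n\<in>{n. s n \<noteq> \<zero>\<^bsub>forms C\<^esub>}. s n) = (\<Oplus>\<^bsub>forms C\<^esub>n\<in>Z. s n)"
    using Z d homogeneous_closed unfolding decomposition_def
    by (intro W.add.finprod_mono_neutral_cong_left) auto
  then show ?thesis using d unfolding decomposition_def by simp
qed

lemma decompositionI:
  assumes s: "\<And>n. s n \<in> homogeneous C n" and Z: "finite Z" "\<And>n. n \<notin> Z \<Longrightarrow> s n = \<zero>\<^bsub>forms C\<^esub>"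
    and w: "\<omega> = (\<Oplus>\<^bsub>forms C\<^esub>n\<in>Z. s n)"
  shows "decomposition C \<omega> s"
proof -
  have sub: "{n. s n \<noteq> \<zero>\<^bsub>forms C\<^esub>} \<subseteq> Z" using Z by blast
  have "(\<Oplus>\<^bsub>forms C\<^esub>n\<in>{n. s n \<noteq> \<zero>\<^bsub>forms C\<^esub>}. s n) = (\<Oplus>\<^bsub>forms C\<^esub>n\<in>Z. s n)"
    using Z(1) sub s homogeneous_closed
    by (intro W.add.finprod_mono_neutral_cong_left) auto
  then show ?thesis using s w finite_subset[OF sub Z(1)] unfolding decomposition_def by simp
qed

lemma decomposition_add:
  assumes d: "decomposition C \<omega> s" "decomposition C \<psi> t"
  shows "decomposition C (\<omega> \<oplus>\<^bsub>forms C\<^esub> \<psi>) (\<lambda>n. s n \<oplus>\<^bsub>forms C\<^esub> t n)"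
proof -
  let ?Z = "{n. s n \<noteq> \<zero>\<^bsub>forms C\<^esub>} \<union> {n. t n \<noteq> \<zero>\<^bsub>forms C\<^esub>}"
  have Z: "finite ?Z" and st: "\<And>n. s n \<in> homogeneous C n" "\<And>n. t n \<in> homogeneous C n"
    using d unfolding decomposition_def by auto
  show ?thesis
  proof (rule decompositionI[OF _ Z])
    show "\<omega> \<oplus>\<^bsub>forms C\<^esub> \<psi> = (\<Oplus>\<^bsub>forms C\<^esub>n\<in>?Z. s n \<oplus>\<^bsub>forms C\<^esub> t n)"
      using decomposition_superset[OF d(1) Z] decomposition_superset[OF d(2) Z] homogeneous_closed[OF st(1)] homogeneous_closed[OF st(2)]
      by (simp add: W.finsum_addf Pi_def)
  qed (use st submodule_facts(3)[OF H] in auto)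
qed

lemma decomposition_smult:
  assumes d: "decomposition C \<omega> s" and c: "c \<in> carrier K"
  shows "decomposition C (c \<odot>\<^bsub>forms C\<^esub> \<omega>) (\<lambda>n. c \<odot>\<^bsub>forms C\<^esub> s n)"
proof -
  let ?Z = "{n. s n \<noteq> \<zero>\<^bsub>forms C\<^esub>}"
  have Z: "finite ?Z" and st: "\<And>n. s n \<in> homogeneous C n"
    using d unfolding decomposition_def by auto
  show ?thesis
  proof (rule decompositionI[OF _ Z])
    show "c \<odot>\<^bsub>forms C\<^esub> \<omega> = (\<Oplus>\<^bsub>forms C\<^esub>n\<in>?Z. c \<odot>\<^bsub>forms C\<^esub> s n)"
      using decomposition_superset[OF d Z order_refl] homogeneous_closed[OF st] c Z
      by (simp add: W.finsum_smult_ldistr Pi_def)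
  qed (use st c submodule_facts(4)[OF H] in auto)
qed

lemma decomposition_homogeneous:
  assumes "x \<in> homogeneous C m"
  shows "decomposition C x (\<lambda>n. if n = m then x else \<zero>\<^bsub>forms C\<^esub>)"
  by (rule decompositionI[of _ "{m}"])
    (use assms submodule_facts(2)[OF H] homogeneous_closed[OF assms] in auto)

lemma ex_decomposition:
  assumes g: "\<And>N. \<lbrakk>submodule N K (forms C); \<And>n. homogeneous C n \<subseteq> N\<rbrakk> \<Longrightarrow> x \<in> N"
  shows "\<exists>s. decomposition C x s"
proof -
  let ?N = "{x \<in> carrier (forms C). \<exists>s. decomposition C x s}"
  have "submodule ?N K (forms C)"
  proof (rule submodule_intro[OF W])
    show "\<zero>\<^bsub>forms C\<^esub> \<in> ?N"
      using decomposition_homogeneous[OF submodule_facts(2)[OF H]] by (auto simp: W.zero_closed)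
  qed (auto intro: decomposition_add decomposition_smult)
  moreover have "homogeneous C n \<subseteq> ?N" for n
    using decomposition_homogeneous homogeneous_closed by blast
  ultimately have "x \<in> ?N" by (rule g)
  then show ?thesis by simp
qed

lemma decomposition_unique:
  assumes \<pi>: "\<And>n. lin K (forms C) (forms C) (\<pi> n)"
    and \<pi>H: "\<And>n x. x \<in> homogeneous C n \<Longrightarrow> \<pi> n x = x"
    and \<pi>0: "\<And>m n x. \<lbrakk>x \<in> homogeneous C m; m \<noteq> n\<rbrakk> \<Longrightarrow> \<pi> n x = \<zero>\<^bsub>forms C\<^esub>"
    and d: "decomposition C \<omega> s"
  shows "s = (\<lambda>n. \<pi> n \<omega>)"
proof
  fix n
  let ?Z = "insert n {n. s n \<noteq> \<zero>\<^bsub>forms C\<^esub>}"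
  have Z: "finite ?Z" and s: "\<And>n. s n \<in> homogeneous C n" using d unfolding decomposition_def by auto
  have "\<pi> n \<omega> = (\<Oplus>\<^bsub>forms C\<^esub>m\<in>?Z. \<pi> n (s m))"
    unfolding decomposition_superset[OF d Z subset_insertI] by (rule lin_finsum[OF \<pi> Z homogeneous_closed[OF s]])
  also have "\<dots> = (\<Oplus>\<^bsub>forms C\<^esub>m\<in>?Z. if n = m then s m else \<zero>\<^bsub>forms C\<^esub>)"
    using \<pi>H[OF s] \<pi>0[OF s] homogeneous_closed[OF s] by (intro W.finsum_cong') auto
  also have "\<dots> = s n"
    using Z homogeneous_closed[OF s] by (intro W.finsum_singleton) auto
  finally show "s n = \<pi> n \<omega>" by simp
qed

end

section \<open>Differential calculi\<close>

context differential_calculus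
begin

lemma W_module: "module K (forms C)" by (rule W.module_axioms)

lemmas W_mult = k_algebra_bilin[OF W.k_algebra_axioms]

lemmas H_closed = homogeneous_closed[OF W_module homogeneous_submodule]

definition component where
  "component n \<omega> = (THE s. decomposition C \<omega> s) n"

lemma component_decomposition:
  "\<omega> \<in> carrier (forms C) \<Longrightarrow> decomposition C \<omega> (\<lambda>n. component n \<omega>)"
  unfolding component_def using theI'[OF direct_sum] by simp

lemma component_eq:
  assumes "\<omega> \<in> carrier (forms C)" "decomposition C \<omega> s" shows "component n \<omega> = s n"
proof -
  have "(THE s. decomposition C \<omega> s) = s"
  proof (rule the_equality[where P = "\<lambda>s. decomposition C \<omega> s"])
    fix u assume u: "decomposition C \<omega> u"
    show "u = s"
      using direct_sum[OF assms(1)]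
    proof (rule ex1E)
      fix t assume t: "\<forall>y. decomposition C \<omega> y \<longrightarrow> y = t"
      show "u = s" using mp[OF spec[OF t] u] mp[OF spec[OF t] assms(2)] by simp
    qed
  qed (rule assms(2))
  then show ?thesis unfolding component_def by simp
qed

lemma component_homogeneous: "\<omega> \<in> carrier (forms C) \<Longrightarrow> component n \<omega> \<in> homogeneous C n"
  using component_decomposition unfolding decomposition_def by blast

lemma component_of_homogeneous:
  "x \<in> homogeneous C m \<Longrightarrow> component n x = (if n = m then x else \<zero>\<^bsub>forms C\<^esub>)"
  by (rule component_eq[OF H_closed decomposition_homogeneous[OF W_module homogeneous_submodule]])

lemma lin_component: "lin K (forms C) (forms C) (component n)"
proof (rule linI[OF W_module W_module])
  fix x assume x: "x \<in> carrier (forms C)"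
  show "component n x \<in> carrier (forms C)" using component_homogeneous[OF x] H_closed by blast
  show "component n (x \<oplus>\<^bsub>forms C\<^esub> y) = component n x \<oplus>\<^bsub>forms C\<^esub> component n y" if "y \<in> carrier (forms C)" for y
    using x that by (intro component_eq decomposition_add[OF W_module homogeneous_submodule] component_decomposition) auto
  show "component n (c \<odot>\<^bsub>forms C\<^esub> x) = c \<odot>\<^bsub>forms C\<^esub> component n x" if "c \<in> carrier K" for c
    using x that by (intro component_eq decomposition_smult[OF W_module homogeneous_submodule] component_decomposition) auto
qed

lemma homogeneous_generated:
  assumes "submodule N K (forms C)" "\<And>n x. x \<in> homogeneous C n \<Longrightarrow> x \<in> N" "x \<in> carrier (forms C)"
  shows "x \<in> N"
proof -
  have d: "decomposition C x (\<lambda>n. component n x)" by (rule component_decomposition[OF assms(3)])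
  then have "x = (\<Oplus>\<^bsub>forms C\<^esub>n\<in>{n. component n x \<noteq> \<zero>\<^bsub>forms C\<^esub>}. component n x)" "finite {n. component n x \<noteq> \<zero>\<^bsub>forms C\<^esub>}"
    unfolding decomposition_def by auto
  then show ?thesis
    using submodule_finsum[OF W_module assms(1), of "{n. component n x \<noteq> \<zero>\<^bsub>forms C\<^esub>}" "\<lambda>n. component n x"]
      assms(2)[OF component_homogeneous[OF assms(3)]] by simp
qed

lemma homogeneous_ext:
  assumes "lin K (forms C) U f" "lin K (forms C) U g" "\<And>n x. x \<in> homogeneous C n \<Longrightarrow> f x = g x" "x \<in> carrier (forms C)"
  shows "f x = g x"
  using homogeneous_generated[OF submodule_equalizer[OF assms(1,2)] _ assms(4)] assms(3) H_closed by blast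

lemma lin_signed: "lin K (forms C) (forms C) (signed C n)"
  unfolding signed_def[abs_def] using lin_id[OF W_module] lin_uminus[OF lin_id[OF W_module]] by (cases "even n") simp_all

lemma parity_superset:
  assumes x: "x \<in> carrier (forms C)" and Z: "finite Z" "{n. component n x \<noteq> \<zero>\<^bsub>forms C\<^esub>} \<subseteq> Z"
  shows "parity C x = (\<Oplus>\<^bsub>forms C\<^esub>n\<in>Z. signed C n (component n x))"
proof -
  have "(\<Oplus>\<^bsub>forms C\<^esub>n\<in>{n. component n x \<noteq> \<zero>\<^bsub>forms C\<^esub>}. signed C n (component n x)) = (\<Oplus>\<^bsub>forms C\<^esub>n\<in>Z. signed C n (component n x))"
    using Z lin_closed[OF lin_signed lin_closed[OF lin_component x]] lin_zero[OF lin_signed]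
    by (intro W.add.finprod_mono_neutral_cong_left) auto
  then show ?thesis unfolding parity_def component_def Let_def .
qed

lemma finite_components: "x \<in> carrier (forms C) \<Longrightarrow> finite {n. component n x \<noteq> \<zero>\<^bsub>forms C\<^esub>}"
  using component_decomposition unfolding decomposition_def by blast

lemma lin_parity: "lin K (forms C) (forms C) (parity C)"
proof (rule linI[OF W_module W_module])
  note c = lin_closed[OF lin_signed lin_closed[OF lin_component]]
  let ?Z = "\<lambda>x. {n. component n x \<noteq> \<zero>\<^bsub>forms C\<^esub>}"
  fix x assume x: "x \<in> carrier (forms C)"
  show "parity C x \<in> carrier (forms C)"
    using parity_superset[OF x finite_components[OF x] order_refl] c[OF x] by (auto intro!: W.finsum_closed)
  show "parity C (x \<oplus>\<^bsub>forms C\<^esub> y) = parity C x \<oplus>\<^bsub>forms C\<^esub> parity C y" if y: "y \<in> carrier (forms C)" for y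
  proof -
    let ?Y = "?Z x \<union> ?Z y"
    have f: "finite ?Y" using finite_components x y by auto
    have Y: "?Z (x \<oplus>\<^bsub>forms C\<^esub> y) \<subseteq> ?Y" using x y by (auto simp: lin_add[OF lin_component])
    have "parity C (x \<oplus>\<^bsub>forms C\<^esub> y) = (\<Oplus>\<^bsub>forms C\<^esub>n\<in>?Y. signed C n (component n x) \<oplus>\<^bsub>forms C\<^esub> signed C n (component n y))"
      unfolding parity_superset[OF module_closed(2)[OF W_module x y] f Y] using x y c
      by (intro W.finsum_cong') (auto simp: lin_add[OF lin_component] lin_add[OF lin_signed] lin_closed[OF lin_component])
    also have "\<dots> = parity C x \<oplus>\<^bsub>forms C\<^esub> parity C y"
      using x y c f by (simp add: parity_superset[OF x f] parity_superset[OF y f] W.finsum_addf Pi_def)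
    finally show ?thesis .
  qed
  show "parity C (a \<odot>\<^bsub>forms C\<^esub> x) = a \<odot>\<^bsub>forms C\<^esub> parity C x" if a: "a \<in> carrier K" for a
  proof -
    have f: "finite (?Z x)" using finite_components x by auto
    have Y: "?Z (a \<odot>\<^bsub>forms C\<^esub> x) \<subseteq> ?Z x" using x a by (auto simp: lin_smult[OF lin_component])
    have "parity C (a \<odot>\<^bsub>forms C\<^esub> x) = (\<Oplus>\<^bsub>forms C\<^esub>n\<in>?Z x. a \<odot>\<^bsub>forms C\<^esub> signed C n (component n x))"
      unfolding parity_superset[OF module_closed(5)[OF W_module a x] f Y] using x a c
      by (intro W.finsum_cong') (auto simp: lin_smult[OF lin_component] lin_smult[OF lin_signed] lin_closed[OF lin_component])
    also have "\<dots> = a \<odot>\<^bsub>forms C\<^esub> parity C x"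
      using x a c f by (simp add: parity_superset[OF x f] W.finsum_smult_ldistr Pi_def)
    finally show ?thesis .
  qed
qed

lemma parity_homogeneous:
  assumes "x \<in> homogeneous C n" shows "parity C x = signed C n x"
proof -
  have "parity C x = (\<Oplus>\<^bsub>forms C\<^esub>m\<in>{n}. signed C m (component m x))"
    using assms by (intro parity_superset H_closed) (auto simp: component_of_homogeneous)
  then show ?thesis using lin_closed[OF lin_signed H_closed[OF assms]] by (simp add: component_of_homogeneous[OF assms])
qed

text \<open>The span of the union of the \<open>G n\<close> contains degree zero and is closed under products and the
  differential, so it is everything; taking components of degree \<open>n\<close> then gives \<open>G n\<close> back. This turns the
  axiom that a calculus is generated in degree zero into an induction principle in each degree.\<close>

lemma graded_induct:
  assumes G: "\<And>n. submodule (G n) K (forms C)" "\<And>n. G n \<subseteq> homogeneous C n"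
    and e: "\<And>a. a \<in> carrier D \<Longrightarrow> embed C a \<in> G 0"
    and m: "\<And>p q x y. \<lbrakk>x \<in> G p; y \<in> G q\<rbrakk> \<Longrightarrow> x \<otimes>\<^bsub>forms C\<^esub> y \<in> G (p + q)"
    and d: "\<And>p x. x \<in> G p \<Longrightarrow> differential C x \<in> G (Suc p)"
    and x: "x \<in> homogeneous C n"
  shows "x \<in> G n"
proof -
  let ?U = "\<Union>n. G n"
  let ?S = "lin_span K (forms C) ?U"
  have U: "?U \<subseteq> carrier (forms C)" using G(2) H_closed by blast
  have S: "submodule ?S K (forms C)" by (rule lin_span_submodule[OF W_module U])
  have GS: "G n \<subseteq> ?S" for n using lin_span_superset[of ?U K "forms C"] by blast
  have dl: "lin K (forms C) (forms C) (differential C)"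
    using differential_linear W_module unfolding lin_def by simp
  have "?S = carrier (forms C)"
  proof (rule generated[OF S])
    show "embed C ` carrier D \<subseteq> ?S" using e GS by blast
    show "\<phi> \<otimes>\<^bsub>forms C\<^esub> \<psi> \<in> ?S" if "\<phi> \<in> ?S" "\<psi> \<in> ?S" for \<phi> \<psi>
      by (rule bilin_maps_span[OF W_mult S U U _ that]) (use m GS in blast)
    show "differential C \<phi> \<in> ?S" if "\<phi> \<in> ?S" for \<phi>
      by (rule lin_maps_span[OF dl S U _ that]) (use d GS in blast)
  qed
  then have xS: "x \<in> ?S" using x H_closed by simp
  have "component n x \<in> G n"
  proof (rule lin_maps_span[OF lin_component G(1) U _ xS])
    fix y assume "y \<in> ?U"
    then obtain k where "y \<in> G k" by blast
    moreover from this have "y \<in> homogeneous C k" using G(2) by blast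
    ultimately show "component n y \<in> G n"
      using component_of_homogeneous[of y k n] submodule_facts(2)[OF G(1)[of n]] by (cases "n = k") simp_all
  qed
  then show ?thesis using component_of_homogeneous[OF x, of n] by simp
qed

lemma embed_facts:
  "lin K D (forms C) (embed C)"
  "a \<in> carrier D \<Longrightarrow> embed C a \<in> homogeneous C 0"
  "a \<in> carrier D \<Longrightarrow> embed C a \<in> carrier (forms C)"
  "\<lbrakk>a \<in> carrier D; b \<in> carrier D\<rbrakk> \<Longrightarrow> embed C (a \<otimes>\<^bsub>D\<^esub> b) = embed C a \<otimes>\<^bsub>forms C\<^esub> embed C b"
  "embed C \<one>\<^bsub>D\<^esub> = \<one>\<^bsub>forms C\<^esub>"
  "homogeneous C 0 = embed C ` carrier D"
proof -
  show "lin K D (forms C) (embed C)"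
    using embed_linear W_module D.module_axioms unfolding lin_def by simp
  show "a \<in> carrier D \<Longrightarrow> embed C a \<in> homogeneous C 0" "homogeneous C 0 = embed C ` carrier D"
    using embed_bij unfolding bij_betw_def by auto
  then show "a \<in> carrier D \<Longrightarrow> embed C a \<in> carrier (forms C)" using H_closed by blast
qed (use embed_hom in \<open>auto simp: ring_hom_def\<close>)

lemma lin_differential: "lin K (forms C) (forms C) (differential C)"
  using differential_linear W_module unfolding lin_def by simp

lemma lin_d0: "lin K D (forms C) (d0 C)"
  unfolding d0_def[abs_def] by (rule lin_comp[OF lin_differential embed_facts(1)])

lemma d0_homogeneous: "a \<in> carrier D \<Longrightarrow> d0 C a \<in> homogeneous C 1"
  unfolding d0_def using differential_degree[OF embed_facts(2)] by simp

lemma d0_mult: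
  assumes "a \<in> carrier D" "b \<in> carrier D"
  shows "d0 C (a \<otimes>\<^bsub>D\<^esub> b) = d0 C a \<otimes>\<^bsub>forms C\<^esub> embed C b \<oplus>\<^bsub>forms C\<^esub> embed C a \<otimes>\<^bsub>forms C\<^esub> d0 C b"
  unfolding d0_def using assms leibniz[OF embed_facts(2) embed_facts(3)] by (simp add: embed_facts signed_def)

lemma differential_one: "differential C \<one>\<^bsub>forms C\<^esub> = \<zero>\<^bsub>forms C\<^esub>"
proof -
  have o: "\<one>\<^bsub>D\<^esub> \<in> carrier D" by simp
  have c: "d0 C \<one>\<^bsub>D\<^esub> \<in> carrier (forms C)" by (rule lin_closed[OF lin_d0 o])
  have "d0 C \<one>\<^bsub>D\<^esub> = d0 C \<one>\<^bsub>D\<^esub> \<oplus>\<^bsub>forms C\<^esub> d0 C \<one>\<^bsub>D\<^esub>"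
    using d0_mult[OF o o] c by (simp add: embed_facts)
  then have "d0 C \<one>\<^bsub>D\<^esub> = \<zero>\<^bsub>forms C\<^esub>" using c by (metis W.add.r_cancel_one')
  then show ?thesis by (simp add: d0_def embed_facts)
qed

lemma one_forms_simps [simp]:
  "carrier (one_forms C) = homogeneous C 1" "zero (one_forms C) = zero (forms C)" "add (one_forms C) = add (forms C)"
  "smult (one_forms C) = smult (forms C)" "lact (one_forms C) x \<omega> = embed C x \<otimes>\<^bsub>forms C\<^esub> \<omega>"
  "\<omega> \<triangleleft>\<^bsub>one_forms C\<^esub> x = \<omega> \<otimes>\<^bsub>forms C\<^esub> embed C x"
  by (simp_all add: one_forms_def)

lemma module_one_forms: "module K (one_forms C)"
  by (rule module_restrict[OF W_module homogeneous_submodule]) simp_all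

lemma lin_one_forms_inclusion: "lin K (one_forms C) (forms C) (\<lambda>\<omega>. \<omega>)"
  by (rule lin_restrict[OF lin_id[OF W_module] module_one_forms _ _ _ W_module]) (auto simp: H_closed)

lemma lin_d0_one_forms: "lin K D (one_forms C) (d0 C)"
  by (rule lin_restrict[OF lin_d0 D.module_axioms _ _ _ module_one_forms]) (auto simp: d0_homogeneous[simplified])

lemma one_forms_bimod: "bimod K D (one_forms C)"
proof (rule bimod.intro)
  note m = bilin_closed[OF W_mult] H_closed embed_facts(3)
  have l: "embed C x \<otimes>\<^bsub>forms C\<^esub> \<omega> \<in> homogeneous C 1" if "x \<in> carrier D" "\<omega> \<in> homogeneous C 1" for x \<omega>
    using homogeneous_mult[OF embed_facts(2)[OF that(1)] that(2)] by simp
  have r: "\<omega> \<otimes>\<^bsub>forms C\<^esub> embed C x \<in> homogeneous C 1" if "x \<in> carrier D" "\<omega> \<in> homogeneous C 1" for x \<omega>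
    using homogeneous_mult[OF that(2) embed_facts(2)[OF that(1)]] by simp
  show "k_algebra K D" by (rule D.k_algebra_axioms)
  show "bilin K D (one_forms C) (one_forms C) (lact (one_forms C))"
  proof (rule bilinI[OF D.module_axioms module_one_forms module_one_forms])
    fix x assume x: "x \<in> carrier D"
    show "lin K (one_forms C) (one_forms C) (\<lambda>\<omega>. lact (one_forms C) x \<omega>)"
      using l x H_closed unfolding one_forms_simps
      by (intro lin_restrict[OF bilin_lin(1)[OF W_mult embed_facts(3)[OF x]] module_one_forms _ _ _ module_one_forms]) auto
  next
    fix \<omega> assume w: "\<omega> \<in> carrier (one_forms C)"
    show "lin K D (one_forms C) (\<lambda>x. lact (one_forms C) x \<omega>)"
      using l w H_closed unfolding one_forms_simps
      by (intro lin_restrict[OF bilin_lin_comp(2)[OF W_mult _ embed_facts(1)] D.module_axioms _ _ _ module_one_forms]) auto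
  qed
  show "bilin K (one_forms C) D (one_forms C) (\<lambda>n x. n \<triangleleft>\<^bsub>one_forms C\<^esub> x)"
  proof (rule bilinI[OF module_one_forms D.module_axioms module_one_forms])
    fix x assume x: "x \<in> carrier D"
    show "lin K (one_forms C) (one_forms C) (\<lambda>\<omega>. \<omega> \<triangleleft>\<^bsub>one_forms C\<^esub> x)"
      using r x H_closed unfolding one_forms_simps
      by (intro lin_restrict[OF bilin_lin(2)[OF W_mult embed_facts(3)[OF x]] module_one_forms _ _ _ module_one_forms]) auto
  next
    fix \<omega> assume w: "\<omega> \<in> carrier (one_forms C)"
    show "lin K D (one_forms C) (\<lambda>x. \<omega> \<triangleleft>\<^bsub>one_forms C\<^esub> x)"
      using r w H_closed unfolding one_forms_simps
      by (intro lin_restrict[OF bilin_lin_comp(1)[OF W_mult _ embed_facts(1)] D.module_axioms _ _ _ module_one_forms]) auto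
  qed
qed (auto simp: H_closed embed_facts W.m_assoc)

text \<open>Right multiples \<open>(db) a = d(b a) - b da\<close> can be rewritten with the coefficient on the left, so
  the family consisting of this span in degree one, and of all forms in the other degrees, admits
  \<open>graded_induct\<close>.\<close>

lemma one_forms_span: "homogeneous C 1 = lin_span K (forms C) {embed C a \<otimes>\<^bsub>forms C\<^esub> d0 C b | a b. a \<in> carrier D \<and> b \<in> carrier D}"
  (is "_ = lin_span K _ ?S")
proof
  have S1: "?S \<subseteq> homogeneous C 1"
    using homogeneous_mult[OF embed_facts(2) d0_homogeneous] by fastforce
  then have S: "?S \<subseteq> carrier (forms C)" using H_closed by blast
  have sp: "submodule (lin_span K (forms C) ?S) K (forms C)" by (rule lin_span_submodule[OF W_module S])
  note sup = lin_span_superset[of ?S K "forms C"]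
  show le: "lin_span K (forms C) ?S \<subseteq> homogeneous C 1"
    by (rule lin_span_least[OF homogeneous_submodule S1])
  define G where "G n = (if n = 1 then lin_span K (forms C) ?S else homogeneous C n)" for n :: nat
  have GH: "G n \<subseteq> homogeneous C n" for n using le by (simp add: G_def)
  have gm: "embed C a \<otimes>\<^bsub>forms C\<^esub> x \<in> lin_span K (forms C) ?S \<and> x \<otimes>\<^bsub>forms C\<^esub> embed C a \<in> lin_span K (forms C) ?S"
    if a: "a \<in> carrier D" and x: "x \<in> lin_span K (forms C) ?S" for a x
  proof
    have c: "embed C a \<in> carrier (forms C)" using embed_facts a by blast
    show "embed C a \<otimes>\<^bsub>forms C\<^esub> x \<in> lin_span K (forms C) ?S"
    proof (rule lin_maps_span[OF bilin_lin(1)[OF W_mult c] sp S _ x])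
      fix y assume "y \<in> ?S"
      then obtain a' b where y: "y = embed C a' \<otimes>\<^bsub>forms C\<^esub> d0 C b" "a' \<in> carrier D" "b \<in> carrier D" by blast
      then have "embed C a \<otimes>\<^bsub>forms C\<^esub> y = embed C (a \<otimes>\<^bsub>D\<^esub> a') \<otimes>\<^bsub>forms C\<^esub> d0 C b"
        using a by (simp add: embed_facts lin_closed[OF lin_d0] W.m_assoc)
      then show "embed C a \<otimes>\<^bsub>forms C\<^esub> y \<in> lin_span K (forms C) ?S" using y a sup by blast
    qed
    show "x \<otimes>\<^bsub>forms C\<^esub> embed C a \<in> lin_span K (forms C) ?S"
    proof (rule lin_maps_span[OF bilin_lin(2)[OF W_mult c] sp S _ x])
      fix y assume "y \<in> ?S"
      then obtain a' b where y: "y = embed C a' \<otimes>\<^bsub>forms C\<^esub> d0 C b" "a' \<in> carrier D" "b \<in> carrier D" by blast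
      note cl = lin_closed[OF lin_d0] embed_facts(3) a y(2,3)
      have "d0 C b \<otimes>\<^bsub>forms C\<^esub> embed C a = d0 C (b \<otimes>\<^bsub>D\<^esub> a) \<oplus>\<^bsub>forms C\<^esub> \<ominus>\<^bsub>forms C\<^esub> (embed C b \<otimes>\<^bsub>forms C\<^esub> d0 C a)"
        by (simp add: d0_mult cl W.a_assoc W.r_neg)
      then have "y \<otimes>\<^bsub>forms C\<^esub> embed C a = embed C a' \<otimes>\<^bsub>forms C\<^esub> d0 C (b \<otimes>\<^bsub>D\<^esub> a)
          \<oplus>\<^bsub>forms C\<^esub> \<ominus>\<^bsub>forms C\<^esub> (embed C (a' \<otimes>\<^bsub>D\<^esub> b) \<otimes>\<^bsub>forms C\<^esub> d0 C a)"
        by (simp add: y(1) cl W.m_assoc W.r_distr W.r_minus embed_facts(4))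
      moreover have "embed C a' \<otimes>\<^bsub>forms C\<^esub> d0 C (b \<otimes>\<^bsub>D\<^esub> a) \<in> lin_span K (forms C) ?S"
        "embed C (a' \<otimes>\<^bsub>D\<^esub> b) \<otimes>\<^bsub>forms C\<^esub> d0 C a \<in> lin_span K (forms C) ?S"
        using y a by (auto intro!: subsetD[OF sup])
      ultimately show "y \<otimes>\<^bsub>forms C\<^esub> embed C a \<in> lin_span K (forms C) ?S"
        using submodule_facts(3)[OF sp] submodule_minus[OF sp W_module] by simp
    qed
  qed
  show "homogeneous C 1 \<subseteq> lin_span K (forms C) ?S"
  proof
    fix x assume x: "x \<in> homogeneous C 1"
    have "x \<in> G 1"
    proof (rule graded_induct[OF _ GH _ _ _ x])
      show "submodule (G n) K (forms C)" for n using sp homogeneous_submodule by (simp add: G_def)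
      show "embed C a \<in> G 0" if "a \<in> carrier D" for a using embed_facts that by (simp add: G_def)
      fix p q x y assume xy: "x \<in> G p" "y \<in> G q"
      have h: "x \<otimes>\<^bsub>forms C\<^esub> y \<in> homogeneous C (p + q)" using xy GH homogeneous_mult by blast
      show "x \<otimes>\<^bsub>forms C\<^esub> y \<in> G (p + q)"
      proof (cases "p + q = 1")
        case False then show ?thesis using h by (simp add: G_def)
      next
        case True
        then consider "p = 0" "q = 1" | "p = 1" "q = 0" by linarith
        then show ?thesis
        proof cases
          case 1
          then obtain a where "a \<in> carrier D" "x = embed C a" using xy embed_facts(6) by (auto simp: G_def)
          then show ?thesis using gm[of a y] xy 1 by (simp add: G_def)
        next
          case 2
          then obtain a where "a \<in> carrier D" "y = embed C a" using xy embed_facts(6) by (auto simp: G_def)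
          then show ?thesis using gm[of a x] xy 2 by (simp add: G_def)
        qed
      qed
    next
      fix p x assume x: "x \<in> G p"
      have h: "differential C x \<in> homogeneous C (Suc p)" using x GH differential_degree by blast
      show "differential C x \<in> G (Suc p)"
      proof (cases "p = 0")
        case False then show ?thesis using h by (simp add: G_def)
      next
        case True
        then obtain a where a: "a \<in> carrier D" "x = embed C a" using x embed_facts(6) by (auto simp: G_def)
        have "embed C \<one>\<^bsub>D\<^esub> \<otimes>\<^bsub>forms C\<^esub> d0 C a \<in> lin_span K (forms C) ?S"
          using a by (intro subsetD[OF sup]) blast
        then show ?thesis using a True by (simp add: G_def embed_facts d0_def lin_closed[OF lin_differential])
      qed
    qed
    then show "x \<in> lin_span K (forms C) ?S" by (simp add: G_def)
  qed
qed

text \<open>A linear left inverse of the embedding, defined on all forms. Tensoring it shows that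
  tensor products of homogeneous parts embed into tensor products of the algebras of forms.\<close>

definition unembed where "unembed \<omega> = inv_into (carrier D) (embed C) (component 0 \<omega>)"

lemma unembed_embed: "a \<in> carrier D \<Longrightarrow> unembed (embed C a) = a"
  using embed_bij unfolding unembed_def bij_betw_def
  by (simp add: component_of_homogeneous[OF embed_facts(2)] inv_into_f_f)

lemma lin_unembed: "lin K (forms C) D unembed"
proof (rule linI[OF W_module D.module_axioms])
  have ex: "\<exists>a \<in> carrier D. component 0 x = embed C a \<and> unembed x = a" if xC: "x \<in> carrier (forms C)" for x
  proof -
    obtain a where a: "a \<in> carrier D" "component 0 x = embed C a"
      using component_homogeneous[OF xC, of 0] embed_facts(6) by blast
    then show ?thesis using embed_bij by (auto simp: unembed_def bij_betw_def inv_into_f_f)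
  qed
  have eq: "unembed x = a" if "x \<in> carrier (forms C)" "a \<in> carrier D" "component 0 x = embed C a" for x a
    using that embed_bij by (auto simp: unembed_def bij_betw_def inv_into_f_f)
  fix x assume x: "x \<in> carrier (forms C)"
  then obtain a where a: "a \<in> carrier D" "component 0 x = embed C a" "unembed x = a" using ex by blast
  then show "unembed x \<in> carrier D" by simp
  show "unembed (c \<odot>\<^bsub>forms C\<^esub> x) = c \<odot>\<^bsub>D\<^esub> unembed x" if c: "c \<in> carrier K" for c
    using a c x by (intro eq) (auto simp: lin_smult[OF lin_component] lin_smult[OF embed_facts(1)])
  fix y assume y: "y \<in> carrier (forms C)"
  then obtain b where b: "b \<in> carrier D" "component 0 y = embed C b" "unembed y = b" using ex by blast
  show "unembed (x \<oplus>\<^bsub>forms C\<^esub> y) = unembed x \<oplus>\<^bsub>D\<^esub> unembed y"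
    using a b x y by (intro eq) (auto simp: lin_add[OF lin_component] lin_add[OF embed_facts(1)])
qed

lemma signed_mult:
  assumes "x \<in> carrier (forms C)" "y \<in> carrier (forms C)"
  shows "signed C (p + q) (x \<otimes>\<^bsub>forms C\<^esub> y) = signed C p x \<otimes>\<^bsub>forms C\<^esub> signed C q y"
  using assms by (auto simp: signed_def W.l_minus W.r_minus)

lemma signed_mult_left:
  assumes "x \<in> carrier (forms C)" "y \<in> carrier (forms C)"
  shows "signed C p (x \<otimes>\<^bsub>forms C\<^esub> y) = signed C p x \<otimes>\<^bsub>forms C\<^esub> y"
  using assms by (auto simp: signed_def W.l_minus)

lemma parity_mult:
  assumes x: "x \<in> homogeneous C p" and y: "y \<in> carrier (forms C)"
  shows "parity C (x \<otimes>\<^bsub>forms C\<^esub> y) = parity C x \<otimes>\<^bsub>forms C\<^esub> parity C y"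
proof (rule homogeneous_ext[OF lin_comp[OF lin_parity bilin_lin(1)[OF W_mult H_closed[OF x]]]
      lin_comp[OF bilin_lin(1)[OF W_mult] lin_parity] _ y])
  show "parity C x \<in> carrier (forms C)" by (rule lin_closed[OF lin_parity H_closed[OF x]])
  fix n y assume "y \<in> homogeneous C n"
  then show "parity C (x \<otimes>\<^bsub>forms C\<^esub> y) = parity C x \<otimes>\<^bsub>forms C\<^esub> parity C y"
    using parity_homogeneous[OF homogeneous_mult[OF x]] x by (simp add: parity_homogeneous signed_mult H_closed)
qed

lemma signed_homogeneous: "x \<in> homogeneous C n \<Longrightarrow> signed C m x \<in> homogeneous C n"
  using submodule_minus[OF homogeneous_submodule W_module] by (auto simp: signed_def)

lemma parity_differential:
  assumes "x \<in> carrier (forms C)"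
  shows "parity C (differential C x) = \<ominus>\<^bsub>forms C\<^esub> differential C (parity C x)"
  by (rule homogeneous_ext[OF lin_comp[OF lin_parity lin_differential] lin_uminus[OF lin_comp[OF lin_differential lin_parity]] _ assms])
    (auto simp: parity_homogeneous parity_homogeneous[OF differential_degree] signed_def lin_minus[OF lin_differential] H_closed lin_closed[OF lin_differential])

lemma differential_mult:
  assumes x: "x \<in> homogeneous C p" and y: "y \<in> carrier (forms C)"
  shows "differential C (x \<otimes>\<^bsub>forms C\<^esub> y) = differential C x \<otimes>\<^bsub>forms C\<^esub> y \<oplus>\<^bsub>forms C\<^esub> parity C x \<otimes>\<^bsub>forms C\<^esub> differential C y"
  using leibniz[OF assms] assms
  by (simp add: signed_mult_left H_closed lin_closed[OF lin_differential] parity_homogeneous)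

text \<open>One-forms are sums of terms \<open>a db\<close>, and the coefficient \<open>a\<close> moves across the
  tensor sign to the element of \<open>M\<close>.\<close>

lemma tensor_one_forms_finite_sum:
  assumes M: "right_module K D M" and z: "z \<in> carrier (tensor_over K D M (one_forms C))"
  shows "\<exists>n f a. f \<in> {..<n::nat} \<rightarrow> carrier M \<and> a \<in> {..<n} \<rightarrow> carrier D \<and>
    z = (\<Oplus>\<^bsub>tensor_over K D M (one_forms C)\<^esub>i\<in>{..<n}. pure_over K D M (one_forms C) (f i) (d0 C (a i)))"
proof -
  interpret bal: balanced_tensor K D M "one_forms C"
    by (intro balanced_tensor.intro one_forms_bimod balanced_tensor_axioms.intro M)
  let ?G = "{bal.po m (d0 C b) | m b. m \<in> carrier M \<and> b \<in> carrier D}"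
  note po = bal.bilin_pure_over
  have d: "d0 C b \<in> carrier (one_forms C)" if "b \<in> carrier D" for b using lin_closed[OF lin_d0_one_forms that] .
  have G: "?G \<subseteq> carrier bal.T" using bilin_closed[OF po _ d] by blast
  have sp: "submodule (lin_span K bal.T ?G) K bal.T" by (rule lin_span_submodule[OF bal.module_T G])
  \<comment> \<open>Makes \<open>m \<otimes> -\<close> available on all forms, where the span of the \<open>a db\<close> is formed.\<close>
  have comp: "lin K (forms C) (one_forms C) (component 1)"
    by (rule lin_restrict[OF lin_component W_module _ _ _ module_one_forms]) (auto intro: component_homogeneous)
  have "z \<in> lin_span K bal.T ?G"
  proof (rule bal.over_generated[OF sp _ z])
    fix m \<omega> assume m: "m \<in> carrier M" and w: "\<omega> \<in> carrier (one_forms C)"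
    have S: "{embed C a \<otimes>\<^bsub>forms C\<^esub> d0 C b | a b. a \<in> carrier D \<and> b \<in> carrier D} \<subseteq> carrier (forms C)"
      using embed_facts(3) lin_closed[OF lin_d0] by blast
    have "bal.po m (component 1 \<omega>) \<in> lin_span K bal.T ?G"
    proof (rule lin_maps_span[OF bilin_lin_comp(1)[OF po m comp] sp S])
      show "\<omega> \<in> lin_span K (forms C) {embed C a \<otimes>\<^bsub>forms C\<^esub> d0 C b | a b. a \<in> carrier D \<and> b \<in> carrier D}"
        using w unfolding one_forms_simps one_forms_span .
      fix x assume "x \<in> {embed C a \<otimes>\<^bsub>forms C\<^esub> d0 C b | a b. a \<in> carrier D \<and> b \<in> carrier D}"
      then obtain a b where x: "x = embed C a \<otimes>\<^bsub>forms C\<^esub> d0 C b" "a \<in> carrier D" "b \<in> carrier D" by blast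
      have h: "x \<in> homogeneous C 1" using homogeneous_mult[OF embed_facts(2)[OF x(2)] d0_homogeneous[OF x(3)]] x by simp
      have "bal.po m (component 1 x) = bal.po (m \<triangleleft>\<^bsub>M\<^esub> a) (d0 C b)"
        using bal.pure_over_balanced[OF m x(2) d[OF x(3)]] component_of_homogeneous[OF h, of 1] x by simp
      moreover have "m \<triangleleft>\<^bsub>M\<^esub> a \<in> carrier M" using bilin_closed[OF bal.M_bilin m x(2)] .
      ultimately have "bal.po m (component 1 x) \<in> ?G" using x by blast
      then show "bal.po m (component 1 x) \<in> lin_span K bal.T ?G" by (rule subsetD[OF lin_span_superset])
    qed
    then show "bal.po m \<omega> \<in> lin_span K bal.T ?G" using w component_of_homogeneous[of \<omega> 1 1] by simp
  qed
  moreover have "c \<odot>\<^bsub>bal.T\<^esub> x \<in> ?G" if c: "c \<in> carrier K" and x: "x \<in> ?G" for c x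
  proof -
    obtain m b where mb: "x = bal.po m (d0 C b)" "m \<in> carrier M" "b \<in> carrier D" using x by blast
    have "c \<odot>\<^bsub>bal.T\<^esub> x = bal.po (c \<odot>\<^bsub>M\<^esub> m) (d0 C b)"
      using lin_smult[OF bilin_lin(2)[OF po d[OF mb(3)]] c mb(2)] mb by simp
    then show ?thesis using mb module_closed(5)[OF bal.modules(2) c mb(2)] by blast
  qed
  ultimately obtain n g where g: "g \<in> {..<n::nat} \<rightarrow> ?G" "z = (\<Oplus>\<^bsub>bal.T\<^esub>i\<in>{..<n}. g i)"
    using lin_span_finite_sum[OF bal.module_T G, of z] by blast
  have "\<forall>i\<in>{..<n}. \<exists>mb. fst mb \<in> carrier M \<and> snd mb \<in> carrier D \<and> g i = bal.po (fst mb) (d0 C (snd mb))"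
    using g(1) by fastforce
  from bchoice[OF this] obtain mb where mb: "\<forall>i\<in>{..<n}. fst (mb i) \<in> carrier M \<and> snd (mb i) \<in> carrier D \<and> g i = bal.po (fst (mb i)) (d0 C (snd (mb i)))"
    by (rule exE)
  interpret T: module K bal.T by (rule bal.module_T)
  have "z = (\<Oplus>\<^bsub>bal.T\<^esub>i\<in>{..<n}. bal.po (fst (mb i)) (d0 C (snd (mb i))))"
    unfolding g(2) using mb bilin_closed[OF po _ d] by (intro T.finsum_cong') auto
  then show ?thesis using mb
    by (intro exI[of _ n] exI[of _ "\<lambda>i. fst (mb i)"] exI[of _ "\<lambda>i. snd (mb i)"]) auto
qed

end

section \<open>The twisted product of the universal calculi\<close>

locale twisted_omega =
  fixes K :: "('k, 'c) ring_scheme" and A :: "('k, 'a, 'r) module_scheme" and B :: "('k, 'b, 's) module_scheme"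
    and R :: "('k, 'b, 'a) tens \<Rightarrow> ('k, 'a, 'b) tens"
    and Rt :: "('k, ('k, 'b) form, ('k, 'a) form) tens \<Rightarrow> ('k, ('k, 'a) form, ('k, 'b) form) tens"
  assumes A_calculus: "differential_calculus K A (omega K A)"
    and B_calculus: "differential_calculus K B (omega K B)"
    and R_twisting: "twisting_map K A B R"
    and extension: "twisting_extension K A B R Rt"

sublocale twisted_omega \<subseteq> a: differential_calculus K A "omega K A" by (rule A_calculus)
sublocale twisted_omega \<subseteq> b: differential_calculus K B "omega K B" by (rule B_calculus)
sublocale twisted_omega \<subseteq> alg: twisted_algebra K A B R
  by (rule twisted_algebra.intro[OF a.D.k_algebra_axioms b.D.k_algebra_axioms R_twisting])
sublocale twisted_omega \<subseteq> big: twisted_algebra K "Omega K A" "Omega K B" Rt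
  using extension unfolding twisting_extension_def
  by (intro twisted_algebra.intro[OF a.W.k_algebra_axioms b.W.k_algebra_axioms]) blast

context twisted_omega
begin

abbreviation "OA \<equiv> Omega K A"
abbreviation "OB \<equiv> Omega K B"
abbreviation "T \<equiv> tensor K OA OB"
abbreviation "t \<equiv> pure K OA OB"
abbreviation "HA \<equiv> homogeneous (omega K A)"
abbreviation "HB \<equiv> homogeneous (omega K B)"
abbreviation "dA \<equiv> differential (omega K A)"
abbreviation "dB \<equiv> differential (omega K B)"
abbreviation "iA \<equiv> embed (omega K A)"
abbreviation "iB \<equiv> embed (omega K B)"
abbreviation "eA \<equiv> parity (omega K A)"
abbreviation "eB \<equiv> parity (omega K B)"
abbreviation "C \<equiv> twisted_calculus K A B Rt"

lemma C_simps:
  "forms C = big.D"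
  "homogeneous C n = lin_span K T {t \<phi> \<omega> | \<phi> \<omega> p q. \<phi> \<in> HA p \<and> \<omega> \<in> HB q \<and> p + q = n}"
  "differential C = tensor_lift K T (\<lambda>\<phi> \<omega>. t (dA \<phi>) \<omega> \<oplus>\<^bsub>T\<^esub> t (eA \<phi>) (dB \<omega>))"
  "embed C = tensor_map K OA OB iA iB"
  by (simp_all add: twisted_calculus_def Let_def)

lemma T_module: "module K T" by (rule big.mods(3))

lemma t_closed: "\<lbrakk>\<phi> \<in> carrier OA; \<omega> \<in> carrier OB\<rbrakk> \<Longrightarrow> t \<phi> \<omega> \<in> carrier T"
  by (rule bilin_closed[OF big.p_bilin])

lemmas clo = t_closed big.closed lin_closed[OF a.lin_parity] lin_closed[OF b.lin_parity]
  lin_closed[OF a.lin_differential] lin_closed[OF b.lin_differential] lin_closed[OF big.lin_Lm] lin_closed[OF big.lin_Rm]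
  a.embed_facts(3) b.embed_facts(3)

lemmas cl = clo a.H_closed b.H_closed

lemma Rt_embed:
  "\<lbrakk>b \<in> carrier B; a \<in> carrier A\<rbrakk> \<Longrightarrow> Rt (pure K OB OA (iB b) (iA a)) = tensor_map K OA OB iA iB (R (pure K B A b a))"
  using extension unfolding twisting_extension_def by blast

lemma Rt_differential:
  assumes "\<omega> \<in> carrier OB" "\<phi> \<in> carrier OA"
  shows "Rt (pure K OB OA (dB \<omega>) \<phi>) = tensor_map K OA OB eA dB (Rt (pure K OB OA \<omega> \<phi>))"
    and "Rt (pure K OB OA \<omega> (dA \<phi>)) = tensor_map K OA OB dA eB (Rt (pure K OB OA \<omega> \<phi>))"
proof -
  have p: "pure K OB OA \<omega> \<phi> \<in> carrier (tensor K OB OA)" using assms by (intro clo)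
  have "tensor_map K OB OA dB (\<lambda>\<phi>. \<phi>) (pure K OB OA \<omega> \<phi>) = pure K OB OA (dB \<omega>) \<phi>"
    "tensor_map K OB OA (\<lambda>\<omega>. \<omega>) dA (pure K OB OA \<omega> \<phi>) = pure K OB OA \<omega> (dA \<phi>)"
    by (rule tensor_map_pure[OF b.lin_differential lin_id[OF a.W_module] assms]
        tensor_map_pure[OF lin_id[OF b.W_module] a.lin_differential assms])+
  then show "Rt (pure K OB OA (dB \<omega>) \<phi>) = tensor_map K OA OB eA dB (Rt (pure K OB OA \<omega> \<phi>))"
    "Rt (pure K OB OA \<omega> (dA \<phi>)) = tensor_map K OA OB dA eB (Rt (pure K OB OA \<omega> \<phi>))"
    using extension p unfolding twisting_extension_def by metis+
qed

section \<open>Bidegrees\<close>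

text \<open>The image of \<open>\<Omega>\<^sup>pA \<otimes> \<Omega>\<^sup>qB\<close>.\<close>

definition "bideg p q = lin_span K T {t \<phi> \<omega> | \<phi> \<omega>. \<phi> \<in> HA p \<and> \<omega> \<in> HB q}"

lemma bideg_gens: "{t \<phi> \<omega> | \<phi> \<omega>. \<phi> \<in> HA p \<and> \<omega> \<in> HB q} \<subseteq> carrier T"
  by (auto simp: cl)

lemma bideg_submodule: "submodule (bideg p q) K T"
  unfolding bideg_def by (rule lin_span_submodule[OF T_module bideg_gens])

lemma bideg_closed: "x \<in> bideg p q \<Longrightarrow> x \<in> carrier T"
  using submodule_facts(1)[OF bideg_submodule] by blast

lemma bideg_pure: "\<lbrakk>\<phi> \<in> HA p; \<omega> \<in> HB q\<rbrakk> \<Longrightarrow> t \<phi> \<omega> \<in> bideg p q"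
  unfolding bideg_def by (rule subsetD[OF lin_span_superset]) blast

lemma bideg_map:
  assumes "lin K T U f" "submodule N K U" "\<And>\<phi> \<omega>. \<lbrakk>\<phi> \<in> HA p; \<omega> \<in> HB q\<rbrakk> \<Longrightarrow> f (t \<phi> \<omega>) \<in> N" "x \<in> bideg p q"
  shows "f x \<in> N"
  by (rule lin_maps_span[OF assms(1,2) bideg_gens _ assms(4)[unfolded bideg_def]]) (use assms(3) in blast)

lemma bideg_ext:
  assumes "lin K T U f" "lin K T U g" "\<And>\<phi> \<omega>. \<lbrakk>\<phi> \<in> HA p; \<omega> \<in> HB q\<rbrakk> \<Longrightarrow> f (t \<phi> \<omega>) = g (t \<phi> \<omega>)" "x \<in> bideg p q"
  shows "f x = g x"
  by (rule lin_eq_on_span[OF assms(1,2) bideg_gens _ assms(4)[unfolded bideg_def]]) (use assms(3) in blast)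

lemma bideg_Lm:
  assumes "\<phi> \<in> HA r" "x \<in> bideg p q" shows "big.Lm \<phi> x \<in> bideg (r + p) q"
  by (rule bideg_map[OF big.lin_Lm bideg_submodule _ assms(2)])
    (use assms(1) in \<open>simp_all add: big.Lm_pure cl bideg_pure a.homogeneous_mult\<close>)

lemma bideg_Rm:
  assumes "\<omega> \<in> HB r" "x \<in> bideg p q" shows "big.Rm \<omega> x \<in> bideg p (q + r)"
  by (rule bideg_map[OF big.lin_Rm bideg_submodule _ assms(2)])
    (use assms(1) in \<open>simp_all add: big.Rm_pure cl bideg_pure b.homogeneous_mult\<close>)

lemma embed_bideg: "x \<in> carrier (tensor K A B) \<Longrightarrow> tensor_map K OA OB iA iB x \<in> bideg 0 0"
proof -
  assume x: "x \<in> carrier (tensor K A B)"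
  note l = a.embed_facts(1) b.embed_facts(1)
  have "x \<in> {x \<in> carrier (tensor K A B). tensor_map K OA OB iA iB x \<in> bideg 0 0}"
    by (rule tensor_generated[OF alg.mods(1,2) submodule_vimage[OF lin_tensor_map[OF l] bideg_submodule] _ x])
      (simp add: tensor_map_pure[OF l] alg.closed bideg_pure a.embed_facts b.embed_facts)
  then show ?thesis by simp
qed

lemma Rt_pure_one_left:
  assumes "\<omega> \<in> carrier OB" "\<phi> \<in> carrier OA" "\<psi> \<in> carrier OB"
  shows "t \<one>\<^bsub>OA\<^esub> \<omega> \<otimes>\<^bsub>big.D\<^esub> t \<phi> \<psi> = big.Rm \<psi> (Rt (pure K OB OA \<omega> \<phi>))"
proof -
  have "t \<phi> \<psi> = big.Rm \<psi> (t \<phi> \<one>\<^bsub>OB\<^esub>)" using assms by (simp add: big.Rm_pure cl big.A_simps)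
  then show ?thesis using assms by (simp add: big.D_mult_Rm cl big.D_mult_generators)
qed

lemma pure_mult_one_right:
  assumes "\<omega> \<in> carrier OB" "\<phi> \<in> carrier OA" "\<psi> \<in> carrier OA"
  shows "t \<psi> \<omega> \<otimes>\<^bsub>big.D\<^esub> t \<phi> \<one>\<^bsub>OB\<^esub> = big.Lm \<psi> (Rt (pure K OB OA \<omega> \<phi>))"
proof -
  have "t \<psi> \<omega> = big.Lm \<psi> (t \<one>\<^bsub>OA\<^esub> \<omega>)" using assms by (simp add: big.Lm_pure cl big.A_simps)
  then show ?thesis using assms by (simp add: big.D_mult_Lm cl big.D_mult_generators)
qed

lemma lin_Rt_right: "\<phi> \<in> carrier OA \<Longrightarrow> lin K OB T (\<lambda>\<omega>. Rt (pure K OB OA \<omega> \<phi>))"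
  and lin_Rt_left: "\<omega> \<in> carrier OB \<Longrightarrow> lin K OA T (\<lambda>\<phi>. Rt (pure K OB OA \<omega> \<phi>))"
  by (auto intro: lin_comp[OF big.lin_R] bilin_lin[OF big.BA_pure])

text \<open>The elements \<open>\<omega>\<close> of degree \<open>q\<close> that satisfy the claim for all \<open>a\<close> are closed under
  products, by \<open>Rt(\<omega> \<omega>' \<otimes> a) = (1 \<otimes> \<omega>) Rt(\<omega>' \<otimes> a)\<close>, and under the differential, by the compatibility
  of \<open>Rt\<close> with \<open>d\<^sub>B\<close>; so the graded induction principle applies. Degree zero on
  the side of \<open>A\<close> comes first because the product rule for \<open>\<omega> \<omega>'\<close> needs the claim for \<open>\<omega>\<close> and the forms
  that occur in \<open>Rt(\<omega>' \<otimes> a)\<close>, and these lie in \<open>A\<close> again.\<close>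

lemma Rt_bidegree_zero:
  assumes w: "\<omega> \<in> HB q" and a: "a \<in> carrier A"
  shows "Rt (pure K OB OA \<omega> (iA a)) \<in> bideg 0 q"
proof -
  let ?G = "\<lambda>q. HB q \<inter> (\<Inter>a\<in>carrier A. {\<omega> \<in> carrier OB. Rt (pure K OB OA \<omega> (iA a)) \<in> bideg 0 q})"
  have iA: "iA a \<in> carrier OA" if "a \<in> carrier A" for a using that by (rule a.embed_facts(3))
  have "\<omega> \<in> ?G q"
  proof (rule b.graded_induct[OF _ _ _ _ _ w])
    fix n
    have e: "?G n = \<Inter>(insert (HB n) ((\<lambda>a. {\<omega> \<in> carrier OB. Rt (pure K OB OA \<omega> (iA a)) \<in> bideg 0 n}) ` carrier A))" by auto
    show "submodule (?G n) K OB" unfolding e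
      using submodule_vimage[OF lin_Rt_right[OF iA] bideg_submodule]
      by (intro submodule_Inter[OF b.W_module]) (auto intro: b.homogeneous_submodule)
  next
    fix b assume "b \<in> carrier B"
    then show "iB b \<in> ?G 0" by (auto simp: b.embed_facts Rt_embed embed_bideg alg.closed)
  next
    fix p q x y assume x: "x \<in> ?G p" and y: "y \<in> ?G q"
    then have h: "x \<in> HB p" "y \<in> HB q" by auto
    note c = b.H_closed[OF h(1)] b.H_closed[OF h(2)]
    have "Rt (pure K OB OA (x \<otimes>\<^bsub>OB\<^esub> y) (iA a)) \<in> bideg 0 (p + q)" if a: "a \<in> carrier A" for a
    proof -
      have "Rt (pure K OB OA (x \<otimes>\<^bsub>OB\<^esub> y) (iA a)) = t \<one>\<^bsub>OA\<^esub> x \<otimes>\<^bsub>big.D\<^esub> Rt (pure K OB OA y (iA a))"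
        by (rule big.R_mult_left[OF c iA[OF a]])
      also have "\<dots> \<in> bideg 0 (p + q)"
      proof (rule bideg_map[OF bilin_lin(1)[OF big.bilin_D_mult] bideg_submodule])
        show "t \<one>\<^bsub>OA\<^esub> x \<in> carrier T" using c by (intro clo)
        show "Rt (pure K OB OA y (iA a)) \<in> bideg 0 q" using y a by auto
        fix \<phi> \<psi> assume f: "\<phi> \<in> HA 0" "\<psi> \<in> HB q"
        then obtain a' where "a' \<in> carrier A" "\<phi> = iA a'" using a.embed_facts(6) by blast
        then have "Rt (pure K OB OA x \<phi>) \<in> bideg 0 p" using x by auto
        then show "t \<one>\<^bsub>OA\<^esub> x \<otimes>\<^bsub>big.D\<^esub> t \<phi> \<psi> \<in> bideg 0 (p + q)"
          using f c by (simp add: Rt_pure_one_left cl bideg_Rm)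
      qed
      finally show ?thesis .
    qed
    then show "x \<otimes>\<^bsub>OB\<^esub> y \<in> ?G (p + q)"
      using h c by (auto simp: b.homogeneous_mult)
  next
    fix p x assume x: "x \<in> ?G p"
    then have h: "x \<in> HB p" by auto
    note c = b.H_closed[OF h]
    have "Rt (pure K OB OA (dB x) (iA a)) \<in> bideg 0 (Suc p)" if a: "a \<in> carrier A" for a
    proof -
      have r: "Rt (pure K OB OA x (iA a)) \<in> bideg 0 p" using x a by auto
      show ?thesis unfolding Rt_differential(1)[OF c iA[OF a]]
        by (rule bideg_map[OF lin_tensor_map[OF a.lin_parity b.lin_differential] bideg_submodule _ r])
          (simp add: tensor_map_pure[OF a.lin_parity b.lin_differential] cl bideg_pure b.differential_degree a.parity_homogeneous a.signed_homogeneous)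
    qed
    then show "dB x \<in> ?G (Suc p)" using h c by (auto simp: b.differential_degree cl)
  qed auto
  then show ?thesis using a by auto
qed

text \<open>Graded induction in the other argument, starting from the previous lemma. All forms \<open>\<omega>\<close> have
  to be considered at the same time since those that occur in \<open>Rt(\<omega> \<otimes> x)\<close> are fed into \<open>Rt(- \<otimes> y)\<close>.\<close>

lemma Rt_bidegree:
  assumes w: "\<omega> \<in> HB q" and f: "\<phi> \<in> HA p"
  shows "Rt (pure K OB OA \<omega> \<phi>) \<in> bideg p q"
proof -
  \<comment> \<open>The index set runs over all forms of all degrees.\<close>
  let ?I = "{(q, \<omega>). \<omega> \<in> HB q}"
  let ?P = "\<lambda>p i. {\<phi> \<in> carrier OA. Rt (pure K OB OA (snd i) \<phi>) \<in> bideg p (fst i)}"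
  let ?G = "\<lambda>p. HA p \<inter> (\<Inter>i\<in>?I. ?P p i)"
  have "\<phi> \<in> ?G p"
  proof (rule a.graded_induct[OF _ _ _ _ _ f])
    fix n
    have e: "?G n = \<Inter>(insert (HA n) (?P n ` ?I))" by auto
    show "submodule (?G n) K OA" unfolding e
      using submodule_vimage[OF lin_Rt_left bideg_submodule]
      by (intro submodule_Inter[OF a.W_module]) (auto intro: a.homogeneous_submodule dest: b.H_closed)
  next
    fix b assume "b \<in> carrier A"
    then show "iA b \<in> ?G 0" by (auto simp: a.embed_facts Rt_bidegree_zero)
  next
    fix p r x y assume x: "x \<in> ?G p" and y: "y \<in> ?G r"
    then have h: "x \<in> HA p" "y \<in> HA r" by auto
    note c = a.H_closed[OF h(1)] a.H_closed[OF h(2)]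
    have "Rt (pure K OB OA \<omega> (x \<otimes>\<^bsub>OA\<^esub> y)) \<in> bideg (p + r) q" if w: "\<omega> \<in> HB q" for \<omega> q
    proof -
      have "Rt (pure K OB OA \<omega> (x \<otimes>\<^bsub>OA\<^esub> y)) = Rt (pure K OB OA \<omega> x) \<otimes>\<^bsub>big.D\<^esub> t y \<one>\<^bsub>OB\<^esub>"
        by (rule big.R_mult_right[OF b.H_closed[OF w] c])
      also have "\<dots> \<in> bideg (p + r) q"
      proof (rule bideg_map[OF bilin_lin(2)[OF big.bilin_D_mult] bideg_submodule])
        show "t y \<one>\<^bsub>OB\<^esub> \<in> carrier T" using c by (intro clo)
        show "Rt (pure K OB OA \<omega> x) \<in> bideg p q" using x w by auto
        fix \<phi> \<psi> assume f: "\<phi> \<in> HA p" "\<psi> \<in> HB q"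
        then have "Rt (pure K OB OA \<psi> y) \<in> bideg r q" using y by auto
        then show "t \<phi> \<psi> \<otimes>\<^bsub>big.D\<^esub> t y \<one>\<^bsub>OB\<^esub> \<in> bideg (p + r) q"
          using f c by (simp add: pure_mult_one_right cl bideg_Lm)
      qed
      finally show ?thesis .
    qed
    then show "x \<otimes>\<^bsub>OA\<^esub> y \<in> ?G (p + r)"
      using h c by (auto simp: a.homogeneous_mult)
  next
    fix p x assume x: "x \<in> ?G p"
    then have h: "x \<in> HA p" by auto
    note c = a.H_closed[OF h]
    have "Rt (pure K OB OA \<omega> (dA x)) \<in> bideg (Suc p) q" if w: "\<omega> \<in> HB q" for \<omega> q
    proof -
      have r: "Rt (pure K OB OA \<omega> x) \<in> bideg p q" using x w by auto
      show ?thesis unfolding Rt_differential(2)[OF b.H_closed[OF w] c]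
        by (rule bideg_map[OF lin_tensor_map[OF a.lin_differential b.lin_parity] bideg_submodule _ r])
          (simp add: tensor_map_pure[OF a.lin_differential b.lin_parity] cl bideg_pure a.differential_degree b.parity_homogeneous b.signed_homogeneous)
    qed
    then show "dA x \<in> ?G (Suc p)" using h c by (auto simp: a.differential_degree cl)
  qed auto
  then show ?thesis using w by auto
qed

section \<open>The total grading\<close>

abbreviation "gens n \<equiv> {t \<phi> \<omega> | \<phi> \<omega> p q. \<phi> \<in> HA p \<and> \<omega> \<in> HB q \<and> p + q = n}"

lemma H_gens: "gens n \<subseteq> carrier T"
  by (auto simp: cl)

lemma H_submodule: "submodule (homogeneous C n) K T"
  unfolding C_simps by (rule lin_span_submodule[OF T_module H_gens])

lemma H_pure: "\<lbrakk>\<phi> \<in> HA p; \<omega> \<in> HB q\<rbrakk> \<Longrightarrow> t \<phi> \<omega> \<in> homogeneous C (p + q)"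
  unfolding C_simps by (rule subsetD[OF lin_span_superset]) blast

lemma H_map:
  assumes "lin K T U f" "submodule N K U" "\<And>p q \<phi> \<omega>. \<lbrakk>\<phi> \<in> HA p; \<omega> \<in> HB q; p + q = n\<rbrakk> \<Longrightarrow> f (t \<phi> \<omega>) \<in> N" "x \<in> homogeneous C n"
  shows "f x \<in> N"
  by (rule lin_maps_span[OF assms(1,2) H_gens _ assms(4)[unfolded C_simps]]) (use assms(3) in blast)

lemma H_ext:
  assumes "lin K T U f" "lin K T U g" "\<And>p q \<phi> \<omega>. \<lbrakk>\<phi> \<in> HA p; \<omega> \<in> HB q; p + q = n\<rbrakk> \<Longrightarrow> f (t \<phi> \<omega>) = g (t \<phi> \<omega>)" "x \<in> homogeneous C n"
  shows "f x = g x"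
  by (rule lin_eq_on_span[OF assms(1,2) H_gens _ assms(4)[unfolded C_simps]]) (use assms(3) in blast)

lemma bideg_H: "x \<in> bideg p q \<Longrightarrow> x \<in> homogeneous C (p + q)"
  by (rule bideg_map[OF lin_id[OF T_module] H_submodule H_pure])

lemma T_generated:
  assumes N: "submodule N K T" and h: "\<And>p q \<phi> \<omega>. \<lbrakk>\<phi> \<in> HA p; \<omega> \<in> HB q\<rbrakk> \<Longrightarrow> t \<phi> \<omega> \<in> N"
    and x: "x \<in> carrier T"
  shows "x \<in> N"
proof (rule tensor_generated[OF a.W_module b.W_module N _ x])
  fix \<phi> \<omega> assume f: "\<phi> \<in> carrier OA" and w: "\<omega> \<in> carrier OB"
  have "\<phi> \<in> {\<phi> \<in> carrier OA. t \<phi> \<omega> \<in> N}"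
  proof (rule a.homogeneous_generated[OF submodule_vimage[OF bilin_lin(2)[OF big.p_bilin w] N] _ f])
    fix p \<phi> assume ph: "\<phi> \<in> HA p"
    then have f: "\<phi> \<in> carrier OA" by (rule a.H_closed)
    have "\<omega> \<in> {\<omega> \<in> carrier OB. t \<phi> \<omega> \<in> N}"
      by (rule b.homogeneous_generated[OF submodule_vimage[OF bilin_lin(1)[OF big.p_bilin f] N] _ w])
        (simp add: b.H_closed h[OF ph])
    then show "\<phi> \<in> {\<phi> \<in> carrier OA. t \<phi> \<omega> \<in> N}" using f by simp
  qed
  then show "t \<phi> \<omega> \<in> N" by simp
qed

lemma T_ext:
  assumes "lin K T U f" "lin K T U g" "\<And>p q \<phi> \<omega>. \<lbrakk>\<phi> \<in> HA p; \<omega> \<in> HB q\<rbrakk> \<Longrightarrow> f (t \<phi> \<omega>) = g (t \<phi> \<omega>)" "x \<in> carrier T"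
  shows "f x = g x"
proof -
  have "x \<in> {x \<in> carrier T. f x = g x}"
    by (rule T_generated[OF submodule_equalizer[OF assms(1,2)] _ assms(4)]) (simp add: assms(3) cl)
  then show ?thesis by simp
qed

text \<open>The projection to total degree \<open>n\<close>.\<close>

definition "total_component n x = (\<Oplus>\<^bsub>T\<^esub>i\<in>{..n}. tensor_map K OA OB (a.component i) (b.component (n - i)) x)"

lemma lin_total_component: "lin K T T (total_component n)"
  unfolding total_component_def[abs_def]
  by (intro lin_sum T_module lin_tensor_map a.lin_component b.lin_component) simp

lemma total_component_pure:
  assumes f: "\<phi> \<in> HA p" and w: "\<omega> \<in> HB q"
  shows "total_component n (t \<phi> \<omega>) = (if p + q = n then t \<phi> \<omega> else \<zero>\<^bsub>T\<^esub>)"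
proof -
  interpret T: module K T by (rule T_module)
  have c: "\<phi> \<in> carrier OA" "\<omega> \<in> carrier OB" "t \<phi> \<omega> \<in> carrier T" using f w by (auto simp: cl)
  have z: "t \<zero>\<^bsub>OA\<^esub> \<psi> = \<zero>\<^bsub>T\<^esub>" "t \<psi>' \<zero>\<^bsub>OB\<^esub> = \<zero>\<^bsub>T\<^esub>" if "\<psi> \<in> carrier OB" "\<psi>' \<in> carrier OA" for \<psi> \<psi>'
    using lin_zero[OF bilin_lin(1)[OF big.p_bilin that(2)]] lin_zero[OF bilin_lin(2)[OF big.p_bilin that(1)]] by auto
  have "total_component n (t \<phi> \<omega>) = (\<Oplus>\<^bsub>T\<^esub>i\<in>{..n}. if p = i then (if p + q = n then t \<phi> \<omega> else \<zero>\<^bsub>T\<^esub>) else \<zero>\<^bsub>T\<^esub>)"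
    unfolding total_component_def using f w c
    by (intro T.finsum_cong')
      (auto simp: tensor_map_pure[OF a.lin_component b.lin_component] a.component_of_homogeneous b.component_of_homogeneous z
        module_closed[OF a.W_module] module_closed[OF b.W_module])
  also have "\<dots> = (if p + q = n then t \<phi> \<omega> else \<zero>\<^bsub>T\<^esub>)"
  proof (cases "p \<le> n")
    case True
    then show ?thesis using c by (intro T.finsum_singleton) auto
  next
    case False
    then have "(\<Oplus>\<^bsub>T\<^esub>i\<in>{..n}. if p = i then (if p + q = n then t \<phi> \<omega> else \<zero>\<^bsub>T\<^esub>) else \<zero>\<^bsub>T\<^esub>) = (\<Oplus>\<^bsub>T\<^esub>i\<in>{..n}. \<zero>\<^bsub>T\<^esub>)"
      by (intro T.finsum_cong') auto
    then show ?thesis using False by simp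
  qed
  finally show ?thesis .
qed

lemma total_component_homogeneous: "x \<in> homogeneous C n \<Longrightarrow> total_component n x = x"
  by (rule H_ext[OF lin_total_component lin_id[OF T_module]]) (simp_all add: total_component_pure)

lemma total_component_other: "\<lbrakk>x \<in> homogeneous C m; m \<noteq> n\<rbrakk> \<Longrightarrow> total_component n x = \<zero>\<^bsub>T\<^esub>"
  by (rule H_ext[OF lin_total_component lin_const_zero[OF T_module T_module]]) (auto simp: total_component_pure)

lemma C_module: "module K (forms C)" unfolding C_simps by (rule big.module_D)

lemma C_homogeneous_submodule: "submodule (homogeneous C n) K (forms C)"
  unfolding C_simps(1) big.submodule_D_iff by (rule H_submodule)

lemma unique_decomposition:
  assumes x: "x \<in> carrier (forms C)" shows "\<exists>!s. decomposition C x s"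
proof (rule ex_ex1I)
  show "\<exists>s. decomposition C x s"
  proof (rule ex_decomposition[OF C_module C_homogeneous_submodule])
    fix N assume N: "submodule N K (forms C)" and h: "\<And>n. homogeneous C n \<subseteq> N"
    show "x \<in> N"
    proof (rule T_generated)
      show "submodule N K T" using N unfolding C_simps(1) big.submodule_D_iff .
      show "x \<in> carrier T" using x unfolding C_simps(1) big.D_simps .
      show "t \<phi> \<omega> \<in> N" if "\<phi> \<in> HA p" "\<omega> \<in> HB q" for p q \<phi> \<omega>
        using H_pure[OF that] h by blast
    qed
  qed
  have l: "lin K (forms C) (forms C) (total_component n)" for n unfolding C_simps(1) big.lin_D_iff by (rule lin_total_component)
  fix s s' assume s: "decomposition C x s" "decomposition C x s'"
  have e: "\<And>n x. x \<in> homogeneous C n \<Longrightarrow> total_component n x = x" by (rule total_component_homogeneous)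
  have z: "\<And>m n x. \<lbrakk>x \<in> homogeneous C m; m \<noteq> n\<rbrakk> \<Longrightarrow> total_component n x = \<zero>\<^bsub>forms C\<^esub>"
    unfolding C_simps(1) big.D_simps by (rule total_component_other)
  show "s = s'"
    using decomposition_unique[OF C_module C_homogeneous_submodule l e z s(1)] decomposition_unique[OF C_module C_homogeneous_submodule l e z s(2)]
    by simp
qed

lemma homogeneous_times:
  assumes "x \<in> homogeneous C p" "y \<in> homogeneous C q"
  shows "x \<otimes>\<^bsub>big.D\<^esub> y \<in> homogeneous C (p + q)"
proof (rule bilin_maps_span[OF big.bilin_D_mult H_submodule H_gens H_gens _ assms[unfolded C_simps(2)]])
  fix x y assume "x \<in> gens p" "y \<in> gens q"
  then obtain \<phi> \<omega> p1 p2 \<phi>' \<omega>' q1 q2 where xy: "x = t \<phi> \<omega>" "y = t \<phi>' \<omega>'"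
    and h: "\<phi> \<in> HA p1" "\<omega> \<in> HB p2" "\<phi>' \<in> HA q1" "\<omega>' \<in> HB q2" and e: "p1 + p2 = p" "q1 + q2 = q" by blast
  have "x \<otimes>\<^bsub>big.D\<^esub> y = big.Rm \<omega>' (big.Lm \<phi> (Rt (pure K OB OA \<omega> \<phi>')))"
    unfolding xy using h by (intro big.D_mult_pure_factored) (auto simp: cl)
  also have "\<dots> \<in> bideg (p1 + q1) (p2 + q2)" by (intro bideg_Rm bideg_Lm Rt_bidegree h)
  finally have "x \<otimes>\<^bsub>big.D\<^esub> y \<in> homogeneous C ((p1 + q1) + (p2 + q2))" by (rule bideg_H)
  also have "(p1 + q1) + (p2 + q2) = p + q" using e by simp
  finally show "x \<otimes>\<^bsub>big.D\<^esub> y \<in> homogeneous C (p + q)" .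
qed

section \<open>The embedding of the degree zero part\<close>

lemmas iAB_lin = lin_tensor_map[OF a.embed_facts(1) b.embed_facts(1)]
lemmas iAB_pure = tensor_map_pure[OF a.embed_facts(1) b.embed_facts(1)]

lemma embed_mult:
  assumes x: "x \<in> carrier (tensor K A B)" and y: "y \<in> carrier (tensor K A B)"
  shows "embed C (x \<otimes>\<^bsub>alg.D\<^esub> y) = embed C x \<otimes>\<^bsub>big.D\<^esub> embed C y"
proof (rule tensor_ext2[OF alg.mods(1,2,1,2) _ _ _ x y])
  show "bilin K (tensor K A B) (tensor K A B) T (\<lambda>x y. embed C (x \<otimes>\<^bsub>alg.D\<^esub> y))"
    unfolding C_simps by (rule bilin_lin_after[OF alg.bilin_D_mult iAB_lin])
  show "bilin K (tensor K A B) (tensor K A B) T (\<lambda>x y. embed C x \<otimes>\<^bsub>big.D\<^esub> embed C y)"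
    unfolding C_simps by (rule bilin_comp[OF big.bilin_D_mult iAB_lin iAB_lin])
  fix a b a' b' assume h: "a \<in> carrier A" "b \<in> carrier B" "a' \<in> carrier A" "b' \<in> carrier B"
  let ?r = "R (pure K B A b a')"
  have r: "?r \<in> carrier (tensor K A B)" using h by (intro alg.closed)
  note la = bilin_lin(1)[OF alg.A_mult h(1)] bilin_lin(2)[OF alg.B_mult h(4)]
  have i: "iA a \<in> carrier OA" "iB b' \<in> carrier OB" using h by (auto simp: cl)
  note lo = bilin_lin(1)[OF big.A_mult i(1)] bilin_lin(2)[OF big.B_mult i(2)]
  have "embed C (alg.p a b \<otimes>\<^bsub>alg.D\<^esub> alg.p a' b') = tensor_map K OA OB (\<lambda>x. iA (a \<otimes>\<^bsub>A\<^esub> x)) (\<lambda>y. iB (y \<otimes>\<^bsub>B\<^esub> b')) ?r"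
    unfolding C_simps alg.D_mult_pure[OF h] by (rule tensor_map_compose[OF la(1) a.embed_facts(1) la(2) b.embed_facts(1) r])
  also have "\<dots> = tensor_map K OA OB (\<lambda>x. iA a \<otimes>\<^bsub>OA\<^esub> iA x) (\<lambda>y. iB y \<otimes>\<^bsub>OB\<^esub> iB b') ?r"
    using h by (intro tensor_map_cong[OF lin_comp[OF a.embed_facts(1) la(1)] lin_comp[OF b.embed_facts(1) la(2)] _ _ r])
      (auto simp: a.embed_facts b.embed_facts)
  also have "\<dots> = tensor_map K OA OB (\<lambda>x. iA a \<otimes>\<^bsub>OA\<^esub> x) (\<lambda>y. y \<otimes>\<^bsub>OB\<^esub> iB b') (tensor_map K OA OB iA iB ?r)"
    by (rule tensor_map_compose[OF a.embed_facts(1) lo(1) b.embed_facts(1) lo(2) r, symmetric])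
  also have "\<dots> = embed C (alg.p a b) \<otimes>\<^bsub>big.D\<^esub> embed C (alg.p a' b')"
    using h by (simp add: C_simps iAB_pure big.D_mult_pure Rt_embed cl)
  finally show "embed C (alg.p a b \<otimes>\<^bsub>alg.D\<^esub> alg.p a' b') = embed C (alg.p a b) \<otimes>\<^bsub>big.D\<^esub> embed C (alg.p a' b')" .
qed

lemma embed_bijective: "bij_betw (embed C) (carrier (tensor K A B)) (homogeneous C 0)"
proof (rule bij_betwI[where g = "tensor_map K A B a.unembed b.unembed"])
  show "embed C \<in> carrier (tensor K A B) \<rightarrow> homogeneous C 0"
    using embed_bideg bideg_H[of _ 0 0] by (auto simp: C_simps(4))
  show "tensor_map K A B a.unembed b.unembed \<in> homogeneous C 0 \<rightarrow> carrier (tensor K A B)"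
    using lin_closed[OF lin_tensor_map[OF a.lin_unembed b.lin_unembed]] submodule_facts(1)[OF H_submodule] by blast
  show "tensor_map K A B a.unembed b.unembed (embed C x) = x" if x: "x \<in> carrier (tensor K A B)" for x
    unfolding C_simps tensor_map_compose[OF a.embed_facts(1) a.lin_unembed b.embed_facts(1) b.lin_unembed x]
    by (rule tensor_map_id[OF alg.mods(1,2) x a.unembed_embed b.unembed_embed])
  show "embed C (tensor_map K A B a.unembed b.unembed y) = y" if y: "y \<in> homogeneous C 0" for y
  proof (rule H_ext[OF lin_comp[OF iAB_lin[folded C_simps(4)] lin_tensor_map[OF a.lin_unembed b.lin_unembed]] lin_id[OF T_module] _ y])
    fix p q \<phi> \<omega> assume "\<phi> \<in> HA p" "\<omega> \<in> HB q" "p + q = 0"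
    then obtain a b where "a \<in> carrier A" "b \<in> carrier B" "\<phi> = iA a" "\<omega> = iB b"
      using a.embed_facts(6) b.embed_facts(6) by auto
    then show "embed C (tensor_map K A B a.unembed b.unembed (t \<phi> \<omega>)) = t \<phi> \<omega>"
      by (simp add: tensor_map_pure[OF a.lin_unembed b.lin_unembed] cl a.unembed_embed b.unembed_embed C_simps iAB_pure)
  qed
qed

section \<open>The differential\<close>

definition "eps = tensor_map K OA OB eA eB"
abbreviation "d1 \<equiv> tensor_map K OA OB dA (\<lambda>\<omega>. \<omega>)"
abbreviation "d2 \<equiv> tensor_map K OA OB eA dB"

lemmas d1_lin = lin_tensor_map[OF a.lin_differential lin_id[OF b.W_module]]
lemmas d2_lin = lin_tensor_map[OF a.lin_parity b.lin_differential]
lemmas d1_pure = tensor_map_pure[OF a.lin_differential lin_id[OF b.W_module]]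
lemmas d2_pure = tensor_map_pure[OF a.lin_parity b.lin_differential]

lemma lin_eps: "lin K T T eps" unfolding eps_def by (rule lin_tensor_map[OF a.lin_parity b.lin_parity])

lemma eps_pure: "\<lbrakk>\<phi> \<in> carrier OA; \<omega> \<in> carrier OB\<rbrakk> \<Longrightarrow> eps (t \<phi> \<omega>) = t (eA \<phi>) (eB \<omega>)"
  unfolding eps_def by (rule tensor_map_pure[OF a.lin_parity b.lin_parity])

lemma bilin_differential: "bilin K OA OB T (\<lambda>\<phi> \<omega>. t (dA \<phi>) \<omega> \<oplus>\<^bsub>T\<^esub> t (eA \<phi>) (dB \<omega>))"
  by (intro bilinI a.W_module b.W_module T_module lin_plus bilin_lin(1)[OF big.p_bilin] bilin_lin_comp[OF big.p_bilin]
      a.lin_differential b.lin_differential a.lin_parity clo)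

lemma lin_dC: "lin K T T (differential C)"
  unfolding C_simps by (rule lin_tensor_lift[OF a.W_module b.W_module bilin_differential])

lemma dC_pure: "\<lbrakk>\<phi> \<in> carrier OA; \<omega> \<in> carrier OB\<rbrakk> \<Longrightarrow> differential C (t \<phi> \<omega>) = t (dA \<phi>) \<omega> \<oplus>\<^bsub>T\<^esub> t (eA \<phi>) (dB \<omega>)"
  unfolding C_simps by (rule tensor_lift_pure[OF a.W_module b.W_module bilin_differential])

lemma dC_eq: "x \<in> carrier T \<Longrightarrow> differential C x = d1 x \<oplus>\<^bsub>T\<^esub> d2 x"
  by (rule tensor_ext[OF a.W_module b.W_module lin_dC lin_plus[OF d1_lin d2_lin]])
    (simp_all add: dC_pure d1_pure d2_pure)

lemmas cld = clo lin_closed[OF lin_dC] lin_closed[OF lin_eps] lin_closed[OF d1_lin] lin_closed[OF d2_lin] module_closed[OF T_module]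
  lin_closed[OF a.lin_signed] lin_closed[OF b.lin_signed]

lemma t_add:
  "\<lbrakk>\<phi> \<in> carrier OA; \<phi>' \<in> carrier OA; \<omega> \<in> carrier OB\<rbrakk> \<Longrightarrow> t (\<phi> \<oplus>\<^bsub>OA\<^esub> \<phi>') \<omega> = t \<phi> \<omega> \<oplus>\<^bsub>T\<^esub> t \<phi>' \<omega>"
  "\<lbrakk>\<phi> \<in> carrier OA; \<omega> \<in> carrier OB; \<omega>' \<in> carrier OB\<rbrakk> \<Longrightarrow> t \<phi> (\<omega> \<oplus>\<^bsub>OB\<^esub> \<omega>') = t \<phi> \<omega> \<oplus>\<^bsub>T\<^esub> t \<phi> \<omega>'"
  "\<lbrakk>\<phi> \<in> carrier OA; \<omega> \<in> carrier OB\<rbrakk> \<Longrightarrow> t (\<ominus>\<^bsub>OA\<^esub> \<phi>) \<omega> = \<ominus>\<^bsub>T\<^esub> t \<phi> \<omega>"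
  "\<lbrakk>\<phi> \<in> carrier OA; \<omega> \<in> carrier OB\<rbrakk> \<Longrightarrow> t \<phi> (\<ominus>\<^bsub>OB\<^esub> \<omega>) = \<ominus>\<^bsub>T\<^esub> t \<phi> \<omega>"
  using lin_add[OF bilin_lin(2)[OF big.p_bilin]] lin_add[OF bilin_lin(1)[OF big.p_bilin]]
    lin_minus[OF bilin_lin(2)[OF big.p_bilin]] lin_minus[OF bilin_lin(1)[OF big.p_bilin]] by auto

lemma signed_C: "signed C n x = (if even n then x else \<ominus>\<^bsub>T\<^esub> x)"
  by (simp add: signed_def C_simps big.D_finsum)

lemma lin_signed_C: "lin K T T (signed C n)"
  unfolding signed_C[abs_def] using lin_id[OF T_module] lin_uminus[OF lin_id[OF T_module]] by (cases "even n") simp_all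

lemma signed_C_signed_C: "x \<in> carrier T \<Longrightarrow> signed C n (signed C n x) = x"
  using module.axioms(2)[OF T_module] by (auto simp: signed_C abelian_group.minus_minus)

lemma t_signed:
  assumes "\<phi> \<in> carrier OA" "\<omega> \<in> carrier OB"
  shows "t (signed (omega K A) p \<phi>) \<omega> = signed C p (t \<phi> \<omega>)" "t \<phi> (signed (omega K B) p \<omega>) = signed C p (t \<phi> \<omega>)"
  using assms by (auto simp: signed_def[of "omega K A"] signed_def[of "omega K B"] signed_C t_add)

lemma signed_C_add: "x \<in> carrier T \<Longrightarrow> signed C p (signed C q x) = signed C (p + q) x"
  using module.axioms(2)[OF T_module] by (auto simp: signed_C abelian_group.minus_minus)

lemma eps_homogeneous: "x \<in> homogeneous C n \<Longrightarrow> eps x = signed C n x"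
proof (rule H_ext[OF lin_eps lin_signed_C])
  fix p q \<phi> \<omega> assume h: "\<phi> \<in> HA p" "\<omega> \<in> HB q" "p + q = n"
  then have c: "\<phi> \<in> carrier OA" "\<omega> \<in> carrier OB" by (auto simp: cl)
  show "eps (t \<phi> \<omega>) = signed C n (t \<phi> \<omega>)"
    using h c by (simp add: eps_pure a.parity_homogeneous b.parity_homogeneous t_signed cld signed_C_add add.commute)
qed

lemma dC_degree:
  assumes "x \<in> homogeneous C n" shows "differential C x \<in> homogeneous C (Suc n)"
proof (rule H_map[OF lin_dC H_submodule _ assms])
  fix p q \<phi> \<omega> assume h: "\<phi> \<in> HA p" "\<omega> \<in> HB q" "p + q = n"
  have "t (dA \<phi>) \<omega> \<in> homogeneous C (Suc p + q)" "t (signed (omega K A) p \<phi>) (dB \<omega>) \<in> homogeneous C (p + Suc q)"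
    by (intro H_pure a.differential_degree b.differential_degree a.signed_homogeneous h)+
  then have "t (dA \<phi>) \<omega> \<in> homogeneous C (Suc n)" "t (eA \<phi>) (dB \<omega>) \<in> homogeneous C (Suc n)"
    using h by (simp_all add: a.parity_homogeneous)
  then show "differential C (t \<phi> \<omega>) \<in> homogeneous C (Suc n)"
    using h submodule_facts(3)[OF H_submodule] by (simp add: dC_pure cl)
qed

lemma dC_square: "x \<in> carrier T \<Longrightarrow> differential C (differential C x) = \<zero>\<^bsub>T\<^esub>"
proof (rule tensor_ext[OF a.W_module b.W_module lin_comp[OF lin_dC lin_dC] lin_const_zero[OF T_module T_module]])
  interpret T: module K T by (rule T_module)
  fix \<phi> \<omega> assume c: "\<phi> \<in> carrier OA" "\<omega> \<in> carrier OB"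
  have z: "t \<zero>\<^bsub>OA\<^esub> \<psi> = \<zero>\<^bsub>T\<^esub>" "t \<psi>' \<zero>\<^bsub>OB\<^esub> = \<zero>\<^bsub>T\<^esub>" if "\<psi> \<in> carrier OB" "\<psi>' \<in> carrier OA" for \<psi> \<psi>'
    using lin_zero[OF bilin_lin(1)[OF big.p_bilin that(2)]] lin_zero[OF bilin_lin(2)[OF big.p_bilin that(1)]] by auto
  show "differential C (differential C (t \<phi> \<omega>)) = \<zero>\<^bsub>T\<^esub>"
    using c by (simp add: dC_pure lin_add[OF lin_dC] cld a.differential_square b.differential_square z
        a.parity_differential t_add T.l_neg)
qed

text \<open>The differential obeys a Leibniz rule for left multiplication by \<open>\<Omega>A\<close>, for right
  multiplication by \<open>\<Omega>B\<close> and for \<open>Rt\<close>; a product of pure tensors is composed of these three operations.\<close>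

lemma dC_Lm:
  assumes f: "\<phi> \<in> HA p" and x: "x \<in> carrier T"
  shows "differential C (big.Lm \<phi> x) = big.Lm (dA \<phi>) x \<oplus>\<^bsub>T\<^esub> big.Lm (eA \<phi>) (differential C x)"
proof -
  interpret T: module K T by (rule T_module)
  have c: "\<phi> \<in> carrier OA" "dA \<phi> \<in> carrier OA" "eA \<phi> \<in> carrier OA" using f by (auto simp: cl)
  show ?thesis
  proof (rule tensor_ext[OF a.W_module b.W_module lin_comp[OF lin_dC big.lin_Lm] lin_plus[OF big.lin_Lm lin_comp[OF big.lin_Lm lin_dC]] _ x])
    fix \<alpha> \<beta> assume h: "\<alpha> \<in> carrier OA" "\<beta> \<in> carrier OB"
    show "differential C (big.Lm \<phi> (t \<alpha> \<beta>)) = big.Lm (dA \<phi>) (t \<alpha> \<beta>) \<oplus>\<^bsub>T\<^esub> big.Lm (eA \<phi>) (differential C (t \<alpha> \<beta>))"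
      using h c by (simp add: big.Lm_pure dC_pure cld a.differential_mult[OF f] a.parity_mult[OF f] t_add lin_add[OF big.lin_Lm] T.a_assoc)
  qed (use c in auto)
qed

lemma dC_Rm:
  assumes w: "\<omega> \<in> carrier OB" and x: "x \<in> carrier T"
  shows "differential C (big.Rm \<omega> x) = big.Rm \<omega> (differential C x) \<oplus>\<^bsub>T\<^esub> big.Rm (dB \<omega>) (eps x)"
proof -
  interpret T: module K T by (rule T_module)
  have c: "dB \<omega> \<in> carrier OB" using w by (auto simp: cl)
  show ?thesis
  proof (rule T_ext[OF lin_comp[OF lin_dC big.lin_Rm] lin_plus[OF lin_comp[OF big.lin_Rm lin_dC] lin_comp[OF big.lin_Rm lin_eps]] _ x])
    fix p q \<alpha> \<beta> assume h: "\<alpha> \<in> HA p" and b: "\<beta> \<in> HB q"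
    then have h': "\<alpha> \<in> carrier OA" "\<beta> \<in> carrier OB" by (auto simp: cl)
    show "differential C (big.Rm \<omega> (t \<alpha> \<beta>)) = big.Rm \<omega> (differential C (t \<alpha> \<beta>)) \<oplus>\<^bsub>T\<^esub> big.Rm (dB \<omega>) (eps (t \<alpha> \<beta>))"
      using h' c w by (simp add: big.Rm_pure dC_pure cld b.differential_mult[OF b] eps_pure t_add lin_add[OF big.lin_Rm] T.a_assoc)
  qed (use c w in auto)
qed

lemma bilin_Rt: "bilin K OB OA T (\<lambda>\<omega> \<phi>. Rt (pure K OB OA \<omega> \<phi>))"
  by (rule bilin_lin_after[OF big.BA_pure big.lin_R])

lemma Rt_signed:
  assumes "\<omega> \<in> carrier OB" "\<phi> \<in> carrier OA"
  shows "Rt (pure K OB OA (signed (omega K B) p \<omega>) \<phi>) = signed C p (Rt (pure K OB OA \<omega> \<phi>))"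
    and "Rt (pure K OB OA \<omega> (signed (omega K A) p \<phi>)) = signed C p (Rt (pure K OB OA \<omega> \<phi>))"
  using assms lin_minus[OF bilin_lin(1)[OF bilin_Rt]] lin_minus[OF bilin_lin(2)[OF bilin_Rt]]
  by (auto simp: signed_def[of "omega K A"] signed_def[of "omega K B"] signed_C)

text \<open>Compatibility of \<open>Rt\<close> with \<open>d\<^sub>A\<close> produces the sign \<open>\<epsilon>\<close> on the right factor of \<open>Rt(\<omega> \<otimes> \<phi>)\<close>.
  That factor has the degree of \<open>\<omega>\<close>, since \<open>Rt\<close> preserves bidegrees, so the sign can be moved to \<open>\<omega>\<close>.\<close>

lemma dC_Rt:
  assumes w: "\<omega> \<in> HB q" and f: "\<phi> \<in> HA p"
  shows "differential C (Rt (pure K OB OA \<omega> \<phi>)) = Rt (pure K OB OA (eB \<omega>) (dA \<phi>)) \<oplus>\<^bsub>T\<^esub> Rt (pure K OB OA (dB \<omega>) \<phi>)"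
proof -
  have c: "\<omega> \<in> carrier OB" "\<phi> \<in> carrier OA" using w f by (auto simp: cl)
  let ?r = "Rt (pure K OB OA \<omega> \<phi>)"
  have rc: "?r \<in> carrier T" using c by (intro clo)
  have "Rt (pure K OB OA \<omega> (dA \<phi>)) = tensor_map K OA OB dA eB ?r" by (rule Rt_differential(2)[OF c])
  also have "\<dots> = signed C q (d1 ?r)"
  proof (rule bideg_ext[OF lin_tensor_map[OF a.lin_differential b.lin_parity] lin_comp[OF lin_signed_C d1_lin] _ Rt_bidegree[OF w f]])
    fix \<alpha> \<beta> assume h: "\<alpha> \<in> HA p" "\<beta> \<in> HB q"
    then have "\<alpha> \<in> carrier OA" "\<beta> \<in> carrier OB" by (auto simp: cl)
    then show "tensor_map K OA OB dA eB (t \<alpha> \<beta>) = signed C q (d1 (t \<alpha> \<beta>))"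
      using h by (simp add: tensor_map_pure[OF a.lin_differential b.lin_parity] d1_pure b.parity_homogeneous t_signed cld)
  qed
  finally have "Rt (pure K OB OA (eB \<omega>) (dA \<phi>)) = d1 ?r"
    using c rc w by (simp add: b.parity_homogeneous Rt_signed cld signed_C_signed_C)
  then show ?thesis using Rt_differential(1)[OF c] rc by (simp add: dC_eq)
qed

lemma eps_Rt:
  assumes w: "\<omega> \<in> HB q" and f: "\<phi> \<in> HA p"
  shows "eps (Rt (pure K OB OA \<omega> \<phi>)) = Rt (pure K OB OA (eB \<omega>) (eA \<phi>))"
proof -
  have c: "\<omega> \<in> carrier OB" "\<phi> \<in> carrier OA" using w f by (auto simp: cl)
  have "eps (Rt (pure K OB OA \<omega> \<phi>)) = signed C (p + q) (Rt (pure K OB OA \<omega> \<phi>))"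
    by (rule eps_homogeneous[OF bideg_H[OF Rt_bidegree[OF w f]]])
  then show ?thesis using c w f
    by (simp add: b.parity_homogeneous a.parity_homogeneous Rt_signed cld signed_C_add add.commute)
qed

lemma eps_Lm:
  assumes f: "\<phi> \<in> HA p" and x: "x \<in> carrier T"
  shows "eps (big.Lm \<phi> x) = big.Lm (eA \<phi>) (eps x)"
proof -
  have c: "\<phi> \<in> carrier OA" "eA \<phi> \<in> carrier OA" using f by (auto simp: cl)
  show ?thesis
    by (rule tensor_ext[OF a.W_module b.W_module lin_comp[OF lin_eps big.lin_Lm] lin_comp[OF big.lin_Lm lin_eps] _ x])
      (simp_all add: c big.Lm_pure eps_pure cld a.parity_mult[OF f])
qed

text \<open>With \<open>(\<phi> \<otimes> \<omega>)(\<phi>' \<otimes> \<omega>') = \<phi> Rt(\<omega> \<otimes> \<phi>') \<omega>'\<close> the three Leibniz rules give four terms on the left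
  side, which are the four terms of the right side.\<close>

lemma dC_mult:
  assumes x: "x \<in> carrier T" and y: "y \<in> carrier T"
  shows "differential C (x \<otimes>\<^bsub>big.D\<^esub> y) = differential C x \<otimes>\<^bsub>big.D\<^esub> y \<oplus>\<^bsub>T\<^esub> eps x \<otimes>\<^bsub>big.D\<^esub> differential C y"
proof -
  interpret T: module K T by (rule T_module)
  note m = big.bilin_D_mult
  have pp: "differential C (t \<phi> \<omega> \<otimes>\<^bsub>big.D\<^esub> t \<phi>' \<omega>') =
      differential C (t \<phi> \<omega>) \<otimes>\<^bsub>big.D\<^esub> t \<phi>' \<omega>' \<oplus>\<^bsub>T\<^esub> eps (t \<phi> \<omega>) \<otimes>\<^bsub>big.D\<^esub> differential C (t \<phi>' \<omega>')"
    if h: "\<phi> \<in> HA p" "\<omega> \<in> HB q" "\<phi>' \<in> HA p'" "\<omega>' \<in> HB q'" for \<phi> \<omega> \<phi>' \<omega>' p q p' q'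
  proof -
    have c: "\<phi> \<in> carrier OA" "\<omega> \<in> carrier OB" "\<phi>' \<in> carrier OA" "\<omega>' \<in> carrier OB" using h by (auto simp: cl)
    let ?r = "\<lambda>\<omega> \<phi>. Rt (pure K OB OA \<omega> \<phi>)"
    have "differential C (t \<phi> \<omega> \<otimes>\<^bsub>big.D\<^esub> t \<phi>' \<omega>') = differential C (big.Rm \<omega>' (big.Lm \<phi> (?r \<omega> \<phi>')))"
      by (simp add: big.D_mult_pure_factored c)
    also have "\<dots> = (big.Rm \<omega>' (big.Lm (dA \<phi>) (?r \<omega> \<phi>')) \<oplus>\<^bsub>T\<^esub> big.Rm \<omega>' (big.Lm (eA \<phi>) (?r (dB \<omega>) \<phi>'))) \<oplus>\<^bsub>T\<^esub>
        (big.Rm \<omega>' (big.Lm (eA \<phi>) (?r (eB \<omega>) (dA \<phi>'))) \<oplus>\<^bsub>T\<^esub> big.Rm (dB \<omega>') (big.Lm (eA \<phi>) (?r (eB \<omega>) (eA \<phi>'))))"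
      using c by (simp add: dC_Rm dC_Lm[OF h(1)] dC_Rt[OF h(2,3)] eps_Lm[OF h(1)] eps_Rt[OF h(2,3)] cld
          lin_add[OF big.lin_Lm] lin_add[OF big.lin_Rm] T.a_ac)
    also have "\<dots> = differential C (t \<phi> \<omega>) \<otimes>\<^bsub>big.D\<^esub> t \<phi>' \<omega>' \<oplus>\<^bsub>T\<^esub> eps (t \<phi> \<omega>) \<otimes>\<^bsub>big.D\<^esub> differential C (t \<phi>' \<omega>')"
      using c by (simp add: dC_pure eps_pure cld big.D_mult_pure_factored lin_add[OF bilin_lin(1)[OF m]] lin_add[OF bilin_lin(2)[OF m]])
    finally show ?thesis .
  qed
  have l1: "lin K T T (\<lambda>y. differential C (x \<otimes>\<^bsub>big.D\<^esub> y))" "lin K T T (\<lambda>y. differential C x \<otimes>\<^bsub>big.D\<^esub> y \<oplus>\<^bsub>T\<^esub> eps x \<otimes>\<^bsub>big.D\<^esub> differential C y)"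
    if "x \<in> carrier T" for x
    by (rule lin_comp[OF lin_dC bilin_lin(1)[OF m that]]
        lin_plus[OF bilin_lin(1)[OF m lin_closed[OF lin_dC that]] bilin_lin_comp(1)[OF m lin_closed[OF lin_eps that] lin_dC]])+
  have l2: "lin K T T (\<lambda>x. differential C (x \<otimes>\<^bsub>big.D\<^esub> y))" "lin K T T (\<lambda>x. differential C x \<otimes>\<^bsub>big.D\<^esub> y \<oplus>\<^bsub>T\<^esub> eps x \<otimes>\<^bsub>big.D\<^esub> differential C y)"
    by (rule lin_comp[OF lin_dC bilin_lin(2)[OF m y]]
        lin_plus[OF bilin_lin_comp(2)[OF m y lin_dC] bilin_lin_comp(2)[OF m lin_closed[OF lin_dC y] lin_eps]])+
  show ?thesis
  proof (rule T_ext[OF l2 _ x])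
    fix p q \<phi> \<omega> assume h: "\<phi> \<in> HA p" "\<omega> \<in> HB q"
    then have c: "t \<phi> \<omega> \<in> carrier T" by (auto simp: cl)
    show "differential C (t \<phi> \<omega> \<otimes>\<^bsub>big.D\<^esub> y) = differential C (t \<phi> \<omega>) \<otimes>\<^bsub>big.D\<^esub> y \<oplus>\<^bsub>T\<^esub> eps (t \<phi> \<omega>) \<otimes>\<^bsub>big.D\<^esub> differential C y"
      by (rule T_ext[OF l1[OF c] pp[OF h] y])
  qed
qed

section \<open>The twisted calculus\<close>

text \<open>Every pure tensor is \<open>(\<phi> \<otimes> 1)(1 \<otimes> \<omega>)\<close>, and both factors are reached because \<open>\<Omega>A\<close> and \<open>\<Omega>B\<close> are
  generated in degree zero.\<close>

lemma C_generated:
  assumes S: "submodule S K (forms C)" and e: "embed C ` carrier alg.D \<subseteq> S"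
    and m: "\<And>\<phi> \<psi>. \<lbrakk>\<phi> \<in> S; \<psi> \<in> S\<rbrakk> \<Longrightarrow> \<phi> \<otimes>\<^bsub>forms C\<^esub> \<psi> \<in> S"
    and d: "\<And>\<phi>. \<phi> \<in> S \<Longrightarrow> differential C \<phi> \<in> S"
  shows "S = carrier (forms C)"
proof -
  note m' = m[unfolded C_simps(1)]
  have S': "submodule S K T" using S unfolding C_simps(1) big.submodule_D_iff .
  interpret T: module K T by (rule T_module)
  have ep: "t (iA a) (iB b) \<in> S" if "a \<in> carrier A" "b \<in> carrier B" for a b
  proof -
    have "alg.p a b \<in> carrier alg.D" using that by (simp add: alg.D_simps alg.closed)
    then have "embed C (alg.p a b) \<in> S" using e by blast
    then show ?thesis using that by (simp add: C_simps iAB_pure)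
  qed
  have z: "t \<psi> \<zero>\<^bsub>OB\<^esub> = \<zero>\<^bsub>T\<^esub>" if "\<psi> \<in> carrier OA" for \<psi>
    by (rule lin_zero[OF bilin_lin(1)[OF big.p_bilin that]])
  have z': "t \<zero>\<^bsub>OA\<^esub> \<psi> = \<zero>\<^bsub>T\<^esub>" if "\<psi> \<in> carrier OB" for \<psi>
    by (rule lin_zero[OF bilin_lin(2)[OF big.p_bilin that]])
  let ?SA = "{\<phi> \<in> carrier OA. t \<phi> \<one>\<^bsub>OB\<^esub> \<in> S}"
  have SA: "?SA = carrier OA"
  proof (rule a.generated)
    show "submodule ?SA K OA" by (rule submodule_vimage[OF bilin_lin(2)[OF big.p_bilin big.closed(2)] S'])
    show "iA ` carrier A \<subseteq> ?SA" using ep[of _ "\<one>\<^bsub>B\<^esub>"] by (auto simp: cl b.embed_facts)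
    show "\<phi> \<otimes>\<^bsub>OA\<^esub> \<psi> \<in> ?SA" if "\<phi> \<in> ?SA" "\<psi> \<in> ?SA" for \<phi> \<psi>
      using that m'[of "t \<phi> \<one>\<^bsub>OB\<^esub>" "t \<psi> \<one>\<^bsub>OB\<^esub>"] by (simp add: big.left_mult_eq cl big.Lm_pure)
    show "dA \<phi> \<in> ?SA" if "\<phi> \<in> ?SA" for \<phi>
      using that d[of "t \<phi> \<one>\<^bsub>OB\<^esub>"] by (simp add: dC_pure cl b.differential_one z)
  qed
  let ?SB = "{\<omega> \<in> carrier OB. t \<one>\<^bsub>OA\<^esub> \<omega> \<in> S}"
  have e1: "eA \<one>\<^bsub>OA\<^esub> = \<one>\<^bsub>OA\<^esub>"
  proof -
    have "\<one>\<^bsub>OA\<^esub> \<in> HA 0" using a.embed_facts(2)[of "\<one>\<^bsub>A\<^esub>"] by (simp add: a.embed_facts)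
    then show ?thesis by (simp add: a.parity_homogeneous signed_def)
  qed
  have SB: "?SB = carrier OB"
  proof (rule b.generated)
    show "submodule ?SB K OB" by (rule submodule_vimage[OF bilin_lin(1)[OF big.p_bilin big.closed(1)] S'])
    show "iB ` carrier B \<subseteq> ?SB" using ep[of "\<one>\<^bsub>A\<^esub>"] by (auto simp: cl a.embed_facts)
    show "\<phi> \<otimes>\<^bsub>OB\<^esub> \<psi> \<in> ?SB" if "\<phi> \<in> ?SB" "\<psi> \<in> ?SB" for \<phi> \<psi>
      using that m'[of "t \<one>\<^bsub>OA\<^esub> \<phi>" "t \<one>\<^bsub>OA\<^esub> \<psi>"] by (simp add: big.right_mult_eq cl big.Rm_pure)
    show "dB \<omega> \<in> ?SB" if "\<omega> \<in> ?SB" for \<omega>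
      using that d[of "t \<one>\<^bsub>OA\<^esub> \<omega>"] by (simp add: dC_pure cl a.differential_one z' e1)
  qed
  have "carrier T \<subseteq> S"
  proof
    fix x assume x: "x \<in> carrier T"
    show "x \<in> S"
    proof (rule tensor_generated[OF a.W_module b.W_module S' _ x])
      fix \<phi> \<omega> assume c: "\<phi> \<in> carrier OA" "\<omega> \<in> carrier OB"
      then have "t \<phi> \<one>\<^bsub>OB\<^esub> \<in> S" "t \<one>\<^bsub>OA\<^esub> \<omega> \<in> S" using SA SB by blast+
      then show "t \<phi> \<omega> \<in> S" using m' big.pure_eq_mult[OF c] by simp
    qed
  qed
  then show ?thesis using submodule_facts(1)[OF S'] by (auto simp: C_simps(1) big.D_simps)
qed

lemma twisted_calculus: "differential_calculus K alg.D C"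
proof (intro differential_calculus.intro differential_calculus_axioms.intro)
  show "k_algebra K alg.D" by (rule alg.twisted_tensor_algebra)
  show "k_algebra K (forms C)" unfolding C_simps by (rule big.twisted_tensor_algebra)
  show "submodule (homogeneous C n) K (forms C)" for n by (rule C_homogeneous_submodule)
  show "\<exists>!s. decomposition C \<omega> s" if "\<omega> \<in> carrier (forms C)" for \<omega> using that by (rule unique_decomposition)
  show "\<phi> \<otimes>\<^bsub>forms C\<^esub> \<psi> \<in> homogeneous C (p + q)" if "\<phi> \<in> homogeneous C p" "\<psi> \<in> homogeneous C q" for \<phi> \<psi> p q
    unfolding C_simps(1) by (rule homogeneous_times[OF that])
  show "linear_map K alg.D (forms C) (embed C)"
    using iAB_lin unfolding C_simps by (intro lin_linear_map) (simp add: alg.lin_D_iff big.lin_D_iff)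
  show "embed C \<in> ring_hom alg.D (forms C)"
  proof (rule ring_hom_memI)
    fix x y assume h: "x \<in> carrier alg.D" "y \<in> carrier alg.D"
    show "embed C x \<in> carrier (forms C)" using h lin_closed[OF iAB_lin] by (simp add: C_simps big.D_simps alg.D_simps)
    show "embed C (x \<otimes>\<^bsub>alg.D\<^esub> y) = embed C x \<otimes>\<^bsub>forms C\<^esub> embed C y"
      using h unfolding C_simps(1) alg.D_simps by (rule embed_mult)
    show "embed C (x \<oplus>\<^bsub>alg.D\<^esub> y) = embed C x \<oplus>\<^bsub>forms C\<^esub> embed C y"
      using h by (simp add: C_simps big.D_simps alg.D_simps lin_add[OF iAB_lin])
  next
    show "embed C \<one>\<^bsub>alg.D\<^esub> = \<one>\<^bsub>forms C\<^esub>"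
      by (simp add: C_simps big.D_simps alg.D_simps iAB_pure alg.closed a.embed_facts b.embed_facts)
  qed
  show "bij_betw (embed C) (carrier alg.D) (homogeneous C 0)" unfolding alg.D_simps by (rule embed_bijective)
  show "linear_map K (forms C) (forms C) (differential C)"
    using lin_dC unfolding C_simps(1) by (intro lin_linear_map) (simp add: big.lin_D_iff)
  show "differential C \<phi> \<in> homogeneous C (Suc p)" if "\<phi> \<in> homogeneous C p" for \<phi> p using that by (rule dC_degree)
  show "differential C (differential C \<phi>) = \<zero>\<^bsub>forms C\<^esub>" if "\<phi> \<in> carrier (forms C)" for \<phi>
    using that dC_square unfolding C_simps(1) big.D_simps by blast
  show "differential C (\<phi> \<otimes>\<^bsub>forms C\<^esub> \<psi>) = differential C \<phi> \<otimes>\<^bsub>forms C\<^esub> \<psi> \<oplus>\<^bsub>forms C\<^esub> signed C p (\<phi> \<otimes>\<^bsub>forms C\<^esub> differential C \<psi>)"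
    if h: "\<phi> \<in> homogeneous C p" "\<psi> \<in> carrier (forms C)" for \<phi> \<psi> p
  proof -
    have c: "\<phi> \<in> carrier T" "\<psi> \<in> carrier T" "differential C \<psi> \<in> carrier T"
      using h submodule_facts(1)[OF H_submodule] lin_closed[OF lin_dC] by (auto simp: C_simps(1) big.D_simps)
    have "eps \<phi> \<otimes>\<^bsub>big.D\<^esub> differential C \<psi> = signed C p (\<phi> \<otimes>\<^bsub>big.D\<^esub> differential C \<psi>)"
      using lin_minus[OF bilin_lin(2)[OF big.bilin_D_mult c(3)] c(1)] by (simp add: eps_homogeneous[OF h(1)] signed_C)
    then show ?thesis using dC_mult[OF c(1,2)] unfolding C_simps(1) big.D_simps by simp
  qed
  show "S = carrier (forms C)" if "submodule S K (forms C)" "embed C ` carrier alg.D \<subseteq> S"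
    "\<And>\<phi> \<psi>. \<lbrakk>\<phi> \<in> S; \<psi> \<in> S\<rbrakk> \<Longrightarrow> \<phi> \<otimes>\<^bsub>forms C\<^esub> \<psi> \<in> S" "\<And>\<phi>. \<phi> \<in> S \<Longrightarrow> differential C \<phi> \<in> S" for S
    using that by (rule C_generated)
qed

end

section \<open>The sum module\<close>

locale product_connection = twisted_omega K A B R Rt
  for K :: "'k ring" and A :: "('k, 'a) module" and B :: "('k, 'b) module"
    and R :: "('k, 'b, 'a) tens \<Rightarrow> ('k, 'a, 'b) tens"
    and Rt :: "('k, ('k, 'b) form, ('k, 'a) form) tens \<Rightarrow> ('k, ('k, 'a) form, ('k, 'b) form) tens" +
  fixes E :: "('k, 'e, 'a) right_module" and F :: "('k, 'f, 'b) right_module"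
    and \<tau> :: "('k, 'f, 'a) tens \<Rightarrow> ('k, 'a, 'f) tens"
    and \<sigma> :: "('k, 'a, 'f) tens \<Rightarrow> ('k, 'f, 'a) tens"
    and nablaE :: "'e \<Rightarrow> ('k, 'e, ('k, 'a) form) tens set"
    and nablaF :: "'f \<Rightarrow> ('k, 'f, ('k, 'b) form) tens set"
  assumes R_bij: "bij_betw R (carrier (tensor K B A)) (carrier (tensor K A B))"
    and E_connection: "right_connection K A (omega K A) E nablaE"
    and F_connection: "right_connection K B (omega K B) F nablaF"
    and \<tau>_twisting: "module_twisting_map K A B R F \<tau>"
    and \<sigma>_closed: "\<sigma> \<in> carrier (tensor K A F) \<rightarrow> carrier (tensor K F A)"
    and \<sigma>_\<tau>: "\<forall>t\<in>carrier (tensor K F A). \<sigma> (\<tau> t) = t"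
    and \<tau>_\<sigma>: "\<forall>t\<in>carrier (tensor K A F). \<tau> (\<sigma> t) = t"
    and compatible: "connection_compatible K A B Rt F \<tau> nablaF"

sublocale product_connection \<subseteq> ind: induced_module K A B R E
  using E_connection unfolding right_connection_def
  by (intro induced_module.intro alg.twisted_algebra_axioms induced_module_axioms.intro) simp

sublocale product_connection \<subseteq> tm: twisted_module K A B R F \<tau>
  using F_connection \<tau>_twisting R_twisting unfolding right_connection_def
  by (intro twisted_module.intro a.D.k_algebra_axioms b.D.k_algebra_axioms) simp_all

sublocale product_connection \<subseteq> c: differential_calculus K alg.D C
  by (rule twisted_calculus)

sublocale product_connection \<subseteq> balE: balanced_tensor K A E "one_forms (omega K A)"
  by (intro balanced_tensor.intro a.one_forms_bimod balanced_tensor_axioms.intro ind.E_module)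

sublocale product_connection \<subseteq> balF: balanced_tensor K B F "one_forms (omega K B)"
  by (intro balanced_tensor.intro b.one_forms_bimod balanced_tensor_axioms.intro tm.F_module)

context product_connection
begin

abbreviation "U \<equiv> tensor K E B"
abbreviation "V \<equiv> tensor K A F"
abbreviation "M \<equiv> sum_module K A B R E F \<tau>"
abbreviation "eact \<equiv> induced_act K B R A E"
abbreviation "vact \<equiv> twisted_act K A F \<tau>"

lemma UV: "module K U" "module K V" by (rule ind.U_mod tm.mods(4))+

lemma M_simps:
  "carrier M = carrier U \<times> carrier V" "zero M = (\<zero>\<^bsub>U\<^esub>, \<zero>\<^bsub>V\<^esub>)"
  "x \<oplus>\<^bsub>M\<^esub> y = (fst x \<oplus>\<^bsub>U\<^esub> fst y, snd x \<oplus>\<^bsub>V\<^esub> snd y)"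
  "k \<odot>\<^bsub>M\<^esub> x = (k \<odot>\<^bsub>U\<^esub> fst x, k \<odot>\<^bsub>V\<^esub> snd x)"
  "x \<triangleleft>\<^bsub>M\<^esub> s = (eact (fst x) s, vact (snd x) s)"
  by (simp_all add: sum_module_def Let_def case_prod_beta induced_act_def twisted_act_def)

lemma M_module: "module K M"
proof -
  interpret U: module K U by (rule UV)
  interpret V: module K V by (rule UV)
  have "abelian_group M"
  proof (rule abelian_groupI)
    fix x assume "x \<in> carrier M"
    then show "\<exists>y\<in>carrier M. y \<oplus>\<^bsub>M\<^esub> x = \<zero>\<^bsub>M\<^esub>"
      by (intro bexI[of _ "(\<ominus>\<^bsub>U\<^esub> fst x, \<ominus>\<^bsub>V\<^esub> snd x)"]) (auto simp: M_simps U.l_neg V.l_neg)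
  qed (auto simp: M_simps U.a_ac V.a_ac)
  then show ?thesis
    by (intro moduleI module.axioms(1)[OF UV(1)])
      (auto simp: M_simps U.smult_l_distr V.smult_l_distr U.smult_r_distr V.smult_r_distr U.smult_assoc1 V.smult_assoc1)
qed

lemma lin_pair: "\<lbrakk>lin K X U f; lin K X V g\<rbrakk> \<Longrightarrow> lin K X M (\<lambda>x. (f x, g x))"
  by (rule linI) (auto simp: lin_module M_module M_simps lin_closed lin_add lin_smult)

lemma lin_fst_snd: "lin K M U fst" "lin K M V snd"
  by (rule linI; auto simp: M_module UV M_simps)+

abbreviation "inl u \<equiv> (u, \<zero>\<^bsub>V\<^esub>)"
abbreviation "inr v \<equiv> (\<zero>\<^bsub>U\<^esub>, v)"

lemma lin_inl: "lin K U M (\<lambda>u. inl u)" by (intro lin_pair lin_id lin_const_zero UV)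
lemma lin_inr: "lin K V M (\<lambda>v. inr v)" by (intro lin_pair lin_id lin_const_zero UV)

lemma M_act_inl: "y \<in> carrier (tensor K A B) \<Longrightarrow> inl u \<triangleleft>\<^bsub>M\<^esub> y = inl (eact u y)"
  by (simp add: M_simps lin_zero[OF bilin_lin(2)[OF tm.bilin_act]])

lemma M_act_inr: "y \<in> carrier (tensor K A B) \<Longrightarrow> inr v \<triangleleft>\<^bsub>M\<^esub> y = inr (vact v y)"
  by (simp add: M_simps lin_zero[OF bilin_lin(2)[OF ind.bilin_eact]])

lemma \<tau>_surj: "v \<in> carrier V \<Longrightarrow> \<exists>s \<in> carrier (tensor K F A). \<tau> s = v"
  using \<tau>_\<sigma> \<sigma>_closed by blast

lemma M_right_module: "right_module K alg.D M"
proof (rule right_moduleI[OF alg.twisted_tensor_algebra])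
  show "bilin K M alg.D M (\<lambda>m x. m \<triangleleft>\<^bsub>M\<^esub> x)"
  proof (rule bilinI[OF M_module alg.module_D M_module])
    fix m assume m: "m \<in> carrier M"
    show "lin K alg.D M (\<lambda>x. m \<triangleleft>\<^bsub>M\<^esub> x)" unfolding M_simps alg.lin_D_iff
      using m by (intro lin_pair bilin_lin(1)[OF ind.bilin_eact] bilin_lin(1)[OF tm.bilin_act]) (auto simp: M_simps)
  next
    fix x assume x: "x \<in> carrier alg.D"
    then have x: "x \<in> carrier (tensor K A B)" by (simp add: alg.D_simps)
    show "lin K M M (\<lambda>m. m \<triangleleft>\<^bsub>M\<^esub> x)" unfolding M_simps
      by (intro lin_pair bilin_lin_comp(2)[OF ind.bilin_eact x] bilin_lin_comp(2)[OF tm.bilin_act x] lin_fst_snd)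
  qed
  fix m x y assume "m \<in> carrier M" "x \<in> carrier alg.D" "y \<in> carrier alg.D"
  then show "m \<triangleleft>\<^bsub>M\<^esub> (x \<otimes>\<^bsub>alg.D\<^esub> y) = (m \<triangleleft>\<^bsub>M\<^esub> x) \<triangleleft>\<^bsub>M\<^esub> y"
    by (auto simp: M_simps alg.D_simps ind.eact_assoc tm.act_assoc)
next
  fix m assume "m \<in> carrier M"
  then show "m \<triangleleft>\<^bsub>M\<^esub> \<one>\<^bsub>alg.D\<^esub> = m"
    by (auto simp: M_simps alg.D_simps ind.eact_one tm.act_one_of_surj[OF \<tau>_surj])
qed

end

sublocale product_connection \<subseteq> bal: balanced_tensor K alg.D M "one_forms C"
  by (intro balanced_tensor.intro c.one_forms_bimod balanced_tensor_axioms.intro M_right_module)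

context product_connection
begin

abbreviation "po \<equiv> bal.po"
abbreviation "Z \<equiv> bal.T"
abbreviation "W1 \<equiv> one_forms C"

lemma Z_module: "module K Z" by (rule bal.module_T)

lemma D_carrier: "carrier alg.D = carrier (tensor K A B)" by (rule alg.D_simps)

lemmas Z_act = bal.bilin_over_act

section \<open>One-forms of the twisted calculus\<close>

abbreviation "i1 a \<equiv> alg.p a \<one>\<^bsub>B\<^esub>"
abbreviation "i2 b \<equiv> alg.p \<one>\<^bsub>A\<^esub> b"

lemma i_closed: "a \<in> carrier A \<Longrightarrow> i1 a \<in> carrier (tensor K A B)" "b \<in> carrier B \<Longrightarrow> i2 b \<in> carrier (tensor K A B)"
  by (simp_all add: alg.closed)

lemma embed_i: "a \<in> carrier A \<Longrightarrow> embed C (i1 a) = t (iA a) \<one>\<^bsub>OB\<^esub>" "b \<in> carrier B \<Longrightarrow> embed C (i2 b) = t \<one>\<^bsub>OA\<^esub> (iB b)"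
  by (simp_all add: C_simps iAB_pure alg.closed a.embed_facts b.embed_facts)

lemma one_degree: "\<one>\<^bsub>OA\<^esub> \<in> HA 0" "\<one>\<^bsub>OB\<^esub> \<in> HB 0"
  using a.embed_facts(2)[of "\<one>\<^bsub>A\<^esub>"] b.embed_facts(2)[of "\<one>\<^bsub>B\<^esub>"] by (auto simp: a.embed_facts b.embed_facts)

lemma d0_i: "a \<in> carrier A \<Longrightarrow> d0 C (i1 a) = t (d0 (omega K A) a) \<one>\<^bsub>OB\<^esub>"
  "b \<in> carrier B \<Longrightarrow> d0 C (i2 b) = t \<one>\<^bsub>OA\<^esub> (d0 (omega K B) b)"
proof -
  interpret T: module K T by (rule T_module)
  have e1: "eA \<one>\<^bsub>OA\<^esub> = \<one>\<^bsub>OA\<^esub>" using one_degree by (simp add: a.parity_homogeneous signed_def)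
  show "a \<in> carrier A \<Longrightarrow> d0 C (i1 a) = t (d0 (omega K A) a) \<one>\<^bsub>OB\<^esub>"
    by (simp add: d0_def embed_i dC_pure clo b.differential_one lin_zero[OF bilin_lin(1)[OF big.p_bilin]])
  show "b \<in> carrier B \<Longrightarrow> d0 C (i2 b) = t \<one>\<^bsub>OA\<^esub> (d0 (omega K B) b)"
    by (simp add: d0_def embed_i dC_pure clo a.differential_one e1 lin_zero[OF bilin_lin(2)[OF big.p_bilin]])
qed

lemma t_one_form: "\<lbrakk>\<phi> \<in> HA 1; \<omega> \<in> HB 0\<rbrakk> \<Longrightarrow> t \<phi> \<omega> \<in> carrier W1" "\<lbrakk>\<phi> \<in> HA 0; \<omega> \<in> HB 1\<rbrakk> \<Longrightarrow> t \<phi> \<omega> \<in> carrier W1"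
  using H_pure[of \<phi> 1 \<omega> 0] H_pure[of \<phi> 0 \<omega> 1] by auto

lemma W1_lin:
  assumes f: "lin K X T f" and m: "\<And>x. x \<in> carrier X \<Longrightarrow> f x \<in> carrier W1"
  shows "lin K X W1 f"
  by (rule lin_restrict[OF f lin_module(1)[OF f] order_refl refl refl c.module_one_forms _ _ m]) (simp_all add: C_simps big.D_simps)

lemma lin_incA: "lin K (one_forms (omega K A)) W1 (\<lambda>\<omega>. t \<omega> \<one>\<^bsub>OB\<^esub>)"
  by (rule W1_lin[OF bilin_lin_comp(2)[OF big.p_bilin big.closed(2) a.lin_one_forms_inclusion]])
    (use t_one_form(1)[OF _ one_degree(2)] in simp)

lemma lin_incB: "lin K (one_forms (omega K B)) W1 (\<lambda>\<omega>. t \<one>\<^bsub>OA\<^esub> \<omega>)"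
  by (rule W1_lin[OF bilin_lin_comp(1)[OF big.p_bilin big.closed(1) b.lin_one_forms_inclusion]])
    (use t_one_form(2)[OF one_degree(1)] in simp)

lemma W1_actions:
  "\<omega> \<triangleleft>\<^bsub>W1\<^esub> x = \<omega> \<otimes>\<^bsub>big.D\<^esub> embed C x" "lact W1 x \<omega> = embed C x \<otimes>\<^bsub>big.D\<^esub> \<omega>"
  by (simp_all add: C_simps)

lemmas po_lin = bilin_lin[OF bal.bilin_pure_over]
lemmas po_closed = bilin_closed[OF bal.bilin_pure_over]
lemmas Z_act_closed = bilin_closed[OF Z_act]

lemma lin_d0_W1: "lin K (tensor K A B) W1 (d0 C)"
  using c.lin_d0_one_forms unfolding alg.lin_D_iff .

lemmas d0_closed = lin_closed[OF lin_d0_W1]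

section \<open>Propagating the Leibniz rule\<close>

text \<open>The step by which the Leibniz rule propagates: passing from \<open>(m, z)\<close> to
  \<open>(m x, z x + m \<otimes> dx)\<close> and then doing the same with \<open>y\<close> amounts to doing it once with \<open>x y\<close>.\<close>

lemma leibniz_mult:
  assumes m: "m \<in> carrier M" and z: "z \<in> carrier Z" and x: "x \<in> carrier (tensor K A B)" and y: "y \<in> carrier (tensor K A B)"
  shows "(z \<triangleleft>\<^bsub>Z\<^esub> x \<oplus>\<^bsub>Z\<^esub> po m (d0 C x)) \<triangleleft>\<^bsub>Z\<^esub> y \<oplus>\<^bsub>Z\<^esub> po (m \<triangleleft>\<^bsub>M\<^esub> x) (d0 C y)
    = z \<triangleleft>\<^bsub>Z\<^esub> (x \<otimes>\<^bsub>alg.D\<^esub> y) \<oplus>\<^bsub>Z\<^esub> po m (d0 C (x \<otimes>\<^bsub>alg.D\<^esub> y))"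
proof -
  interpret Z: module K Z by (rule Z_module)
  have xD: "x \<in> carrier alg.D" "y \<in> carrier alg.D" using x y by (auto simp: D_carrier)
  have d: "d0 C x \<in> carrier W1" "d0 C y \<in> carrier W1" by (rule d0_closed[OF x] d0_closed[OF y])+
  have "d0 C x \<triangleleft>\<^bsub>W1\<^esub> y \<in> carrier W1" "lact W1 x (d0 C y) \<in> carrier W1"
    using bilin_closed[OF bal.ract_bilin d(1) xD(2)] bilin_closed[OF bal.lact_bilin xD(1) d(2)] .
  note cl = this d m z xD po_closed Z_act_closed bilin_closed[OF bal.M_bilin]
  have "d0 C (x \<otimes>\<^bsub>alg.D\<^esub> y) = d0 C x \<triangleleft>\<^bsub>W1\<^esub> y \<oplus>\<^bsub>W1\<^esub> lact W1 x (d0 C y)"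
    using c.d0_mult[OF xD] by simp
  then have "po m (d0 C (x \<otimes>\<^bsub>alg.D\<^esub> y)) = po m (d0 C x \<triangleleft>\<^bsub>W1\<^esub> y) \<oplus>\<^bsub>Z\<^esub> po m (lact W1 x (d0 C y))"
    using lin_add[OF po_lin(1)[OF m]] cl(1,2) by presburger
  moreover have "(z \<triangleleft>\<^bsub>Z\<^esub> x \<oplus>\<^bsub>Z\<^esub> po m (d0 C x)) \<triangleleft>\<^bsub>Z\<^esub> y = z \<triangleleft>\<^bsub>Z\<^esub> (x \<otimes>\<^bsub>alg.D\<^esub> y) \<oplus>\<^bsub>Z\<^esub> po m (d0 C x \<triangleleft>\<^bsub>W1\<^esub> y)"
    using lin_add[OF bal.lin_over_act[OF xD(2)], of "z \<triangleleft>\<^bsub>Z\<^esub> x" "po m (d0 C x)"] bal.over_act_mult[OF xD z]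
      bal.over_act_pure[OF xD(2) m d(1)] cl(9,10) m z d xD by presburger
  moreover have "po (m \<triangleleft>\<^bsub>M\<^esub> x) (d0 C y) = po m (lact W1 x (d0 C y))"
    by (rule bal.pure_over_balanced[OF m xD(1) d(2)])
  moreover have "z \<triangleleft>\<^bsub>Z\<^esub> (x \<otimes>\<^bsub>alg.D\<^esub> y) \<in> carrier Z"
    using Z_act_closed[OF z] alg.closed(8)[OF x y] by (simp add: D_carrier)
  ultimately show ?thesis
    using po_closed[OF m cl(1)] po_closed[OF m cl(2)] by (simp add: Z.a_assoc)
qed

text \<open>The carrier of the one-forms stays folded from here on, so that the closure rules stated for it
  apply.\<close>

declare a.one_forms_simps(1)[simp del] b.one_forms_simps(1)[simp del] c.one_forms_simps[simp del]

abbreviation "WA \<equiv> one_forms (omega K A)"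
abbreviation "WB \<equiv> one_forms (omega K B)"
abbreviation "ZE \<equiv> balE.T"
abbreviation "ZF \<equiv> balF.T"
abbreviation "dA0 \<equiv> d0 (omega K A)"
abbreviation "dB0 \<equiv> d0 (omega K B)"

lemmas WA_closed = lin_closed[OF a.lin_one_forms_inclusion]
lemmas WB_closed = lin_closed[OF b.lin_one_forms_inclusion]
lemmas dA0_closed = lin_closed[OF a.lin_d0_one_forms]
lemmas dB0_closed = lin_closed[OF b.lin_d0_one_forms]
lemmas incA_closed = lin_closed[OF lin_incA]
lemmas incB_closed = lin_closed[OF lin_incB]

lemma WB_homogeneous: "\<eta> \<in> carrier WB \<longleftrightarrow> \<eta> \<in> HB 1" by (simp only: b.one_forms_simps)

lemma nablaE: "lin K E ZE nablaE"
  "\<lbrakk>e \<in> carrier E; a \<in> carrier A\<rbrakk> \<Longrightarrow> nablaE (e \<triangleleft>\<^bsub>E\<^esub> a) = nablaE e \<triangleleft>\<^bsub>ZE\<^esub> a \<oplus>\<^bsub>ZE\<^esub> balE.po e (dA0 a)"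
  using E_connection balE.module_T ind.E_mod unfolding right_connection_def lin_def by auto

lemma nablaF: "lin K F ZF nablaF"
  "\<lbrakk>g \<in> carrier F; b \<in> carrier B\<rbrakk> \<Longrightarrow> nablaF (g \<triangleleft>\<^bsub>F\<^esub> b) = nablaF g \<triangleleft>\<^bsub>ZF\<^esub> b \<oplus>\<^bsub>ZF\<^esub> balF.po g (dB0 b)"
  using F_connection balF.module_T tm.mods(3) unfolding right_connection_def lin_def by auto

abbreviation "mE e \<equiv> inl (pure K E B e \<one>\<^bsub>B\<^esub>)"
abbreviation "mF a g \<equiv> inr (pure K A F a g)"

lemma lin_mE: "lin K E M (\<lambda>e. mE e)"
  by (rule lin_comp[OF lin_inl bilin_lin(2)[OF ind.U_pure alg.closed(2)]])

lemma lin_mF: "a \<in> carrier A \<Longrightarrow> lin K F M (\<lambda>g. mF a g)" "g \<in> carrier F \<Longrightarrow> lin K A M (\<lambda>a. mF a g)"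
  by (rule lin_comp[OF lin_inr bilin_lin(1)[OF tm.V_pure]], assumption)
    (rule lin_comp[OF lin_inr bilin_lin(2)[OF tm.V_pure]], assumption)

lemmas mE_closed = lin_closed[OF lin_mE]
lemmas mF_closed = lin_closed[OF lin_mF(1)]

lemma D_one: "y \<in> carrier (tensor K A B) \<Longrightarrow> alg.p \<one>\<^bsub>A\<^esub> \<one>\<^bsub>B\<^esub> \<otimes>\<^bsub>alg.D\<^esub> y = y"
  using monoid.l_one[OF ring.is_monoid[OF k_algebra_ring[OF alg.twisted_tensor_algebra]], of y] by (simp add: alg.D_simps)

lemma mE_act: "\<lbrakk>e \<in> carrier E; y \<in> carrier (tensor K A B)\<rbrakk> \<Longrightarrow> mE e \<triangleleft>\<^bsub>M\<^esub> y = inl (ind.inc e y)"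
  by (simp add: M_act_inl ind.eact_pure alg.closed D_one)

lemma mE_ract: "\<lbrakk>e \<in> carrier E; a \<in> carrier A\<rbrakk> \<Longrightarrow> mE (e \<triangleleft>\<^bsub>E\<^esub> a) = mE e \<triangleleft>\<^bsub>M\<^esub> i1 a"
  by (simp add: mE_act i_closed ind.inc_pure alg.closed)

lemma vact_i2: "\<lbrakk>a \<in> carrier A; g \<in> carrier F; b \<in> carrier B\<rbrakk> \<Longrightarrow> vact (pure K A F a g) (i2 b) = pure K A F a (g \<triangleleft>\<^bsub>F\<^esub> b)"
proof -
  assume h: "a \<in> carrier A" "g \<in> carrier F" "b \<in> carrier B"
  have "i2 b = alg.Rm b (alg.p \<one>\<^bsub>A\<^esub> \<one>\<^bsub>B\<^esub>)" using h by (simp add: alg.Rm_pure alg.closed alg.A_simps)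
  then show ?thesis using h by (simp add: tm.act_Rm tm.closed tm.act_one_of_surj[OF \<tau>_surj] tm.Rm_pure)
qed

lemma mF_ract: "\<lbrakk>a \<in> carrier A; g \<in> carrier F; b \<in> carrier B\<rbrakk> \<Longrightarrow> mF a (g \<triangleleft>\<^bsub>F\<^esub> b) = mF a g \<triangleleft>\<^bsub>M\<^esub> i2 b"
  by (simp add: M_act_inr i_closed vact_i2)

lemma mF_act_i1: "\<lbrakk>g \<in> carrier F; a \<in> carrier A\<rbrakk> \<Longrightarrow> mF \<one>\<^bsub>A\<^esub> g \<triangleleft>\<^bsub>M\<^esub> i1 a = inr (\<tau> (pure K F A g a))"
  by (simp add: M_act_inr i_closed tm.act_generators)

lemma lin_i: "lin K A alg.D (\<lambda>a. i1 a)" "lin K B alg.D (\<lambda>b. i2 b)"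
  unfolding alg.lin_D_iff by (rule bilin_lin[OF alg.p_bilin] alg.closed)+

lemma lin_d0_i: "lin K A W1 (\<lambda>a. d0 C (i1 a))" "lin K B W1 (\<lambda>b. d0 C (i2 b))"
  using lin_i lin_comp[OF lin_d0_W1] unfolding alg.lin_D_iff by auto

lemma i_D: "a \<in> carrier A \<Longrightarrow> i1 a \<in> carrier alg.D" "b \<in> carrier B \<Longrightarrow> i2 b \<in> carrier alg.D"
  by (simp_all add: D_carrier i_closed)

lemma incA_actions:
  assumes "\<omega> \<in> carrier WA" "a \<in> carrier A"
  shows "lact W1 (i1 a) (t \<omega> \<one>\<^bsub>OB\<^esub>) = t (lact WA a \<omega>) \<one>\<^bsub>OB\<^esub>" "t \<omega> \<one>\<^bsub>OB\<^esub> \<triangleleft>\<^bsub>W1\<^esub> i1 a = t (\<omega> \<triangleleft>\<^bsub>WA\<^esub> a) \<one>\<^bsub>OB\<^esub>"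
  using assms WA_closed by (simp_all add: W1_actions embed_i big.left_mult_eq clo big.Lm_pure)

lemma incB_actions:
  assumes "\<omega> \<in> carrier WB" "b \<in> carrier B"
  shows "lact W1 (i2 b) (t \<one>\<^bsub>OA\<^esub> \<omega>) = t \<one>\<^bsub>OA\<^esub> (lact WB b \<omega>)" "t \<one>\<^bsub>OA\<^esub> \<omega> \<triangleleft>\<^bsub>W1\<^esub> i2 b = t \<one>\<^bsub>OA\<^esub> (\<omega> \<triangleleft>\<^bsub>WB\<^esub> b)"
  using assms WB_closed by (simp_all add: W1_actions embed_i big.right_mult_eq clo big.Rm_pure)

section \<open>The first connection\<close>

lemma bilin_betaE: "bilin K E WA Z (\<lambda>e \<omega>. po (mE e) (t \<omega> \<one>\<^bsub>OB\<^esub>))"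
  by (rule bilin_comp[OF bal.bilin_pure_over lin_mE lin_incA])

lemma balanced_betaE:
  assumes "e \<in> carrier E" "a \<in> carrier A" "\<omega> \<in> carrier WA"
  shows "po (mE (e \<triangleleft>\<^bsub>E\<^esub> a)) (t \<omega> \<one>\<^bsub>OB\<^esub>) = po (mE e) (t (lact WA a \<omega>) \<one>\<^bsub>OB\<^esub>)"
  unfolding mE_ract[OF assms(1,2)] incA_actions(1)[OF assms(3,2), symmetric]
  by (rule bal.pure_over_balanced[OF mE_closed[OF assms(1)] i_D(1)[OF assms(2)] incA_closed[OF assms(3)]])

text \<open>The map that extends scalars from \<open>A\<close> to \<open>A \<otimes>\<^sub>R B\<close> in \<open>E \<otimes>\<^sub>A \<Omega>\<^sup>1A\<close>.\<close>

definition "pushE = tensor_over_lift K Z (\<lambda>e \<omega>. po (mE e) (t \<omega> \<one>\<^bsub>OB\<^esub>))"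

lemma lin_pushE: "lin K ZE Z pushE"
  unfolding pushE_def by (rule balE.lin_over_lift[OF bilin_betaE balanced_betaE])

lemma pushE_po: "\<lbrakk>e \<in> carrier E; \<omega> \<in> carrier WA\<rbrakk> \<Longrightarrow> pushE (balE.po e \<omega>) = po (mE e) (t \<omega> \<one>\<^bsub>OB\<^esub>)"
  unfolding pushE_def by (rule balE.over_lift_pure[OF bilin_betaE balanced_betaE])

lemma pushE_act:
  assumes z: "z \<in> carrier ZE" and a: "a \<in> carrier A"
  shows "pushE (z \<triangleleft>\<^bsub>ZE\<^esub> a) = pushE z \<triangleleft>\<^bsub>Z\<^esub> i1 a"
proof (rule balE.over_ext[OF lin_comp[OF lin_pushE balE.lin_over_act[OF a]] lin_comp[OF bal.lin_over_act[OF i_D(1)[OF a]] lin_pushE] _ z])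
  fix e \<omega> assume h: "e \<in> carrier E" "\<omega> \<in> carrier WA"
  have wa: "\<omega> \<triangleleft>\<^bsub>WA\<^esub> a \<in> carrier WA" by (rule bilin_closed[OF balE.ract_bilin h(2) a])
  show "pushE (balE.po e \<omega> \<triangleleft>\<^bsub>ZE\<^esub> a) = pushE (balE.po e \<omega>) \<triangleleft>\<^bsub>Z\<^esub> i1 a"
    unfolding balE.over_act_pure[OF a h] pushE_po[OF h] pushE_po[OF h(1) wa]
      bal.over_act_pure[OF i_D(1)[OF a] mE_closed[OF h(1)] incA_closed[OF h(2)]] incA_actions(2)[OF h(2) a] by (rule refl)
qed

text \<open>The value at \<open>e \<otimes> b = (e \<otimes> 1)(1 \<otimes> b)\<close> is what the Leibniz rule dictates if the value at \<open>e \<otimes> 1\<close>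
  is the image of \<open>\<nabla>\<^sup>E e\<close>. In this form it is visibly independent of the way in which \<open>\<nabla>\<^sup>E e\<close> is written
  as a sum.\<close>

definition "N1 = tensor_lift K Z (\<lambda>e b. pushE (nablaE e) \<triangleleft>\<^bsub>Z\<^esub> i2 b \<oplus>\<^bsub>Z\<^esub> po (mE e) (d0 C (i2 b)))"

lemma bilin_N1: "bilin K E B Z (\<lambda>e b. pushE (nablaE e) \<triangleleft>\<^bsub>Z\<^esub> i2 b \<oplus>\<^bsub>Z\<^esub> po (mE e) (d0 C (i2 b)))"
proof (rule bilinI[OF ind.E_mod alg.mods(2) Z_module])
  fix e assume e: "e \<in> carrier E"
  show "lin K B Z (\<lambda>b. pushE (nablaE e) \<triangleleft>\<^bsub>Z\<^esub> i2 b \<oplus>\<^bsub>Z\<^esub> po (mE e) (d0 C (i2 b)))"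
    by (rule lin_plus[OF bilin_lin_comp(1)[OF Z_act lin_closed[OF lin_pushE lin_closed[OF nablaE(1) e]] lin_i(2)]
        bilin_lin_comp(1)[OF bal.bilin_pure_over mE_closed[OF e] lin_d0_i(2)]])
next
  fix b assume b: "b \<in> carrier B"
  show "lin K E Z (\<lambda>e. pushE (nablaE e) \<triangleleft>\<^bsub>Z\<^esub> i2 b \<oplus>\<^bsub>Z\<^esub> po (mE e) (d0 C (i2 b)))"
    by (rule lin_plus[OF bilin_lin_comp(2)[OF Z_act i_D(2)[OF b] lin_comp[OF lin_pushE nablaE(1)]]
        bilin_lin_comp(2)[OF bal.bilin_pure_over lin_closed[OF lin_d0_i(2) b] lin_mE]])
qed

lemma lin_N1: "lin K U Z N1"
  unfolding N1_def by (rule lin_tensor_lift[OF ind.E_mod alg.mods(2) bilin_N1])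

lemma N1_pure: "\<lbrakk>e \<in> carrier E; b \<in> carrier B\<rbrakk> \<Longrightarrow> N1 (pure K E B e b) = pushE (nablaE e) \<triangleleft>\<^bsub>Z\<^esub> i2 b \<oplus>\<^bsub>Z\<^esub> po (mE e) (d0 C (i2 b))"
  unfolding N1_def by (rule tensor_lift_pure[OF ind.E_mod alg.mods(2) bilin_N1])

text \<open>On \<open>a \<otimes> b\<close> the Leibniz rule of \<open>\<nabla>\<^sup>E\<close> accounts for \<open>a\<close>, and the definition of \<open>\<nabla>\<^sub>1\<close> for \<open>b\<close>.\<close>

lemma N1_leibniz:
  assumes e: "e \<in> carrier E" and y: "y \<in> carrier (tensor K A B)"
  shows "N1 (ind.inc e y) = pushE (nablaE e) \<triangleleft>\<^bsub>Z\<^esub> y \<oplus>\<^bsub>Z\<^esub> po (mE e) (d0 C y)"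
proof -
  have z: "pushE (nablaE e) \<in> carrier Z" by (rule lin_closed[OF lin_pushE lin_closed[OF nablaE(1) e]])
  have la: "lin K (tensor K A B) Z (\<lambda>y. pushE (nablaE e) \<triangleleft>\<^bsub>Z\<^esub> y)"
    using bilin_lin(1)[OF Z_act z] unfolding alg.lin_D_iff .
  show ?thesis
  proof (rule tensor_ext[OF alg.mods(1,2) lin_comp[OF lin_N1 bilin_lin(1)[OF ind.bilin_inc e]]
        lin_plus[OF la bilin_lin_comp(1)[OF bal.bilin_pure_over mE_closed[OF e] lin_d0_W1]] _ y])
    fix a b assume h: "a \<in> carrier A" "b \<in> carrier B"
    have ne: "nablaE e \<in> carrier ZE" by (rule lin_closed[OF nablaE(1) e])
    have ea: "e \<triangleleft>\<^bsub>E\<^esub> a \<in> carrier E" by (rule bilin_closed[OF ind.E_act e h(1)])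
    have "pushE (nablaE (e \<triangleleft>\<^bsub>E\<^esub> a)) = pushE (nablaE e) \<triangleleft>\<^bsub>Z\<^esub> i1 a \<oplus>\<^bsub>Z\<^esub> po (mE e) (d0 C (i1 a))"
      unfolding nablaE(2)[OF e h(1)] d0_i(1)[OF h(1)] pushE_act[OF ne h(1), symmetric] pushE_po[OF e dA0_closed[OF h(1)], symmetric]
      by (rule lin_add[OF lin_pushE lin_closed[OF balE.lin_over_act[OF h(1)] ne] bilin_closed[OF balE.bilin_pure_over e dA0_closed[OF h(1)]]])
    then have "N1 (ind.inc e (alg.p a b)) = (pushE (nablaE e) \<triangleleft>\<^bsub>Z\<^esub> i1 a \<oplus>\<^bsub>Z\<^esub> po (mE e) (d0 C (i1 a))) \<triangleleft>\<^bsub>Z\<^esub> i2 b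
        \<oplus>\<^bsub>Z\<^esub> po (mE e \<triangleleft>\<^bsub>M\<^esub> i1 a) (d0 C (i2 b))"
      unfolding ind.inc_pure[OF e h] N1_pure[OF ea h(2)] mE_ract[OF e h(1), symmetric] by simp
    also have "\<dots> = pushE (nablaE e) \<triangleleft>\<^bsub>Z\<^esub> alg.p a b \<oplus>\<^bsub>Z\<^esub> po (mE e) (d0 C (alg.p a b))"
      unfolding alg.pure_eq_mult[OF h] by (rule leibniz_mult[OF mE_closed[OF e] z i_closed(1)[OF h(1)] i_closed(2)[OF h(2)]])
    finally show "N1 (ind.inc e (alg.p a b)) = pushE (nablaE e) \<triangleleft>\<^bsub>Z\<^esub> alg.p a b \<oplus>\<^bsub>Z\<^esub> po (mE e) (d0 C (alg.p a b))" .
  qed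
qed

section \<open>The second connection\<close>

lemma bilin_betaF: "a \<in> carrier A \<Longrightarrow> bilin K F WB Z (\<lambda>g \<eta>. po (mF a g) (t \<one>\<^bsub>OA\<^esub> \<eta>))"
  by (rule bilin_comp[OF bal.bilin_pure_over lin_mF(1) lin_incB])

lemma balanced_betaF:
  assumes "a \<in> carrier A" "g \<in> carrier F" "b \<in> carrier B" "\<eta> \<in> carrier WB"
  shows "po (mF a (g \<triangleleft>\<^bsub>F\<^esub> b)) (t \<one>\<^bsub>OA\<^esub> \<eta>) = po (mF a g) (t \<one>\<^bsub>OA\<^esub> (lact WB b \<eta>))"
  unfolding mF_ract[OF assms(1-3)] incB_actions(1)[OF assms(4,3), symmetric]
  by (rule bal.pure_over_balanced[OF mF_closed[OF assms(1,2)] i_D(2)[OF assms(3)] incB_closed[OF assms(4)]])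

text \<open>For \<open>a = 1\<close> this is the extension of scalars from \<open>B\<close> to \<open>A \<otimes>\<^sub>R B\<close> in \<open>F \<otimes>\<^sub>B \<Omega>\<^sup>1B\<close>; the general \<open>a\<close>
  occurs in the first sum of \<open>\<nabla>\<^sub>2(a \<otimes> f)\<close>.\<close>

definition "pushF a = tensor_over_lift K Z (\<lambda>g \<eta>. po (mF a g) (t \<one>\<^bsub>OA\<^esub> \<eta>))"

lemma pushF_po: "\<lbrakk>a \<in> carrier A; g \<in> carrier F; \<eta> \<in> carrier WB\<rbrakk> \<Longrightarrow> pushF a (balF.po g \<eta>) = po (mF a g) (t \<one>\<^bsub>OA\<^esub> \<eta>)"
  unfolding pushF_def by (rule balF.over_lift_pure[OF bilin_betaF balanced_betaF])

lemma bilin_pushF: "bilin K A ZF Z pushF"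
proof (rule bilinI[OF alg.mods(1) balF.module_T Z_module])
  fix a assume a: "a \<in> carrier A"
  show "lin K ZF Z (\<lambda>z. pushF a z)"
    unfolding pushF_def by (rule balF.lin_over_lift[OF bilin_betaF[OF a] balanced_betaF[OF a]])
next
  fix z assume z: "z \<in> carrier ZF"
  show "lin K A Z (\<lambda>a. pushF a z)"
    unfolding pushF_def
    by (rule balF.lin_over_lift_param[OF alg.mods(1) Z_module z bilin_betaF balanced_betaF])
      (auto intro: bilin_lin_comp(2)[OF bal.bilin_pure_over incB_closed lin_mF(2)])
qed

lemma pushF_act:
  assumes z: "z \<in> carrier ZF" and a: "a \<in> carrier A" and b: "b \<in> carrier B"
  shows "pushF a (z \<triangleleft>\<^bsub>ZF\<^esub> b) = pushF a z \<triangleleft>\<^bsub>Z\<^esub> i2 b"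
proof (rule balF.over_ext[OF lin_comp[OF bilin_lin(1)[OF bilin_pushF a] balF.lin_over_act[OF b]]
      lin_comp[OF bal.lin_over_act[OF i_D(2)[OF b]] bilin_lin(1)[OF bilin_pushF a]] _ z])
  fix g \<omega> assume h: "g \<in> carrier F" "\<omega> \<in> carrier WB"
  have wb: "\<omega> \<triangleleft>\<^bsub>WB\<^esub> b \<in> carrier WB" by (rule bilin_closed[OF balF.ract_bilin h(2) b])
  show "pushF a (balF.po g \<omega> \<triangleleft>\<^bsub>ZF\<^esub> b) = pushF a (balF.po g \<omega>) \<triangleleft>\<^bsub>Z\<^esub> i2 b"
    unfolding balF.over_act_pure[OF b h] pushF_po[OF a h] pushF_po[OF a h(1) wb]
      bal.over_act_pure[OF i_D(2)[OF b] mF_closed[OF a h(1)] incB_closed[OF h(2)]] incB_actions(2)[OF h(2) b] by (rule refl)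
qed

text \<open>The two sums in the formula for \<open>\<nabla>\<^sub>2\<close>; the second one is a function of \<open>\<sigma>(a \<otimes> f)\<close>.\<close>

definition "N2_first = tensor_lift K Z (\<lambda>a f. pushF a (nablaF f))"
definition "N2_second = tensor_lift K Z (\<lambda>g a. po (mF \<one>\<^bsub>A\<^esub> g) (d0 C (i1 a)))"
definition "N2 v = N2_first v \<oplus>\<^bsub>Z\<^esub> N2_second (\<sigma> v)"

lemma bilin_N2_first: "bilin K A F Z (\<lambda>a f. pushF a (nablaF f))"
  by (rule bilin_comp[OF bilin_pushF lin_id[OF alg.mods(1)] nablaF(1)])

lemma lin_N2_first: "lin K V Z N2_first" and N2_first_pure: "\<lbrakk>a \<in> carrier A; f \<in> carrier F\<rbrakk> \<Longrightarrow> N2_first (pure K A F a f) = pushF a (nablaF f)"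
  unfolding N2_first_def by (rule lin_tensor_lift[OF tm.mods(1,3) bilin_N2_first] tensor_lift_pure[OF tm.mods(1,3) bilin_N2_first]; assumption?)+

lemma bilin_N2_second: "bilin K F A Z (\<lambda>g a. po (mF \<one>\<^bsub>A\<^esub> g) (d0 C (i1 a)))"
  by (rule bilin_comp[OF bal.bilin_pure_over lin_mF(1)[OF alg.closed(1)] lin_d0_i(1)])

lemma lin_N2_second: "lin K (tensor K F A) Z N2_second" and N2_second_pure: "\<lbrakk>g \<in> carrier F; a \<in> carrier A\<rbrakk> \<Longrightarrow> N2_second (pure K F A g a) = po (mF \<one>\<^bsub>A\<^esub> g) (d0 C (i1 a))"
  unfolding N2_second_def by (rule lin_tensor_lift[OF tm.mods(3,1) bilin_N2_second] tensor_lift_pure[OF tm.mods(3,1) bilin_N2_second]; assumption?)+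

lemma lin_\<sigma>: "lin K V (tensor K F A) \<sigma>"
proof (rule linI[OF tm.mods(4,7)])
  note s = funcset_mem[OF \<sigma>_closed] and ts = bspec[OF \<tau>_\<sigma>] and st = bspec[OF \<sigma>_\<tau>]
  fix x assume x: "x \<in> carrier V"
  show "\<sigma> x \<in> carrier (tensor K F A)" using s[OF x] .
  show "\<sigma> (x \<oplus>\<^bsub>V\<^esub> y) = \<sigma> x \<oplus>\<^bsub>tensor K F A\<^esub> \<sigma> y" if y: "y \<in> carrier V" for y
    using st[OF module_closed(2)[OF tm.mods(7) s[OF x] s[OF y]]] by (simp add: lin_add[OF tm.lin_\<tau> s[OF x] s[OF y]] ts x y)
  show "\<sigma> (k \<odot>\<^bsub>V\<^esub> x) = k \<odot>\<^bsub>tensor K F A\<^esub> \<sigma> x" if k: "k \<in> carrier K" for k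
    using st[OF module_closed(5)[OF tm.mods(7) k s[OF x]]] by (simp add: lin_smult[OF tm.lin_\<tau> k s[OF x]] ts x)
qed

lemma lin_N2: "lin K V Z N2"
  unfolding N2_def[abs_def] by (rule lin_plus[OF lin_N2_first lin_comp[OF lin_N2_second lin_\<sigma>]])

section \<open>The compatibility condition\<close>

abbreviation "AW \<equiv> tensor K A WB"
abbreviation "AZ \<equiv> tensor K A ZF"

text \<open>The inclusion of \<open>A \<otimes> \<Omega>\<^sup>1B\<close> into \<open>\<Omega>A \<otimes> \<Omega>B\<close>, and a linear map on all of \<open>\<Omega>A \<otimes> \<Omega>B\<close> inverting it on
  its image. By means of the latter \<open>twist_one_form\<close>, which is defined by an inverse image, is seen to be
  linear.\<close>

definition "incl_form = tensor_map K OA OB iA (\<lambda>\<omega>. \<omega>)"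
definition "read_form = tensor_map K A WB a.unembed (b.component 1)"

lemma lin_component_WB: "lin K OB WB (b.component 1)"
  by (rule lin_restrict[OF b.lin_component b.W_module _ _ _ b.module_one_forms])
    (auto simp: WB_homogeneous b.component_homogeneous[simplified])

lemma component_WB: "\<eta> \<in> carrier WB \<Longrightarrow> b.component 1 \<eta> = \<eta>"
  unfolding WB_homogeneous by (simp add: b.component_of_homogeneous[where m = 1, simplified])

lemmas component_WB' = component_WB[unfolded One_nat_def]

lemma AW_module: "module K AW" by (rule module_tensor[OF alg.mods(1) b.module_one_forms])
lemma AZ_module: "module K AZ" by (rule module_tensor[OF alg.mods(1) balF.module_T])

lemma lin_incl_form: "lin K AW T incl_form" and incl_form_pure: "\<lbrakk>a \<in> carrier A; \<eta> \<in> carrier WB\<rbrakk> \<Longrightarrow> incl_form (pure K A WB a \<eta>) = t (iA a) \<eta>"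
  unfolding incl_form_def by (rule lin_tensor_map[OF a.embed_facts(1) b.lin_one_forms_inclusion]
      tensor_map_pure[OF a.embed_facts(1) b.lin_one_forms_inclusion]; assumption?)+

lemma lin_read_form: "lin K T AW read_form" and read_form_pure: "\<lbrakk>\<phi> \<in> carrier OA; \<omega> \<in> carrier OB\<rbrakk> \<Longrightarrow> read_form (t \<phi> \<omega>) = pure K A WB (a.unembed \<phi>) (b.component 1 \<omega>)"
  unfolding read_form_def by (rule lin_tensor_map[OF a.lin_unembed lin_component_WB]
      tensor_map_pure[OF a.lin_unembed lin_component_WB]; assumption?)+

lemma read_incl_form: "y \<in> carrier AW \<Longrightarrow> read_form (incl_form y) = y"
  by (rule tensor_ext[OF alg.mods(1) b.module_one_forms lin_comp[OF lin_read_form lin_incl_form] lin_id[OF AW_module]])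
    (simp_all add: incl_form_pure read_form_pure a.embed_facts WB_closed a.unembed_embed component_WB')

lemma read_form_embed: "\<lbrakk>a \<in> carrier A; \<eta> \<in> carrier WB\<rbrakk> \<Longrightarrow> read_form (t (iA a) \<eta>) = pure K A WB a \<eta>"
  by (simp add: read_form_pure a.embed_facts WB_closed a.unembed_embed component_WB')

lemma incl_read_form: "x \<in> bideg 0 1 \<Longrightarrow> incl_form (read_form x) = x"
proof (rule bideg_ext[OF lin_comp[OF lin_incl_form lin_read_form] lin_id[OF T_module]])
  fix \<phi> \<omega> assume h: "\<phi> \<in> HA 0" "\<omega> \<in> HB 1"
  then obtain a where a: "a \<in> carrier A" "\<phi> = iA a" using a.embed_facts(6) by blast
  have w: "\<omega> \<in> carrier WB" using h(2) unfolding WB_homogeneous .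
  show "incl_form (read_form (t \<phi> \<omega>)) = t \<phi> \<omega>" unfolding a(2) read_form_embed[OF a(1) w] by (rule incl_form_pure[OF a(1) w])
qed

lemma incl_form_bideg: "y \<in> carrier AW \<Longrightarrow> incl_form y \<in> bideg 0 1"
proof -
  assume y: "y \<in> carrier AW"
  have "y \<in> {y \<in> carrier AW. incl_form y \<in> bideg 0 1}"
    by (rule tensor_generated[OF alg.mods(1) b.module_one_forms submodule_vimage[OF lin_incl_form bideg_submodule] _ y])
      (simp add: bilin_closed[OF bilin_pure[OF alg.mods(1) b.module_one_forms]] incl_form_pure bideg_pure a.embed_facts WB_homogeneous[simplified])
  then show ?thesis by simp
qed

lemma bideg_W1: "x \<in> bideg 0 1 \<Longrightarrow> x \<in> carrier W1"
  using bideg_H[of x 0 1] by (simp add: c.one_forms_simps(1))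

lemma lin_incl_form_W1: "lin K AW W1 incl_form"
  by (rule W1_lin[OF lin_incl_form]) (rule bideg_W1[OF incl_form_bideg])

lemma Rt_one_form:
  assumes "\<eta> \<in> carrier WB" "a \<in> carrier A"
  shows "Rt (pure K OB OA \<eta> (iA a)) \<in> bideg 0 1"
  using assms by (intro Rt_bidegree a.embed_facts) (simp_all only: WB_homogeneous)

lemma twist_one_form_eq:
  assumes "\<eta> \<in> carrier WB" "a \<in> carrier A"
  shows "twist_one_form K A B Rt \<eta> a = read_form (Rt (pure K OB OA \<eta> (iA a)))"
proof -
  let ?x = "Rt (pure K OB OA \<eta> (iA a))"
  have x: "?x \<in> bideg 0 1" by (rule Rt_one_form[OF assms])
  have inj: "inj_on incl_form (carrier AW)" by (rule inj_on_inverseI[where g = read_form]) (rule read_incl_form)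
  have "twist_one_form K A B Rt \<eta> a = inv_into (carrier AW) incl_form ?x" unfolding twist_one_form_def incl_form_def ..
  also have "\<dots> = inv_into (carrier AW) incl_form (incl_form (read_form ?x))" unfolding incl_read_form[OF x] ..
  also have "\<dots> = read_form ?x" by (rule inv_into_f_f[OF inj lin_closed[OF lin_read_form bideg_closed[OF x]]])
  finally show ?thesis .
qed

abbreviation "with_form \<eta> \<equiv> tensor_map K A ZF (\<lambda>\<alpha>. \<alpha>) (\<lambda>g. balF.po g \<eta>)"

lemma lin_with_form: "\<eta> \<in> carrier WB \<Longrightarrow> lin K V AZ (with_form \<eta>)"
  by (rule lin_tensor_map[OF lin_id[OF alg.mods(1)] bilin_lin(2)[OF balF.bilin_pure_over]])

lemma with_form_pure: "\<lbrakk>\<eta> \<in> carrier WB; a \<in> carrier A; g \<in> carrier F\<rbrakk> \<Longrightarrow> with_form \<eta> (pure K A F a g) = pure K A ZF a (balF.po g \<eta>)"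
  by (rule tensor_map_pure[OF lin_id[OF alg.mods(1)] bilin_lin(2)[OF balF.bilin_pure_over]])

text \<open>The map \<open>a \<otimes> \<eta> \<mapsto> \<tau>(g \<otimes> a) \<otimes>\<^sub>B \<eta>\<close> into \<open>A \<otimes> (F \<otimes>\<^sub>B \<Omega>\<^sup>1B)\<close>, the last step in the right-hand side of the
  compatibility condition.\<close>

definition "twist_form g = tensor_lift K AZ (\<lambda>a \<eta>. with_form \<eta> (\<tau> (pure K F A g a)))"

lemma bilin_twist_form_inner: "g \<in> carrier F \<Longrightarrow> bilin K A WB AZ (\<lambda>a \<eta>. with_form \<eta> (\<tau> (pure K F A g a)))"
proof (rule bilinI[OF alg.mods(1) b.module_one_forms AZ_module])
  assume g: "g \<in> carrier F"
  show "lin K WB AZ (\<lambda>\<eta>. with_form \<eta> (\<tau> (pure K F A g a)))" if "a \<in> carrier A" for a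
    using that g by (intro lin_tensor_map_param_right[OF lin_id[OF alg.mods(1)] bilin_flip[OF balF.bilin_pure_over]] tm.closed)
  show "lin K A AZ (\<lambda>a. with_form \<eta> (\<tau> (pure K F A g a)))" if "\<eta> \<in> carrier WB" for \<eta>
    by (rule lin_comp[OF lin_with_form[OF that] lin_comp[OF tm.lin_\<tau> bilin_lin(1)[OF tm.FA_pure g]]])
qed

lemma bilin_twist_form: "bilin K F AW AZ twist_form"
proof (rule bilinI[OF tm.mods(3) AW_module AZ_module])
  show "lin K AW AZ (\<lambda>y. twist_form g y)" if "g \<in> carrier F" for g
    unfolding twist_form_def by (rule lin_tensor_lift[OF alg.mods(1) b.module_one_forms bilin_twist_form_inner[OF that]])
  show "lin K F AZ (\<lambda>g. twist_form g y)" if "y \<in> carrier AW" for y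
    unfolding twist_form_def
    by (rule lin_tensor_lift_param[OF alg.mods(1) b.module_one_forms tm.mods(3) AZ_module that bilin_twist_form_inner], assumption)
      (rule lin_comp[OF lin_with_form lin_comp[OF tm.lin_\<tau> bilin_lin(2)[OF tm.FA_pure]]])
qed

lemma twist_form_pure: "\<lbrakk>g \<in> carrier F; a \<in> carrier A; \<eta> \<in> carrier WB\<rbrakk> \<Longrightarrow> twist_form g (pure K A WB a \<eta>) = with_form \<eta> (\<tau> (pure K F A g a))"
  unfolding twist_form_def by (rule tensor_lift_pure[OF alg.mods(1) b.module_one_forms bilin_twist_form_inner])

lemma twist_form_embed:
  assumes g: "g \<in> carrier F" and \<eta>: "\<eta> \<in> carrier WB" and r: "r \<in> carrier (tensor K A B)"
  shows "with_form \<eta> (vact (pure K A F \<one>\<^bsub>A\<^esub> g) r) = twist_form g (read_form (big.Rm \<eta> (tensor_map K OA OB iA iB r)))"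
proof -
  have g1: "pure K A F \<one>\<^bsub>A\<^esub> g \<in> carrier V" using g by (intro tm.closed)
  show ?thesis
  proof (rule tensor_ext[OF alg.mods(1,2) lin_comp[OF lin_with_form[OF \<eta>] bilin_lin(1)[OF tm.bilin_act g1]]
        lin_comp[OF bilin_lin(1)[OF bilin_twist_form g] lin_comp[OF lin_read_form lin_comp[OF big.lin_Rm[OF WB_closed[OF \<eta>]] iAB_lin]]] _ r])
    fix x y assume h: "x \<in> carrier A" "y \<in> carrier B"
    let ?v = "\<tau> (pure K F A g x)"
    have v: "?v \<in> carrier V" using g h by (intro tm.closed)
    have ye: "iB y \<otimes>\<^bsub>OB\<^esub> \<eta> \<in> carrier WB"
      using bilin_closed[OF balF.lact_bilin h(2) \<eta>] by simp
    note l = bilin_lin(1)[OF tm.A_mult tm.closed(1)] lin_id[OF alg.mods(1)] bilin_lin(2)[OF tm.F_act h(2)] bilin_lin(2)[OF balF.bilin_pure_over \<eta>]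
    have "with_form \<eta> (vact (pure K A F \<one>\<^bsub>A\<^esub> g) (alg.p x y)) = tensor_map K A ZF (\<lambda>z. \<one>\<^bsub>A\<^esub> \<otimes>\<^bsub>A\<^esub> z) (\<lambda>q. balF.po (q \<triangleleft>\<^bsub>F\<^esub> y) \<eta>) ?v"
      unfolding tm.act_pure[OF tm.closed(1) g h] by (rule tensor_map_compose[OF l v])
    also have "\<dots> = with_form (iB y \<otimes>\<^bsub>OB\<^esub> \<eta>) ?v"
      using balF.pure_over_balanced[OF _ h(2) \<eta>]
      by (intro tensor_map_cong[OF l(1) lin_comp[OF l(4,3)] _ _ v]) (simp_all add: alg.A_simps)
    also have "\<dots> = twist_form g (pure K A WB x (iB y \<otimes>\<^bsub>OB\<^esub> \<eta>))" by (rule twist_form_pure[OF g h(1) ye, symmetric])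
    also have "pure K A WB x (iB y \<otimes>\<^bsub>OB\<^esub> \<eta>) = read_form (big.Rm \<eta> (tensor_map K OA OB iA iB (alg.p x y)))"
      unfolding iAB_pure[OF h] using h WB_closed[OF \<eta>] by (simp add: big.Rm_pure clo read_form_embed[OF h(1) ye])
    finally show "with_form \<eta> (vact (pure K A F \<one>\<^bsub>A\<^esub> g) (alg.p x y)) = twist_form g (read_form (big.Rm \<eta> (tensor_map K OA OB iA iB (alg.p x y))))" .
  qed
qed

text \<open>The right-hand side of the compatibility condition is a lift to \<open>F \<otimes>\<^sub>B \<Omega>\<^sup>1B\<close> of a
  map defined on representatives, and is computable only once this map is known to be balanced. It is,
  because \<open>\<tau>(g b \<otimes> a) = (1 \<otimes> g) R(b \<otimes> a)\<close> and \<open>Rt(b \<eta> \<otimes> a) = (1 \<otimes> b) Rt(\<eta> \<otimes> a)\<close> distribute \<open>b\<close> in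
  the same way.\<close>

lemma twist_form_balanced:
  assumes g: "g \<in> carrier F" and b: "b \<in> carrier B" and x: "x \<in> bideg 0 1"
  shows "twist_form (g \<triangleleft>\<^bsub>F\<^esub> b) (read_form x) = twist_form g (read_form (t \<one>\<^bsub>OA\<^esub> (iB b) \<otimes>\<^bsub>big.D\<^esub> x))"
proof -
  have tb: "t \<one>\<^bsub>OA\<^esub> (iB b) \<in> carrier T" and gb: "g \<triangleleft>\<^bsub>F\<^esub> b \<in> carrier F" using g b by (auto intro: clo tm.closed)
  show ?thesis
  proof (rule bideg_ext[OF lin_comp[OF bilin_lin(1)[OF bilin_twist_form gb] lin_read_form]
        lin_comp[OF bilin_lin(1)[OF bilin_twist_form g] lin_comp[OF lin_read_form bilin_lin(1)[OF big.bilin_D_mult tb]]] _ x])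
    fix \<phi> \<eta> assume h: "\<phi> \<in> HA 0" "\<eta> \<in> HB 1"
    then obtain a where a: "a \<in> carrier A" "\<phi> = iA a" using a.embed_facts(6) by blast
    have w: "\<eta> \<in> carrier WB" using h(2) unfolding WB_homogeneous .
    have r: "R (pure K B A b a) \<in> carrier (tensor K A B)" using a b by (intro alg.closed)
    have "twist_form (g \<triangleleft>\<^bsub>F\<^esub> b) (read_form (t \<phi> \<eta>)) = with_form \<eta> (vact (pure K A F \<one>\<^bsub>A\<^esub> g) (R (pure K B A b a)))"
      unfolding a(2) read_form_embed[OF a(1) w] twist_form_pure[OF gb a(1) w] tm.\<tau>_ract[OF g b a(1)] ..
    also have "\<dots> = twist_form g (read_form (big.Rm \<eta> (Rt (pure K OB OA (iB b) (iA a)))))"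
      unfolding twist_form_embed[OF g w r] Rt_embed[OF b a(1)] ..
    also have "\<dots> = twist_form g (read_form (t \<one>\<^bsub>OA\<^esub> (iB b) \<otimes>\<^bsub>big.D\<^esub> t \<phi> \<eta>))"
      unfolding a(2) using a(1) b WB_closed[OF w] by (simp add: Rt_pure_one_left clo)
    finally show "twist_form (g \<triangleleft>\<^bsub>F\<^esub> b) (read_form (t \<phi> \<eta>)) = twist_form g (read_form (t \<one>\<^bsub>OA\<^esub> (iB b) \<otimes>\<^bsub>big.D\<^esub> t \<phi> \<eta>))" .
  qed
qed

definition "pushF_lift = tensor_lift K Z pushF"

lemma lin_pushF_lift: "lin K AZ Z pushF_lift" and pushF_lift_pure: "\<lbrakk>a \<in> carrier A; z \<in> carrier ZF\<rbrakk> \<Longrightarrow> pushF_lift (pure K A ZF a z) = pushF a z"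
  unfolding pushF_lift_def by (rule lin_tensor_lift[OF alg.mods(1) balF.module_T bilin_pushF] tensor_lift_pure[OF alg.mods(1) balF.module_T bilin_pushF]; assumption?)+

lemma N2_first_eq: "v \<in> carrier V \<Longrightarrow> N2_first v = pushF_lift (tensor_map K A ZF (\<lambda>\<alpha>. \<alpha>) nablaF v)"
proof -
  note l = lin_id[OF alg.mods(1)] nablaF(1)
  assume v: "v \<in> carrier V"
  show ?thesis
    by (rule tensor_ext[OF tm.mods(1,3) lin_N2_first lin_comp[OF lin_pushF_lift lin_tensor_map[OF l]] _ v])
      (simp add: N2_first_pure tensor_map_pure[OF l] pushF_lift_pure lin_closed[OF l(2)])
qed

lemma pushF_lift_with_form:
  assumes e: "\<eta> \<in> carrier WB" and v: "v \<in> carrier V"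
  shows "pushF_lift (with_form \<eta> v) = po (inr v) (t \<one>\<^bsub>OA\<^esub> \<eta>)"
  by (rule tensor_ext[OF tm.mods(1,3) lin_comp[OF lin_pushF_lift lin_with_form[OF e]] lin_comp[OF po_lin(2)[OF incB_closed[OF e]] lin_inr] _ v])
    (simp add: with_form_pure e pushF_lift_pure bilin_closed[OF balF.bilin_pure_over] pushF_po)

text \<open>In \<open>Z\<close> the coefficient in \<open>A\<close> can be moved from \<open>M\<close> to the form, by
  \<open>\<tau>(g \<otimes> a) = (1 \<otimes> g)(a \<otimes> 1)\<close>; what was twisted past \<open>g\<close> becomes an honest one-form again.\<close>

lemma pushF_lift_twist_form:
  assumes g: "g \<in> carrier F" and y: "y \<in> carrier AW"
  shows "pushF_lift (twist_form g y) = po (mF \<one>\<^bsub>A\<^esub> g) (incl_form y)"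
proof (rule tensor_ext[OF alg.mods(1) b.module_one_forms lin_comp[OF lin_pushF_lift bilin_lin(1)[OF bilin_twist_form g]]
      lin_comp[OF po_lin(1)[OF mF_closed[OF alg.closed(1) g]] lin_incl_form_W1] _ y])
  fix a \<eta> assume h: "a \<in> carrier A" "\<eta> \<in> carrier WB"
  have v: "\<tau> (pure K F A g a) \<in> carrier V" using g h by (intro tm.closed)
  have "pushF_lift (twist_form g (pure K A WB a \<eta>)) = po (mF \<one>\<^bsub>A\<^esub> g \<triangleleft>\<^bsub>M\<^esub> i1 a) (t \<one>\<^bsub>OA\<^esub> \<eta>)"
    unfolding twist_form_pure[OF g h] pushF_lift_with_form[OF h(2) v] mF_act_i1[OF g h(1)] ..
  also have "\<dots> = po (mF \<one>\<^bsub>A\<^esub> g) (lact W1 (i1 a) (t \<one>\<^bsub>OA\<^esub> \<eta>))"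
    by (rule bal.pure_over_balanced[OF mF_closed[OF alg.closed(1) g] i_D(1)[OF h(1)] incB_closed[OF h(2)]])
  also have "lact W1 (i1 a) (t \<one>\<^bsub>OA\<^esub> \<eta>) = incl_form (pure K A WB a \<eta>)"
    unfolding incl_form_pure[OF h] using h WB_closed[OF h(2)] by (simp add: W1_actions embed_i big.pure_eq_mult[of "iA a" \<eta>] clo)
  finally show "pushF_lift (twist_form g (pure K A WB a \<eta>)) = po (mF \<one>\<^bsub>A\<^esub> g) (incl_form (pure K A WB a \<eta>))" .
qed

text \<open>The meaning of the compatibility condition: the first sum of \<open>\<nabla>\<^sub>2\<close> at
  \<open>\<tau>(g \<otimes> a) = (1 \<otimes> g)(a \<otimes> 1)\<close> is its value at \<open>1 \<otimes> g\<close> times \<open>a\<close>.\<close>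

lemma N2_first_\<tau>:
  assumes g: "g \<in> carrier F" and a: "a \<in> carrier A"
  shows "N2_first (\<tau> (pure K F A g a)) = pushF \<one>\<^bsub>A\<^esub> (nablaF g) \<triangleleft>\<^bsub>Z\<^esub> i1 a"
proof -
  let ?rt = "\<lambda>\<eta>. Rt (pure K OB OA \<eta> (iA a))"
  let ?\<beta> = "\<lambda>g \<eta>. twist_form g (twist_one_form K A B Rt \<eta> a)"
  have ia: "iA a \<in> carrier OA" using a by (rule a.embed_facts(3))
  have lt: "lin K WB AW (\<lambda>\<eta>. twist_one_form K A B Rt \<eta> a)"
    by (rule lin_cong[OF lin_comp[OF lin_read_form lin_comp[OF lin_Rt_right[OF ia] b.lin_one_forms_inclusion]]])
      (rule twist_one_form_eq[OF _ a])
  have b: "bilin K F WB AZ ?\<beta>" by (rule bilin_comp[OF bilin_twist_form lin_id[OF tm.mods(3)] lt])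
  have bal: "?\<beta> (g \<triangleleft>\<^bsub>F\<^esub> b) \<eta> = ?\<beta> g (lact WB b \<eta>)" if h: "g \<in> carrier F" "b \<in> carrier B" "\<eta> \<in> carrier WB" for g b \<eta>
  proof -
    have bh: "lact WB b \<eta> \<in> carrier WB" by (rule bilin_closed[OF balF.lact_bilin h(2,3)])
    have "?rt (lact WB b \<eta>) = t \<one>\<^bsub>OA\<^esub> (iB b) \<otimes>\<^bsub>big.D\<^esub> ?rt \<eta>"
      using h WB_closed[OF h(3)] ia by (simp add: big.R_mult_left clo)
    then show ?thesis
      unfolding twist_one_form_eq[OF h(3) a] twist_one_form_eq[OF bh a] twist_form_balanced[OF h(1,2) Rt_one_form[OF h(3) a]] by simp
  qed
  have "tensor_map K A ZF (\<lambda>\<alpha>. \<alpha>) nablaF (\<tau> (pure K F A g a)) = tensor_over_lift K AZ ?\<beta> (nablaF g)"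
    using compatible g a unfolding connection_compatible_def Let_def twist_form_def by blast
  moreover have "\<tau> (pure K F A g a) \<in> carrier V" using g a by (intro tm.closed)
  ultimately have "N2_first (\<tau> (pure K F A g a)) = pushF_lift (tensor_over_lift K AZ ?\<beta> (nablaF g))" using N2_first_eq by simp
  also have "\<dots> = pushF \<one>\<^bsub>A\<^esub> (nablaF g) \<triangleleft>\<^bsub>Z\<^esub> i1 a"
  proof (rule balF.over_ext[OF lin_comp[OF lin_pushF_lift balF.lin_over_lift[OF b bal]]
        lin_comp[OF bal.lin_over_act[OF i_D(1)[OF a]] bilin_lin(1)[OF bilin_pushF alg.closed(1)]] _ lin_closed[OF nablaF(1) g]])
    fix q \<eta> assume h: "q \<in> carrier F" "\<eta> \<in> carrier WB"
    have r: "?rt \<eta> \<in> bideg 0 1" by (rule Rt_one_form[OF h(2) a])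
    have "tensor_over_lift K AZ ?\<beta> (balF.po q \<eta>) = ?\<beta> q \<eta>"
      by (rule balF.over_lift_pure[OF b bal h])
    then have "pushF_lift (tensor_over_lift K AZ ?\<beta> (balF.po q \<eta>)) = pushF_lift (twist_form q (read_form (?rt \<eta>)))"
      using twist_one_form_eq[OF h(2) a] by simp
    also have "\<dots> = po (mF \<one>\<^bsub>A\<^esub> q) (?rt \<eta>)"
      unfolding pushF_lift_twist_form[OF h(1) lin_closed[OF lin_read_form bideg_closed[OF r]]] incl_read_form[OF r] ..
    also have "?rt \<eta> = t \<one>\<^bsub>OA\<^esub> \<eta> \<triangleleft>\<^bsub>W1\<^esub> i1 a"
      using WB_closed[OF h(2)] ia a by (simp add: W1_actions embed_i big.D_mult_generators)
    also have "po (mF \<one>\<^bsub>A\<^esub> q) (t \<one>\<^bsub>OA\<^esub> \<eta> \<triangleleft>\<^bsub>W1\<^esub> i1 a) = pushF \<one>\<^bsub>A\<^esub> (balF.po q \<eta>) \<triangleleft>\<^bsub>Z\<^esub> i1 a"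
      unfolding pushF_po[OF alg.closed(1) h]
      by (rule bal.over_act_pure[OF i_D(1)[OF a] mF_closed[OF alg.closed(1) h(1)] incB_closed[OF h(2)], symmetric])
    finally show "pushF_lift (tensor_over_lift K AZ ?\<beta> (balF.po q \<eta>)) = pushF \<one>\<^bsub>A\<^esub> (balF.po q \<eta>) \<triangleleft>\<^bsub>Z\<^esub> i1 a" .
  qed
  finally show ?thesis .
qed

lemma N2_leibniz_i1:
  assumes g: "g \<in> carrier F" and a: "a \<in> carrier A"
  shows "N2 (vact (pure K A F \<one>\<^bsub>A\<^esub> g) (i1 a)) = pushF \<one>\<^bsub>A\<^esub> (nablaF g) \<triangleleft>\<^bsub>Z\<^esub> i1 a \<oplus>\<^bsub>Z\<^esub> po (mF \<one>\<^bsub>A\<^esub> g) (d0 C (i1 a))"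
proof -
  have "pure K F A g a \<in> carrier (tensor K F A)" using g a by (intro tm.closed)
  then show ?thesis
    unfolding tm.act_generators[OF g a] N2_def N2_first_\<tau>[OF g a] using \<sigma>_\<tau> N2_second_pure[OF g a] by simp
qed

text \<open>Written as \<open>(1 \<otimes> b)(a \<otimes> 1)\<close>, an element of the algebra first meets the Leibniz rule of \<open>\<nabla>\<^sup>F\<close> and
  then the previous lemma.\<close>

lemma N2_leibniz:
  assumes g: "g \<in> carrier F" and y: "y \<in> carrier (tensor K A B)"
  shows "N2 (vact (pure K A F \<one>\<^bsub>A\<^esub> g) y) = pushF \<one>\<^bsub>A\<^esub> (nablaF g) \<triangleleft>\<^bsub>Z\<^esub> y \<oplus>\<^bsub>Z\<^esub> po (mF \<one>\<^bsub>A\<^esub> g) (d0 C y)"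
proof -
  have one: "\<one>\<^bsub>A\<^esub> \<in> carrier A" by (rule alg.closed)
  have ng: "nablaF g \<in> carrier ZF" by (rule lin_closed[OF nablaF(1) g])
  have z: "pushF \<one>\<^bsub>A\<^esub> (nablaF g) \<in> carrier Z" by (rule bilin_closed[OF bilin_pushF one ng])
  have g1: "pure K A F \<one>\<^bsub>A\<^esub> g \<in> carrier V" using g by (intro tm.closed)
  have la: "lin K (tensor K A B) Z (\<lambda>y. pushF \<one>\<^bsub>A\<^esub> (nablaF g) \<triangleleft>\<^bsub>Z\<^esub> y)"
    using bilin_lin(1)[OF Z_act z] unfolding alg.lin_D_iff .
  \<comment> \<open>The elements \<open>R(b \<otimes> a) = (1 \<otimes> b)(a \<otimes> 1)\<close> span the algebra.\<close>
  have "y \<in> R ` carrier (tensor K B A)" using y bij_betw_imp_surj_on[OF R_bij] by simp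
  then obtain s where ys: "y = R s" and s: "s \<in> carrier (tensor K B A)" by (rule imageE)
  have "N2 (vact (pure K A F \<one>\<^bsub>A\<^esub> g) (R s)) = pushF \<one>\<^bsub>A\<^esub> (nablaF g) \<triangleleft>\<^bsub>Z\<^esub> R s \<oplus>\<^bsub>Z\<^esub> po (mF \<one>\<^bsub>A\<^esub> g) (d0 C (R s))"
  proof (rule tensor_ext[OF alg.mods(2,1) lin_comp[OF lin_N2 lin_comp[OF bilin_lin(1)[OF tm.bilin_act g1] alg.lin_R]]
        lin_plus[OF lin_comp[OF la alg.lin_R] bilin_lin_comp(1)[OF bal.bilin_pure_over mF_closed[OF one g] lin_comp[OF lin_d0_W1 alg.lin_R]]] _ s])
    fix b a assume h: "b \<in> carrier B" "a \<in> carrier A"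
    have gb: "g \<triangleleft>\<^bsub>F\<^esub> b \<in> carrier F" by (rule bilin_closed[OF tm.F_act g h(1)])
    have R: "R (pure K B A b a) = i2 b \<otimes>\<^bsub>alg.D\<^esub> i1 a" by (rule alg.D_mult_generators[OF h, symmetric])
    have "pushF \<one>\<^bsub>A\<^esub> (nablaF (g \<triangleleft>\<^bsub>F\<^esub> b)) = pushF \<one>\<^bsub>A\<^esub> (nablaF g) \<triangleleft>\<^bsub>Z\<^esub> i2 b \<oplus>\<^bsub>Z\<^esub> po (mF \<one>\<^bsub>A\<^esub> g) (d0 C (i2 b))"
      unfolding nablaF(2)[OF g h(1)] d0_i(2)[OF h(1)] pushF_act[OF ng one h(1), symmetric] pushF_po[OF one g dB0_closed[OF h(1)], symmetric]
      by (rule lin_add[OF bilin_lin(1)[OF bilin_pushF one] lin_closed[OF balF.lin_over_act[OF h(1)] ng] bilin_closed[OF balF.bilin_pure_over g dB0_closed[OF h(1)]]])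
    moreover have "vact (pure K A F \<one>\<^bsub>A\<^esub> g) (R (pure K B A b a)) = vact (pure K A F \<one>\<^bsub>A\<^esub> (g \<triangleleft>\<^bsub>F\<^esub> b)) (i1 a)"
      unfolding R tm.act_assoc[OF g1 i_closed(2)[OF h(1)] i_closed(1)[OF h(2)]] vact_i2[OF one g h(1)] ..
    ultimately have "N2 (vact (pure K A F \<one>\<^bsub>A\<^esub> g) (R (pure K B A b a)))
        = (pushF \<one>\<^bsub>A\<^esub> (nablaF g) \<triangleleft>\<^bsub>Z\<^esub> i2 b \<oplus>\<^bsub>Z\<^esub> po (mF \<one>\<^bsub>A\<^esub> g) (d0 C (i2 b))) \<triangleleft>\<^bsub>Z\<^esub> i1 a
          \<oplus>\<^bsub>Z\<^esub> po (mF \<one>\<^bsub>A\<^esub> g \<triangleleft>\<^bsub>M\<^esub> i2 b) (d0 C (i1 a))"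
      using N2_leibniz_i1[OF gb h(2)] mF_ract[OF one g h(1)] by simp
    also have "\<dots> = pushF \<one>\<^bsub>A\<^esub> (nablaF g) \<triangleleft>\<^bsub>Z\<^esub> R (pure K B A b a) \<oplus>\<^bsub>Z\<^esub> po (mF \<one>\<^bsub>A\<^esub> g) (d0 C (R (pure K B A b a)))"
      unfolding R by (rule leibniz_mult[OF mF_closed[OF one g] z i_closed(2)[OF h(1)] i_closed(1)[OF h(2)]])
    finally show "N2 (vact (pure K A F \<one>\<^bsub>A\<^esub> g) (R (pure K B A b a))) = pushF \<one>\<^bsub>A\<^esub> (nablaF g) \<triangleleft>\<^bsub>Z\<^esub> R (pure K B A b a) \<oplus>\<^bsub>Z\<^esub> po (mF \<one>\<^bsub>A\<^esub> g) (d0 C (R (pure K B A b a)))" .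
  qed
  then show ?thesis unfolding ys .
qed

section \<open>The Leibniz rule on the sum module\<close>

text \<open>Both sides of the Leibniz rule at \<open>(e \<otimes> 1) x\<close> are given by \<open>N1_leibniz\<close>, for the products
  \<open>x y\<close> and \<open>x\<close>. The next lemma repeats this with \<open>(1 \<otimes> g)(a \<otimes> 1) = \<tau>(g \<otimes> a)\<close>.\<close>

lemma N1_rule:
  assumes u: "u \<in> carrier U" and y: "y \<in> carrier (tensor K A B)"
  shows "N1 (eact u y) = N1 u \<triangleleft>\<^bsub>Z\<^esub> y \<oplus>\<^bsub>Z\<^esub> po (inl u) (d0 C y)"
proof -
  have yD: "y \<in> carrier alg.D" using y unfolding D_carrier .
  show ?thesis
  proof (rule tensor_ext[OF ind.E_mod alg.mods(2) lin_comp[OF lin_N1 bilin_lin(2)[OF ind.bilin_eact y]]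
        lin_plus[OF lin_comp[OF bal.lin_over_act[OF yD] lin_N1] lin_comp[OF po_lin(2)[OF d0_closed[OF y]] lin_inl]] _ u])
    fix e b assume h: "e \<in> carrier E" "b \<in> carrier B"
    note x = i_closed(2)[OF h(2)]
    have z: "pushE (nablaE e) \<in> carrier Z" by (rule lin_closed[OF lin_pushE lin_closed[OF nablaE(1) h(1)]])
    show "N1 (eact (pure K E B e b) y) = N1 (pure K E B e b) \<triangleleft>\<^bsub>Z\<^esub> y \<oplus>\<^bsub>Z\<^esub> po (inl (pure K E B e b)) (d0 C y)"
      unfolding ind.pure_inc[OF h] ind.eact_inc[OF h(1) x y] N1_leibniz[OF h(1) alg.closed(8)[OF x y]] N1_leibniz[OF h(1) x]
        mE_act[OF h(1) x, symmetric]
      by (rule leibniz_mult[OF mE_closed[OF h(1)] z x y, symmetric])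
  qed
qed

lemma N2_rule:
  assumes v: "v \<in> carrier V" and y: "y \<in> carrier (tensor K A B)"
  shows "N2 (vact v y) = N2 v \<triangleleft>\<^bsub>Z\<^esub> y \<oplus>\<^bsub>Z\<^esub> po (inr v) (d0 C y)"
proof -
  have yD: "y \<in> carrier alg.D" using y unfolding D_carrier .
  obtain s where s: "s \<in> carrier (tensor K F A)" and vs: "\<tau> s = v" using \<tau>_surj[OF v] by (rule bexE)
  have "N2 (vact (\<tau> s) y) = N2 (\<tau> s) \<triangleleft>\<^bsub>Z\<^esub> y \<oplus>\<^bsub>Z\<^esub> po (inr (\<tau> s)) (d0 C y)"
  proof (rule tensor_ext[OF tm.mods(3,1) lin_comp[OF lin_N2 lin_comp[OF bilin_lin(2)[OF tm.bilin_act y] tm.lin_\<tau>]]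
        lin_plus[OF lin_comp[OF bal.lin_over_act[OF yD] lin_comp[OF lin_N2 tm.lin_\<tau>]]
          lin_comp[OF po_lin(2)[OF d0_closed[OF y]] lin_comp[OF lin_inr tm.lin_\<tau>]]] _ s])
    fix g a assume h: "g \<in> carrier F" "a \<in> carrier A"
    note x = i_closed(1)[OF h(2)]
    have one: "\<one>\<^bsub>A\<^esub> \<in> carrier A" by (rule alg.closed)
    have g1: "pure K A F \<one>\<^bsub>A\<^esub> g \<in> carrier V" using h by (intro tm.closed)
    have z: "pushF \<one>\<^bsub>A\<^esub> (nablaF g) \<in> carrier Z" by (rule bilin_closed[OF bilin_pushF one lin_closed[OF nablaF(1) h(1)]])
    have \<tau>: "\<tau> (pure K F A g a) = vact (pure K A F \<one>\<^bsub>A\<^esub> g) (i1 a)" by (rule tm.act_generators[OF h, symmetric])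
    show "N2 (vact (\<tau> (pure K F A g a)) y) = N2 (\<tau> (pure K F A g a)) \<triangleleft>\<^bsub>Z\<^esub> y \<oplus>\<^bsub>Z\<^esub> po (inr (\<tau> (pure K F A g a))) (d0 C y)"
      unfolding \<tau> tm.act_assoc[OF g1 x y, symmetric] N2_leibniz[OF h(1) alg.closed(8)[OF x y]] N2_leibniz[OF h(1) x]
        M_act_inr[OF x, symmetric]
      by (rule leibniz_mult[OF mF_closed[OF one h(1)] z x y, symmetric])
  qed
  then show ?thesis unfolding vs .
qed

lemma sum_connection: "right_connection K alg.D C M (\<lambda>(u, v). N1 u \<oplus>\<^bsub>Z\<^esub> N2 v)"
proof -
  interpret Z: module K Z by (rule Z_module)
  have nab: "lin K M Z (\<lambda>(u, v). N1 u \<oplus>\<^bsub>Z\<^esub> N2 v)"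
    using lin_plus[OF lin_comp[OF lin_N1 lin_fst_snd(1)] lin_comp[OF lin_N2 lin_fst_snd(2)]] by (simp add: case_prod_beta')
  have leib: "N1 (fst (m \<triangleleft>\<^bsub>M\<^esub> y)) \<oplus>\<^bsub>Z\<^esub> N2 (snd (m \<triangleleft>\<^bsub>M\<^esub> y)) = (N1 (fst m) \<oplus>\<^bsub>Z\<^esub> N2 (snd m)) \<triangleleft>\<^bsub>Z\<^esub> y \<oplus>\<^bsub>Z\<^esub> po m (d0 C y)"
    if m: "m \<in> carrier M" and yD: "y \<in> carrier alg.D" for m y
  proof -
    have y: "y \<in> carrier (tensor K A B)" using yD unfolding D_carrier .
    have u: "fst m \<in> carrier U" and v: "snd m \<in> carrier V" using m by (auto simp: M_simps)
    have "m = inl (fst m) \<oplus>\<^bsub>M\<^esub> inr (snd m)"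
      using u v UV by (auto simp: M_simps abelian_monoid.r_zero abelian_monoid.l_zero module.axioms abelian_group.axioms)
    then have m': "po m (d0 C y) = po (inl (fst m)) (d0 C y) \<oplus>\<^bsub>Z\<^esub> po (inr (snd m)) (d0 C y)"
      using lin_add[OF po_lin(2)[OF d0_closed[OF y]] lin_closed[OF lin_inl u] lin_closed[OF lin_inr v]] by simp
    note c = lin_closed[OF lin_N1 u] lin_closed[OF lin_N2 v] po_closed[OF lin_closed[OF lin_inl u] d0_closed[OF y]]
      po_closed[OF lin_closed[OF lin_inr v] d0_closed[OF y]]
    note c' = Z_act_closed[OF c(1) yD] Z_act_closed[OF c(2) yD]
    show ?thesis
      unfolding M_simps(5) fst_conv snd_conv N1_rule[OF u y] N2_rule[OF v y] m' lin_add[OF bal.lin_over_act[OF yD] c(1,2)]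
      using c c' by (simp add: Z.a_ac)
  qed
  show ?thesis unfolding right_connection_def
  proof (intro conjI ballI)
    show "linear_map K M Z (\<lambda>(u, v). N1 u \<oplus>\<^bsub>Z\<^esub> N2 v)" by (rule lin_linear_map[OF nab])
    fix m y assume "m \<in> carrier M" "y \<in> carrier alg.D"
    then show "(case m \<triangleleft>\<^bsub>M\<^esub> y of (u, v) \<Rightarrow> N1 u \<oplus>\<^bsub>Z\<^esub> N2 v) = (case m of (u, v) \<Rightarrow> N1 u \<oplus>\<^bsub>Z\<^esub> N2 v) \<triangleleft>\<^bsub>Z\<^esub> y \<oplus>\<^bsub>Z\<^esub> po m (d0 C y)"
      unfolding case_prod_beta' by (rule leib)
  qed (rule c.differential_calculus_axioms M_right_module)+
qed

section \<open>The defining formulas\<close>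

lemma N1_formula:
  assumes e: "e \<in> carrier E" and b: "b \<in> carrier B"
    and ei: "ei \<in> {..<n::nat} \<rightarrow> carrier E" and ai: "ai \<in> {..<n} \<rightarrow> carrier A"
    and eq: "nablaE e = (\<Oplus>\<^bsub>ZE\<^esub>i\<in>{..<n}. balE.po (ei i) (dA0 (ai i)))"
  shows "N1 (pure K E B e b) = (\<Oplus>\<^bsub>Z\<^esub>i\<in>{..<n}. po (mE (ei i)) (t (dA0 (ai i)) (iB b))) \<oplus>\<^bsub>Z\<^esub> po (mE e) (t (iA \<one>\<^bsub>A\<^esub>) (dB0 b))"
proof -
  interpret Z: module K Z by (rule Z_module)
  note bD = i_D(2)[OF b]
  have f: "lin K ZE Z (\<lambda>z. pushE z \<triangleleft>\<^bsub>Z\<^esub> i2 b)" by (rule lin_comp[OF bal.lin_over_act[OF bD] lin_pushE])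
  have fp: "pushE (balE.po e' (dA0 a)) \<triangleleft>\<^bsub>Z\<^esub> i2 b = po (mE e') (t (dA0 a) (iB b))" "po (mE e') (t (dA0 a) (iB b)) \<in> carrier Z"
    if h: "e' \<in> carrier E" "a \<in> carrier A" for e' a
  proof -
    have w: "dA0 a \<in> carrier WA" by (rule dA0_closed[OF h(2)])
    have "t (dA0 a) \<one>\<^bsub>OB\<^esub> \<triangleleft>\<^bsub>W1\<^esub> i2 b = t (dA0 a) (iB b)"
      unfolding W1_actions embed_i(2)[OF b] by (rule big.pure_eq_mult[OF WA_closed[OF w] b.embed_facts(3)[OF b], symmetric])
    then show *: "pushE (balE.po e' (dA0 a)) \<triangleleft>\<^bsub>Z\<^esub> i2 b = po (mE e') (t (dA0 a) (iB b))"
      unfolding pushE_po[OF h(1) w] bal.over_act_pure[OF bD mE_closed[OF h(1)] incA_closed[OF w]] by simp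
    show "po (mE e') (t (dA0 a) (iB b)) \<in> carrier Z"
      unfolding *[symmetric] by (rule lin_closed[OF f bilin_closed[OF balE.bilin_pure_over h(1) w]])
  qed
  have "pushE (nablaE e) \<triangleleft>\<^bsub>Z\<^esub> i2 b = (\<Oplus>\<^bsub>Z\<^esub>i\<in>{..<n}. pushE (balE.po (ei i) (dA0 (ai i))) \<triangleleft>\<^bsub>Z\<^esub> i2 b)"
    unfolding eq by (rule lin_finsum[OF f finite_lessThan])
      (rule bilin_closed[OF balE.bilin_pure_over funcset_mem[OF ei] dA0_closed[OF funcset_mem[OF ai]]])
  also have "\<dots> = (\<Oplus>\<^bsub>Z\<^esub>i\<in>{..<n}. po (mE (ei i)) (t (dA0 (ai i)) (iB b)))"
    by (rule Z.finsum_cong'[OF refl]) (auto intro!: fp funcset_mem[OF ei] funcset_mem[OF ai])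
  finally show ?thesis unfolding N1_pure[OF e b] d0_i(2)[OF b] a.embed_facts(5) by simp
qed

lemma N2_formula:
  assumes a: "a \<in> carrier A" and f: "f \<in> carrier F"
    and fk: "fk \<in> {..<n::nat} \<rightarrow> carrier F" and bk: "bk \<in> {..<n} \<rightarrow> carrier B"
    and fs: "fs \<in> {..<m::nat} \<rightarrow> carrier F" and as: "as \<in> {..<m} \<rightarrow> carrier A"
    and eq: "nablaF f = (\<Oplus>\<^bsub>ZF\<^esub>k\<in>{..<n}. balF.po (fk k) (dB0 (bk k)))"
    and eq': "\<sigma> (pure K A F a f) = (\<Oplus>\<^bsub>tensor K F A\<^esub>j\<in>{..<m}. pure K F A (fs j) (as j))"
  shows "N2 (pure K A F a f) = (\<Oplus>\<^bsub>Z\<^esub>k\<in>{..<n}. po (mF a (fk k)) (t (iA \<one>\<^bsub>A\<^esub>) (dB0 (bk k))))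
    \<oplus>\<^bsub>Z\<^esub> (\<Oplus>\<^bsub>Z\<^esub>j\<in>{..<m}. po (mF \<one>\<^bsub>A\<^esub> (fs j)) (t (dA0 (as j)) (iB \<one>\<^bsub>B\<^esub>)))"
proof -
  interpret Z: module K Z by (rule Z_module)
  have one: "\<one>\<^bsub>A\<^esub> \<in> carrier A" by (rule alg.closed)
  have "N2_first (pure K A F a f) = (\<Oplus>\<^bsub>Z\<^esub>k\<in>{..<n}. pushF a (balF.po (fk k) (dB0 (bk k))))"
    unfolding N2_first_pure[OF a f] eq by (rule lin_finsum[OF bilin_lin(1)[OF bilin_pushF a] finite_lessThan])
      (rule bilin_closed[OF balF.bilin_pure_over funcset_mem[OF fk] dB0_closed[OF funcset_mem[OF bk]]])
  also have "\<dots> = (\<Oplus>\<^bsub>Z\<^esub>k\<in>{..<n}. po (mF a (fk k)) (t (iA \<one>\<^bsub>A\<^esub>) (dB0 (bk k))))"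
    unfolding a.embed_facts(5)
    by (rule Z.finsum_cong'[OF refl])
      (auto intro!: pushF_po[OF a] po_closed mF_closed[OF a] incB_closed dB0_closed funcset_mem[OF fk] funcset_mem[OF bk])
  finally have N2_first: "N2_first (pure K A F a f) = (\<Oplus>\<^bsub>Z\<^esub>k\<in>{..<n}. po (mF a (fk k)) (t (iA \<one>\<^bsub>A\<^esub>) (dB0 (bk k))))" .
  have "N2_second (\<sigma> (pure K A F a f)) = (\<Oplus>\<^bsub>Z\<^esub>j\<in>{..<m}. N2_second (pure K F A (fs j) (as j)))"
    unfolding eq' by (rule lin_finsum[OF lin_N2_second finite_lessThan])
      (rule bilin_closed[OF tm.FA_pure funcset_mem[OF fs] funcset_mem[OF as]])
  also have "\<dots> = (\<Oplus>\<^bsub>Z\<^esub>j\<in>{..<m}. po (mF \<one>\<^bsub>A\<^esub> (fs j)) (t (dA0 (as j)) (iB \<one>\<^bsub>B\<^esub>)))"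
  proof (rule Z.finsum_cong'[OF refl])
    have q: "N2_second (pure K F A g x) = po (mF \<one>\<^bsub>A\<^esub> g) (t (dA0 x) (iB \<one>\<^bsub>B\<^esub>))" "po (mF \<one>\<^bsub>A\<^esub> g) (t (dA0 x) (iB \<one>\<^bsub>B\<^esub>)) \<in> carrier Z"
      if "g \<in> carrier F" "x \<in> carrier A" for g x
      unfolding b.embed_facts(5) d0_i(1)[OF that(2), symmetric]
      by (rule N2_second_pure[OF that] po_closed[OF mF_closed[OF one that(1)] d0_closed[OF i_closed(1)[OF that(2)]]])+
    show "(\<lambda>j. po (mF \<one>\<^bsub>A\<^esub> (fs j)) (t (dA0 (as j)) (iB \<one>\<^bsub>B\<^esub>))) \<in> {..<m} \<rightarrow> carrier Z"
      by (intro Pi_I q(2) funcset_mem[OF fs] funcset_mem[OF as])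
    show "N2_second (pure K F A (fs j) (as j)) = po (mF \<one>\<^bsub>A\<^esub> (fs j)) (t (dA0 (as j)) (iB \<one>\<^bsub>B\<^esub>))" if "j \<in> {..<m}" for j
      by (rule q(1)[OF funcset_mem[OF fs that] funcset_mem[OF as that]])
  qed
  finally show ?thesis unfolding N2_def N2_first by simp
qed

lemma nabla1: "nabla1_formula K A B R Rt E F \<tau> nablaE N1"
  unfolding nabla1_formula_def Let_def
  by (intro conjI ballI allI impI lin_linear_map[OF lin_N1] N1_formula)

lemma nabla2: "nabla2_formula K A B R Rt E F \<tau> \<sigma> nablaF N2"
  unfolding nabla2_formula_def Let_def
  by (intro conjI ballI allI impI lin_linear_map[OF lin_N2] N2_formula; elim conjE)

text \<open>The formula prescribes the values on pure tensors since \<open>\<nabla>\<^sup>E e\<close> can be written as a sum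
  of the required form.\<close>

lemma nabla1_unique:
  assumes N: "nabla1_formula K A B R Rt E F \<tau> nablaE N" and u: "u \<in> carrier U"
  shows "N u = N1 u"
proof -
  note N' = N[unfolded nabla1_formula_def Let_def]
  have l: "lin K U Z N" unfolding lin_def by (intro conjI UV Z_module conjunct1[OF N'])
  show ?thesis
  proof (rule tensor_ext[OF ind.E_mod alg.mods(2) l lin_N1 _ u])
    fix e b assume h: "e \<in> carrier E" "b \<in> carrier B"
    obtain n ei ai where r: "ei \<in> {..<n::nat} \<rightarrow> carrier E" "ai \<in> {..<n} \<rightarrow> carrier A"
      "nablaE e = (\<Oplus>\<^bsub>ZE\<^esub>i\<in>{..<n}. balE.po (ei i) (dA0 (ai i)))"
      using a.tensor_one_forms_finite_sum[OF ind.E_module lin_closed[OF nablaE(1) h(1)]] by (elim exE conjE)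
    show "N (pure K E B e b) = N1 (pure K E B e b)"
      unfolding N1_formula[OF h r]
      by (rule mp[OF bspec[OF bspec[OF spec[OF bspec[OF bspec[OF conjunct2[OF N'] h(1)] h(2)]] r(1)] r(2)] r(3)])
  qed
qed

lemma nabla2_unique:
  assumes N: "nabla2_formula K A B R Rt E F \<tau> \<sigma> nablaF N" and v: "v \<in> carrier V"
  shows "N v = N2 v"
proof -
  note N' = N[unfolded nabla2_formula_def Let_def]
  have l: "lin K V Z N" unfolding lin_def by (intro conjI UV Z_module conjunct1[OF N'])
  show ?thesis
  proof (rule tensor_ext[OF tm.mods(1,3) l lin_N2 _ v])
    fix a f assume h: "a \<in> carrier A" "f \<in> carrier F"
    obtain n fk bk where r: "fk \<in> {..<n::nat} \<rightarrow> carrier F" "bk \<in> {..<n} \<rightarrow> carrier B"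
      "nablaF f = (\<Oplus>\<^bsub>ZF\<^esub>k\<in>{..<n}. balF.po (fk k) (dB0 (bk k)))"
      using b.tensor_one_forms_finite_sum[OF tm.F_module lin_closed[OF nablaF(1) h(2)]] by (elim exE conjE)
    have "\<sigma> (pure K A F a f) \<in> carrier (tensor K F A)" by (rule lin_closed[OF lin_\<sigma> bilin_closed[OF tm.V_pure h]])
    from tensor_finite_sum[OF tm.mods(3,1) this]
    obtain m fs as where s: "fs \<in> {..<m::nat} \<rightarrow> carrier F" "as \<in> {..<m} \<rightarrow> carrier A"
      "\<sigma> (pure K A F a f) = (\<Oplus>\<^bsub>tensor K F A\<^esub>j\<in>{..<m}. pure K F A (fs j) (as j))" by (elim exE conjE)
    show "N (pure K A F a f) = N2 (pure K A F a f)"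
      unfolding N2_formula[OF h r(1,2) s(1,2) r(3) s(3)]
      by (rule mp[OF bspec[OF bspec[OF spec[OF bspec[OF bspec[OF spec[OF bspec[OF bspec[OF conjunct2[OF N'] h(1)] h(2)]] r(1)] r(2)]] s(1)] s(2)]
          conjI[OF r(3) s(3)]])
  qed
qed

end

theorem mainTheorem1:
  fixes K :: "'k ring"
    and A :: "('k, 'a) module" and B :: "('k, 'b) module"
    and E :: "('k, 'e, 'a) right_module" and F :: "('k, 'f, 'b) right_module"
    and R :: "('k, 'b, 'a) tens \<Rightarrow> ('k, 'a, 'b) tens"
    and Rt :: "('k, ('k, 'b) form, ('k, 'a) form) tens \<Rightarrow> ('k, ('k, 'a) form, ('k, 'b) form) tens"
    and \<tau> :: "('k, 'f, 'a) tens \<Rightarrow> ('k, 'a, 'f) tens"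
    and \<sigma> :: "('k, 'a, 'f) tens \<Rightarrow> ('k, 'f, 'a) tens"
    and nablaE :: "'e \<Rightarrow> ('k, 'e, ('k, 'a) form) tens set"
    and nablaF :: "'f \<Rightarrow> ('k, 'f, ('k, 'b) form) tens set"
  assumes "field K" and "k_algebra K A" and "k_algebra K B"
    and "twisting_map K A B R"
    and "bij_betw R (carrier (tensor K B A)) (carrier (tensor K A B))"
    and "twisting_extension K A B R Rt"
    and "right_connection K A (omega K A) E nablaE"
    and "right_connection K B (omega K B) F nablaF"
    and "module_twisting_map K A B R F \<tau>"
    and "\<sigma> \<in> carrier (tensor K A F) \<rightarrow> carrier (tensor K F A)"
    and "\<forall>t\<in>carrier (tensor K F A). \<sigma> (\<tau> t) = t"
    and "\<forall>t\<in>carrier (tensor K A F). \<tau> (\<sigma> t) = t"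
    and "connection_compatible K A B Rt F \<tau> nablaF"
  shows "\<exists>N1 N2.
    nabla1_formula K A B R Rt E F \<tau> nablaE N1 \<and>
    nabla2_formula K A B R Rt E F \<tau> \<sigma> nablaF N2 \<and>
    (\<forall>N1'. nabla1_formula K A B R Rt E F \<tau> nablaE N1' \<longrightarrow>
      (\<forall>u\<in>carrier (tensor K E B). N1' u = N1 u)) \<and>
    (\<forall>N2'. nabla2_formula K A B R Rt E F \<tau> \<sigma> nablaF N2' \<longrightarrow>
      (\<forall>v\<in>carrier (tensor K A F). N2' v = N2 v)) \<and>
    right_connection K (twisted_tensor K A B R) (twisted_calculus K A B Rt)
      (sum_module K A B R E F \<tau>)
      (\<lambda>(u, v). N1 u
        \<oplus>\<^bsub>tensor_over K (twisted_tensor K A B R) (sum_module K A B R E F \<tau>)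
           (one_forms (twisted_calculus K A B Rt))\<^esub> N2 v)"
proof -
  interpret product_connection K A B R Rt E F \<tau> \<sigma> nablaE nablaF
    using assms unfolding right_connection_def[of K A] right_connection_def[of K B]
    by (intro product_connection.intro twisted_omega.intro product_connection_axioms.intro assms) blast+
  show ?thesis
    using nabla1 nabla2 nabla1_unique nabla2_unique sum_connection by (intro exI[of _ N1] exI[of _ N2]) blast
qed

end
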